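(* Let $n\ge 2$ and let $G_n$ be either $vP_n$ or $vP_n^+$. For all $k\ge1$, the lower central series ranks of $G_n$ are given by $$\phi_k(G_n)=\frac{1}{k}\sum_{d\mid k}\mu\!\left(\frac{k}{d}\right)\left[\sum_{m_1+2m_2+\cdots+nm_n=d}(-1)^{s_n}\,d\,(m!)\prod_{j=1}^{n}\frac{(b_{n,n-j})^{m_j}}{(m_j)!}\right],$$ where the inner sum is over non-negative integers $m_1,\dots,m_n$, $s_n=\sum_{i=1}^{\lfloor n/2\rfloor}m_{2i}$, $m=\left(\sum_{i=1}^nm_i\right)-1$, $\mu$ is the Möbius function, and $b_{n,j}$ are the Lah numbers $L(n,j)$ if $G_n=vP_n$, and the Stirling numbers of the second kind $S(n,j)$ if $G_n=vP_n^+$.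
   Context: The pure virtual braid group $vP_n$ is the group with generators $x_{ij}$ ($1\le i\ne j\le n$) and relations $x_{ij}x_{ik}x_{jk}=x_{jk}x_{ik}x_{ij}$ for distinct $i,j,k$, and $x_{ij}x_{kl}=x_{kl}x_{ij}$ for distinct $i,j,k,l$. The group $vP_n^+$ is the subgroup of $vP_n$ generated by the $x_{ij}$ with $i<j$; it has a presentation with these generators and relations $x_{ij}x_{ik}x_{jk}=x_{jk}x_{ik}x_{ij}$ for $i<j<k$, and $x_{ij}x_{kl}=x_{kl}x_{ij}$ for $i,j,k,l$ distinct, $i<j$, $k<l$. For a finitely generated group $G$, $\phi_k(G)=\dim_{\mathbb{C}}(\Gamma_kG/\Gamma_{k+1}G)\otimes\mathbb{C}$, where $\Gamma_1G=G$, $\Gamma_{k+1}G=[\Gamma_kG,G]$. The Lah number $L(n,j)$ is the number of ways of partitioning $\{1,\dots,n\}$ into $j$ nonempty ordered subsets (each block linearly ordered), and $S(n,j)$ is the number of partitions of $\{1,\dots,n\}$ into $j$ nonempty unordered subsets; in particular both vanish for $j=0$. The convention $0^0=1$ is used. *)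

theory Defs
  imports
    "Jordan_Normal_Form.VS_Connect"
    "HOL-Algebra.Free_Abelian_Groups"
    "HOL-Combinatorics.Stirling"
    "HOL-Computational_Algebra.Squarefree"
    "HOL-Library.Disjoint_Sets"
begin

section \<open>Groups given by generators and relations\<close>

text \<open>A letter \<open>(x, True)\<close> stands for the generator \<open>x\<close> and \<open>(x, False)\<close> for its inverse.
  Two words over \<open>S\<close> are identified if they are related by the smallest congruence
  containing the free cancellations and the relations \<open>r = s\<close> for \<open>(r, s) \<in> R\<close>.\<close>

type_synonym 'a word = "('a \<times> bool) list"

definition words :: "'a set \<Rightarrow> 'a word set" where
  "words S = lists (S \<times> UNIV)"

inductive_set pres_rel :: "'a set \<Rightarrow> ('a word \<times> 'a word) set \<Rightarrow> ('a word \<times> 'a word) set"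
  for S :: "'a set" and R :: "('a word \<times> 'a word) set" where
  refl: "u \<in> words S \<Longrightarrow> (u, u) \<in> pres_rel S R"
| sym: "(u, v) \<in> pres_rel S R \<Longrightarrow> (v, u) \<in> pres_rel S R"
| trans: "(u, v) \<in> pres_rel S R \<Longrightarrow> (v, w) \<in> pres_rel S R \<Longrightarrow> (u, w) \<in> pres_rel S R"
| cancel: "u \<in> words S \<Longrightarrow> v \<in> words S \<Longrightarrow> x \<in> S \<Longrightarrow>
    (u @ [(x, b), (x, \<not> b)] @ v, u @ v) \<in> pres_rel S R"
| relation: "u \<in> words S \<Longrightarrow> v \<in> words S \<Longrightarrow> (r, s) \<in> R \<Longrightarrow>
    (u @ r @ v, u @ s @ v) \<in> pres_rel S R"

definition presented_group :: "'a set \<Rightarrow> ('a word \<times> 'a word) set \<Rightarrow> 'a word set monoid" where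
  "presented_group S R =
     \<lparr>carrier = words S // pres_rel S R,
      monoid.mult = (\<lambda>A B. \<Union>u\<in>A. \<Union>v\<in>B. pres_rel S R `` {u @ v}),
      one = pres_rel S R `` {[]}\<rparr>"

lemma words_append [simp]: "u @ v \<in> words S \<longleftrightarrow> u \<in> words S \<and> v \<in> words S"
  by (auto simp: words_def)

lemma words_Nil [simp]: "[] \<in> words S"
  by (simp add: words_def)

lemma pres_rel_subset:
  assumes "R \<subseteq> words S \<times> words S"
  shows "pres_rel S R \<subseteq> words S \<times> words S"
proof -
  have "p \<in> words S \<and> q \<in> words S" if "(p, q) \<in> pres_rel S R" for p q
    using that assms by induction (auto simp: words_def)
  then show ?thesis by auto
qed

lemma equiv_pres_rel:
  assumes "R \<subseteq> words S \<times> words S"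
  shows "equiv (words S) (pres_rel S R)"
  using pres_rel_subset[OF assms]
  by (auto simp: equiv_def refl_on_def sym_def trans_def
           intro: pres_rel.refl pres_rel.sym pres_rel.trans)

lemma pres_rel_context:
  assumes "(p, q) \<in> pres_rel S R" "u \<in> words S" "v \<in> words S"
  shows "(u @ p @ v, u @ q @ v) \<in> pres_rel S R"
  using assms(1)
proof induction
  case (cancel p q x b)
  then show ?case
    using pres_rel.cancel[of "u @ p" S "q @ v" x b R] assms by simp
next
  case (relation p q r s)
  then show ?case
    using pres_rel.relation[of "u @ p" S "q @ v" r s R] assms by simp
qed (use assms in \<open>auto intro: pres_rel.refl pres_rel.sym pres_rel.trans\<close>)

lemma pres_rel_append:
  assumes "R \<subseteq> words S \<times> words S" "(p, p') \<in> pres_rel S R" "(q, q') \<in> pres_rel S R"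
  shows "(p @ q, p' @ q') \<in> pres_rel S R"
proof -
  have w: "q \<in> words S" "p' \<in> words S"
    using pres_rel_subset[OF assms(1)] assms by auto
  have "(p @ q, p' @ q) \<in> pres_rel S R"
    using pres_rel_context[OF assms(2), of "[]" q] w by simp
  moreover have "(p' @ q, p' @ q') \<in> pres_rel S R"
    using pres_rel_context[OF assms(3), of p' "[]"] w by simp
  ultimately show ?thesis by (rule pres_rel.trans)
qed

lemma presented_group_mult:
  assumes R: "R \<subseteq> words S \<times> words S" and "u \<in> words S" "v \<in> words S"
  shows "pres_rel S R `` {u} \<otimes>\<^bsub>presented_group S R\<^esub> pres_rel S R `` {v} = pres_rel S R `` {u @ v}"
proof -
  have "(\<Union>p\<in>pres_rel S R `` {u}. \<Union>q\<in>pres_rel S R `` {v}. pres_rel S R `` {p @ q}) =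
        pres_rel S R `` {u @ v}"
    using pres_rel_append[OF R] assms(2,3)
    by (auto intro: pres_rel.refl pres_rel.sym pres_rel.trans)
       (meson pres_rel.refl pres_rel.sym pres_rel.trans)+
  then show ?thesis by (simp add: presented_group_def)
qed

lemma word_inverse:
  assumes "u \<in> words S"
  shows "(rev (map (map_prod id Not) u) @ u, []) \<in> pres_rel S R"
  using assms
proof (induction u)
  case Nil
  then show ?case by (auto intro: pres_rel.refl)
next
  case (Cons a u)
  obtain x b where a: "a = (x, b)" by force
  have w: "u \<in> words S" "x \<in> S" "rev (map (map_prod id Not) u) \<in> words S"
    using Cons.prems by (auto simp: words_def a in_lists_conv_set)
  have "(rev (map (map_prod id Not) u) @ [(x, \<not> b), (x, \<not> \<not> b)] @ u,
         rev (map (map_prod id Not) u) @ u) \<in> pres_rel S R"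
    using w by (intro pres_rel.cancel) auto
  from pres_rel.trans[OF this Cons.IH[OF w(1)]] show ?case by (simp add: a id_def)
qed

lemma group_presented_group:
  assumes R: "R \<subseteq> words S \<times> words S"
  shows "group (presented_group S R)"
proof (rule groupI)
  let ?G = "presented_group S R"
  have carrier: "carrier ?G = (\<lambda>u. pres_rel S R `` {u}) ` words S"
    by (auto simp: presented_group_def quotient_def)
  have one: "\<one>\<^bsub>?G\<^esub> = pres_rel S R `` {[]}"
    by (simp add: presented_group_def)
  note mult = presented_group_mult[OF R]
  show "x \<otimes>\<^bsub>?G\<^esub> y \<in> carrier ?G" if "x \<in> carrier ?G" "y \<in> carrier ?G" for x y
    using that by (auto simp: carrier mult)
  show "\<one>\<^bsub>?G\<^esub> \<in> carrier ?G" by (auto simp: carrier one)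
  show "x \<otimes>\<^bsub>?G\<^esub> y \<otimes>\<^bsub>?G\<^esub> z = x \<otimes>\<^bsub>?G\<^esub> (y \<otimes>\<^bsub>?G\<^esub> z)"
    if "x \<in> carrier ?G" "y \<in> carrier ?G" "z \<in> carrier ?G" for x y z
    using that by (auto simp: carrier mult)
  show "\<one>\<^bsub>?G\<^esub> \<otimes>\<^bsub>?G\<^esub> x = x" if "x \<in> carrier ?G" for x
    using that by (auto simp: carrier mult one)
  show "\<exists>y\<in>carrier ?G. y \<otimes>\<^bsub>?G\<^esub> x = \<one>\<^bsub>?G\<^esub>" if "x \<in> carrier ?G" for x
  proof -
    obtain u where u: "u \<in> words S" "x = pres_rel S R `` {u}"
      using \<open>x \<in> carrier ?G\<close> unfolding carrier by blast
    let ?v = "rev (map (map_prod id Not) u)"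
    have v: "?v \<in> words S" using u(1) by (auto simp: words_def in_lists_conv_set)
    have "pres_rel S R `` {?v} \<otimes>\<^bsub>?G\<^esub> x = \<one>\<^bsub>?G\<^esub>"
      using equiv_class_eq[OF equiv_pres_rel[OF R] word_inverse[OF u(1)]] u v
      by (simp add: mult one)
    then show ?thesis using v by (auto simp: carrier)
  qed
qed


section \<open>The pure virtual braid groups\<close>

definition vP_gens :: "nat \<Rightarrow> (nat \<times> nat) set" where
  "vP_gens n = {(i, j). i \<in> {1..n} \<and> j \<in> {1..n} \<and> i \<noteq> j}"

abbreviation gen_letter :: "nat \<Rightarrow> nat \<Rightarrow> (nat \<times> nat) \<times> bool" where
  "gen_letter i j \<equiv> ((i, j), True)"

definition vP_rels :: "nat \<Rightarrow> ((nat \<times> nat) word \<times> (nat \<times> nat) word) set" where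
  "vP_rels n =
     {([gen_letter i j, gen_letter i k, gen_letter j k],
       [gen_letter j k, gen_letter i k, gen_letter i j]) | i j k.
        {i, j, k} \<subseteq> {1..n} \<and> distinct [i, j, k]} \<union>
     {([gen_letter i j, gen_letter k l], [gen_letter k l, gen_letter i j]) | i j k l.
        {i, j, k, l} \<subseteq> {1..n} \<and> distinct [i, j, k, l]}"

definition vP :: "nat \<Rightarrow> (nat \<times> nat) word set monoid" where
  "vP n = presented_group (vP_gens n) (vP_rels n)"

definition vP_gen :: "nat \<Rightarrow> nat \<Rightarrow> nat \<Rightarrow> (nat \<times> nat) word set" where
  "vP_gen n i j = pres_rel (vP_gens n) (vP_rels n) `` {[gen_letter i j]}"

definition vP_plus :: "nat \<Rightarrow> (nat \<times> nat) word set monoid" where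
  "vP_plus n = (vP n)\<lparr>carrier :=
     generate (vP n) {vP_gen n i j | i j. 1 \<le> i \<and> i < j \<and> j \<le> n}\<rparr>"

lemma group_vP: "group (vP n)"
  unfolding vP_def
  by (rule group_presented_group) (auto simp: vP_rels_def vP_gens_def words_def)

lemma group_vP_plus: "group (vP_plus n)"
  unfolding vP_plus_def
proof (intro group.subgroup_imp_group[OF group_vP] group.generate_is_subgroup[OF group_vP] subsetI)
  fix x assume "x \<in> {vP_gen n i j | i j. 1 \<le> i \<and> i < j \<and> j \<le> n}"
  then show "x \<in> carrier (vP n)"
    by (auto simp: vP_def presented_group_def vP_gen_def words_def vP_gens_def intro!: quotientI)
qed


section \<open>Lower central series ranks\<close>

definition commutator_subgroup ::
    "('a, 'b) monoid_scheme \<Rightarrow> 'a set \<Rightarrow> 'a set \<Rightarrow> 'a set" where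
  "commutator_subgroup G H K =
     generate G (\<Union>h\<in>H. \<Union>k\<in>K. {h \<otimes>\<^bsub>G\<^esub> k \<otimes>\<^bsub>G\<^esub> (inv\<^bsub>G\<^esub> h) \<otimes>\<^bsub>G\<^esub> (inv\<^bsub>G\<^esub> k)})"

text \<open>The series is indexed from 1; the value at 0 is a dummy.\<close>

fun lower_central :: "('a, 'b) monoid_scheme \<Rightarrow> nat \<Rightarrow> 'a set" where
  "lower_central G 0 = carrier G"
| "lower_central G (Suc 0) = carrier G"
| "lower_central G (Suc (Suc k)) =
     commutator_subgroup G (lower_central G (Suc k)) (carrier G)"

text \<open>For an abelian group \<open>A\<close> (written multiplicatively), the complex vector space
  \<open>A \<otimes> \<complex>\<close> (tensor product over the integers): the free abelian group on the pairs
  \<open>(a, z)\<close> modulo the biadditivity relations, with the complex numbers acting on the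
  second component. The multiplication and unit fields of the record
  are not part of the module structure.\<close>

definition tensor_rels :: "('a, 'b) monoid_scheme \<Rightarrow> (('a \<times> complex) \<Rightarrow>\<^sub>0 int) set" where
  "tensor_rels A = generate (free_Abelian_group (carrier A \<times> UNIV))
     ({frag_of (a \<otimes>\<^bsub>A\<^esub> b, z) - frag_of (a, z) - frag_of (b, z) | a b z.
         a \<in> carrier A \<and> b \<in> carrier A} \<union>
      {frag_of (a, z + w) - frag_of (a, z) - frag_of (a, w) | a z w. a \<in> carrier A})"

definition tensor_quot ::
    "('a, 'b) monoid_scheme \<Rightarrow> (('a \<times> complex) \<Rightarrow>\<^sub>0 int) set monoid" where
  "tensor_quot A = free_Abelian_group (carrier A \<times> UNIV) Mod tensor_rels A"

definition tensor_complex ::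
    "('a, 'b) monoid_scheme \<Rightarrow> (complex, (('a \<times> complex) \<Rightarrow>\<^sub>0 int) set) module" where
  "tensor_complex A =
     \<lparr>carrier = carrier (tensor_quot A),
      monoid.mult = undefined,
      one = undefined,
      ring.zero = \<one>\<^bsub>tensor_quot A\<^esub>,
      ring.add = (\<otimes>\<^bsub>tensor_quot A\<^esub>),
      smult = (\<lambda>c X. \<Union>x\<in>X.
        tensor_rels A #>\<^bsub>free_Abelian_group (carrier A \<times> UNIV)\<^esub>
          frag_extend (\<lambda>(a, z). frag_of (a, c * z)) x)\<rparr>"

lemma vectorspace_tensor_complex:
  fixes A (structure)
  assumes "comm_group A"
  shows "vectorspace class_ring (tensor_complex A)"
proof -
  interpret A: comm_group A by fact
  let ?S = "carrier A \<times> (UNIV :: complex set)"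
  let ?F = "free_Abelian_group ?S" and ?R = "tensor_rels A" and ?Q = "tensor_quot A"
  let ?T = "tensor_complex A"
  interpret F: comm_group ?F by (rule abelian_free_Abelian_group)
  define rels where "rels =
      {frag_of (a \<otimes> b, z) - frag_of (a, z) - frag_of (b, z) | a b (z :: complex).
         a \<in> carrier A \<and> b \<in> carrier A} \<union>
      {frag_of (a, z + w) - frag_of (a, z) - frag_of (a, w) | a (z :: complex) w. a \<in> carrier A}"
  have R_def: "?R = generate ?F rels"
    by (simp add: tensor_rels_def rels_def)
  have diff_F: "x - y \<in> carrier ?F" if "x \<in> carrier ?F" "y \<in> carrier ?F" for x y
    using that keys_diff[of x y] by auto
  have rels_sub: "rels \<subseteq> carrier ?F"
    unfolding rels_def
    by (auto intro!: diff_F simp del: carrier_free_Abelian_group_iff)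
  have sub: "subgroup ?R ?F"
    unfolding R_def by (rule F.generate_is_subgroup[OF rels_sub])
  have normal: "?R \<lhd> ?F"
    by (rule F.subgroup_imp_normal[OF sub])
  interpret R: normal ?R ?F by (rule normal)
  have Q_comm: "comm_group ?Q"
    unfolding tensor_quot_def by (rule F.abelian_FactGroup[OF sub])
  interpret Q: comm_group ?Q by (rule Q_comm)
  define sc where "sc c = frag_extend (\<lambda>(a, z). frag_of (a :: 'a, c * z))" for c :: complex
  have sc_of: "sc c (frag_of (a, z)) = frag_of (a, c * z)" for c a z
    by (simp add: sc_def)
  have sc_add: "sc c (x + y) = sc c x + sc c y" for c x y
    by (simp add: sc_def frag_extend_add)
  have sc_diff: "sc c (x - y) = sc c x - sc c y" for c x y
    by (simp add: sc_def frag_extend_diff)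
  have sc_minus: "sc c (- x) = - sc c x" for c x
    by (simp add: sc_def frag_extend_minus)
  have sc_0: "sc c 0 = 0" for c
    by (simp add: sc_def)
  have sc_F: "sc c x \<in> carrier ?F" if "x \<in> carrier ?F" for c x
    using that keys_frag_extend[of "\<lambda>(a, z). frag_of (a :: 'a, c * z)" x]
    by (fastforce simp: sc_def)
  have sc_R: "sc c x \<in> ?R" if "x \<in> ?R" for c x
    using that unfolding R_def
  proof induction
    case one
    show ?case using generate.one[of ?F rels] by (simp add: sc_0)
  next
    case (incl h)
    then have "sc c h \<in> rels"
      unfolding rels_def by (fastforce simp: sc_diff sc_of distrib_left)
    then show ?case by (rule generate.incl)
  next
    case (inv h)
    then have "sc c h \<in> rels"
      unfolding rels_def by (fastforce simp: sc_diff sc_of distrib_left)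
    then have "inv\<^bsub>?F\<^esub> (sc c h) \<in> generate ?F rels" by (rule generate.inv)
    moreover have "h \<in> carrier ?F" "sc c h \<in> carrier ?F"
      using inv \<open>sc c h \<in> rels\<close> rels_sub by blast+
    ultimately show ?case by (simp add: sc_minus)
  next
    case (eng h1 h2)
    then show ?case using generate.eng[of "sc c h1" ?F rels "sc c h2"] by (simp add: sc_add)
  qed
  have coset_eq: "?R #>\<^bsub>?F\<^esub> x = ?R #>\<^bsub>?F\<^esub> y"
    if "x \<in> carrier ?F" "y \<in> carrier ?F" "x - y \<in> ?R" for x y
  proof -
    have "x = (x - y) \<otimes>\<^bsub>?F\<^esub> y" by simp
    then have "x \<in> ?R #>\<^bsub>?F\<^esub> y" using that(3) unfolding r_coset_def by blast
    then show ?thesis using F.repr_independence[OF _ that(2) sub] by simp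
  qed
  have carrier: "carrier ?T = (\<lambda>x. ?R #>\<^bsub>?F\<^esub> x) ` carrier ?F"
    by (auto simp: tensor_complex_def tensor_quot_def FactGroup_def RCOSETS_def)
  have add: "(?R #>\<^bsub>?F\<^esub> x) \<oplus>\<^bsub>?T\<^esub> (?R #>\<^bsub>?F\<^esub> y) = ?R #>\<^bsub>?F\<^esub> (x + y)"
    if "x \<in> carrier ?F" "y \<in> carrier ?F" for x y
    using R.rcos_sum[OF that] by (simp add: tensor_complex_def tensor_quot_def FactGroup_def)
  have smult: "c \<odot>\<^bsub>?T\<^esub> (?R #>\<^bsub>?F\<^esub> x) = ?R #>\<^bsub>?F\<^esub> sc c x" if x: "x \<in> carrier ?F" for c x
  proof -
    have "?R #>\<^bsub>?F\<^esub> sc c y = ?R #>\<^bsub>?F\<^esub> sc c x" if "y \<in> ?R #>\<^bsub>?F\<^esub> x" for y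
    proof -
      have "\<exists>r\<in>?R. y = r + x"
        using that by (simp only: r_coset_def mult_free_Abelian_group UN_iff singleton_iff)
      then obtain r where r: "r \<in> ?R" "y = r + x" by (elim bexE)
      have "y \<in> carrier ?F"
        using F.m_closed[OF R.mem_carrier[OF r(1)] x] r(2) by simp
      moreover have "sc c y - sc c x \<in> ?R"
        using sc_R[OF r(1), of c] by (simp add: r(2) sc_add)
      ultimately show ?thesis by (intro coset_eq sc_F x)
    qed
    moreover have "x \<in> ?R #>\<^bsub>?F\<^esub> x" by (rule F.rcos_self[OF x sub])
    ultimately have "(\<Union>y\<in>?R #>\<^bsub>?F\<^esub> x. ?R #>\<^bsub>?F\<^esub> sc c y) = ?R #>\<^bsub>?F\<^esub> sc c x"
      by blast
    then show ?thesis by (simp add: tensor_complex_def sc_def)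
  qed
  have coset_in: "?R #>\<^bsub>?F\<^esub> x \<in> carrier ?T" if "x \<in> carrier ?F" for x
    using that carrier by blast
  have keys_add_F: "x + y \<in> carrier ?F" if "x \<in> carrier ?F" "y \<in> carrier ?F" for x y
    using F.m_closed[OF that] by simp
  have gen_ind [consumes 1, case_names zero diff gen]: "P x" if "x \<in> carrier ?F" "P 0"
      "\<And>x y. x \<in> carrier ?F \<Longrightarrow> y \<in> carrier ?F \<Longrightarrow> P x \<Longrightarrow> P y \<Longrightarrow> P (x - y)"
      "\<And>a z. a \<in> carrier A \<Longrightarrow> P (frag_of (a, z))" for P x
    using free_Abelian_group_induct[of x ?S P] that by auto
  have sc_sum: "sc (c + d) x - (sc c x + sc d x) \<in> ?R" if "x \<in> carrier ?F" for c d x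
    using that
  proof (induction x rule: gen_ind)
    case zero
    show ?case using R.one_closed by (simp add: sc_0)
  next
    case (diff x y)
    have "(sc (c + d) x - (sc c x + sc d x)) \<otimes>\<^bsub>?F\<^esub>
          inv\<^bsub>?F\<^esub> (sc (c + d) y - (sc c y + sc d y)) \<in> ?R"
      by (intro R.m_closed R.m_inv_closed diff)
    then show ?case
      using R.mem_carrier[OF diff(4)] by (simp add: sc_diff algebra_simps)
  next
    case (gen a z)
    then have "frag_of (a, c * z + d * z) - frag_of (a, c * z) - frag_of (a, d * z) \<in> rels"
      unfolding rels_def by blast
    then have "frag_of (a, c * z + d * z) - frag_of (a, c * z) - frag_of (a, d * z) \<in> ?R"
      unfolding R_def by (rule generate.incl)
    then show ?case by (simp add: sc_of algebra_simps)
  qed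
  have sc_sc: "sc c (sc d x) = sc (c * d) x" if "x \<in> carrier ?F" for c d x
    using that by (induction x rule: gen_ind) (simp_all add: sc_0 sc_diff sc_of mult.assoc)
  have sc_1: "sc 1 x = x" if "x \<in> carrier ?F" for x
    using that by (induction x rule: gen_ind) (simp_all add: sc_0 sc_diff sc_of)
  have "abelian_group ?T"
  proof (rule abelian_groupI)
    have eqs: "carrier ?T = carrier ?Q" "add ?T = monoid.mult ?Q" "\<zero>\<^bsub>?T\<^esub> = \<one>\<^bsub>?Q\<^esub>"
      by (simp_all add: tensor_complex_def)
    show "\<exists>y\<in>carrier ?T. y \<oplus>\<^bsub>?T\<^esub> x = \<zero>\<^bsub>?T\<^esub>" if "x \<in> carrier ?T" for x
      using that Q.l_inv_ex[of x] by (auto simp: eqs)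
  qed (simp_all add: tensor_complex_def Q.m_ac)
  then have "module class_ring ?T"
  proof (intro moduleI)
    show "cring (class_ring :: complex ring)"
      by (intro domain.axioms(1) field.axioms(1) class_field)
    fix c d x y
    assume "x \<in> carrier ?T"
    then obtain x' where x: "x' \<in> carrier ?F" "x = ?R #>\<^bsub>?F\<^esub> x'" using carrier by auto
    show "c \<odot>\<^bsub>?T\<^esub> x \<in> carrier ?T"
      unfolding x(2) smult[OF x(1)] by (rule coset_in[OF sc_F[OF x(1)]])
    show "(c \<oplus>\<^bsub>class_ring\<^esub> d) \<odot>\<^bsub>?T\<^esub> x = c \<odot>\<^bsub>?T\<^esub> x \<oplus>\<^bsub>?T\<^esub> d \<odot>\<^bsub>?T\<^esub> x"
      unfolding x(2) smult[OF x(1)] add[OF sc_F[OF x(1)] sc_F[OF x(1)]]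
      using coset_eq[OF sc_F[OF x(1)] keys_add_F[OF sc_F[OF x(1)] sc_F[OF x(1)]] sc_sum[OF x(1)]]
      by simp
    show "(c \<otimes>\<^bsub>class_ring\<^esub> d) \<odot>\<^bsub>?T\<^esub> x = c \<odot>\<^bsub>?T\<^esub> (d \<odot>\<^bsub>?T\<^esub> x)"
      unfolding x(2) smult[OF x(1)] smult[OF sc_F[OF x(1)]] using sc_sc[OF x(1)] by simp
    show "\<one>\<^bsub>class_ring\<^esub> \<odot>\<^bsub>?T\<^esub> x = x"
      unfolding x(2) smult[OF x(1)] using sc_1[OF x(1)] by simp
    assume "y \<in> carrier ?T"
    then obtain y' where y: "y' \<in> carrier ?F" "y = ?R #>\<^bsub>?F\<^esub> y'" using carrier by auto
    show "c \<odot>\<^bsub>?T\<^esub> (x \<oplus>\<^bsub>?T\<^esub> y) = c \<odot>\<^bsub>?T\<^esub> x \<oplus>\<^bsub>?T\<^esub> c \<odot>\<^bsub>?T\<^esub> y"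
      unfolding x(2) y(2) add[OF x(1) y(1)] smult[OF x(1)] smult[OF y(1)]
        smult[OF keys_add_F[OF x(1) y(1)]] add[OF sc_F[OF x(1)] sc_F[OF y(1)]] sc_add ..
  qed
  then show ?thesis by (intro vectorspace.intro class_field)
qed

definition lcs_rank :: "('a, 'b) monoid_scheme \<Rightarrow> nat \<Rightarrow> nat" where
  "lcs_rank G k = vectorspace.dim class_ring
     (tensor_complex (G\<lparr>carrier := lower_central G k\<rparr> Mod lower_central G (Suc k)))"


section \<open>Arithmetic and combinatorial functions\<close>

definition moebius_mu :: "nat \<Rightarrow> int" where
  "moebius_mu n = (if squarefree n then (- 1) ^ card (prime_factors n) else 0)"

text \<open>A partition of \<open>{1..n}\<close> into linearly ordered blocks is a set of nonempty lists without
  repetitions whose underlying sets are the blocks of a partition, one list for each block.\<close>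

definition Lah :: "nat \<Rightarrow> nat \<Rightarrow> nat" where
  "Lah n j = card {P :: nat list set.
     (\<forall>xs\<in>P. distinct xs) \<and> inj_on set P \<and> partition_on {1..n} (set ` P) \<and> card P = j}"

lemma partition_on_remove:
  assumes "partition_on A Q" "q \<in> Q"
  shows "disjnt q (\<Union>(Q - {q}))" and "partition_on (A - q) (Q - {q})"
    and "q \<subseteq> A" and "q \<noteq> {}"
proof -
  show 1: "disjnt q (\<Union>(Q - {q}))"
    using partition_onD2[OF assms(1)] assms(2) unfolding pairwise_def disjnt_iff by blast
  have "insert q (Q - {q}) = Q" using assms(2) by blast
  then have "partition_on A (insert q (Q - {q}))" using assms(1) by simp
  then show "partition_on (A - q) (Q - {q})" "q \<subseteq> A" "q \<noteq> {}"
    using partition_on_insert[OF 1] by blast+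
qed

text \<open>The library's Stirling numbers of the second kind count partitions into blocks.\<close>

lemma card_partition_on_Stirling:
  assumes "finite A"
  shows "card {P. partition_on A P \<and> card P = k} = Stirling (card A) k"
  using assms
proof (induction A arbitrary: k rule: finite_induct)
  case empty
  show ?case by (cases k) (simp_all add: partition_on_empty Collect_conv_if)
next
  case (insert x A)
  let ?parts = "\<lambda>A k. {P. partition_on A P \<and> card P = k}"
  have fin: "finite Q" if "partition_on A Q" for Q
    using finite_elements[OF insert.hyps(1) that] .
  have fin_parts: "finite (?parts A k)" for k
    by (rule finite_subset[OF _ finitely_many_partition_on[OF insert.hyps(1)]]) auto
  have notin: "x \<notin> p" if "partition_on A Q" "p \<in> Q" for Q p
    using that insert.hyps(2) by (auto simp: partition_on_def)
  show ?case
  proof (cases k)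
    case 0
    have "P = {}" if "partition_on (insert x A) P" "card P = 0" for P
      using finite_elements[OF _ that(1)] insert.hyps(1) that(2) by simp
    then have "?parts (insert x A) k = {}"
      using 0 by (auto simp: partition_on_def)
    then have "card (?parts (insert x A) k) = 0" by (simp only: card.empty)
    then show ?thesis using 0 insert.hyps by simp
  next
    case (Suc l)
    define f where "f Q = insert {x} Q" for Q
    define g where "g = (\<lambda>(Q, q). insert (insert x q) (Q - {q}))"
    have f_in: "f Q \<in> ?parts (insert x A) k" if "Q \<in> ?parts A l" for Q
    proof -
      have Q: "partition_on A Q" "card Q = l" using that by auto
      have "{x} \<notin> Q" using notin[OF Q(1)] by auto
      moreover have "partition_on (insert x A) (insert {x} Q)"
      proof (subst partition_on_insert)
        show "disjnt {x} (\<Union>Q)" using notin[OF Q(1)] by (auto simp: disjnt_iff)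
      qed (use Q(1) insert.hyps(2) in simp)
      ultimately show ?thesis using Q fin[OF Q(1)] Suc by (simp add: f_def)
    qed
    have g_in: "g (Q, q) \<in> ?parts (insert x A) k" if "Q \<in> ?parts A k" "q \<in> Q" for Q q
    proof -
      have Q: "partition_on A Q" "card Q = k" using that by auto
      have "insert x q \<notin> Q" using notin[OF Q(1)] by auto
      moreover have "partition_on (insert x A) (insert (insert x q) (Q - {q}))"
      proof (subst partition_on_insert)
        show "disjnt (insert x q) (\<Union>(Q - {q}))"
          using notin[OF Q(1)] partition_on_remove(1)[OF Q(1) that(2)] by (auto simp: disjnt_iff)
        have "insert x A - insert x q = A - q" using insert.hyps(2) by auto
        then show "partition_on (insert x A - insert x q) (Q - {q}) \<and>
            insert x q \<subseteq> insert x A \<and> insert x q \<noteq> {}"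
          using partition_on_remove[OF Q(1) that(2)] by auto
      qed
      ultimately show ?thesis
        using Q fin[OF Q(1)] Suc \<open>q \<in> Q\<close> by (simp add: g_def card_Diff_singleton)
    qed
    have split: "?parts (insert x A) k = f ` ?parts A l \<union> g ` Sigma (?parts A k) (\<lambda>Q. Q)"
    proof (intro equalityI subsetI)
      fix P assume "P \<in> ?parts (insert x A) k"
      then have P: "partition_on (insert x A) P" "card P = k" by auto
      have finP: "finite P" using finite_elements[OF _ P(1)] insert.hyps by auto
      obtain p where p: "p \<in> P" "x \<in> p" using P(1) by (auto simp: partition_on_def)
      note part = partition_on_remove[OF P(1) p(1)]
      show "P \<in> f ` ?parts A l \<union> g ` Sigma (?parts A k) (\<lambda>Q. Q)"
      proof (cases "p = {x}")
        case True
        then have "P - {p} \<in> ?parts A l"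
          using part(2) P finP p Suc insert.hyps(2) by (simp add: card_Diff_singleton)
        moreover have "P = f (P - {p})" using p True by (auto simp: f_def)
        ultimately show ?thesis by blast
      next
        case False
        define q where "q = p - {x}"
        define Q where "Q = insert q (P - {p})"
        have q: "q \<noteq> {}" "q \<subseteq> A" "p = insert x q" "x \<notin> q"
          using False p part(3) by (auto simp: q_def)
        have disj: "disjnt q (\<Union>(P - {p}))" using part(1) by (auto simp: q_def disjnt_iff)
        then have "q \<notin> P - {p}" using q(1) by (auto simp: disjnt_iff)
        moreover have "partition_on A Q"
        proof -
          have "A - q = insert x A - p" using q insert.hyps(2) by auto
          then show ?thesis
            unfolding Q_def partition_on_insert[OF disj] using q part(2) by simp
        qed
        ultimately have "Q \<in> ?parts A k" "q \<in> Q" "P = g (Q, q)"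
          using finP P(2) p q(3) Suc
          by (auto simp: Q_def g_def card_Diff_singleton)
        then show ?thesis by blast
      qed
    qed (use f_in g_in in blast)
    have disj: "f ` ?parts A l \<inter> g ` Sigma (?parts A k) (\<lambda>Q. Q) = {}"
    proof -
      have False if "partition_on A Q" "partition_on A Q'" "q \<in> Q'" "f Q = g (Q', q)" for Q Q' q
      proof -
        have "{x} \<in> insert (insert x q) (Q' - {q})"
          using that(4) by (auto simp: f_def g_def)
        moreover have "q \<noteq> {}" using that by (auto simp: partition_on_def)
        ultimately show False using notin[OF that(2)] that(3) by auto
      qed
      then show ?thesis by blast
    qed
    have inj_f: "inj_on f (?parts A l)"
    proof (intro inj_onI)
      fix Q Q' assume "Q \<in> ?parts A l" "Q' \<in> ?parts A l" and eq: "f Q = f Q'"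
      then have "{x} \<notin> Q" "{x} \<notin> Q'" using notin by blast+
      then show "Q = Q'" using eq unfolding f_def by (simp add: insert_ident)
    qed
    have inj_g: "inj_on g (Sigma (?parts A k) (\<lambda>Q. Q))"
    proof (intro inj_onI, clarify)
      fix Q q Q' q'
      assume Q: "partition_on A Q" "q \<in> Q" "partition_on A Q'" "q' \<in> Q'"
        and eq: "g (Q, q) = g (Q', q')"
      have nx: "x \<notin> q" "x \<notin> q'" using notin Q by auto
      have "insert x q \<in> insert (insert x q') (Q' - {q'})" using eq by (auto simp: g_def)
      then have "insert x q = insert x q'" using notin[OF Q(3)] by auto
      then have qq: "q = q'" using nx by (simp add: insert_ident)
      have "insert x q \<notin> Q" "insert x q \<notin> Q'" using notin Q by auto
      then have "Q - {q} = Q' - {q}" 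
        using eq unfolding g_def qq by (simp add: insert_ident)
      then show "Q = Q' \<and> q = q'" using Q qq by blast
    qed
    have "card (?parts (insert x A) k) =
        card (f ` ?parts A l) + card (g ` Sigma (?parts A k) (\<lambda>Q. Q))"
      unfolding split using fin fin_parts disj
      by (intro card_Un_disjoint finite_imageI finite_SigmaI) auto
    also have "\<dots> = card (?parts A l) + (\<Sum>Q\<in>?parts A k. card Q)"
      using fin fin_parts by (simp add: card_image inj_f inj_g)
    also have "(\<Sum>Q\<in>?parts A k. card Q) = k * card (?parts A k)"
      by simp
    finally show ?thesis using insert Suc by simp
  qed
qed

end

theory Submission
  imports Defs "HOL-Library.Poly_Mapping" "HOL-Computational_Algebra.Formal_Power_Series"
begin

text \<open>Let \<open>\<phi> k\<close> be the ranks. All statements amount to the identity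
  \<open>\<Prod>k (1 - t ^ k) ^ \<phi> k = \<Sum>j (- 1) ^ j b(n, n - j) t ^ j\<close>, from which the formula follows by a
  logarithmic derivative, the multinomial expansion and Moebius inversion. The right-hand side
  is the clique polynomial of a graph on coloured edges \<open>i < j\<close>: a clique is a forest of
  increasing trees whose blue edges start at roots, and adding the last vertex gives the recursions of the
  Lah numbers (two colours) and of the Stirling numbers (blue only). By Cartier and Foata its inverse
  counts the words in the edges up to commutations along the graph. By Poincare, Birkhoff and Witt
  the inverse of the left-hand side counts the ordered words in a basis of the graded Lie algebra of
  the lower central series. Both counts agree in every degree.

  On the one hand the quadratic relations of the graded Lie algebra turn the commutator of two adjacent
  edges into products of higher level, so one word of each commutation class spans the enveloping
  algebra. On the other hand the Magnus expansion \<open>x i j \<mapsto> 1 + X i j\<close> maps the group to the free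
  algebra modulo the group relations, where the words in the basis span everything, while one word of each
  commutation class stays independent. The independence is a diamond lemma modulo commutations: it suffices
  that the Jacobi sum of three pairwise adjacent letters lies in the ideal at a higher level, and for the
  pure virtual braid relations this follows from the boundary of the permutohedron.\<close>

section \<open>Free algebras and commutation relators\<close>

text \<open>Two algebras must be shown to have the same size: the enveloping algebra of the graded
  Lie algebra and the quotient that receives the Magnus expansion. Each requires an independence
  statement in the presence of relators with tails, so a single diamond lemma is stated for an
  arbitrary graph; Poincare-Birkhoff-Witt is its instance for a complete graph. Two gradings are
  kept apart. The level rises strictly in tails and drives the inductions; the degree never falls,
  which makes the truncation at \<open>p\<close> consistent. The Magnus expansion respects
  filtrations only, so counts are compared cumulatively below each \<open>p\<close>. Red letters
  \<open>x i j + x j i\<close> are introduced because suitable combinations of triangle relations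
  then have a single commutator as leading term. Lower central quotients are handled through complex
  functionals on the group. Elements of \<open>vP_plus\<close> are classes of words in all
  generators; its Magnus map is therefore defined on all of \<open>vP n\<close>, with generators of
  decreasing indices sent to inverses.\<close>

instantiation list :: (type) monoid_add
begin
definition zero_list :: "'a list" where "zero_list = []"
definition plus_list :: "'a list \<Rightarrow> 'a list \<Rightarrow> 'a list" where "plus_list = (@)"
instance by standard (simp_all add: zero_list_def plus_list_def)
end

abbreviation "lookup \<equiv> Poly_Mapping.lookup"
abbreviation "keys \<equiv> Poly_Mapping.keys"

text \<open>With lists as an additive monoid under append, the convolution product of finitely
  supported functions is concatenation, so this type is the free associative algebra over the
  complex numbers.\<close>

type_synonym 'a free_algebra = "'a list \<Rightarrow>\<^sub>0 complex"

definition mon :: "'a list \<Rightarrow> 'a free_algebra" where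
  "mon w = Poly_Mapping.single w 1"

definition scal :: "complex \<Rightarrow> 'a free_algebra \<Rightarrow> 'a free_algebra" where
  "scal c f = Poly_Mapping.single [] c * f"

lemma lookup_scal [simp]: "lookup (scal c f) w = c * lookup f w"
proof -
  have "lookup (scal c f) w = Sum_any (\<lambda>l. (c when [] = l) * Sum_any (\<lambda>q. lookup f q when w = l @ q))"
    by (simp add: scal_def lookup_mult lookup_single plus_list_def)
  also have "\<dots> = Sum_any (\<lambda>l. (c * Sum_any (\<lambda>q. lookup f q when w = l @ q)) when [] = l)"
    by (intro Sum_any.cong) (simp add: when_def)
  also have "\<dots> = c * lookup f w" by simp
  finally show ?thesis .
qed

lemma lookup_mult_single_Nil: "lookup (f * Poly_Mapping.single [] c) w = lookup f w * (c :: complex)"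
proof -
  have "lookup (f * Poly_Mapping.single [] c) w = Sum_any (\<lambda>l. lookup f l * Sum_any (\<lambda>q. (c when w = l @ q) when [] = q))"
    by (simp add: lookup_mult lookup_single plus_list_def when_when conj_commute cong: conj_cong)
  also have "\<dots> = Sum_any (\<lambda>l. (lookup f l * c) when w = l)" by (simp add: mult_when)
  also have "\<dots> = lookup f w * c" by simp
  finally show ?thesis .
qed

lemma scal_commute: "scal c f = f * Poly_Mapping.single [] c"
  by (simp add: poly_mapping_eq_iff fun_eq_iff lookup_mult_single_Nil)

interpretation fa: vector_space scal
  by unfold_locales (auto simp: poly_mapping_eq_iff fun_eq_iff lookup_add algebra_simps)

lemma scal_mult_left [simp]: "scal c f * g = scal c (f * g)"
  by (simp add: scal_def mult.assoc)

lemma scal_mult_right [simp]: "f * scal c g = scal c (f * g)"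
  by (simp add: scal_commute mult.assoc)

lemma mon_Nil: "mon [] = 1"
  by (simp add: mon_def flip: zero_list_def)

lemma mon_append: "mon (u @ v) = mon u * mon v"
  by (simp add: mon_def mult_single flip: plus_list_def)

lemma mon_Cons: "mon (x # v) = mon [x] * mon v"
  using mon_append[of "[x]" v] by simp

lemma lookup_mon: "lookup (mon v) w = (if v = w then 1 else 0)"
  by (simp add: mon_def lookup_single when_def)

lemma keys_mon [simp]: "keys (mon w) = {w}"
  by (simp add: mon_def)

lemma free_algebra_expand:
  assumes "finite A" "keys f \<subseteq> A"
  shows "f = (\<Sum>w\<in>A. scal (lookup f w) (mon w))"
proof -
  have "(\<Sum>w\<in>A. lookup f w * lookup (mon w) v) = lookup f v" for v
  proof -
    have "(\<Sum>w\<in>A. lookup f w * lookup (mon w) v) = (\<Sum>w\<in>A. if w = v then lookup f v else 0)"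
      by (intro sum.cong) (auto simp: lookup_mon)
    also have "\<dots> = (if v \<in> A then lookup f v else 0)" using assms(1) by simp
    also have "\<dots> = lookup f v" using assms(2) by (metis in_keys_iff subsetD)
    finally show ?thesis .
  qed
  then show ?thesis by (simp add: poly_mapping_eq_iff fun_eq_iff lookup_sum)
qed

lemma free_algebra_in_span: "f \<in> fa.span (mon ` keys f)"
proof -
  have "(\<Sum>w\<in>keys f. scal (lookup f w) (mon w)) \<in> fa.span (mon ` keys f)"
    by (intro fa.span_sum fa.span_scale fa.span_base) auto
  then show ?thesis using free_algebra_expand[of "keys f" f] by simp
qed

lemma keys_scal: "keys (scal c f) \<subseteq> keys f"
  by (auto simp: in_keys_iff)

lemma keys_mult_mon: "keys (f * g) \<subseteq> {u @ v | u v. u \<in> keys f \<and> v \<in> keys g}"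
  using keys_mult[of f g] by (auto simp: plus_list_def)

lemma keys_diff_subset: "keys (f - g :: 'a free_algebra) \<subseteq> keys f \<union> keys g"
  by (auto simp: in_keys_iff lookup_minus)

lemma subspace_keys: "fa.subspace {f :: 'a free_algebra. \<forall>w\<in>keys f. P w}"
proof (rule fa.subspaceI)
  fix f g :: "'a free_algebra" assume "f \<in> {f. \<forall>w\<in>keys f. P w}" "g \<in> {f. \<forall>w\<in>keys f. P w}"
  then show "f + g \<in> {f. \<forall>w\<in>keys f. P w}" using keys_add[of f g] by blast
next
  fix c and f :: "'a free_algebra" assume "f \<in> {f. \<forall>w\<in>keys f. P w}"
  then show "scal c f \<in> {f. \<forall>w\<in>keys f. P w}" using keys_scal[of c f] by blast
qed simp

definition weight :: "('a \<Rightarrow> nat) \<Rightarrow> 'a list \<Rightarrow> nat" where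
  "weight d w = sum_list (map d w)"

lemma weight_simps [simp]:
  "weight d [] = 0" "weight d (x # w) = d x + weight d w" "weight d (u @ v) = weight d u + weight d v"
  by (simp_all add: weight_def)

text \<open>Words of degree at least \<open>p\<close> are killed throughout, so \<open>relator_ideal E d \<omega> p \<rho> 0\<close> is the
  truncated ideal of relations; \<open>relator_ideal E d \<omega> p \<rho> s\<close> is the part that is visibly of level
  at least \<open>s\<close>.\<close>

definition relator_ideal :: "('a \<Rightarrow> 'a \<Rightarrow> bool) \<Rightarrow> ('a \<Rightarrow> nat) \<Rightarrow> ('a \<Rightarrow> nat) \<Rightarrow> nat \<Rightarrow>
    ('a \<Rightarrow> 'a \<Rightarrow> 'a free_algebra) \<Rightarrow> nat \<Rightarrow> 'a free_algebra set" where
  "relator_ideal E d \<omega> p \<rho> s = fa.span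
     ({mon u * \<rho> x y * mon v | u x y v. E x y \<and> weight \<omega> u + \<omega> x + \<omega> y + weight \<omega> v \<ge> s} \<union>
      {mon w | w. weight d w \<ge> p})"

lemma relator_idealI:
  "E x y \<Longrightarrow> weight \<omega> u + \<omega> x + \<omega> y + weight \<omega> v \<ge> s \<Longrightarrow>
    mon u * \<rho> x y * mon v \<in> relator_ideal E d \<omega> p \<rho> s"
  unfolding relator_ideal_def by (rule fa.span_base) blast

lemma subspace_relator_ideal: "fa.subspace (relator_ideal E d \<omega> p \<rho> s)"
  by (simp add: relator_ideal_def)

section \<open>Commutation classes of words and their initial letters\<close>

inductive commute_step :: "('a \<Rightarrow> 'a \<Rightarrow> bool) \<Rightarrow> 'a list \<Rightarrow> 'a list \<Rightarrow> bool"
  for E :: "'a \<Rightarrow> 'a \<Rightarrow> bool" where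
  "E x y \<Longrightarrow> commute_step E (u @ x # y # v) (u @ y # x # v)"

definition commute_equiv :: "('a \<Rightarrow> 'a \<Rightarrow> bool) \<Rightarrow> 'a list \<Rightarrow> 'a list \<Rightarrow> bool" where
  "commute_equiv E = (commute_step E)\<^sup>*\<^sup>*"

definition initial :: "('a \<Rightarrow> 'a \<Rightarrow> bool) \<Rightarrow> 'a list \<Rightarrow> 'a set" where
  "initial E w = {m. \<exists>u v. w = u @ m # v \<and> (\<forall>z\<in>set u. E z m)}"

locale commutation =
  fixes E :: "'a \<Rightarrow> 'a \<Rightarrow> bool"
  assumes irrefl: "\<not> E x x" and sym: "E x y \<Longrightarrow> E y x"
begin

lemma step_sym: "commute_step E u v \<Longrightarrow> commute_step E v u"
  by (auto elim!: commute_step.cases intro: commute_step.intros sym)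

lemma equiv_sym: "commute_equiv E u v \<Longrightarrow> commute_equiv E v u"
  unfolding commute_equiv_def
  by (induction rule: rtranclp_induct) (auto intro: step_sym converse_rtranclp_into_rtranclp)

lemma equiv_refl [simp]: "commute_equiv E u u"
  by (simp add: commute_equiv_def)

lemma equiv_trans: "commute_equiv E u v \<Longrightarrow> commute_equiv E v w \<Longrightarrow> commute_equiv E u w"
  unfolding commute_equiv_def by (rule rtranclp_trans)

lemma equiv_induct [consumes 1, case_names refl step]:
  assumes "commute_equiv E u v" "P u"
    "\<And>a x y b. commute_equiv E u (a @ x # y # b) \<Longrightarrow> E x y \<Longrightarrow> P (a @ x # y # b) \<Longrightarrow> P (a @ y # x # b)"
  shows "P v"
  using assms(1) unfolding commute_equiv_def
proof (induction rule: rtranclp_induct)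
  case (step y z)
  then show ?case using assms(3) by (auto elim!: commute_step.cases simp: commute_equiv_def)
qed (fact assms(2))

lemma equiv_context:
  assumes "commute_equiv E u v"
  shows "commute_equiv E (a @ u @ b) (a @ v @ b)"
  using assms
proof (induction rule: equiv_induct)
  case (step c x y d)
  have "commute_step E ((a @ c) @ x # y # (d @ b)) ((a @ c) @ y # x # (d @ b))"
    using step(2) by (rule commute_step.intros)
  then have "commute_equiv E (a @ (c @ x # y # d) @ b) (a @ (c @ y # x # d) @ b)"
    by (simp add: commute_equiv_def r_into_rtranclp)
  with step(3) show ?case by (rule equiv_trans)
qed simp

lemma equiv_swap: "E x y \<Longrightarrow> commute_equiv E (u @ x # y # v) (u @ y # x # v)"
  by (simp add: commute_equiv_def commute_step.intros r_into_rtranclp)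

lemma equiv_weight: "commute_equiv E u v \<Longrightarrow> weight d u = weight d v"
  by (induction rule: equiv_induct) simp_all

lemma equiv_mset: "commute_equiv E u v \<Longrightarrow> mset u = mset v"
  by (induction rule: equiv_induct) simp_all

text \<open>No letter is adjacent to itself, so an occurrence that can be moved to the front is the
  first one.\<close>

lemma initial_decomp:
  assumes "m \<in> initial E w"
  obtains u v where "w = u @ m # v" "\<And>z. z \<in> set u \<Longrightarrow> E z m" "m \<notin> set u"
  using assms irrefl unfolding initial_def by blast

lemma initial_nonempty: "w \<noteq> [] \<Longrightarrow> initial E w \<noteq> {}"
proof -
  assume "w \<noteq> []"
  then have "w = [] @ hd w # tl w" by simp
  then have "hd w \<in> initial E w" unfolding initial_def by fastforce
  then show ?thesis by blast
qed

lemma initial_step: "E x y \<Longrightarrow> initial E (u @ x # y # v) \<subseteq> initial E (u @ y # x # v)"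
proof
  fix m assume xy: "E x y" and m: "m \<in> initial E (u @ x # y # v)"
  obtain a b where ab: "u @ x # y # v = a @ m # b" "\<And>z. z \<in> set a \<Longrightarrow> E z m" "m \<notin> set a"
    using initial_decomp[OF m] by metis
  \<comment> \<open>The movable occurrence of \<open>m\<close> lies before the swapped pair, is one
    of its two letters, or lies behind it.\<close>
  consider c where "u = a @ m # c" | "u = a" "m = x" | "u @ [x] = a" "m = y"
    | c where "a = u @ x # y # c" "v = c @ m # b"
    using ab(1) by (auto simp: append_eq_append_conv2 append_eq_Cons_conv Cons_eq_append_conv)
  then show "m \<in> initial E (u @ y # x # v)"
  proof cases
    case 1
    then have "u @ y # x # v = a @ m # (c @ y # x # v)" by simp
    then show ?thesis unfolding initial_def using ab(2) by blast
  next
    case 2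
    then have "u @ y # x # v = (u @ [y]) @ m # v" by simp
    moreover have "\<forall>z\<in>set (u @ [y]). E z m" using ab(2) 2 sym[OF xy] by auto
    ultimately show ?thesis unfolding initial_def by blast
  next
    case 3
    then have "u @ y # x # v = u @ m # (x # v)" "\<forall>z\<in>set u. E z m" using ab(2) by auto
    then show ?thesis unfolding initial_def by blast
  next
    case (4 c)
    then have "u @ y # x # v = (u @ y # x # c) @ m # b" by simp
    moreover have "\<forall>z\<in>set (u @ y # x # c). E z m" using ab(2) 4 by auto
    ultimately show ?thesis unfolding initial_def by blast
  qed
qed

lemma initial_equiv: "commute_equiv E u v \<Longrightarrow> initial E u = initial E v"
proof (induction rule: equiv_induct)
  case (step a x y b)
  then show ?case using initial_step[of x y a b] initial_step[OF sym, of x y a b] by blast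
qed simp

end

text \<open>The two conditions in \<open>tail\<close> have different tasks. The strict rise of the
  level makes commutators the leading terms; the degree condition guarantees that relators never
  turn a dead word into a live one.\<close>

locale relators_base = commutation E for E :: "'a \<Rightarrow> 'a \<Rightarrow> bool" +
  fixes d \<omega> :: "'a \<Rightarrow> nat" and p :: nat and \<rho> :: "'a \<Rightarrow> 'a \<Rightarrow> 'a free_algebra"
  assumes rho_sym: "E x y \<Longrightarrow> \<rho> y x = - \<rho> x y"
    and tail: "E x y \<Longrightarrow> w \<in> keys (\<rho> x y - (mon [x, y] - mon [y, x])) \<Longrightarrow>
      \<omega> x + \<omega> y < weight \<omega> w \<and> d x + d y \<le> weight d w"
begin

abbreviation "J \<equiv> relator_ideal E d \<omega> p \<rho>"

text \<open>The level filtration of the whole free algebra, up to words killed by the truncation.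
  The aim is \<open>J_far\<close>: on the ideal it coincides with the filtration by visible
  level.\<close>

definition far :: "nat \<Rightarrow> 'a free_algebra set" where
  "far s = {f. \<forall>w\<in>keys f. weight \<omega> w \<ge> s \<or> weight d w \<ge> p}"

lemma far_subspace: "fa.subspace (far s)"
  unfolding far_def by (rule subspace_keys)

lemmas J_subspace = subspace_relator_ideal[of E d \<omega> p \<rho>]

lemmas J_gen = relator_idealI[of E _ _ _ \<omega> _ _ \<rho> d p]

lemma J_dead: "(\<And>w. w \<in> keys f \<Longrightarrow> weight d w \<ge> p) \<Longrightarrow> f \<in> J s"
proof -
  assume *: "\<And>w. w \<in> keys f \<Longrightarrow> weight d w \<ge> p"
  have "f \<in> fa.span (mon ` keys f)" by (rule free_algebra_in_span)
  moreover have "fa.span (mon ` keys f) \<subseteq> J s"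
    unfolding relator_ideal_def by (intro fa.span_mono) (use * in blast)
  ultimately show ?thesis by blast
qed

lemma J_antimono: "s \<le> t \<Longrightarrow> J t \<subseteq> J s"
  unfolding relator_ideal_def by (intro fa.span_mono) fastforce

lemmas J_add = fa.subspace_add[OF J_subspace] and J_diff = fa.subspace_diff[OF J_subspace]
  and J_scale = fa.subspace_scale[OF J_subspace] and J_0 = fa.subspace_0[OF J_subspace]
  and J_neg = fa.subspace_neg[OF J_subspace] and J_sum = fa.subspace_sum[OF J_subspace]

lemma J_induct [consumes 1, case_names zero add gen dead]:
  assumes "f \<in> J s" "P 0" "\<And>c f g. P f \<Longrightarrow> P g \<Longrightarrow> P (scal c f + g)"
    "\<And>u x y v. E x y \<Longrightarrow> weight \<omega> u + \<omega> x + \<omega> y + weight \<omega> v \<ge> s \<Longrightarrow> P (mon u * \<rho> x y * mon v)"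
    "\<And>w. weight d w \<ge> p \<Longrightarrow> P (mon w)"
  shows "P f"
  using assms(1) unfolding relator_ideal_def
proof (induction rule: fa.span_induct_alt)
  case (step c x y)
  then show ?case using assms(3)[of x y c] assms(4,5) by blast
qed (fact assms(2))

lemma keys_rho:
  assumes "E x y" "w \<in> keys (\<rho> x y)"
  shows "w = [x, y] \<or> w = [y, x] \<or> w \<in> keys (\<rho> x y - (mon [x, y] - mon [y, x]))"
  using assms(2) by (auto simp: in_keys_iff lookup_minus lookup_mon split: if_splits)

lemma keys_rho_weight:
  assumes "E x y" "w \<in> keys (\<rho> x y)"
  shows "\<omega> x + \<omega> y \<le> weight \<omega> w \<and> d x + d y \<le> weight d w"
  using keys_rho[OF assms] tail[OF assms(1)] by force

lemma keys_mon_mult_mon: "keys (mon u * f * mon v) \<subseteq> (\<lambda>w. u @ w @ v) ` keys f"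
  using keys_mult_mon[of "mon u * f" "mon v"] keys_mult_mon[of "mon u" f] by fastforce

text \<open>A word of degree at least \<open>p\<close> makes the product dead whatever its level; in
  all other cases levels add.\<close>

lemma J_mult_right:
  assumes "f \<in> J a" "g \<in> far b"
  shows "f * g \<in> J (a + b)"
proof -
  have mon: "f * mon w \<in> J (a + b)" if "weight \<omega> w \<ge> b \<or> weight d w \<ge> p" for w
    using assms(1)
  proof (induction rule: J_induct)
    case (add c f g)
    then show ?case by (simp add: distrib_right J_add J_scale)
  next
    case (gen u x y v)
    show ?case
    proof (cases "weight d w \<ge> p")
      case True
      have "keys (mon u * \<rho> x y * mon v * mon w) \<subseteq> (\<lambda>z. u @ z @ (v @ w)) ` keys (\<rho> x y)"
        using keys_mon_mult_mon[of u "\<rho> x y" "v @ w"] by (simp add: mon_append mult.assoc)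
      then show ?thesis using True by (intro J_dead) auto
    next
      case False
      then show ?thesis using gen that J_gen[of x y "a + b" u "v @ w"]
        by (simp add: mon_append mult.assoc)
    qed
  next
    case (dead v)
    then have "weight d (v @ w) \<ge> p" by simp
    then show ?case by (intro J_dead) (simp add: keys_mon flip: mon_append)
  qed (simp add: J_0)
  have "g = (\<Sum>w\<in>keys g. scal (lookup g w) (mon w))" by (rule free_algebra_expand) auto
  then have "f * g = (\<Sum>w\<in>keys g. scal (lookup g w) (f * mon w))"
    by (metis (no_types, lifting) scal_mult_right sum.cong sum_distrib_left)
  also have "\<dots> \<in> J (a + b)"
    using assms(2) by (intro J_sum J_scale mon) (auto simp: far_def)
  finally show ?thesis .
qed

lemma J_mult_left:
  assumes "f \<in> J a" "g \<in> far b"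
  shows "g * f \<in> J (a + b)"
proof -
  have mon: "mon w * f \<in> J (a + b)" if "weight \<omega> w \<ge> b \<or> weight d w \<ge> p" for w
    using assms(1)
  proof (induction rule: J_induct)
    case (add c f g)
    then show ?case by (simp add: distrib_left J_add J_scale)
  next
    case (gen u x y v)
    show ?case
    proof (cases "weight d w \<ge> p")
      case True
      have "keys (mon w * (mon u * \<rho> x y * mon v)) \<subseteq> (\<lambda>z. (w @ u) @ z @ v) ` keys (\<rho> x y)"
        using keys_mon_mult_mon[of "w @ u" "\<rho> x y" v] by (simp add: mon_append mult.assoc)
      then show ?thesis using True by (intro J_dead) auto
    next
      case False
      then show ?thesis using gen that J_gen[of x y "a + b" "w @ u" v]
        by (simp add: mon_append mult.assoc)
    qed
  next
    case (dead v)
    then have "weight d (w @ v) \<ge> p" by simp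
    then show ?case by (intro J_dead) (simp add: keys_mon flip: mon_append)
  qed (simp add: J_0)
  have "g = (\<Sum>w\<in>keys g. scal (lookup g w) (mon w))" by (rule free_algebra_expand) auto
  then have "g * f = (\<Sum>w\<in>keys g. scal (lookup g w) (mon w * f))"
    by (metis (no_types, lifting) scal_mult_left sum.cong sum_distrib_right)
  also have "\<dots> \<in> J (a + b)"
    using assms(2) by (intro J_sum J_scale mon) (auto simp: far_def)
  finally show ?thesis .
qed

lemma far_0 [simp]: "f \<in> far 0"
  by (simp add: far_def)

lemma far_mon: "weight \<omega> w \<ge> s \<Longrightarrow> mon w \<in> far s"
  by (simp add: far_def)

lemma far_mult: "f \<in> far a \<Longrightarrow> g \<in> far b \<Longrightarrow> f * g \<in> far (a + b)"
proof -
  assume *: "f \<in> far a" "g \<in> far b"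
  have "weight \<omega> w \<ge> a + b \<or> weight d w \<ge> p" if wk: "w \<in> keys (f * g)" for w
  proof -
    obtain u v where w: "w = u @ v" "u \<in> keys f" "v \<in> keys g"
      using subsetD[OF keys_mult_mon wk] by auto
    then have "weight \<omega> u \<ge> a \<or> weight d u \<ge> p" "weight \<omega> v \<ge> b \<or> weight d v \<ge> p"
      using * by (auto simp: far_def)
    then show ?thesis using w by auto
  qed
  then show ?thesis by (simp add: far_def)
qed

definition tl_rho :: "'a \<Rightarrow> 'a \<Rightarrow> 'a free_algebra" where
  "tl_rho x y = \<rho> x y - (mon [x, y] - mon [y, x])"

lemma tl_rho_far: "E x y \<Longrightarrow> tl_rho x y \<in> far (\<omega> x + \<omega> y + 1)"
  using tail unfolding far_def tl_rho_def by fastforce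

lemma rho_far: "E x y \<Longrightarrow> \<rho> x y \<in> far (\<omega> x + \<omega> y)"
  using keys_rho_weight unfolding far_def by blast

lemma comm_eq: "mon [x] * mon [y] - mon [y] * mon [x] = \<rho> x y - tl_rho x y"
  by (simp add: tl_rho_def flip: mon_append)

end

text \<open>Relators at disjoint positions are interchangeable up to higher level by themselves. The
  remaining overlap is that of three pairwise adjacent letters, whose order can be reversed in two
  ways; \<open>jacobi\<close> is the confluence condition for it.\<close>

locale relators = relators_base E d \<omega> p \<rho> for E :: "'a \<Rightarrow> 'a \<Rightarrow> bool" and d \<omega> p \<rho> +
  assumes jacobi: "E x y \<Longrightarrow> E y z \<Longrightarrow> E x z \<Longrightarrow>
      mon [x] * \<rho> y z - \<rho> y z * mon [x] + (mon [y] * \<rho> z x - \<rho> z x * mon [y]) +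
      (mon [z] * \<rho> x y - \<rho> x y * mon [z]) \<in> relator_ideal E d \<omega> p \<rho> (\<omega> x + \<omega> y + \<omega> z + 1)"
begin

text \<open>The sum of the relators met when \<open>m\<close> is moved to the left across \<open>u\<close>.\<close>

fun cross :: "'a list \<Rightarrow> 'a \<Rightarrow> 'a free_algebra" where
  "cross [] m = 0"
| "cross (x # u) m = \<rho> x m * mon u + mon [x] * cross u m"

fun cross_tl :: "'a list \<Rightarrow> 'a \<Rightarrow> 'a free_algebra" where
  "cross_tl [] m = 0"
| "cross_tl (x # u) m = tl_rho x m * mon u + mon [x] * cross_tl u m"

lemma cross_append: "cross (u @ v) m = cross u m * mon v + mon u * cross v m"
proof (induction u)
  case (Cons x u)
  then show ?case by (simp add: mon_append mon_Cons[of x u] algebra_simps)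
qed (simp add: mon_Nil)

text \<open>The leading parts of the relators telescope along the path of \<open>m\<close>, and only
  the tails are left over.\<close>

lemma cross_eq: "cross u m = mon u * mon [m] - mon [m] * mon u + cross_tl u m"
proof (induction u)
  case (Cons x u)
  have rho: "\<rho> x m = mon [x] * mon [m] - mon [m] * mon [x] + tl_rho x m"
    using comm_eq[of x m] by (simp add: algebra_simps)
  show ?case unfolding cross.simps cross_tl.simps Cons.IH rho mon_Cons[of x u]
    by (simp add: algebra_simps)
qed (simp add: mon_Nil)

lemma cross_in_J: "\<forall>z\<in>set u. E z m \<Longrightarrow> cross u m \<in> J (weight \<omega> u + \<omega> m)"
proof (induction u)
  case (Cons x u)
  have "mon [] * \<rho> x m * mon u \<in> J (weight \<omega> (x # u) + \<omega> m)" using Cons by (intro J_gen) auto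
  moreover have "mon [x] * cross u m \<in> J (weight \<omega> u + \<omega> m + \<omega> x)"
    using Cons by (intro J_mult_left) (auto intro: far_mon)
  ultimately show ?case by (simp add: mon_Nil add.commute add.left_commute J_add)
qed (simp add: J_0)

lemma cross_tl_far: "\<forall>z\<in>set u. E z m \<Longrightarrow> cross_tl u m \<in> far (weight \<omega> u + \<omega> m + 1)"
proof (induction u)
  case Nil then show ?case by (simp add: far_def)
next
  case (Cons x u)
  have "tl_rho x m * mon u \<in> far ((\<omega> x + \<omega> m + 1) + weight \<omega> u)"
    using Cons by (intro far_mult tl_rho_far far_mon) auto
  moreover have "mon [x] * cross_tl u m \<in> far (\<omega> x + (weight \<omega> u + \<omega> m + 1))"
    using Cons by (intro far_mult far_mon) auto
  ultimately show ?case by (simp add: add_ac fa.subspace_add[OF far_subspace])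
qed

text \<open>Trivial syzygy: two relators sitting at disjoint positions.\<close>

lemma cross_exchange:
  assumes "\<forall>z\<in>set u. E z m" "E x y" "s = weight \<omega> u + \<omega> m + weight \<omega> c + \<omega> x + \<omega> y + 1"
  shows "cross u m * mon c * (mon [x] * mon [y] - mon [y] * mon [x]) -
      (mon u * mon [m] - mon [m] * mon u) * mon c * \<rho> x y \<in> J s"
    and "(mon [x] * mon [y] - mon [y] * mon [x]) * mon c * cross u m -
      \<rho> x y * mon c * (mon u * mon [m] - mon [m] * mon u) \<in> J s"
proof -
  have 1: "mon u * mon [m] - mon [m] * mon u = cross u m - cross_tl u m"
    using cross_eq[of u m] by simp
  have rho: "mon [] * \<rho> x y * mon [] \<in> J (\<omega> x + \<omega> y)" using assms(2) by (intro J_gen) auto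
  have a: "cross u m * (mon c * tl_rho x y) \<in> J ((weight \<omega> u + \<omega> m) + (weight \<omega> c + (\<omega> x + \<omega> y + 1)))"
    using assms by (intro J_mult_right cross_in_J far_mult tl_rho_far far_mon) auto
  have b: "(cross_tl u m * mon c) * (mon [] * \<rho> x y * mon []) \<in>
      J ((\<omega> x + \<omega> y) + ((weight \<omega> u + \<omega> m + 1) + weight \<omega> c))"
    using assms by (intro J_mult_left rho far_mult cross_tl_far far_mon) auto
  have "cross u m * mon c * (mon [x] * mon [y] - mon [y] * mon [x]) -
      (mon u * mon [m] - mon [m] * mon u) * mon c * \<rho> x y =
     (cross_tl u m * mon c) * (mon [] * \<rho> x y * mon []) - cross u m * (mon c * tl_rho x y)"
    unfolding 1 comm_eq by (simp add: mon_Nil algebra_simps)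
  with J_diff[of _ s] a b show "cross u m * mon c * (mon [x] * mon [y] - mon [y] * mon [x]) -
      (mon u * mon [m] - mon [m] * mon u) * mon c * \<rho> x y \<in> J s"
    by (simp add: assms(3) add_ac)
  have a: "(tl_rho x y * mon c) * cross u m \<in> J ((weight \<omega> u + \<omega> m) + ((\<omega> x + \<omega> y + 1) + weight \<omega> c))"
    using assms by (intro J_mult_left cross_in_J far_mult tl_rho_far far_mon) auto
  have b: "(mon [] * \<rho> x y * mon []) * (mon c * cross_tl u m) \<in>
      J ((\<omega> x + \<omega> y) + (weight \<omega> c + (weight \<omega> u + \<omega> m + 1)))"
    using assms by (intro J_mult_right rho far_mult cross_tl_far far_mon) auto
  have "(mon [x] * mon [y] - mon [y] * mon [x]) * mon c * cross u m -
      \<rho> x y * mon c * (mon u * mon [m] - mon [m] * mon u) =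
     (mon [] * \<rho> x y * mon []) * (mon c * cross_tl u m) - (tl_rho x y * mon c) * cross u m"
    unfolding 1 comm_eq by (simp add: mon_Nil algebra_simps)
  with J_diff[of _ s] a b show "(mon [x] * mon [y] - mon [y] * mon [x]) * mon c * cross u m -
      \<rho> x y * mon c * (mon u * mon [m] - mon [m] * mon u) \<in> J s"
    by (simp add: assms(3) add_ac)
qed

text \<open>Chosen from the set \<open>initial E w\<close> alone, hence the same letter for all
  words of a commutation class. This is what makes the paths from two neighbouring words
  comparable.\<close>

definition front :: "'a list \<Rightarrow> 'a" where
  "front w = (SOME m. m \<in> initial E w)"

lemma front_in: "w \<noteq> [] \<Longrightarrow> front w \<in> initial E w"
  unfolding front_def using initial_nonempty by (simp add: some_in_eq)

lemma front_swap: "E x y \<Longrightarrow> front (u @ x # y # v) = front (u @ y # x # v)"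
  unfolding front_def using initial_equiv[OF equiv_swap[of x y u v]] by simp

text \<open>The total of the relators met on the way from \<open>w\<close> to a normal form, reached by repeatedly
  moving a chosen initial letter to the front.\<close>

function potential :: "'a list \<Rightarrow> 'a free_algebra" where
  "potential w = (if w \<noteq> [] then
     cross (takeWhile (\<lambda>z. z \<noteq> front w) w) (front w) * mon (tl (dropWhile (\<lambda>z. z \<noteq> front w) w)) +
     mon [front w] * potential (remove1 (front w) w) else 0)"
  by auto
termination
proof (relation "measure length", goal_cases)
  case (2 w)
  then have "front w \<in> set w" using front_in[of w] by (metis initial_decomp in_set_conv_decomp)
  then have "length (remove1 (front w) w) < length w"
    using 2 by (simp add: length_remove1 length_greater_0_conv[symmetric] del: length_greater_0_conv)
  then show ?case by simp
qed simp

declare potential.simps [simp del]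

lemma potential_front:
  assumes "w = u @ front w # v" "front w \<notin> set u"
  shows "potential w = cross u (front w) * mon v + mon [front w] * potential (u @ v)"
proof -
  define m where "m = front w"
  have w: "w = u @ m # v" "m \<notin> set u" using assms by (simp_all add: m_def)
  have "takeWhile (\<lambda>z. z \<noteq> m) w = u" "dropWhile (\<lambda>z. z \<noteq> m) w = m # v"
    "remove1 m w = u @ v" "w \<noteq> []"
    using w by (auto simp: takeWhile_append dropWhile_append remove1_append)
  then show ?thesis by (subst potential.simps) (simp add: m_def[symmetric])
qed

text \<open>Both words give up the same front letter \<open>m\<close>, and the position of
  \<open>m\<close> decides. If \<open>m\<close> is \<open>x\<close> or \<open>y\<close>, the two
  paths differ by exactly one relator. If \<open>m\<close> stands before the pair, a trivial syzygy
  remains besides the induction hypothesis. If it stands behind the pair, moving \<open>m\<close>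
  across \<open>x\<close> and \<open>y\<close> in both orders produces a Jacobi sum as well.\<close>

lemma potential_swap:
  assumes "E x y" "s = weight \<omega> (u @ x # y # v) + 1"
  shows "potential (u @ x # y # v) - potential (u @ y # x # v) - mon u * \<rho> x y * mon v \<in> J s"
  using assms
proof (induction "length (u @ v)" arbitrary: u v x y s rule: less_induct)
  case less
  note xy = less.prems(1) and s = less.prems(2)
  have ne: "x \<noteq> y" using irrefl xy by blast
  define w w' where "w = u @ x # y # v" and "w' = u @ y # x # v"
  define m where "m = front w"
  have m': "front w' = m" unfolding m_def w_def w'_def by (rule front_swap[OF xy, symmetric])
  have m: "m \<in> initial E w" unfolding m_def by (rule front_in) (simp add: w_def)
  obtain a b where ab: "w = a @ m # b" "\<And>z. z \<in> set a \<Longrightarrow> E z m" "m \<notin> set a"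
    using initial_decomp[OF m] by metis
  have pot_w: "potential w = cross a m * mon b + mon [m] * potential (a @ b)"
    by (rule potential_front[of w a b, folded m_def, OF ab(1,3)])
  have pot_w': "potential w' = cross a' m * mon b' + mon [m] * potential (a' @ b')"
    if "w' = a' @ m # b'" "m \<notin> set a'" for a' b'
    by (rule potential_front[of w' a' b', unfolded m', OF that])
  consider c where "u = a @ m # c" "b = c @ x # y # v" | "u = a" "m = x" "b = y # v"
    | "u @ [x] = a" "m = y" "b = v" | c where "a = u @ x # y # c" "v = c @ m # b"
    using ab(1) unfolding w_def
    by (auto simp: append_eq_append_conv2 append_eq_Cons_conv Cons_eq_append_conv)
  then show ?case
  proof cases
    case (1 c)
    have w': "w' = a @ m # (c @ y # x # v)" using 1 by (simp add: w'_def)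
    have IH: "potential ((a @ c) @ x # y # v) - potential ((a @ c) @ y # x # v) -
        mon (a @ c) * \<rho> x y * mon v \<in> J (weight \<omega> ((a @ c) @ x # y # v) + 1)"
      using xy 1 by (intro less.hyps) auto
    have 2: "mon [m] * (potential ((a @ c) @ x # y # v) - potential ((a @ c) @ y # x # v) -
        mon (a @ c) * \<rho> x y * mon v) \<in> J s"
      using J_mult_left[OF IH far_mon[of "\<omega> m" "[m]"]] by (simp add: s 1 add_ac)
    have 3: "(cross a m * mon c * (mon [x] * mon [y] - mon [y] * mon [x]) -
      (mon a * mon [m] - mon [m] * mon a) * mon c * \<rho> x y) * mon v \<in> J s"
    proof -
      have "(cross a m * mon c * (mon [x] * mon [y] - mon [y] * mon [x]) -
        (mon a * mon [m] - mon [m] * mon a) * mon c * \<rho> x y) \<in>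
        J (weight \<omega> a + \<omega> m + weight \<omega> c + \<omega> x + \<omega> y + 1)"
        using ab(2) xy by (intro cross_exchange) auto
      from J_mult_right[OF this far_mon[of "weight \<omega> v" v]] show ?thesis by (simp add: s 1 add_ac)
    qed
    have "potential w - potential w' - mon u * \<rho> x y * mon v =
       mon [m] * (potential ((a @ c) @ x # y # v) - potential ((a @ c) @ y # x # v) -
        mon (a @ c) * \<rho> x y * mon v) +
       (cross a m * mon c * (mon [x] * mon [y] - mon [y] * mon [x]) -
      (mon a * mon [m] - mon [m] * mon a) * mon c * \<rho> x y) * mon v"
      unfolding pot_w pot_w'[OF w' ab(3)] using 1
      by (simp add: mon_append mon_Cons[of _ "_ # _"] mon_Cons[of _ v] mon_Cons[of _ c] algebra_simps)
    with J_add[OF 2 3] show ?thesis by (simp add: w_def w'_def)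
  next
    case 2
    have w': "w' = (u @ [y]) @ m # v" "m \<notin> set (u @ [y])" using 2 ab(3) ne by (auto simp: w'_def)
    have "potential w - potential w' - mon u * \<rho> x y * mon v = 0"
      unfolding pot_w pot_w'[OF w'] using 2 rho_sym[OF xy]
      by (simp add: cross_append mon_Nil mon_Cons[of _ v] algebra_simps)
    then show ?thesis using J_0 by (simp add: w_def w'_def)
  next
    case 3
    have w': "w' = u @ m # (x # v)" "m \<notin> set u" using 3 ab(3) ne by (auto simp: w'_def)
    have "potential w - potential w' - mon u * \<rho> x y * mon v = 0"
      unfolding pot_w pot_w'[OF w'] using 3
      by (auto simp: cross_append mon_Nil mon_Cons[of _ v] algebra_simps)
    then show ?thesis using J_0 by (simp add: w_def w'_def)
  next
    case (4 c)
    have w': "w' = (u @ y # x # c) @ m # b" "m \<notin> set (u @ y # x # c)"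
      using 4 ab(3) by (auto simp: w'_def)
    have Em: "E x m" "E y m" "\<forall>z\<in>set u. E z m" "\<forall>z\<in>set c. E z m" using ab(2) 4 by auto
    have IH: "potential (u @ x # y # (c @ b)) - potential (u @ y # x # (c @ b)) -
        mon u * \<rho> x y * mon (c @ b) \<in> J (weight \<omega> (u @ x # y # (c @ b)) + 1)"
      using xy 4 by (intro less.hyps) auto
    have i1: "mon [m] * (potential (u @ x # y # (c @ b)) - potential (u @ y # x # (c @ b)) -
        mon u * \<rho> x y * mon (c @ b)) \<in> J s"
      using J_mult_left[OF IH far_mon[of "\<omega> m" "[m]"]] by (simp add: s 4 add_ac)
    have i2: "(cross u m * mon [] * (mon [x] * mon [y] - mon [y] * mon [x]) -
      (mon u * mon [m] - mon [m] * mon u) * mon [] * \<rho> x y) * mon (c @ b) \<in> J s"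
    proof -
      have "(cross u m * mon [] * (mon [x] * mon [y] - mon [y] * mon [x]) -
        (mon u * mon [m] - mon [m] * mon u) * mon [] * \<rho> x y) \<in>
        J (weight \<omega> u + \<omega> m + weight \<omega> [] + \<omega> x + \<omega> y + 1)"
        using Em xy by (intro cross_exchange) auto
      from J_mult_right[OF this far_mon[of "weight \<omega> (c @ b)" "c @ b"]] show ?thesis
        by (simp add: s 4 add_ac)
    qed
    have i3: "mon u * ((mon [x] * mon [y] - mon [y] * mon [x]) * mon [] * cross c m -
      \<rho> x y * mon [] * (mon c * mon [m] - mon [m] * mon c)) * mon b \<in> J s"
    proof -
      have "((mon [x] * mon [y] - mon [y] * mon [x]) * mon [] * cross c m -
        \<rho> x y * mon [] * (mon c * mon [m] - mon [m] * mon c)) \<in>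
        J (weight \<omega> c + \<omega> m + weight \<omega> [] + \<omega> x + \<omega> y + 1)"
        using Em xy by (intro cross_exchange) auto
      from J_mult_right[OF J_mult_left[OF this far_mon[of "weight \<omega> u" u]] far_mon[of "weight \<omega> b" b]]
      show ?thesis by (simp add: s 4 add_ac)
    qed
    have i4: "mon u * (mon [x] * \<rho> y m - \<rho> y m * mon [x] + (mon [y] * \<rho> m x - \<rho> m x * mon [y]) +
      (mon [m] * \<rho> x y - \<rho> x y * mon [m])) * mon (c @ b) \<in> J s"
    proof -
      have "(mon [x] * \<rho> y m - \<rho> y m * mon [x] + (mon [y] * \<rho> m x - \<rho> m x * mon [y]) +
        (mon [m] * \<rho> x y - \<rho> x y * mon [m])) \<in> J (\<omega> x + \<omega> y + \<omega> m + 1)"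
        using Em xy by (intro jacobi)
      from J_mult_right[OF J_mult_left[OF this far_mon[of "weight \<omega> u" u]]
          far_mon[of "weight \<omega> (c @ b)" "c @ b"]]
      show ?thesis by (simp add: s 4 add_ac)
    qed
    \<comment> \<open>The pieces in order: the induction hypothesis, the syzygy with
      \<open>u\<close>, the syzygy with \<open>c\<close>, and the Jacobi sum of \<open>x\<close>,
      \<open>y\<close>, \<open>m\<close>.\<close>
    have "potential w - potential w' - mon u * \<rho> x y * mon v =
       mon [m] * (potential (u @ x # y # (c @ b)) - potential (u @ y # x # (c @ b)) -
        mon u * \<rho> x y * mon (c @ b)) +
       (cross u m * mon [] * (mon [x] * mon [y] - mon [y] * mon [x]) -
      (mon u * mon [m] - mon [m] * mon u) * mon [] * \<rho> x y) * mon (c @ b) +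
       mon u * ((mon [x] * mon [y] - mon [y] * mon [x]) * mon [] * cross c m -
      \<rho> x y * mon [] * (mon c * mon [m] - mon [m] * mon c)) * mon b +
      mon u * (mon [x] * \<rho> y m - \<rho> y m * mon [x] + (mon [y] * \<rho> m x - \<rho> m x * mon [y]) +
      (mon [m] * \<rho> x y - \<rho> x y * mon [m])) * mon (c @ b)"
      unfolding pot_w pot_w'[OF w'] using 4 rho_sym[OF Em(1)]
      by (simp add: cross_append mon_append mon_Nil mon_Cons[of _ "_ # _"] mon_Cons[of _ "_ @ _"]
          mon_Cons[of _ c] mon_Cons[of _ b] algebra_simps)
    with J_add[OF J_add[OF J_add[OF i1 i2] i3] i4] show ?thesis by (simp add: w_def w'_def)
  qed
qed

lemma cross_dead:
  "\<forall>z\<in>set u. E z m \<Longrightarrow> w \<in> keys (cross u m) \<Longrightarrow> weight d w \<ge> weight d u + d m"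
proof (induction u arbitrary: w)
  case (Cons x u)
  then have "w \<in> keys (\<rho> x m * mon u) \<or> w \<in> keys (mon [x] * cross u m)"
    using keys_add[of "\<rho> x m * mon u" "mon [x] * cross u m"] by auto
  then show ?case
  proof
    assume "w \<in> keys (\<rho> x m * mon u)"
    then obtain v where "w = v @ u" "v \<in> keys (\<rho> x m)"
      using keys_mult_mon[of "\<rho> x m" "mon u"] by auto
    then show ?thesis using keys_rho_weight[of x m v] Cons.prems by auto
  next
    assume "w \<in> keys (mon [x] * cross u m)"
    then obtain v where "w = x # v" "v \<in> keys (cross u m)"
      using keys_mult_mon[of "mon [x]" "cross u m"] by auto
    then show ?thesis using Cons.IH[of v] Cons.prems by auto
  qed
qed simp

text \<open>Crossing letters never lowers the degree, so the potential of a dead word consists of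
  dead words.\<close>

lemma potential_dead: "v \<in> keys (potential w) \<Longrightarrow> weight d v \<ge> weight d w"
proof (induction "length w" arbitrary: v w rule: less_induct)
  case less
  show ?case
  proof (cases "w = []")
    case False
    define m where "m = front w"
    have m: "m \<in> initial E w" unfolding m_def by (rule front_in[OF False])
    obtain a b where ab: "w = a @ m # b" "\<And>z. z \<in> set a \<Longrightarrow> E z m" "m \<notin> set a"
      using initial_decomp[OF m] by metis
    have "potential w = cross a m * mon b + mon [m] * potential (a @ b)"
      by (rule potential_front[of w a b, folded m_def, OF ab(1,3)])
    then have "v \<in> keys (cross a m * mon b) \<or> v \<in> keys (mon [m] * potential (a @ b))"
      using less.prems keys_add[of "cross a m * mon b" "mon [m] * potential (a @ b)"] by auto
    then show ?thesis
    proof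
      assume "v \<in> keys (cross a m * mon b)"
      then obtain z where "v = z @ b" "z \<in> keys (cross a m)"
        using keys_mult_mon[of "cross a m" "mon b"] by auto
      then show ?thesis using cross_dead[of a m z] ab by auto
    next
      assume "v \<in> keys (mon [m] * potential (a @ b))"
      then obtain z where "v = m # z" "z \<in> keys (potential (a @ b))"
        using keys_mult_mon[of "mon [m]" "potential (a @ b)"] by auto
      then show ?thesis using less.hyps[of "a @ b" z] ab by auto
    qed
  qed simp
qed

text \<open>A linear section for the leading terms: it reads off the words of level \<open>s\<close>
  in an element and returns a combination of relators with those leading terms, provided the element
  lies in \<open>J s\<close>.\<close>

definition lead :: "nat \<Rightarrow> 'a free_algebra \<Rightarrow> 'a free_algebra" where
  "lead s f = (\<Sum>w\<in>{w\<in>keys f. weight \<omega> w = s}. scal (lookup f w) (potential w))"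

lemma lead_superset:
  assumes "finite A" "keys f \<subseteq> A"
  shows "lead s f = (\<Sum>w\<in>{w\<in>A. weight \<omega> w = s}. scal (lookup f w) (potential w))"
  unfolding lead_def using assms
  by (intro sum.mono_neutral_left) (auto simp: in_keys_iff)

lemma lead_add: "lead s (f + g) = lead s f + lead s g"
proof -
  let ?A = "keys f \<union> keys g"
  have "keys (f + g) \<subseteq> ?A" by (rule keys_add)
  then show ?thesis
    using lead_superset[of ?A "f + g" s] lead_superset[of ?A f s] lead_superset[of ?A g s]
    by (simp add: lookup_add fa.scale_left_distrib sum.distrib)
qed

lemma lead_scal: "lead s (scal c f) = scal c (lead s f)"
  using lead_superset[of "keys f" "scal c f" s] keys_scal[of c f]
  by (simp add: lead_def fa.scale_sum_right mult.assoc)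

lemma lead_diff: "lead s (f - g) = lead s f - lead s g"
  using lead_add[of s "f - g" g] by simp

lemma lead_mon: "lead s (mon w) = (if weight \<omega> w = s then potential w else 0)"
  by (auto simp: lead_def lookup_mon Collect_conv_if)

lemma lead_far: "f \<in> far (s + 1) \<Longrightarrow> lead s f \<in> J (s + 1)"
  unfolding lead_def
proof (intro J_sum J_scale)
  fix w assume "f \<in> far (s + 1)" "w \<in> {w \<in> keys f. weight \<omega> w = s}"
  then have "weight d w \<ge> p" by (auto simp: far_def)
  then show "potential w \<in> J (s + 1)" using potential_dead[of _ w] by (intro J_dead) force
qed

text \<open>The leading words of a relator of level exactly \<open>s\<close> differ by one swap, so
  by \<open>potential_swap\<close> the difference of their potentials is the relator itself up to
  level \<open>s + 1\<close>. A relator of higher level has no live words of level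
  \<open>s\<close>.\<close>

lemma lead_approx:
  assumes "f \<in> J s"
  shows "f - lead s f \<in> J (s + 1)"
  using assms
proof (induction rule: J_induct)
  case (add c f g)
  have "scal c f + g - lead s (scal c f + g) = scal c (f - lead s f) + (g - lead s g)"
    by (simp add: lead_add lead_scal fa.scale_right_diff_distrib)
  then show ?case using add by (metis J_add J_scale)
next
  case (gen u x y v)
  define t where "t = weight \<omega> u + \<omega> x + \<omega> y + weight \<omega> v"
  have tl: "mon u * tl_rho x y * mon v \<in> far (t + 1)"
    using far_mult[OF far_mult[OF far_mon[of "weight \<omega> u" u] tl_rho_far[OF gen(1)]]
        far_mon[of "weight \<omega> v" v]] by (simp add: t_def add_ac)
  have eq: "mon u * \<rho> x y * mon v = (mon (u @ x # y # v) - mon (u @ y # x # v)) + mon u * tl_rho x y * mon v"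
    by (simp add: mon_append mon_Cons[of _ "_ # _"] mon_Cons[of _ v] tl_rho_def algebra_simps)
  show ?case
  proof (cases "t = s")
    case True
    have "potential (u @ x # y # v) - potential (u @ y # x # v) - mon u * \<rho> x y * mon v \<in> J (s + 1)"
      using gen(1) True by (intro potential_swap) (auto simp: t_def)
    moreover have "lead s (mon u * \<rho> x y * mon v) =
       potential (u @ x # y # v) - potential (u @ y # x # v) + lead s (mon u * tl_rho x y * mon v)"
      using True unfolding eq lead_add lead_diff lead_mon by (simp add: t_def add_ac)
    moreover have "lead s (mon u * tl_rho x y * mon v) \<in> J (s + 1)"
      using tl True by (intro lead_far) simp
    ultimately have "(mon u * \<rho> x y * mon v - lead s (mon u * \<rho> x y * mon v)) =
        - (potential (u @ x # y # v) - potential (u @ y # x # v) - mon u * \<rho> x y * mon v)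
        - lead s (mon u * tl_rho x y * mon v)" by simp
    then show ?thesis
      by (metis J_neg J_diff \<open>lead s (mon u * tl_rho x y * mon v) \<in> J (s + 1)\<close>
        \<open>potential (u @ x # y # v) - potential (u @ y # x # v) - mon u * \<rho> x y * mon v \<in> J (s + 1)\<close>)
  next
    case False
    then have t: "t \<ge> s + 1" using gen(2) by (simp add: t_def)
    then have "mon u * \<rho> x y * mon v \<in> J (s + 1)" using gen(1) by (intro J_gen) (auto simp: t_def)
    moreover have "mon u * \<rho> x y * mon v \<in> far t"
      using far_mult[OF far_mult[OF far_mon[of "weight \<omega> u" u] rho_far[OF gen(1)]]
        far_mon[of "weight \<omega> v" v]] by (simp add: t_def add_ac)
    then have "mon u * \<rho> x y * mon v \<in> far (s + 1)" using t by (force simp: far_def)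
    then have "lead s (mon u * \<rho> x y * mon v) \<in> J (s + 1)" by (rule lead_far)
    ultimately show ?thesis by (rule J_diff)
  qed
next
  case (dead w)
  then have "potential w \<in> J (s + 1)" using potential_dead[of _ w] by (intro J_dead) force
  moreover have "mon w \<in> J (s + 1)" using dead by (intro J_dead) simp
  ultimately show ?case by (simp add: lead_mon J_diff)
qed (simp add: J_0 lead_def)

text \<open>One level is gained at a time: \<open>f\<close> agrees with \<open>lead s f\<close>
  modulo \<open>J (s + 1)\<close>, and once \<open>f\<close> has no live words of level
  \<open>s\<close>, the latter lies in \<open>J (s + 1)\<close> too.\<close>

lemma J_far: "f \<in> J 0 \<Longrightarrow> f \<in> far s \<Longrightarrow> f \<in> J s"
proof (induction s)
  case (Suc s)
  have "f \<in> far s" using Suc.prems(2) by (fastforce simp: far_def)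
  then have "f - lead s f \<in> J (s + 1)" using Suc by (intro lead_approx)
  moreover have "lead s f \<in> J (s + 1)" using Suc.prems by (intro lead_far) simp
  ultimately show ?case using J_add[of "f - lead s f" "s + 1" "lead s f"] by simp
qed simp

text \<open>At the level of \<open>w\<close> tails are invisible, and the two leading words of a
  relator are equivalent and carry opposite signs.\<close>

lemma class_sum_J:
  assumes "f \<in> J (weight \<omega> w)" "weight d w < p"
  shows "(\<Sum>v\<in>{v\<in>keys f. commute_equiv E w v}. lookup f v) = 0"
proof -
  define S where "S f = (\<Sum>v\<in>{v\<in>keys f. commute_equiv E w v}. lookup f v)" for f :: "'a free_algebra"
  have S_sup: "S f = (\<Sum>v\<in>{v\<in>A. commute_equiv E w v}. lookup f v)"
    if "finite A" "keys f \<subseteq> A" for f A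
    unfolding S_def using that by (intro sum.mono_neutral_left) (auto simp: in_keys_iff)
  have S_add: "S (f + g) = S f + S g" for f g
    using S_sup[of "keys f \<union> keys g" "f + g"] S_sup[of "keys f \<union> keys g" f]
      S_sup[of "keys f \<union> keys g" g] keys_add[of f g] by (simp add: lookup_add sum.distrib)
  have S_scal: "S (scal c f) = c * S f" for c f
    using S_sup[of "keys f" "scal c f"] keys_scal[of c f] by (simp add: S_def sum_distrib_left)
  have S_mon: "S (mon v) = (if commute_equiv E w v then 1 else 0)" for v
    by (auto simp: S_def lookup_mon Collect_conv_if)
  have S_diff: "S (f - g) = S f - S g" for f g using S_add[of "f - g" g] by simp
  have S_far: "S f = 0" if "f \<in> far (weight \<omega> w + 1)" for f
  proof -
    have "{v\<in>keys f. commute_equiv E w v} = {}"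
      using that assms(2) equiv_weight[of w _ \<omega>] equiv_weight[of w _ d] unfolding far_def by force
    then show ?thesis by (simp only: S_def sum.empty)
  qed
  have "S f = 0" using assms(1)
  proof (induction rule: J_induct)
    case (gen u x y v)
    define t where "t = weight \<omega> u + \<omega> x + \<omega> y + weight \<omega> v"
    have tl: "mon u * tl_rho x y * mon v \<in> far (t + 1)"
      using far_mult[OF far_mult[OF far_mon[of "weight \<omega> u" u] tl_rho_far[OF gen(1)]]
        far_mon[of "weight \<omega> v" v]] by (simp add: t_def add_ac)
    then have tl: "mon u * tl_rho x y * mon v \<in> far (weight \<omega> w + 1)"
      using gen(2) by (fastforce simp: far_def t_def)
    have eq: "mon u * \<rho> x y * mon v = (mon (u @ x # y # v) - mon (u @ y # x # v)) + mon u * tl_rho x y * mon v"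
      by (simp add: mon_append mon_Cons[of _ "_ # _"] mon_Cons[of _ v] tl_rho_def algebra_simps)
    show ?case unfolding eq S_add S_diff S_mon S_far[OF tl]
      using equiv_trans equiv_swap[OF gen(1)] equiv_swap[OF sym[OF gen(1)]] by (auto; blast)
  next
    case (dead v)
    then show ?case using assms(2) equiv_weight[of w v d] by (auto simp: S_mon)
  qed (simp_all add: S_add S_scal, simp add: S_def)
  then show ?thesis by (simp add: S_def)
qed

text \<open>In a nontrivial combination, a word of least level would be the only one of its class,
  so its coefficient would be a vanishing class sum.\<close>

theorem inequivalent_words_independent:
  assumes "finite W" and deg: "\<And>w. w \<in> W \<Longrightarrow> weight d w < p"
    and ineq: "\<And>v w. v \<in> W \<Longrightarrow> w \<in> W \<Longrightarrow> commute_equiv E v w \<Longrightarrow> v = w"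
    and J: "(\<Sum>w\<in>W. scal (c w) (mon w)) \<in> J 0" and "w \<in> W"
  shows "c w = 0"
proof (rule ccontr)
  assume "c w \<noteq> 0"
  define f where "f = (\<Sum>w\<in>W. scal (c w) (mon w))"
  have lookup: "lookup f v = (if v \<in> W then c v else 0)" for v
    using \<open>finite W\<close> by (simp add: f_def lookup_sum lookup_mon if_distrib cong: if_cong)
  have keys: "keys f = {v\<in>W. c v \<noteq> 0}" by (auto simp: in_keys_iff lookup split: if_splits)
  have "w \<in> keys f" using \<open>w \<in> W\<close> \<open>c w \<noteq> 0\<close> by (simp add: keys)
  then have ne: "keys f \<noteq> {}" by blast
  define v where "v = arg_min_on (weight \<omega>) (keys f)"
  have v1: "v \<in> keys f" unfolding v_def
    by (rule arg_min_if_finite(1)[OF finite_keys ne])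
  have v2: "weight \<omega> v \<le> weight \<omega> u" if "u \<in> keys f" for u
    unfolding v_def by (rule arg_min_least[where f = "weight \<omega>", OF finite_keys ne that])
  have far: "f \<in> far (weight \<omega> v)" unfolding far_def using v2 by blast
  have "f \<in> J 0" using J by (simp only: f_def)
  from J_far[OF this far] have "f \<in> J (weight \<omega> v)" .
  then have "(\<Sum>u\<in>{u\<in>keys f. commute_equiv E v u}. lookup f u) = 0"
  proof (rule class_sum_J)
    show "weight d v < p" using v1 deg unfolding keys by blast
  qed
  moreover have "{u\<in>keys f. commute_equiv E v u} = {v}" using v1 ineq by (auto simp: keys)
  ultimately show False using v1 by (simp add: in_keys_iff)
qed

end

section \<open>Counting commutation classes\<close>

text \<open>Serves twice: for sets of initial letters in the count of classes, and for sets of prime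
  factors in the divisor sum of the Moebius function.\<close>

lemma sum_alternating_Pow:
  assumes "finite A"
  shows "(\<Sum>C\<in>Pow A. (- 1) ^ card C) = (if A = {} then 1 else 0 :: 'a :: ring_1)"
  using assms
proof (induction A rule: finite_induct)
  case (insert x A)
  have "(\<Sum>C\<in>Pow (insert x A). (- 1) ^ card C) =
      (\<Sum>C\<in>Pow A. (- 1) ^ card C) + (\<Sum>C\<in>insert x ` Pow A. (- 1) ^ card C :: 'a)"
    unfolding Pow_insert using insert.hyps by (intro sum.union_disjoint) auto
  also have "(\<Sum>C\<in>insert x ` Pow A. (- 1) ^ card C) = (\<Sum>C\<in>Pow A. (- 1) ^ card (insert x C) :: 'a)"
    using insert.hyps by (subst sum.reindex) (auto simp: inj_on_def insert_ident subset_iff)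
  also have "\<dots> = (\<Sum>C\<in>Pow A. - ((- 1) ^ card C))"
  proof (intro sum.cong HOL.refl)
    fix C assume "C \<in> Pow A"
    then have "x \<notin> C" "finite C" using insert.hyps by (auto intro: finite_subset)
    then show "(- 1) ^ card (insert x C) = - ((- 1) ^ card C :: 'a)" by simp
  qed
  finally show ?case by (simp add: sum_negf)
qed simp

definition commute_class :: "('a \<Rightarrow> 'a \<Rightarrow> bool) \<Rightarrow> 'a list \<Rightarrow> 'a list set" where
  "commute_class E w = {v. commute_equiv E w v}"

definition words_of :: "('a \<Rightarrow> nat) \<Rightarrow> 'a set \<Rightarrow> nat \<Rightarrow> 'a list set" where
  "words_of d S n = {w. set w \<subseteq> S \<and> weight d w = n}"

definition trace_classes :: "('a \<Rightarrow> 'a \<Rightarrow> bool) \<Rightarrow> ('a \<Rightarrow> nat) \<Rightarrow> 'a set \<Rightarrow> nat \<Rightarrow> 'a list set set" where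
  "trace_classes E d S n = commute_class E ` words_of d S n"

definition cliques :: "('a \<Rightarrow> 'a \<Rightarrow> bool) \<Rightarrow> 'a set \<Rightarrow> 'a set set" where
  "cliques E S = {C. C \<subseteq> S \<and> (\<forall>x\<in>C. \<forall>y\<in>C. x \<noteq> y \<longrightarrow> E x y)}"

lemma length_le_weight:
  assumes "\<And>x. x \<in> S \<Longrightarrow> d x > 0" "set w \<subseteq> S"
  shows "length w \<le> weight d w"
  using assms(2)
proof (induction w)
  case (Cons x w)
  then show ?case using assms(1)[of x] by auto
qed simp

lemma finite_words_of:
  assumes "finite S" "\<And>x. x \<in> S \<Longrightarrow> d x > 0"
  shows "finite (words_of d S n)"
proof (rule finite_subset)
  show "words_of d S n \<subseteq> {w. set w \<subseteq> S \<and> length w \<le> n}"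
    using length_le_weight[of S d] assms(2) by (auto simp: words_of_def)
qed (use finite_lists_length_le[OF assms(1)] in auto)

context commutation
begin

lemma class_eq_iff: "commute_class E u = commute_class E v \<longleftrightarrow> commute_equiv E u v"
proof
  assume "commute_class E u = commute_class E v"
  then have "v \<in> commute_class E u" by (simp only:) (simp add: commute_class_def)
  then show "commute_equiv E u v" by (simp add: commute_class_def)
next
  assume "commute_equiv E u v"
  then show "commute_class E u = commute_class E v"
    unfolding commute_class_def using equiv_trans equiv_sym by blast
qed

text \<open>Yields left cancellation for commutation classes, since removing a leading letter undoes
  prefixing it.\<close>

lemma remove1_equiv:
  assumes "commute_equiv E u v"
  shows "commute_equiv E (remove1 a u) (remove1 a v)"
  using assms
proof (induction rule: equiv_induct)
  case (step c x y e)
  have ne: "x \<noteq> y" using irrefl step(2) by blast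
  have "commute_equiv E (remove1 a (c @ x # y # e)) (remove1 a (c @ y # x # e))"
  proof (cases "a \<in> set c")
    case True
    then show ?thesis using equiv_swap[OF step(2), of "remove1 a c" e] by (simp add: remove1_append)
  next
    case False
    then show ?thesis using equiv_swap[OF step(2), of c "remove1 a e"] ne
      by (simp add: remove1_append)
  qed
  with step(3) show ?case by (rule equiv_trans)
qed simp

lemma equiv_Cons_iff: "commute_equiv E (x # u) (x # v) \<longleftrightarrow> commute_equiv E u v"
  using remove1_equiv[of "x # u" "x # v" x] equiv_context[of u v "[x]" "[]"] by auto

lemma initial_move:
  assumes "m \<in> initial E w"
  shows "commute_equiv E w (m # remove1 m w)"
proof -
  obtain u v where w: "w = u @ m # v" "\<And>z. z \<in> set u \<Longrightarrow> E z m" "m \<notin> set u"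
    using initial_decomp[OF assms] by metis
  have "commute_equiv E (u @ m # v) (m # u @ v)"
    using w(2)
  proof (induction u arbitrary: v rule: rev_induct)
    case (snoc z u)
    have "commute_equiv E (u @ z # m # v) (u @ m # z # v)" using snoc.prems by (intro equiv_swap) auto
    moreover have "commute_equiv E (u @ m # z # v) (m # u @ z # v)"
      using snoc.IH[of "z # v"] snoc.prems by simp
    ultimately have "commute_equiv E (u @ z # m # v) (m # u @ z # v)" by (rule equiv_trans)
    then show ?case by simp
  qed simp
  then show ?thesis using w by (simp add: remove1_append)
qed

lemma initial_Cons: "initial E (x # w) = insert x {y \<in> initial E w. E x y}"
proof (intro equalityI subsetI)
  fix y assume "y \<in> initial E (x # w)"
  then obtain u v where "x # w = u @ y # v" "\<forall>z\<in>set u. E z y" unfolding initial_def by blast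
  then show "y \<in> insert x {y \<in> initial E w. E x y}"
    by (cases u) (auto simp: initial_def)
next
  fix y assume y: "y \<in> insert x {y \<in> initial E w. E x y}"
  show "y \<in> initial E (x # w)"
  proof (cases "y = x")
    case True
    have "x # w = [] @ x # w \<and> (\<forall>z\<in>set []. E z x)" by simp
    then show ?thesis unfolding initial_def True by blast
  next
    case False
    with y obtain u v where "w = u @ y # v" "\<forall>z\<in>set u. E z y" "E x y" unfolding initial_def by blast
    then have "x # w = (x # u) @ y # v \<and> (\<forall>z\<in>set (x # u). E z y)" by simp
    then show ?thesis unfolding initial_def by blast
  qed
qed

lemma initial_subset: "initial E w \<subseteq> set w"
  by (auto simp: initial_def)

lemma initial_clique: "a \<in> initial E w \<Longrightarrow> b \<in> initial E w \<Longrightarrow> a \<noteq> b \<Longrightarrow> E a b"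
  by (induction w) (use initial_subset[of "[]"] in \<open>auto simp: initial_Cons intro: sym\<close>)

definition count_initial :: "('a \<Rightarrow> nat) \<Rightarrow> 'a set \<Rightarrow> 'a set \<Rightarrow> nat \<Rightarrow> 'a list set set" where
  "count_initial d S C n = commute_class E ` {w \<in> words_of d S n. C \<subseteq> initial E w}"

text \<open>By left cancellation, prefixing \<open>x\<close> is a bijection onto the classes with
  initial letter \<open>x\<close>; the letters of \<open>C\<close> remain initial because
  \<open>x\<close> is adjacent to them.\<close>

lemma card_count_initial_insert:
  assumes "x \<in> S" "x \<notin> C" "\<And>c. c \<in> C \<Longrightarrow> E x c"
  shows "card (count_initial d S (insert x C) n) =
    (if d x \<le> n then card (count_initial d S C (n - d x)) else 0)"
proof (cases "d x \<le> n")
  case False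
  have "{w \<in> words_of d S n. insert x C \<subseteq> initial E w} = {}"
  proof -
    have False if "w \<in> words_of d S n" "x \<in> initial E w" for w
    proof -
      have "weight d w = weight d (x # remove1 x w)" by (rule equiv_weight[OF initial_move[OF that(2)]])
      then show False using that(1) False by (simp add: words_of_def)
    qed
    then show ?thesis by blast
  qed
  then have "count_initial d S (insert x C) n = {}" by (simp only: count_initial_def image_empty)
  then show ?thesis using False by simp
next
  case True
  define f where "f K = (\<Union>w\<in>K. commute_class E (x # w))" for K
  have f: "f (commute_class E w) = commute_class E (x # w)" for w
  proof -
    have "commute_class E (x # v) = commute_class E (x # w)" if "v \<in> commute_class E w" for v
      using that equiv_sym unfolding class_eq_iff equiv_Cons_iff by (simp add: commute_class_def)
    moreover have "w \<in> commute_class E w" by (simp add: commute_class_def)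
    ultimately show ?thesis unfolding f_def by blast
  qed
  have "inj_on f (count_initial d S C (n - d x))"
    by (auto simp: inj_on_def count_initial_def f class_eq_iff equiv_Cons_iff)
  moreover have "f ` count_initial d S C (n - d x) = count_initial d S (insert x C) n"
  proof (intro equalityI subsetI)
    fix K assume "K \<in> f ` count_initial d S C (n - d x)"
    then obtain w where w: "w \<in> words_of d S (n - d x)" "C \<subseteq> initial E w" "K = commute_class E (x # w)"
      by (auto simp: count_initial_def f)
    then have "x # w \<in> words_of d S n" "insert x C \<subseteq> initial E (x # w)"
      using assms True by (auto simp: words_of_def initial_Cons)
    then show "K \<in> count_initial d S (insert x C) n" using w(3) by (auto simp: count_initial_def)
  next
    fix K assume "K \<in> count_initial d S (insert x C) n"
    then obtain w where w: "w \<in> words_of d S n" "insert x C \<subseteq> initial E w" "K = commute_class E w"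
      by (auto simp: count_initial_def)
    have e: "commute_equiv E w (x # remove1 x w)" using w(2) by (intro initial_move) auto
    have "weight d w = weight d (x # remove1 x w)" by (rule equiv_weight[OF e])
    then have 1: "remove1 x w \<in> words_of d S (n - d x)"
      using w(1) set_remove1_subset[of x w] by (auto simp: words_of_def)
    have "C \<subseteq> initial E (x # remove1 x w)" using w(2) initial_equiv[OF e] by blast
    then have "C \<subseteq> initial E (remove1 x w)" using assms(2) by (auto simp: initial_Cons)
    with 1 have "commute_class E (remove1 x w) \<in> count_initial d S C (n - d x)"
      by (auto simp: count_initial_def)
    moreover have "K = f (commute_class E (remove1 x w))" using e w(3) by (simp add: f class_eq_iff)
    ultimately show "K \<in> f ` count_initial d S C (n - d x)" by blast
  qed
  ultimately show ?thesis using True card_image by fastforce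
qed

lemma card_count_initial:
  assumes "finite C" "C \<in> cliques E S"
  shows "card (count_initial d S C n) = (if sum d C \<le> n then card (trace_classes E d S (n - sum d C)) else 0)"
  using assms
proof (induction C arbitrary: n rule: finite_induct)
  case empty
  then show ?case by (simp add: count_initial_def trace_classes_def)
next
  case (insert x C)
  have C: "C \<in> cliques E S" using insert.prems by (auto simp: cliques_def)
  have 1: "card (count_initial d S (insert x C) n) =
    (if d x \<le> n then card (count_initial d S C (n - d x)) else 0)"
    using insert.prems insert.hyps by (intro card_count_initial_insert) (auto simp: cliques_def)
  have "sum d (insert x C) = d x + sum d C" using insert.hyps by simp
  then show ?case unfolding 1 insert.IH[OF C] by (simp add: le_diff_conv2 add.commute)
qed

definition class_series :: "('a \<Rightarrow> nat) \<Rightarrow> 'a set \<Rightarrow> real fps" where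
  "class_series d S = Abs_fps (\<lambda>n. real (card (trace_classes E d S n)))"

definition clique_series :: "('a \<Rightarrow> nat) \<Rightarrow> 'a set \<Rightarrow> real fps" where
  "clique_series d S = (\<Sum>C\<in>cliques E S. (- 1) ^ card C * fps_X ^ sum d C)"

text \<open>Cartier and Foata: the signed sum over the cliques contained in the set of initial letters
  of a class vanishes unless the class is that of the empty word.\<close>

theorem clique_series_mult_class_series:
  assumes S: "finite S" "\<And>x. x \<in> S \<Longrightarrow> d x > 0"
  shows "clique_series d S * class_series d S = 1"
proof (rule fps_ext)
  fix n
  \<comment> \<open>The sets of initial letters agree within a class, so the union is just their
    common value.\<close>
  define I where "I K = (\<Union>w\<in>K. initial E w)" for K
  have I: "I (commute_class E w) = initial E w" for w
    unfolding I_def using initial_equiv by (force simp: commute_class_def)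
  have fin: "finite (trace_classes E d S n)"
    unfolding trace_classes_def by (intro finite_imageI finite_words_of S)
  have fin_cl: "finite (cliques E S)"
    by (rule finite_subset[of _ "Pow S"]) (use S in \<open>auto simp: cliques_def\<close>)
  have cnt: "count_initial d S C n = {K \<in> trace_classes E d S n. C \<subseteq> I K}" for C
    by (auto simp: count_initial_def trace_classes_def I)
  have "fps_nth ((- 1) ^ card C * fps_X ^ sum d C * class_series d S) n =
      (- 1) ^ card C * (\<Sum>K\<in>trace_classes E d S n. if C \<subseteq> I K then 1 else 0)"
    if "C \<in> cliques E S" for C
  proof -
    have C: "finite C" using that S(1) by (auto simp: cliques_def intro: finite_subset)
    have s: "(- 1 :: real fps) ^ k = fps_const ((- 1) ^ k)" for k
    proof -
      have "(- 1 :: real fps) = fps_const (- 1)" by (metis fps_const_neg fps_const_1_eq_1)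
      then show ?thesis by (simp only: fps_const_power)
    qed
    have "fps_nth ((- 1) ^ card C * fps_X ^ sum d C * class_series d S) n =
      (- 1) ^ card C * real (card (count_initial d S C n))"
      unfolding s mult.assoc using card_count_initial[OF C that, of d n]
      by (simp add: fps_X_power_mult_nth class_series_def)
    also have "real (card (count_initial d S C n)) = (\<Sum>K\<in>trace_classes E d S n. if C \<subseteq> I K then 1 else 0)"
      using fin by (simp add: cnt sum.If_cases Int_def)
    finally show ?thesis .
  qed
  then have "fps_nth (clique_series d S * class_series d S) n =
      (\<Sum>C\<in>cliques E S. (- 1) ^ card C * (\<Sum>K\<in>trace_classes E d S n. if C \<subseteq> I K then 1 else 0))"
    by (simp add: clique_series_def sum_distrib_right fps_sum_nth)
  also have "\<dots> = (\<Sum>C\<in>cliques E S. \<Sum>K\<in>trace_classes E d S n. if C \<subseteq> I K then (- 1) ^ card C else 0)"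
    by (simp add: sum_distrib_left if_distrib cong: if_cong)
  also have "\<dots> = (\<Sum>K\<in>trace_classes E d S n. \<Sum>C\<in>cliques E S. if C \<subseteq> I K then (- 1) ^ card C else 0)"
    by (rule sum.swap)
  also have "\<dots> = (\<Sum>K\<in>trace_classes E d S n. if n = 0 then 1 else 0)"
  proof (intro sum.cong HOL.refl)
    fix K assume "K \<in> trace_classes E d S n"
    then obtain w where w: "w \<in> words_of d S n" "K = commute_class E w" by (auto simp: trace_classes_def)
    have sub: "initial E w \<subseteq> S" using w(1) initial_subset[of w] by (auto simp: words_of_def)
    have "{C \<in> cliques E S. C \<subseteq> I K} = Pow (initial E w)"
      using sub initial_clique[of _ w] by (auto simp: cliques_def w(2) I)
    then have "(\<Sum>C\<in>cliques E S. if C \<subseteq> I K then (- 1) ^ card C else 0) =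
        (\<Sum>C\<in>Pow (initial E w). (- 1) ^ card C :: real)"
      using fin_cl by (simp add: sum.inter_filter[symmetric])
    also have "\<dots> = (if initial E w = {} then 1 else 0)"
      by (rule sum_alternating_Pow) (use S(1) sub in \<open>auto intro: finite_subset\<close>)
    also have "initial E w = {} \<longleftrightarrow> w = []" using initial_nonempty[of w] initial_subset[of w] by auto
    also have "w = [] \<longleftrightarrow> n = 0"
      using w(1) length_le_weight[of S d w, OF S(2)] by (auto simp: words_of_def)
    finally show "(\<Sum>C\<in>cliques E S. if C \<subseteq> I K then (- 1) ^ card C else 0) = (if n = 0 then 1 else 0 :: real)" .
  qed
  also have "\<dots> = fps_nth (1 :: real fps) n"
  proof (cases "n = 0")
    case True
    have "words_of d S 0 = {[]}"
      using length_le_weight[of S d, OF S(2)] by (fastforce simp: words_of_def)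
    then show ?thesis using True by (simp add: trace_classes_def)
  qed simp
  finally show "fps_nth (clique_series d S * class_series d S) n = fps_nth 1 n" .
qed

end

text \<open>In a complete graph every subset is a clique, and the expanded product runs over all
  subsets. This is the Euler product attached to the ordered basis words.\<close>

lemma (in commutation) clique_series_complete:
  assumes "finite S" and "\<And>x y. x \<in> S \<Longrightarrow> y \<in> S \<Longrightarrow> x \<noteq> y \<Longrightarrow> E x y"
  shows "clique_series d S = (\<Prod>x\<in>S. 1 - fps_X ^ d x)"
proof -
  have "(\<Sum>C\<in>Pow S. (- 1) ^ card C * fps_X ^ sum d C) = (\<Prod>x\<in>S. 1 - fps_X ^ d x :: real fps)"
    using assms(1)
  proof (induction S rule: finite_induct)
    case (insert x S)
    let ?t = "\<lambda>C. (- 1) ^ card C * fps_X ^ sum d C :: real fps"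
    have "(\<Sum>C\<in>Pow (insert x S). ?t C) = (\<Sum>C\<in>Pow S. ?t C) + (\<Sum>C\<in>insert x ` Pow S. ?t C)"
      unfolding Pow_insert using insert.hyps by (intro sum.union_disjoint) auto
    also have "(\<Sum>C\<in>insert x ` Pow S. ?t C) = (\<Sum>C\<in>Pow S. ?t (insert x C))"
      using insert.hyps by (subst sum.reindex) (auto simp: inj_on_def insert_ident subset_iff)
    also have "\<dots> = (\<Sum>C\<in>Pow S. - (fps_X ^ d x * ?t C))"
    proof (intro sum.cong HOL.refl)
      fix C assume "C \<in> Pow S"
      then have "x \<notin> C" "finite C" using insert.hyps by (auto intro: finite_subset)
      then show "?t (insert x C) = - (fps_X ^ d x * ?t C)" by (simp add: power_add mult_ac)
    qed
    also have "\<dots> = - (fps_X ^ d x * (\<Sum>C\<in>Pow S. ?t C))" by (simp add: sum_negf sum_distrib_left)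
    finally show ?case using insert by (simp add: algebra_simps)
  qed simp
  moreover have "cliques E S = Pow S" using assms(2) by (auto simp: cliques_def)
  ultimately show ?thesis by (simp add: clique_series_def)
qed

section \<open>Spanning sets modulo a subspace\<close>

text \<open>A dimension comparison in the quotient by \<open>J\<close>, carried out upstairs: the
  expansions of the finitely many \<open>f w\<close> involve finitely many elements of
  \<open>J\<close>, and a basis \<open>B\<close> of their span is added to both families before the
  exchange lemma is applied.\<close>

lemma (in vector_space) card_le_of_independent_modulo:
  assumes J: "subspace J" and fin: "finite W" "finite T"
    and indep: "\<And>c w. (\<Sum>w\<in>W. c w *s f w) \<in> J \<Longrightarrow> w \<in> W \<Longrightarrow> c w = 0"
    and span: "\<And>w. w \<in> W \<Longrightarrow> f w \<in> span (T \<union> J)"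
  shows "card W \<le> card T"
proof -
  have nJ: "f w \<notin> J" if "w \<in> W" for w
  proof
    assume "f w \<in> J"
    have "(\<Sum>v\<in>W. (if v = w then 1 else 0) *s f v) = (\<Sum>v\<in>W. if v = w then f v else 0)"
      by (intro sum.cong) auto
    also have "\<dots> = f w" using fin that by simp
    finally show False using indep[of "\<lambda>v. if v = w then 1 else 0" w] \<open>f w \<in> J\<close> that by simp
  qed
  have inj: "inj_on f W"
  proof (rule inj_onI, rule ccontr)
    fix v w assume vw: "v \<in> W" "w \<in> W" "f v = f w" "v \<noteq> w"
    define c where "c u = (if u = v then 1 else if u = w then - 1 else 0 :: 'a)" for u
    have "(\<Sum>u\<in>W. c u *s f u) = (\<Sum>u\<in>{v, w}. c u *s f u)"
      using vw fin by (intro sum.mono_neutral_right) (auto simp: c_def)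
    also have "\<dots> = 0" using vw by (simp add: c_def)
    finally show False using indep[of c v] subspace_0[OF J] vw by (simp add: c_def)
  qed
  have "\<exists>K. finite K \<and> K \<subseteq> J \<and> f w \<in> span (T \<union> K)" if w: "w \<in> W" for w
  proof -
    obtain t r where t: "finite t" "t \<subseteq> T \<union> J" "f w = (\<Sum>a\<in>t. r a *s a)"
      using span[OF w] unfolding span_explicit by blast
    have "f w \<in> span (T \<union> (t \<inter> J))" unfolding t(3)
      by (intro span_sum span_scale span_base) (use t(2) in blast)
    then show ?thesis using t(1) by blast
  qed
  then obtain K where K: "\<And>w. w \<in> W \<Longrightarrow> finite (K w) \<and> K w \<subseteq> J \<and> f w \<in> span (T \<union> K w)"
    by metis
  define J0 where "J0 = (\<Union>w\<in>W. K w)"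
  have J0: "finite J0" "J0 \<subseteq> J" using K fin unfolding J0_def by blast+
  obtain B where B: "B \<subseteq> J0" "independent B" "J0 \<subseteq> span B"
    using maximal_independent_subset[of J0] by auto
  have finB: "finite B" using B(1) J0(1) by (rule finite_subset)
  have disj: "f ` W \<inter> B = {}" using nJ B(1) J0(2) by blast
  have "independent (f ` W \<union> B)"
  proof (rule independent_if_scalars_zero)
    fix g x assume sum0: "(\<Sum>x\<in>f ` W \<union> B. g x *s x) = 0" and x: "x \<in> f ` W \<union> B"
    have split: "(\<Sum>w\<in>W. g (f w) *s f w) + (\<Sum>x\<in>B. g x *s x) = 0"
      using sum0 fin finB disj by (simp add: sum.union_disjoint sum.reindex[OF inj])
    have "(\<Sum>x\<in>B. g x *s x) \<in> J"
      using B(1) J0(2) by (intro subspace_sum[OF J] subspace_scale[OF J]) blast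
    moreover have "(\<Sum>w\<in>W. g (f w) *s f w) = - (\<Sum>x\<in>B. g x *s x)"
      using split by (simp add: eq_neg_iff_add_eq_0)
    ultimately have "(\<Sum>w\<in>W. g (f w) *s f w) \<in> J" using subspace_neg[OF J] by simp
    then have z: "g (f w) = 0" if "w \<in> W" for w using indep[of "\<lambda>w. g (f w)" w] that by simp
    then have "(\<Sum>x\<in>B. g x *s x) = 0" using split by simp
    then have "g x = 0" if "x \<in> B" for x using B(2) finB that unfolding dependent_finite[OF finB] by blast
    then show "g x = 0" using x z by blast
  qed (use fin finB in auto)
  moreover have "f ` W \<union> B \<subseteq> span (T \<union> B)"
  proof -
    have "T \<union> K w \<subseteq> span (T \<union> B)" if "w \<in> W" for w
    proof -
      have "K w \<subseteq> span B" using that B(3) by (auto simp: J0_def)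
      also have "\<dots> \<subseteq> span (T \<union> B)" by (intro span_mono) auto
      finally show ?thesis using span_superset[of "T \<union> B"] by blast
    qed
    then have "span (T \<union> K w) \<subseteq> span (T \<union> B)" if "w \<in> W" for w
      using that span_minimal subspace_span by meson
    then show ?thesis using K span_superset[of "T \<union> B"] by blast
  qed
  ultimately have "card (f ` W \<union> B) \<le> card (T \<union> B)"
    using independent_span_bound[of "T \<union> B" "f ` W \<union> B"] fin finB by blast
  also have "card (f ` W \<union> B) = card W + card B"
    using fin finB disj by (simp add: card_Un_disjoint card_image inj)
  also have "card (T \<union> B) \<le> card T + card B" by (rule card_Un_le)
  finally show ?thesis by simp
qed

text \<open>Reduces a congruence between vectors to scalar identities; through it the expansion of
  complex-valued functionals on the group carries over to algebra-valued maps.\<close>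

lemma (in vector_space) separating_functional:
  assumes "subspace M" "v \<notin> M"
  obtains f where "Vector_Spaces.linear scale (*) f" "\<forall>x\<in>M. f x = 0" "f v \<noteq> 0"
proof -
  interpret vector_space_pair scale "(*) :: 'a \<Rightarrow> 'a \<Rightarrow> 'a"
    by unfold_locales (simp_all add: algebra_simps)
  obtain B where B: "B \<subseteq> M" "independent B" "M \<subseteq> span B"
    using maximal_independent_subset[of M] by auto
  have spB: "span B = M" using span_subspace[OF B(1,3) assms(1)] .
  then have "independent (insert v B)" using assms(2) B(2) by (simp add: independent_insertI)
  then obtain f where f: "Vector_Spaces.linear scale (*) f" "\<forall>x\<in>insert v B. f x = (if x = v then 1 else 0)"
    using linear_independent_extend[of "insert v B" "\<lambda>x. if x = v then 1 else 0"] by blast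
  have "v \<notin> B" using assms(2) B(1) by blast
  have "f x = 0" if "x \<in> M" for x
  proof -
    have "x \<in> span B" using that spB by simp
    then show ?thesis
    proof (induction rule: span_induct_alt)
      case (step c x y)
      then have "f x = 0" using f(2) \<open>v \<notin> B\<close> by auto
      then show ?case using step linear_add[OF f(1)] linear_scale[OF f(1)] by simp
    qed (rule linear_0[OF f(1)])
  qed
  moreover have "f v \<noteq> 0" using f(2) by simp
  ultimately show ?thesis using that f(1) by blast
qed

text \<open>Swapping adjacent letters costs only terms of higher level, and levels are bounded by
  \<open>N\<close> on \<open>W\<close>. Induction on the distance to \<open>N\<close> disposes of
  these terms, so each word may be replaced by the representative of its class.\<close>

lemma (in commutation) class_representatives_span:
  fixes val :: "'a list \<Rightarrow> 'b free_algebra"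
  assumes bound: "\<And>w. w \<in> W \<Longrightarrow> weight \<omega> w \<le> N"
    and closed: "\<And>u v. u \<in> W \<Longrightarrow> commute_equiv E u v \<Longrightarrow> v \<in> W"
    and swap: "\<And>u x y v. E x y \<Longrightarrow> u @ x # y # v \<in> W \<Longrightarrow>
      val (u @ x # y # v) - val (u @ y # x # v) \<in>
        fa.span (val ` {w \<in> W. weight \<omega> w > weight \<omega> (u @ x # y # v)} \<union> M)"
    and reps: "\<And>w. w \<in> W \<Longrightarrow> \<exists>r\<in>R. commute_equiv E w r"
    and "w \<in> W"
  shows "val w \<in> fa.span (val ` R \<union> M)"
  using \<open>w \<in> W\<close>
proof (induction "N - weight \<omega> w" arbitrary: w rule: less_induct)
  case less
  let ?S = "fa.span (val ` R \<union> M)"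
  have later: "fa.span (val ` {v \<in> W. weight \<omega> v > weight \<omega> w} \<union> M) \<subseteq> ?S"
  proof (rule fa.span_minimal)
    have "val v \<in> ?S" if "v \<in> W" "weight \<omega> v > weight \<omega> w" for v
      using less.hyps[of v] that bound[of v] by simp
    then show "val ` {v \<in> W. weight \<omega> v > weight \<omega> w} \<union> M \<subseteq> ?S"
      using fa.span_superset[of "val ` R \<union> M"] by blast
  qed simp
  have "val w - val v \<in> ?S" if "commute_equiv E w v" for v
    using that
  proof (induction rule: equiv_induct)
    case (step a x y b)
    have w: "weight \<omega> (a @ x # y # b) = weight \<omega> w"
      by (rule equiv_weight[OF step(1), symmetric])
    have "a @ x # y # b \<in> W" by (rule closed[OF less.prems step(1)])
    from subsetD[OF later, OF swap[OF step(2) this, unfolded w]]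
    have "val (a @ x # y # b) - val (a @ y # x # b) \<in> ?S" .
    then show ?case using fa.span_add[OF step(3)] by fastforce
  qed (simp add: fa.span_zero)
  moreover obtain r where "r \<in> R" "commute_equiv E w r" using reps[OF less.prems] by blast
  moreover have "val r \<in> ?S" using \<open>r \<in> R\<close> by (intro fa.span_base) blast
  ultimately show ?case using fa.span_add[of "val w - val r" _ "val r"] by fastforce
qed

text \<open>The representative depends on the class alone, and commutations preserve letters and
  weights; hence one choice works for all \<open>d\<close>, \<open>S\<close> and \<open>n\<close>
  simultaneously.\<close>

lemma (in commutation) class_representatives:
  obtains r where "\<forall>w. commute_equiv E w (r w)" "\<forall>v w. commute_equiv E v w \<longrightarrow> r v = r w"
    "\<forall>d S n. r ` words_of d S n \<subseteq> words_of d S n"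
    "\<forall>d S n. card (r ` words_of d S n) = card (trace_classes E d S n)"
proof -
  define r where "r w = (SOME v. v \<in> commute_class E w)" for w
  have r: "commute_equiv E w (r w)" for w
  proof -
    have "w \<in> commute_class E w" by (simp add: commute_class_def)
    then have "r w \<in> commute_class E w" unfolding r_def by (rule someI)
    then show ?thesis by (simp add: commute_class_def)
  qed
  have r2: "r v = r w" if "commute_equiv E v w" for v w
    using that class_eq_iff[of v w] by (simp add: r_def)
  have r3: "r ` words_of d S n \<subseteq> words_of d S n" for d and S :: "'a set" and n
  proof
    fix v assume "v \<in> r ` words_of d S n"
    then obtain w where w: "v = r w" "set w \<subseteq> S" "weight d w = n" by (auto simp: words_of_def)
    have "set (r w) = set w" using equiv_mset[OF r[of w]] by (metis set_mset_mset)
    then show "v \<in> words_of d S n" using w equiv_weight[OF r[of w], of d] by (simp add: words_of_def)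
  qed
  have r4: "card (r ` words_of d S n) = card (trace_classes E d S n)" for d S n
  proof -
    have "trace_classes E d S n = commute_class E ` r ` words_of d S n"
      unfolding trace_classes_def image_image using r class_eq_iff by (intro image_cong) auto
    moreover have "inj_on (commute_class E) (r ` words_of d S n)"
    proof (rule inj_onI, clarify)
      fix u v assume "commute_class E (r u) = commute_class E (r v)"
      then have "commute_equiv E u v" using r class_eq_iff equiv_trans equiv_sym by metis
      then show "r u = r v" by (rule r2)
    qed
    ultimately show ?thesis by (simp add: card_image)
  qed
  show thesis by (rule that[of r]) (use r r2 r3 r4 in blast)+
qed

section \<open>Tensor products with the complex numbers\<close>

text \<open>The additive map on formal sums of pairs induced by \<open>f\<close>. For additive
  \<open>f\<close> it kills the tensor relations and so induces a linear functional on the tensor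
  product.\<close>

definition form_extend :: "('a \<Rightarrow> complex) \<Rightarrow> ('a \<times> complex \<Rightarrow>\<^sub>0 int) \<Rightarrow> complex" where
  "form_extend f x = (\<Sum>q\<in>keys x. of_int (lookup x q) * (snd q * f (fst q)))"

lemma form_extend_superset:
  assumes "finite S" "keys x \<subseteq> S"
  shows "form_extend f x = (\<Sum>q\<in>S. of_int (lookup x q) * (snd q * f (fst q)))"
  unfolding form_extend_def using assms by (intro sum.mono_neutral_left) (auto simp: in_keys_iff)

lemma form_extend_add: "form_extend f (x + y) = form_extend f x + form_extend f y"
  using form_extend_superset[of "keys x \<union> keys y" "x + y" f] form_extend_superset[of "keys x \<union> keys y" x f]
    form_extend_superset[of "keys x \<union> keys y" y f] keys_add[of x y]
  by (simp add: lookup_add distrib_right sum.distrib)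

lemma form_extend_diff: "form_extend f (x - y) = form_extend f x - form_extend f y"
  using form_extend_add[of f "x - y" y] by simp

lemma form_extend_of: "form_extend f (frag_of (a, z)) = z * f a"
  by (simp add: form_extend_def keys_frag_of)

lemma form_extend_0: "form_extend f 0 = 0"
  by (simp add: form_extend_def)

lemma form_extend_rels:
  assumes f: "\<And>g h. g \<in> carrier A \<Longrightarrow> h \<in> carrier A \<Longrightarrow> f (g \<otimes>\<^bsub>A\<^esub> h) = f g + f h"
    and A: "comm_group A" and "x \<in> tensor_rels A"
  shows "form_extend f x = 0"
proof -
  interpret A: comm_group A by fact
  let ?F = "free_Abelian_group (carrier A \<times> (UNIV :: complex set))"
  interpret F: comm_group ?F by (rule abelian_free_Abelian_group)
  define rels where "rels =
      {frag_of (a \<otimes>\<^bsub>A\<^esub> b, z) - frag_of (a, z) - frag_of (b, z) | a b (z :: complex).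
         a \<in> carrier A \<and> b \<in> carrier A} \<union>
      {frag_of (a, z + w) - frag_of (a, z) - frag_of (a, w) | a (z :: complex) w. a \<in> carrier A}"
  have rels: "form_extend f h = 0" "keys h \<subseteq> carrier A \<times> UNIV" if "h \<in> rels" for h
  proof -
    show "form_extend f h = 0"
      using that f unfolding rels_def by (auto simp: form_extend_diff form_extend_of ring_distribs)
    show "keys h \<subseteq> carrier A \<times> UNIV"
      using that unfolding rels_def
      by (auto dest!: subsetD[OF keys_diff] simp: keys_frag_of)
  qed
  have "x \<in> generate ?F rels" using assms(3) by (simp add: tensor_rels_def rels_def)
  then show ?thesis
  proof induction
    case (inv h)
    then have "inv\<^bsub>?F\<^esub> h = 0 - h" using rels(2) by simp
    then show ?case using rels(1)[OF inv] by (simp only: form_extend_diff form_extend_0 diff_self)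
  qed (auto simp: form_extend_0 form_extend_add rels)
qed

text \<open>Translates the dimension of the tensor product into statements about additive functions
  on \<open>A\<close>. Such functions factor through the tensor product, so the coordinates in a
  basis taken from the images of the generators expand all of them.\<close>

lemma dual_basis_tensor_complex:
  fixes A (structure) and S :: "'a set"
  assumes A: "comm_group A" and S: "finite S" "S \<subseteq> carrier A" "generate A S = carrier A"
  obtains B \<chi> where "B \<subseteq> S" "card B = vectorspace.dim class_ring (tensor_complex A)"
    "\<And>b g h. b \<in> B \<Longrightarrow> g \<in> carrier A \<Longrightarrow> h \<in> carrier A \<Longrightarrow> \<chi> b (g \<otimes> h) = \<chi> b g + (\<chi> b h :: complex)"
    "\<And>b c. b \<in> B \<Longrightarrow> c \<in> B \<Longrightarrow> \<chi> b c = (if b = c then 1 else 0)"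
    "\<And>f g. (\<And>g h. g \<in> carrier A \<Longrightarrow> h \<in> carrier A \<Longrightarrow> f (g \<otimes> h) = f g + f h) \<Longrightarrow> g \<in> carrier A \<Longrightarrow>
      f g = (\<Sum>b\<in>B. \<chi> b g * f b)"
proof -
  interpret A: comm_group A by fact
  define F where "F = free_Abelian_group (carrier A \<times> (UNIV :: complex set))"
  define T where "T = tensor_complex A"
  let ?R = "tensor_rels A"
  interpret F: comm_group F unfolding F_def by (rule abelian_free_Abelian_group)
  interpret V: vectorspace class_ring T unfolding T_def by (rule vectorspace_tensor_complex[OF A])
  define rels where "rels =
      {frag_of (a \<otimes> b, z) - frag_of (a, z) - frag_of (b, z) | a b (z :: complex).
         a \<in> carrier A \<and> b \<in> carrier A} \<union>
      {frag_of (a, z + w) - frag_of (a, z) - frag_of (a, w) | a (z :: complex) w. a \<in> carrier A}"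
  have R: "?R = generate F rels" by (simp add: tensor_rels_def rels_def F_def)
  have Fc: "x \<in> carrier F \<longleftrightarrow> keys x \<subseteq> carrier A \<times> UNIV" for x by (simp add: F_def)
  have Fm: "x \<otimes>\<^bsub>F\<^esub> y = x + y" for x y by (simp add: F_def)
  have rels: "rels \<subseteq> carrier F"
    unfolding rels_def Fc subset_iff by (auto dest!: subsetD[OF keys_diff] simp: keys_frag_of)
  have sub: "subgroup ?R F" unfolding R by (rule F.generate_is_subgroup[OF rels])
  interpret R: normal ?R F by (rule F.subgroup_imp_normal[OF sub])
  have F_add: "x + y \<in> carrier F" if "x \<in> carrier F" "y \<in> carrier F" for x y
    using F.m_closed[OF that] by (simp add: Fm)
  have F_diff: "x - y \<in> carrier F" if "x \<in> carrier F" "y \<in> carrier F" for x y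
    using that keys_diff[of x y] by (auto simp: Fc)
  have F_of: "frag_of (a, z) \<in> carrier F" if "a \<in> carrier A" for a z
    using that by (simp add: Fc keys_frag_of)
  have F_induct [consumes 1, case_names zero diff gen]: "P x" if "x \<in> carrier F" "P 0"
      "\<And>x y. x \<in> carrier F \<Longrightarrow> y \<in> carrier F \<Longrightarrow> P x \<Longrightarrow> P y \<Longrightarrow> P (x - y)"
      "\<And>a z. a \<in> carrier A \<Longrightarrow> P (frag_of (a, z))" for P x
    using free_Abelian_group_induct[of x "carrier A \<times> UNIV" P] that by (auto simp: Fc)
  define cos where "cos x = ?R #>\<^bsub>F\<^esub> x" for x
  have cos_self: "x \<in> cos x" if "x \<in> carrier F" for x
    unfolding cos_def by (rule F.rcos_self[OF that sub])
  have cos_eqI: "cos x = cos y" if "x \<in> cos y" "y \<in> carrier F" for x y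
    using F.repr_independence[OF _ _ sub] that by (simp add: cos_def)
  have cos_mem: "\<exists>r\<in>?R. x = r + y" if "x \<in> cos y" for x y
    using that unfolding cos_def by (simp only: r_coset_def Fm UN_iff singleton_iff)
  have cos_rel: "cos x = cos y" if "x \<in> carrier F" "y \<in> carrier F" "x - y \<in> ?R" for x y
  proof (rule cos_eqI)
    have "x = (x - y) + y" by simp
    then show "x \<in> cos y" using that(3) unfolding cos_def r_coset_def Fm by blast
  qed fact
  have carrier: "carrier T = cos ` carrier F"
    by (auto simp: T_def tensor_complex_def tensor_quot_def FactGroup_def RCOSETS_def cos_def F_def)
  have add: "cos x \<oplus>\<^bsub>T\<^esub> cos y = cos (x + y)" if "x \<in> carrier F" "y \<in> carrier F" for x y
    using R.rcos_sum[OF that]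
    by (simp add: T_def tensor_complex_def tensor_quot_def FactGroup_def cos_def Fm flip: F_def)
  have T_zero: "\<zero>\<^bsub>T\<^esub> = cos 0"
    using F.coset_mult_one[OF R.subset]
    by (simp add: T_def tensor_complex_def tensor_quot_def FactGroup_def cos_def)
       (simp add: F_def)
  have smult_mem: "frag_extend (\<lambda>(a, z). frag_of (a, c * z)) x \<in> c \<odot>\<^bsub>T\<^esub> X"
    if "x \<in> X" "X \<in> carrier T" "frag_extend (\<lambda>(a, z). frag_of (a, c * z)) x \<in> carrier F" for c x X
  proof -
    have "c \<odot>\<^bsub>T\<^esub> X = (\<Union>x\<in>X. cos (frag_extend (\<lambda>(a, z). frag_of (a, c * z)) x))"
      by (simp add: T_def tensor_complex_def cos_def F_def)
    then show ?thesis using that cos_self by blast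
  qed
  have F_sc: "frag_extend (\<lambda>(a, z). frag_of (a, c * z)) x \<in> carrier F" if "x \<in> carrier F" for c x
    using that keys_frag_extend[of "\<lambda>(a, z). frag_of (a :: 'a, c * z)" x]
    by (fastforce simp: Fc keys_frag_of)
  define \<iota> where "\<iota> a = cos (frag_of (a, 1))" for a
  have \<iota>_in: "\<iota> a \<in> carrier T" if "a \<in> carrier A" for a
    using F_of[OF that] by (auto simp: \<iota>_def carrier)
  have smult_\<iota>: "z \<odot>\<^bsub>T\<^esub> \<iota> a = cos (frag_of (a, z))" if a: "a \<in> carrier A" for a z
  proof -
    have "frag_of (a, z * 1) \<in> z \<odot>\<^bsub>T\<^esub> \<iota> a"
      using smult_mem[of "frag_of (a, 1)" "\<iota> a" z] F_of[OF a] cos_self[OF F_of[OF a]] \<iota>_in[OF a]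
      by (simp add: \<iota>_def)
    moreover have "z \<odot>\<^bsub>T\<^esub> \<iota> a \<in> carrier T" using \<iota>_in[OF a] by (intro V.smult_closed) auto
    then obtain y where "y \<in> carrier F" "z \<odot>\<^bsub>T\<^esub> \<iota> a = cos y" unfolding carrier by blast
    ultimately show ?thesis using cos_eqI by auto
  qed
  have \<iota>_mult: "\<iota> (a \<otimes> b) = \<iota> a \<oplus>\<^bsub>T\<^esub> \<iota> b" if "a \<in> carrier A" "b \<in> carrier A" for a b
  proof -
    have "frag_of (a \<otimes> b, 1) - frag_of (a, 1) - frag_of (b, 1) \<in> rels"
      using that unfolding rels_def by blast
    then have "frag_of (a \<otimes> b, 1) - (frag_of (a, 1) + frag_of (b, 1)) \<in> ?R"
      unfolding R by (simp add: generate.incl diff_diff_eq)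
    then have "cos (frag_of (a \<otimes> b, 1)) = cos (frag_of (a, 1) + frag_of (b, 1))"
      using that by (intro cos_rel F_of F_add) auto
    then show ?thesis unfolding \<iota>_def using that by (simp add: add F_of)
  qed
  have S_sub: "\<iota> ` S \<subseteq> carrier T" using S(2) \<iota>_in by blast
  interpret sp: submodule class_ring "V.span (\<iota> ` S)" T by (rule V.span_is_submodule[OF S_sub])
  have \<iota>_span: "\<iota> a \<in> V.span (\<iota> ` S)" if "a \<in> carrier A" for a
  proof -
    have "\<iota> \<one> \<oplus>\<^bsub>T\<^esub> \<iota> \<one> = \<iota> \<one>" using \<iota>_mult[of \<one> \<one>] by simp
    then have one: "\<iota> \<one> = \<zero>\<^bsub>T\<^esub>" using \<iota>_in[OF A.one_closed] by (metis V.M.add.r_cancel_one)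
    have "a \<in> generate A S" using that S(3) by simp
    then show ?thesis
    proof induction
      case (incl h)
      then show ?case using V.in_own_span[OF S_sub] by blast
    next
      case (inv h)
      then have h: "h \<in> carrier A" using S(2) by blast
      have "\<iota> (inv h) \<oplus>\<^bsub>T\<^esub> \<iota> h = \<zero>\<^bsub>T\<^esub>" using \<iota>_mult[of "inv h" h] h one by simp
      then have "\<iota> (inv h) = \<ominus>\<^bsub>T\<^esub> \<iota> h"
        using V.M.minus_equality[OF _ \<iota>_in[OF h] \<iota>_in[OF A.inv_closed[OF h]]] by simp
      also have "\<dots> = (- 1) \<odot>\<^bsub>T\<^esub> \<iota> h"
        using V.smult_l_minus[of 1 "\<iota> h"] \<iota>_in[OF h] V.smult_one[OF \<iota>_in[OF h]]
        by (simp add: class_ring_simps)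
      finally show ?case using V.in_own_span[OF S_sub] inv by auto
    next
      case (eng g h)
      then have "g \<in> carrier A" "h \<in> carrier A" using A.generate_in_carrier[OF S(2)] by auto
      then show ?case using eng by (simp add: \<iota>_mult)
    qed (simp add: one)
  qed
  have span: "V.span (\<iota> ` S) = carrier T"
  proof
    show "carrier T \<subseteq> V.span (\<iota> ` S)"
    proof
      fix X assume "X \<in> carrier T"
      then obtain x where x: "X = cos x" "x \<in> carrier F" using carrier by blast
      have "cos x \<in> V.span (\<iota> ` S)" using x(2)
      proof (induction x rule: F_induct)
        case zero
        show ?case using sp.zero_closed by (simp add: T_zero)
      next
        case (diff x y)
        note F = diff(1,2)
        have "cos (x - y) \<oplus>\<^bsub>T\<^esub> cos y = cos x" using add[OF F_diff[OF F] F(2)] by simp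
        moreover have c: "cos (x - y) \<in> carrier T" "cos y \<in> carrier T" using F F_diff carrier by auto
        ultimately have "cos (x - y) = cos x \<oplus>\<^bsub>T\<^esub> (- 1) \<odot>\<^bsub>T\<^esub> cos y"
          using V.smult_l_minus[of 1 "cos y"] V.smult_one[OF c(2)]
          by (simp add: class_ring_simps) (metis V.M.add.inv_solve_right V.M.add.m_closed)
        then show ?case using diff by auto
      next
        case (gen a z)
        then show ?case using smult_\<iota>[of a z] \<iota>_span[of a] sp.smult_closed[of z "\<iota> a"]
          by simp
      qed
      then show "X \<in> V.span (\<iota> ` S)" by (simp add: x)
    qed
  qed (rule sp.subset)
  \<comment> \<open>A minimal generating set is a basis; taking it among the images of
    \<open>S\<close> lets every basis vector be represented by a group element.\<close>
  obtain \<beta> where \<beta>: "\<beta> \<subseteq> \<iota> ` S" "minimal \<beta> (\<lambda>S. S \<subseteq> carrier T \<and> V.gen_set S)"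
    using minimal_exists[of "\<iota> ` S" "\<lambda>S. S \<subseteq> carrier T \<and> V.gen_set S"] S(1) S_sub span by auto
  have basis: "V.basis \<beta>" by (rule V.min_gen_is_basis[OF \<beta>(2)])
  have fin: "finite \<beta>" using \<beta>(1) S(1) finite_subset by blast
  have \<beta>c: "\<beta> \<subseteq> carrier T" using \<beta>(1) S_sub by blast
  define B where "B = inv_into S \<iota> ` \<beta>"
  have B_inv: "\<iota> (inv_into S \<iota> u) = u" "inv_into S \<iota> u \<in> S" if "u \<in> \<beta>" for u
    using that \<beta>(1) by (auto simp: f_inv_into_f inv_into_into)
  have B_sub: "B \<subseteq> S" using B_inv by (auto simp: B_def)
  have inj_B: "inj_on \<iota> B" unfolding B_def using B_inv by (auto simp: inj_on_def)
  have im_B: "\<iota> ` B = \<beta>" unfolding B_def using B_inv by force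
  have card_B: "card B = V.dim"
    using V.dim_basis[OF fin basis] card_image[OF inj_B] im_B by simp
  have ex1: "\<exists>!a. a \<in> \<beta> \<rightarrow>\<^sub>E UNIV \<and> V.lincomb a \<beta> = v" if "v \<in> carrier T" for v
    using basis that unfolding V.basis_criterion[OF fin \<beta>c] by simp
  define crd where "crd v = (THE a. a \<in> \<beta> \<rightarrow>\<^sub>E UNIV \<and> V.lincomb a \<beta> = v)" for v
  have crd: "crd v \<in> \<beta> \<rightarrow>\<^sub>E UNIV" "V.lincomb (crd v) \<beta> = v" if "v \<in> carrier T" for v
    using theI'[OF ex1[OF that]] by (simp_all add: crd_def)
  have crd_eqI: "crd v u = c u" if "V.lincomb c \<beta> = v" "u \<in> \<beta>" "v \<in> carrier T" for c u v
  proof -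
    have "V.lincomb (restrict c \<beta>) \<beta> = V.lincomb c \<beta>"
      by (rule V.lincomb_cong) (auto simp: \<beta>c)
    then have "crd v = restrict c \<beta>"
      using that(1) ex1[OF that(3)] crd[OF that(3)] by auto
    then show ?thesis using that(2) by simp
  qed
  have crd_add: "crd (v \<oplus>\<^bsub>T\<^esub> w) u = crd v u + crd w u"
    if "v \<in> carrier T" "w \<in> carrier T" "u \<in> \<beta>" for v w u
  proof (rule crd_eqI)
    show "V.lincomb (\<lambda>u. crd v u + crd w u) \<beta> = v \<oplus>\<^bsub>T\<^esub> w"
      using V.lincomb_sum[OF fin \<beta>c, of "crd v" "crd w"] crd(2)[OF that(1)] crd(2)[OF that(2)]
      by simp
  qed (use that in auto)
  have crd_basis: "crd v u = (if u = v then 1 else 0)" if "v \<in> \<beta>" "u \<in> \<beta>" for u v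
  proof (rule crd_eqI)
    let ?c = "\<lambda>u. if u = v then 1 else 0 :: complex"
    have "V.lincomb ?c \<beta> = (?c v \<odot>\<^bsub>T\<^esub> v) \<oplus>\<^bsub>T\<^esub> V.lincomb ?c (\<beta> - {v})"
      using that \<beta>c fin by (intro V.lincomb_del2) auto
    also have "V.lincomb ?c (\<beta> - {v}) = \<zero>\<^bsub>T\<^esub>" using \<beta>c by (intro V.lincomb_zero) auto
    finally show "V.lincomb ?c \<beta> = v" using that \<beta>c V.smult_one[of v] by auto
  qed (use that \<beta>c in auto)
  define \<chi> where "\<chi> b g = crd (\<iota> g) (\<iota> b)" for b g
  show thesis
  proof (rule that[OF B_sub])
    show "card B = vectorspace.dim class_ring (tensor_complex A)" using card_B by (simp add: T_def)
    show "\<chi> b (g \<otimes> h) = \<chi> b g + \<chi> b h" if "b \<in> B" "g \<in> carrier A" "h \<in> carrier A" for b g h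
      unfolding \<chi>_def using that im_B by (simp add: \<iota>_mult crd_add \<iota>_in flip: im_B)
    show "\<chi> b c = (if b = c then 1 else 0)" if "b \<in> B" "c \<in> B" for b c
      unfolding \<chi>_def using that im_B inj_onD[OF inj_B, of b c] by (subst crd_basis) auto
    show "f g = (\<Sum>b\<in>B. \<chi> b g * f b)"
      if f: "\<And>g h. g \<in> carrier A \<Longrightarrow> h \<in> carrier A \<Longrightarrow> f (g \<otimes> h) = f g + f h" and g: "g \<in> carrier A" for f g
    proof -
      \<comment> \<open>The functional on the tensor product induced by \<open>f\<close>; its value
        does not depend on the chosen representative because \<open>form_extend f\<close> vanishes
        on the tensor relations.\<close>
      define f' where "f' X = form_extend f (SOME x. x \<in> X)" for X
      have f'_mem: "f' (cos y) = form_extend f x" if "x \<in> cos y" for x y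
      proof -
        have "form_extend f z = form_extend f y" if z: "z \<in> cos y" for z
        proof -
          obtain r where "r \<in> ?R" "z = r + y" using cos_mem[OF z] by blast
          then show ?thesis using form_extend_rels[of A f r, OF f A] by (simp add: form_extend_add)
        qed
        moreover have "(SOME z. z \<in> cos y) \<in> cos y" using that by (rule someI)
        ultimately show ?thesis using that by (simp only: f'_def)
      qed
      have f'_cos: "f' (cos y) = form_extend f y" if "y \<in> carrier F" for y
        using f'_mem cos_self[OF that] by blast
      have f'_add: "f' (v \<oplus>\<^bsub>T\<^esub> w) = f' v + f' w" if "v \<in> carrier T" "w \<in> carrier T" for v w
        using that unfolding carrier by (auto simp: add f'_cos F_add form_extend_add)
      have f'_smult: "f' (c \<odot>\<^bsub>T\<^esub> v) = c * f' v" if v: "v \<in> carrier T" for c v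
      proof -
        obtain x where x: "x \<in> carrier F" "v = cos x" using v carrier by blast
        let ?y = "frag_extend (\<lambda>(a, z). frag_of (a, c * z)) x"
        have y: "?y \<in> c \<odot>\<^bsub>T\<^esub> v" using cos_self[OF x(1)] v F_sc[OF x(1)] x(2) by (intro smult_mem) auto
        have "c \<odot>\<^bsub>T\<^esub> v \<in> carrier T" using v by (intro V.smult_closed) auto
        then obtain z where z: "c \<odot>\<^bsub>T\<^esub> v = cos z" unfolding carrier by blast
        have "f' (c \<odot>\<^bsub>T\<^esub> v) = form_extend f ?y" using f'_mem y unfolding z by blast
        also have "\<dots> = c * form_extend f x"
        proof -
          show ?thesis using x(1)
            by (induction x rule: F_induct)
               (auto simp: form_extend_0 form_extend_diff frag_extend_diff form_extend_of algebra_simps)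
        qed
        finally show ?thesis using f'_cos[OF x(1)] x(2) by simp
      qed
      have f'_zero: "f' \<zero>\<^bsub>T\<^esub> = 0" using f'_cos[of 0] by (simp add: T_zero form_extend_0 Fc)
      have f'_lincomb: "f' (V.lincomb c \<gamma>) = (\<Sum>u\<in>\<gamma>. c u * f' u)" if "finite \<gamma>" "\<gamma> \<subseteq> carrier T" for c \<gamma>
        using that
      proof (induction \<gamma> rule: finite_induct)
        case empty
        then show ?case using f'_zero by (simp add: V.lincomb_def)
      next
        case (insert u \<gamma>)
        have "V.lincomb c (\<gamma> \<union> {u}) = (c u \<odot>\<^bsub>T\<^esub> u) \<oplus>\<^bsub>T\<^esub> V.lincomb c \<gamma>"
          using insert by (intro V.lincomb_insert) auto
        moreover have "V.lincomb c \<gamma> \<in> carrier T" using insert by (intro V.lincomb_closed) auto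
        moreover have "c u \<odot>\<^bsub>T\<^esub> u \<in> carrier T" using insert by (intro V.smult_closed) auto
        ultimately show ?case using insert by (simp add: f'_add f'_smult)
      qed
      have f'_\<iota>: "f' (\<iota> a) = f a" if "a \<in> carrier A" for a
        using f'_cos[OF F_of[OF that]] by (simp add: \<iota>_def form_extend_of)
      have "f g = f' (V.lincomb (crd (\<iota> g)) \<beta>)" using crd(2)[OF \<iota>_in[OF g]] f'_\<iota>[OF g] by simp
      also have "\<dots> = (\<Sum>u\<in>\<iota> ` B. crd (\<iota> g) u * f' u)" using f'_lincomb[OF fin \<beta>c] by (simp add: im_B)
      also have "\<dots> = (\<Sum>b\<in>B. \<chi> b g * f b)"
        unfolding sum.reindex[OF inj_B] using B_sub S(2) f'_\<iota> by (intro sum.cong) (auto simp: \<chi>_def)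
      finally show ?thesis .
    qed
  qed
qed

section \<open>Commutator calculus\<close>

context group
begin

abbreviation comm :: "'a \<Rightarrow> 'a \<Rightarrow> 'a" where
  "comm x y \<equiv> x \<otimes> y \<otimes> inv x \<otimes> inv y"

lemma cancel_left [simp]:
  assumes "x \<in> carrier G" "y \<in> carrier G"
  shows "inv x \<otimes> (x \<otimes> y) = y" "x \<otimes> (inv x \<otimes> y) = y"
  using assms by (simp_all flip: m_assoc)

text \<open>The Hall-Witt identity for the commutator convention used here. It is the source of both
  the estimate \<open>comm_in_lcs_add\<close> and the Jacobi identity.\<close>

lemma hall_witt:
  assumes "x \<in> carrier G" "y \<in> carrier G" "z \<in> carrier G"
  shows "comm (comm x y) (y \<otimes> z \<otimes> inv y) \<otimes> comm (comm y z) (z \<otimes> x \<otimes> inv z) \<otimes>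
    comm (comm z x) (x \<otimes> y \<otimes> inv x) = \<one>"
  using assms by (simp add: m_assoc inv_mult_group)

lemma comm_mult_left:
  assumes "a \<in> carrier G" "b \<in> carrier G" "c \<in> carrier G"
  shows "comm (a \<otimes> b) c = comm a (comm b c) \<otimes> comm b c \<otimes> comm a c"
  using assms by (simp add: m_assoc inv_mult_group)

lemma comm_mult_right:
  assumes "a \<in> carrier G" "b \<in> carrier G" "c \<in> carrier G"
  shows "comm a (b \<otimes> c) = comm a b \<otimes> comm b (comm a c) \<otimes> comm a c"
  using assms by (simp add: m_assoc inv_mult_group)

lemma comm_inv_left:
  assumes "a \<in> carrier G" "c \<in> carrier G"
  shows "comm (inv a) c = inv (comm (inv a) (comm a c) \<otimes> comm a c)"
  using assms by (simp add: m_assoc inv_mult_group)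

lemma comm_inv_right:
  assumes "a \<in> carrier G" "c \<in> carrier G"
  shows "comm a (inv c) = inv (comm (inv c) (comm a c) \<otimes> comm a c)"
  using assms by (simp add: m_assoc inv_mult_group)

lemma comm_swap: "a \<in> carrier G \<Longrightarrow> b \<in> carrier G \<Longrightarrow> comm b a = inv (comm a b)"
  by (simp add: m_assoc inv_mult_group)

abbreviation lcs :: "nat \<Rightarrow> 'a set" where "lcs \<equiv> lower_central G"

lemma lcs_Suc: "k \<ge> 1 \<Longrightarrow> lcs (Suc k) = generate G (\<Union>h\<in>lcs k. \<Union>g\<in>carrier G. {comm h g})"
  by (cases k) (simp_all add: commutator_subgroup_def)

lemma lcs_1: "lcs (Suc 0) = carrier G"
  by simp

lemma lcs_normal: "lcs k \<lhd> G"
proof (induction k)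
  case 0
  show ?case by (simp add: normal_self)
next
  case (Suc k)
  show ?case
  proof (cases "k = 0")
    case True
    then show ?thesis by (simp add: normal_self)
  next
    case False
    have sub: "h \<in> carrier G" if "h \<in> lcs k" for h
      using that normal_imp_subgroup[OF Suc] subgroup.mem_carrier by metis
    have "generate G (\<Union>h\<in>lcs k. \<Union>g\<in>carrier G. {comm h g}) \<lhd> G"
    proof (rule normal_generateI)
      show "(\<Union>h\<in>lcs k. \<Union>g\<in>carrier G. {comm h g}) \<subseteq> carrier G" using sub by auto
      fix c x assume "c \<in> (\<Union>h\<in>lcs k. \<Union>g\<in>carrier G. {comm h g})" and x: "x \<in> carrier G"
      then obtain h g where hg: "h \<in> lcs k" "g \<in> carrier G" "c = comm h g" by blast
      then have "x \<otimes> c \<otimes> inv x = comm (x \<otimes> h \<otimes> inv x) (x \<otimes> g \<otimes> inv x)"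
        using x sub by (simp add: m_assoc inv_mult_group)
      moreover have "x \<otimes> h \<otimes> inv x \<in> lcs k" using Suc x hg(1) by (rule normal.inv_op_closed2)
      moreover have "x \<otimes> g \<otimes> inv x \<in> carrier G" using x hg(2) by simp
      ultimately show "x \<otimes> c \<otimes> inv x \<in> (\<Union>h\<in>lcs k. \<Union>g\<in>carrier G. {comm h g})" by blast
    qed
    then show ?thesis using False lcs_Suc[of k] by simp
  qed
qed

lemma lcs_subgroup: "subgroup (lcs k) G"
  by (rule normal_imp_subgroup[OF lcs_normal])

lemmas lcs_carrier = subgroup.mem_carrier[OF lcs_subgroup]
  and lcs_mult = subgroup.m_closed[OF lcs_subgroup]
  and lcs_inv = subgroup.m_inv_closed[OF lcs_subgroup]
  and lcs_one = subgroup.one_closed[OF lcs_subgroup]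
  and lcs_conj = normal.inv_op_closed2[OF lcs_normal]

lemma comm_in_lcs_Suc: "k \<ge> 1 \<Longrightarrow> h \<in> lcs k \<Longrightarrow> g \<in> carrier G \<Longrightarrow> comm h g \<in> lcs (Suc k)"
  unfolding lcs_Suc by (rule generate.incl) blast

lemma comm_in_lcs_Suc': "k \<ge> 1 \<Longrightarrow> h \<in> lcs k \<Longrightarrow> g \<in> carrier G \<Longrightarrow> comm g h \<in> lcs (Suc k)"
  using comm_in_lcs_Suc[of k h g] lcs_inv comm_swap[of h g] lcs_carrier by metis

lemma lcs_Suc_subset: "lcs (Suc k) \<subseteq> lcs k"
proof (cases "k = 0")
  case False
  have "comm h g \<in> lcs k" if "h \<in> lcs k" "g \<in> carrier G" for h g
  proof -
    have "comm h g = h \<otimes> (g \<otimes> inv h \<otimes> inv g)" using that lcs_carrier by (simp add: m_assoc)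
    then show ?thesis using that lcs_mult lcs_inv lcs_conj by simp
  qed
  then show ?thesis using False
    by (simp add: lcs_Suc) (intro generate_subgroup_incl lcs_subgroup, blast)
qed simp

lemma lcs_Suc_induct [consumes 2, case_names comm one inv mult]:
  assumes "c \<in> lcs (Suc k)" "k \<ge> 1"
    "\<And>h g. h \<in> lcs k \<Longrightarrow> g \<in> carrier G \<Longrightarrow> P (comm h g)" "P \<one>"
    "\<And>c. c \<in> lcs (Suc k) \<Longrightarrow> P c \<Longrightarrow> P (inv c)"
    "\<And>c d. c \<in> lcs (Suc k) \<Longrightarrow> d \<in> lcs (Suc k) \<Longrightarrow> P c \<Longrightarrow> P d \<Longrightarrow> P (c \<otimes> d)"
  shows "P c"
  using assms(1) unfolding lcs_Suc[OF assms(2)]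
proof induction
  case (inv h)
  then have "P h" "h \<in> lcs (Suc k)" using assms(2,3) comm_in_lcs_Suc by auto
  then show ?case by (intro assms(5))
next
  case (eng h1 h2)
  then show ?case using lcs_Suc[OF assms(2)] by (intro assms(6)) auto
qed (use assms in auto)

text \<open>Induction on \<open>j\<close> in the manner of the three subgroup lemma. For
  \<open>c = comm b g\<close> the Hall-Witt identity expresses the double commutator through two
  others, which are covered by the induction hypothesis for \<open>i\<close> and for
  \<open>Suc i\<close>.\<close>

lemma comm_in_lcs_add:
  assumes "i \<ge> 1" "j \<ge> 1" "a \<in> lcs i" "c \<in> lcs j"
  shows "comm a c \<in> lcs (i + j)"
  using assms(2,1,3,4)
proof (induction j arbitrary: i a c rule: nat_induct_at_least)
  case base
  then show ?case using comm_in_lcs_Suc[of i a c] by simp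
next
  case (Suc j)
  note IH = Suc.IH
  have ac: "a \<in> carrier G" using Suc.prems lcs_carrier by blast
  have "comm a c \<in> lcs (Suc (i + j))"
    using Suc.prems(3) Suc.hyps
  proof (induction rule: lcs_Suc_induct)
    case (comm b g)
    have b: "b \<in> carrier G" using comm lcs_carrier by blast
    \<comment> \<open>Conjugating \<open>a\<close> in advance makes the conjugate that appears in
      the Hall-Witt identity equal to \<open>a\<close>.\<close>
    define z where "z = inv g \<otimes> a \<otimes> inv (inv g)"
    have z: "z \<in> lcs i" unfolding z_def using comm Suc.prems by (intro lcs_conj) auto
    have zc: "z \<in> carrier G" using z lcs_carrier by blast
    have a_z: "g \<otimes> z \<otimes> inv g = a" using ac comm(2) by (simp add: z_def m_assoc)
    have "comm z g \<in> lcs (Suc i)" using z comm(2) Suc.prems by (intro comm_in_lcs_Suc) auto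
    then have gz: "comm g z \<in> lcs (Suc i)" using comm_in_lcs_Suc'[of i z g] z comm(2) Suc.prems by simp
    have "z \<otimes> b \<otimes> inv z \<in> lcs j" using comm(1) zc by (intro lcs_conj)
    then have t2: "comm (comm g z) (z \<otimes> b \<otimes> inv z) \<in> lcs (Suc (i + j))"
      using IH[of "Suc i" "comm g z"] gz by simp
    have "comm z b \<in> lcs (i + j)" using IH[of i z b] z comm(1) Suc.prems by simp
    then have t3: "comm (comm z b) (b \<otimes> g \<otimes> inv b) \<in> lcs (Suc (i + j))"
      using b comm(2) Suc.prems by (intro comm_in_lcs_Suc) auto
    define p q r where "p = comm (comm b g) a" and "q = comm (comm g z) (z \<otimes> b \<otimes> inv z)"
      and "r = comm (comm z b) (b \<otimes> g \<otimes> inv b)"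
    have pqr: "p \<in> carrier G" "q \<in> carrier G" "r \<in> carrier G"
      using ac b zc comm(2) by (simp_all add: p_def q_def r_def)
    have "p \<otimes> q \<otimes> r = \<one>"
      using hall_witt[OF b comm(2) zc] unfolding a_z p_def q_def r_def .
    then have "p = inv (q \<otimes> r)" using pqr by (metis inv_equality inv_inv m_assoc m_closed)
    then have "p \<in> lcs (Suc (i + j))"
      using t2 t3 lcs_inv lcs_mult unfolding q_def[symmetric] r_def[symmetric] by simp
    moreover have "comm a (comm b g) = inv p"
      unfolding p_def using ac b comm(2) by (intro comm_swap) auto
    ultimately show ?case using lcs_inv by simp
  next
    case one
    then show ?case using ac lcs_one by (simp add: m_assoc)
  next
    case (inv c)
    have c: "c \<in> carrier G" using inv(1) lcs_carrier by blast
    have "comm (inv c) (comm a c) \<in> lcs (Suc (i + j))"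
      by (rule subsetD[OF lcs_Suc_subset comm_in_lcs_Suc'[OF _ inv(2) inv_closed[OF c]]]) simp
    then show ?case unfolding comm_inv_right[OF ac c] using inv lcs_inv lcs_mult by simp
  next
    case (mult c e)
    have c: "c \<in> carrier G" "e \<in> carrier G" using mult lcs_carrier by blast+
    have "comm c (comm a e) \<in> lcs (Suc (i + j))"
      by (rule subsetD[OF lcs_Suc_subset comm_in_lcs_Suc'[OF _ mult(4) c(1)]]) simp
    then show ?case unfolding comm_mult_right[OF ac c] using mult lcs_mult by simp
  qed
  then show ?case by simp
qed

text \<open>A linear functional on the \<open>n\<close>-th lower central quotient tensored with the
  complex numbers, kept as a function on the group; its values outside \<open>lcs n\<close> are
  arbitrary.\<close>

definition lcs_form :: "nat \<Rightarrow> ('a \<Rightarrow> complex) \<Rightarrow> bool" where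
  "lcs_form n f \<longleftrightarrow> (\<forall>g\<in>lcs n. \<forall>h\<in>lcs n. f (g \<otimes> h) = f g + f h) \<and> (\<forall>g\<in>lcs (Suc n). f g = 0)"

lemma lcs_formD:
  assumes "lcs_form n f"
  shows "g \<in> lcs n \<Longrightarrow> h \<in> lcs n \<Longrightarrow> f (g \<otimes> h) = f g + f h" "g \<in> lcs (Suc n) \<Longrightarrow> f g = 0"
  using assms by (auto simp: lcs_form_def)

lemma lcs_form_one: "lcs_form n f \<Longrightarrow> f \<one> = 0"
  using lcs_formD(2) lcs_one by blast

lemma lcs_form_inv:
  assumes "lcs_form n f" "g \<in> lcs n"
  shows "f (inv g) = - f g"
  using lcs_formD(1)[OF assms(1) assms(2) lcs_inv[OF assms(2)]] lcs_form_one[OF assms(1)]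
    lcs_carrier[OF assms(2)] by (simp add: eq_neg_iff_add_eq_0 add.commute)

text \<open>The correction factor in \<open>comm_mult_left\<close> lies one step deeper in the lower
  central series, where \<open>f\<close> vanishes.\<close>

lemma lcs_form_comm_mult_left:
  assumes f: "lcs_form (i + j) f" and ij: "i \<ge> 1" "j \<ge> 1"
    and el: "a \<in> lcs i" "b \<in> lcs i" "c \<in> lcs j"
  shows "f (comm (a \<otimes> b) c) = f (comm a c) + f (comm b c)"
proof -
  have c: "a \<in> carrier G" "b \<in> carrier G" "c \<in> carrier G" using el lcs_carrier by blast+
  have 1: "comm a c \<in> lcs (i + j)" "comm b c \<in> lcs (i + j)" using el ij comm_in_lcs_add by blast+
  have 2: "comm a (comm b c) \<in> lcs (Suc (i + j))" using comm_in_lcs_Suc'[OF _ 1(2) c(1)] ij by simp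
  then have 3: "comm a (comm b c) \<in> lcs (i + j)" using lcs_Suc_subset by blast
  show ?thesis
    unfolding comm_mult_left[OF c] lcs_formD(1)[OF f lcs_mult[OF 3 1(2)] 1(1)] lcs_formD(1)[OF f 3 1(2)]
      lcs_formD(2)[OF f 2] by simp
qed

lemma lcs_form_comm_swap:
  assumes f: "lcs_form (i + j) f" and ij: "i \<ge> 1" "j \<ge> 1" and el: "a \<in> lcs i" "b \<in> lcs j"
  shows "f (comm b a) = - f (comm a b)"
  using lcs_form_inv[OF f comm_in_lcs_add[OF ij el]] el lcs_carrier comm_swap by metis

lemma lcs_form_comm_mult_right:
  assumes f: "lcs_form (i + j) f" and ij: "i \<ge> 1" "j \<ge> 1"
    and el: "a \<in> lcs i" "b \<in> lcs j" "c \<in> lcs j"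
  shows "f (comm a (b \<otimes> c)) = f (comm a b) + f (comm a c)"
proof -
  have f': "lcs_form (j + i) f" using f by (simp add: add.commute)
  have "f (comm (b \<otimes> c) a) = f (comm b a) + f (comm c a)"
    using el ij by (intro lcs_form_comm_mult_left[OF f'])
  then show ?thesis
    using lcs_form_comm_swap[OF f' ij(2,1)] el lcs_mult[OF el(2,3)] by simp
qed

lemma lcs_form_comm_Suc_left:
  assumes f: "lcs_form (i + j) f" and ij: "i \<ge> 1" "j \<ge> 1" and el: "a \<in> lcs (Suc i)" "c \<in> lcs j"
  shows "f (comm a c) = 0"
  using comm_in_lcs_add[of "Suc i" j a c] assms by (simp add: lcs_formD(2)[OF f])

lemma lcs_form_comm_left:
  assumes "lcs_form (i + j) f" "i \<ge> 1" "j \<ge> 1" "c \<in> lcs j"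
  shows "lcs_form i (\<lambda>a. f (comm a c))"
  unfolding lcs_form_def using lcs_form_comm_mult_left[OF assms(1-3)] lcs_form_comm_Suc_left[OF assms(1-3)]
    assms(4) by blast

lemma lcs_form_comm_right:
  assumes "lcs_form (i + j) f" "i \<ge> 1" "j \<ge> 1" "a \<in> lcs i"
  shows "lcs_form j (\<lambda>c. f (comm a c))"
proof -
  have f': "lcs_form (j + i) f" using assms by (simp add: add.commute)
  have "f (comm a c) = 0" if "c \<in> lcs (Suc j)" for c
  proof -
    have "c \<in> lcs j" using that lcs_Suc_subset by blast
    then show ?thesis
      using lcs_form_comm_Suc_left[OF f' assms(3,2) that assms(4)]
        lcs_form_comm_swap[OF f' assms(3,2), of c a] assms(4) by simp
  qed
  then show ?thesis
    unfolding lcs_form_def using lcs_form_comm_mult_right[OF assms(1-3)] assms(4) by blast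
qed

text \<open>Conjugation multiplies \<open>z\<close> by a commutator from the next term of the
  series, which no functional in the second argument can see.\<close>

lemma lcs_form_comm_conj:
  assumes f: "lcs_form (m + k) f" and mk: "m \<ge> 1" "k \<ge> 1"
    and el: "u \<in> lcs m" "z \<in> lcs k" "y \<in> carrier G"
  shows "f (comm u (y \<otimes> z \<otimes> inv y)) = f (comm u z)"
proof -
  have c: "z \<in> carrier G" using el lcs_carrier by blast
  have 1: "comm y z \<in> lcs (Suc k)" using comm_in_lcs_Suc'[OF mk(2) el(2,3)] .
  then have 2: "comm y z \<in> lcs k" using lcs_Suc_subset by blast
  have "y \<otimes> z \<otimes> inv y = comm y z \<otimes> z" using c el(3) by (simp add: m_assoc)
  then show ?thesis
    using lcs_form_comm_mult_right[OF f mk el(1) 2 el(2)]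
      lcs_formD(2)[OF lcs_form_comm_right[OF f mk el(1)] 1] by simp
qed

text \<open>Apply \<open>f\<close> to the Hall-Witt identity; the product becomes a sum and the
  conjugations disappear.\<close>

lemma lcs_form_jacobi:
  assumes f: "lcs_form (i + j + k) f" and ijk: "i \<ge> 1" "j \<ge> 1" "k \<ge> 1"
    and el: "x \<in> lcs i" "y \<in> lcs j" "z \<in> lcs k"
  shows "f (comm (comm x y) z) + f (comm (comm y z) x) + f (comm (comm z x) y) = 0"
proof -
  have c: "x \<in> carrier G" "y \<in> carrier G" "z \<in> carrier G" using el lcs_carrier by blast+
  have xy: "comm x y \<in> lcs (i + j)" "comm y z \<in> lcs (j + k)" "comm z x \<in> lcs (k + i)"
    using el ijk comm_in_lcs_add by blast+
  have f2: "lcs_form ((j + k) + i) f" "lcs_form ((k + i) + j) f" using f by (simp_all add: add_ac)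
  define p q r where "p = comm (comm x y) (y \<otimes> z \<otimes> inv y)" and "q = comm (comm y z) (z \<otimes> x \<otimes> inv z)"
    and "r = comm (comm z x) (x \<otimes> y \<otimes> inv x)"
  have p: "p \<in> lcs (i + j + k)" unfolding p_def using xy el c ijk
    by (intro comm_in_lcs_add lcs_conj) auto
  have "q \<in> lcs (j + k + i)" unfolding q_def using xy el c ijk
    by (intro comm_in_lcs_add lcs_conj) auto
  then have q: "q \<in> lcs (i + j + k)" by (simp add: add_ac)
  have "r \<in> lcs (k + i + j)" unfolding r_def using xy el c ijk
    by (intro comm_in_lcs_add lcs_conj) auto
  then have r: "r \<in> lcs (i + j + k)" by (simp add: add_ac)
  have "p \<otimes> q \<otimes> r = \<one>" unfolding p_def q_def r_def by (rule hall_witt[OF c])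
  then have "f p + f q + f r = 0"
    using lcs_formD(1)[OF f lcs_mult[OF p q] r] lcs_formD(1)[OF f p q] lcs_form_one[OF f] by simp
  moreover have "f p = f (comm (comm x y) z)" unfolding p_def
    using f xy el c ijk by (intro lcs_form_comm_conj) auto
  moreover have "f q = f (comm (comm y z) x)" unfolding q_def
    using f2 xy el c ijk by (intro lcs_form_comm_conj) auto
  moreover have "f r = f (comm (comm z x) y)" unfolding r_def
    using f2 xy el c ijk by (intro lcs_form_comm_conj) auto
  ultimately show ?thesis by simp
qed

section \<open>Generators and dual bases of the lower central quotients\<close>

fun simple_commutators :: "'a set \<Rightarrow> nat \<Rightarrow> 'a set" where
  "simple_commutators S 0 = S"
| "simple_commutators S (Suc k) = (\<lambda>(c, x). comm c x) ` (simple_commutators S k \<times> S)"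

lemma simple_commutators_lcs: "S \<subseteq> carrier G \<Longrightarrow> simple_commutators S k \<subseteq> lcs (Suc k)"
proof (induction k)
  case (Suc k)
  show ?case
  proof
    fix w assume "w \<in> simple_commutators S (Suc k)"
    then obtain c x where cx: "c \<in> simple_commutators S k" "x \<in> S" "w = comm c x" by auto
    show "w \<in> lcs (Suc (Suc k))"
      unfolding cx(3) by (rule comm_in_lcs_Suc) (use Suc cx in auto)
  qed
qed simp

text \<open>Commutators are bimultiplicative up to the next term of the series, so commutators of
  generators suffice modulo that term. For a finite generating set this makes all lower central
  quotients finitely generated.\<close>

lemma lcs_generated:
  assumes S: "S \<subseteq> carrier G" "generate G S = carrier G"
  shows "generate G (simple_commutators S k \<union> lcs (Suc (Suc k))) = lcs (Suc k)"
proof (induction k)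
  case 0
  have "generate G S \<subseteq> generate G (S \<union> lcs (Suc (Suc 0)))" by (intro mono_generate) auto
  moreover have "generate G (S \<union> lcs (Suc (Suc 0))) \<subseteq> carrier G"
    using S(1) lcs_carrier by (intro generate_incl) blast
  ultimately show ?case using S(2) by simp
next
  case (Suc k)
  let ?C = "simple_commutators S" and ?m = "Suc (Suc k)"
  define N where "N = generate G (?C (Suc k) \<union> lcs (Suc ?m))"
  have sub: "?C (Suc k) \<union> lcs (Suc ?m) \<subseteq> lcs ?m"
    using simple_commutators_lcs[OF S(1), of "Suc k"] lcs_Suc_subset by blast
  have N: "subgroup N G" unfolding N_def
    by (rule generate_is_subgroup) (use sub lcs_carrier in blast)
  have N_m: "N \<subseteq> lcs ?m" unfolding N_def by (rule generate_subgroup_incl[OF sub lcs_subgroup])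
  have N_next: "lcs (Suc ?m) \<subseteq> N" unfolding N_def by (intro subsetI generate.incl) blast
  have Ncomm: "comm g n \<in> N" if "n \<in> N" "g \<in> carrier G" for n g
    by (rule subsetD[OF N_next comm_in_lcs_Suc'[OF _ subsetD[OF N_m that(1)] that(2)]]) simp
  note Nc = subgroup.m_closed[OF N] subgroup.m_inv_closed[OF N] subgroup.one_closed[OF N]
  have C_car: "c \<in> carrier G" if "c \<in> ?C k" for c
    using that simple_commutators_lcs[OF S(1), of k] lcs_carrier by blast
  have 1: "comm c g \<in> N" if c: "c \<in> ?C k" and "g \<in> carrier G" for c g
    using that(2) unfolding S(2)[symmetric]
  proof induction
    case one
    then show ?case using C_car[OF c] Nc(3) by simp
  next
    case (incl h)
    then have "comm c h \<in> ?C (Suc k)" using c by force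
    then show ?case unfolding N_def by (intro generate.incl) blast
  next
    case (inv h)
    then have h: "h \<in> carrier G" using S(1) by blast
    have "comm c h \<in> ?C (Suc k)" using c inv by force
    then have n: "comm c h \<in> N" unfolding N_def by (intro generate.incl) blast
    show ?case unfolding comm_inv_right[OF C_car[OF c] h]
      by (rule Nc(2)[OF Nc(1)[OF Ncomm[OF n inv_closed[OF h]] n]])
  next
    case (eng a b)
    then have ab: "a \<in> carrier G" "b \<in> carrier G" using S by auto
    show ?case unfolding comm_mult_right[OF C_car[OF c] ab]
      by (rule Nc(1)[OF Nc(1)[OF eng(3) Ncomm[OF eng(4) ab(1)]] eng(4)])
  qed
  have 2: "comm h g \<in> N" if "h \<in> lcs (Suc k)" and g: "g \<in> carrier G" for h g
    using that(1) unfolding Suc[symmetric]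
  proof induction
    case one
    then show ?case using g Nc(3) by simp
  next
    case (incl h)
    then show ?case
    proof
      assume "h \<in> lcs ?m"
      then show ?thesis using comm_in_lcs_Suc[of ?m h g] g N_next by auto
    qed (use 1 g in blast)
  next
    case (inv h)
    then have h: "h \<in> carrier G" using C_car lcs_carrier by blast
    have n: "comm h g \<in> N" using inv
    proof
      assume "h \<in> lcs ?m"
      then show ?thesis using comm_in_lcs_Suc[of ?m h g] g N_next by auto
    qed (use 1 g in blast)
    show ?case unfolding comm_inv_left[OF h g]
      by (rule Nc(2)[OF Nc(1)[OF Ncomm[OF n inv_closed[OF h]] n]])
  next
    case (eng a b)
    have ab: "a \<in> carrier G" "b \<in> carrier G"
      using eng(1,2) Suc lcs_carrier by blast+
    show ?case unfolding comm_mult_left[OF ab g]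
      by (rule Nc(1)[OF Nc(1)[OF Ncomm[OF eng(4) ab(1)] eng(4)] eng(3)])
  qed
  have "generate G (\<Union>h\<in>lcs (Suc k). \<Union>g\<in>carrier G. {comm h g}) \<subseteq> N"
    by (rule generate_subgroup_incl[OF _ N]) (use 2 in blast)
  then have "lcs ?m \<subseteq> N" by (subst lcs_Suc) simp_all
  then show ?case using N_m unfolding N_def by blast
qed

text \<open>Pulls the dual basis of the tensor product back to the group: the \<open>a i\<close> are
  lifts of basis elements and the \<open>\<chi> i\<close> are coordinates. From here on the rank
  enters only as the number of these functionals.\<close>

lemma lcs_rank_dual_basis:
  assumes S: "finite S" "S \<subseteq> carrier G" "generate G S = carrier G" and k: "k \<ge> 1"
  obtains a \<chi> where "\<And>i. i < lcs_rank G k \<Longrightarrow> a i \<in> lcs k"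
    "\<And>i. i < lcs_rank G k \<Longrightarrow> lcs_form k (\<chi> i)"
    "\<And>i j. i < lcs_rank G k \<Longrightarrow> j < lcs_rank G k \<Longrightarrow> \<chi> i (a j) = (if i = j then 1 else 0)"
    "\<And>f g. lcs_form k f \<Longrightarrow> g \<in> lcs k \<Longrightarrow> f g = (\<Sum>i<lcs_rank G k. \<chi> i g * f (a i))"
proof -
  obtain m where m: "k = Suc m" using k by (cases k) auto
  define L where "L = G\<lparr>carrier := lcs k\<rparr>"
  define N where "N = lcs (Suc k)"
  define A where "A = L Mod N"
  have N_sub: "N \<subseteq> lcs k" unfolding N_def by (rule lcs_Suc_subset)
  interpret L: group L unfolding L_def by (rule subgroup.subgroup_is_group[OF lcs_subgroup group_axioms])
  have LN: "N \<lhd> L" unfolding L_def N_def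
    by (rule normal_restrict_supergroup[OF lcs_subgroup lcs_normal lcs_Suc_subset])
  interpret N: normal N L by (rule LN)
  have [simp]: "carrier L = lcs k" "\<And>x y. x \<otimes>\<^bsub>L\<^esub> y = x \<otimes> y" "\<one>\<^bsub>L\<^esub> = \<one>" by (simp_all add: L_def)
  define cos where "cos x = N #>\<^bsub>L\<^esub> x" for x
  have Ac: "carrier A = cos ` lcs k" by (auto simp: A_def FactGroup_def RCOSETS_def cos_def)
  have Am: "cos x \<otimes>\<^bsub>A\<^esub> cos y = cos (x \<otimes> y)" if "x \<in> lcs k" "y \<in> lcs k" for x y
    using N.rcos_sum[of x y] that by (simp add: A_def FactGroup_def cos_def)
  have cos_self: "x \<in> cos x" if "x \<in> lcs k" for x
    unfolding cos_def using that N.subgroup_axioms by (intro L.rcos_self) auto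
  have cos_mem: "\<exists>n\<in>N. y = n \<otimes> x" if "y \<in> cos x" for x y
    using that by (auto simp: cos_def r_coset_def)
  have cos_eq: "cos (n \<otimes> x) = cos x" if "n \<in> N" "x \<in> lcs k" for n x
  proof -
    have "n \<otimes> x \<in> cos x" using that(1) by (auto simp: cos_def r_coset_def)
    then show ?thesis using L.repr_independence[of "n \<otimes> x" N x] that N.subgroup_axioms by (simp add: cos_def)
  qed
  interpret A: group A unfolding A_def by (rule N.factorgroup_is_group)
  have comm_group: "comm_group A"
  proof (rule A.group_comm_groupI)
    fix X Y assume "X \<in> carrier A" "Y \<in> carrier A"
    then obtain x y where xy: "x \<in> lcs k" "y \<in> lcs k" "X = cos x" "Y = cos y" by (auto simp: Ac)
    have c: "x \<in> carrier G" "y \<in> carrier G" using xy lcs_carrier by blast+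
    have "x \<otimes> y = comm x y \<otimes> (y \<otimes> x)" using c by (simp add: m_assoc)
    moreover have "comm x y \<in> N" unfolding N_def using xy c k by (intro comm_in_lcs_Suc)
    ultimately have "cos (x \<otimes> y) = cos (y \<otimes> x)" using cos_eq[of "comm x y" "y \<otimes> x"] xy lcs_mult by simp
    then show "X \<otimes>\<^bsub>A\<^esub> Y = Y \<otimes>\<^bsub>A\<^esub> X" using xy by (simp add: Am)
  qed
  let ?C = "simple_commutators S m"
  have finC: "finite ?C" using S(1) by (induction m) auto
  have C_sub: "?C \<subseteq> lcs k" using simple_commutators_lcs[OF S(2)] by (simp add: m)
  have A_one: "\<one>\<^bsub>A\<^esub> = cos \<one>"
    using L.coset_mult_one[of N] N_sub by (simp add: cos_def A_def FactGroup_def)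
  have A_inv: "inv\<^bsub>A\<^esub> (cos x) = cos (inv x)" if "x \<in> lcs k" for x
  proof -
    have "cos (inv x) \<otimes>\<^bsub>A\<^esub> cos x = cos \<one>" using that lcs_inv lcs_carrier by (simp add: Am)
    also note A_one[symmetric]
    finally show ?thesis using that lcs_inv by (intro A.inv_equality) (auto simp: Ac)
  qed
  have imC: "cos ` ?C \<subseteq> carrier A" using C_sub Ac by blast
  have gen: "generate A (cos ` ?C) = carrier A"
  proof
    show "carrier A \<subseteq> generate A (cos ` ?C)"
    proof
      fix X assume "X \<in> carrier A"
      then obtain x where x: "x \<in> lcs k" "X = cos x" by (auto simp: Ac)
      have n1: "cos h = \<one>\<^bsub>A\<^esub>" if "h \<in> N" for h
        using cos_eq[OF that lcs_one] lcs_carrier[OF subsetD[OF N_sub that]] by (simp add: A_one)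
      have "x \<in> generate G (?C \<union> N)" using x(1) lcs_generated[OF S(2,3), of m] by (simp add: m N_def)
      then have "cos x \<in> generate A (cos ` ?C)"
      proof induction
        case one
        then show ?case using generate.one[of A] by (simp add: A_one)
      next
        case (incl h)
        then show ?case using n1 generate.one[of A] by (auto intro: generate.incl)
      next
        case (inv h)
        then have h: "h \<in> lcs k" using C_sub N_sub by blast
        show ?case
        proof (cases "h \<in> N")
          case True
          then have "inv h \<in> N" using lcs_inv by (simp add: N_def)
          then show ?thesis using n1 generate.one[of A] by simp
        next
          case False
          then have "inv\<^bsub>A\<^esub> (cos h) \<in> generate A (cos ` ?C)" using inv by (intro generate.inv) blast
          then show ?thesis using A_inv[OF h] by simp
        qed
      next
        case (eng g h)
        have "g \<in> lcs k" "h \<in> lcs k"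
          using eng(1,2) lcs_generated[OF S(2,3), of m] by (simp_all add: m N_def)
        then show ?case using eng Am generate.eng[of "cos g" A _ "cos h"] by simp
      qed
      then show "X \<in> generate A (cos ` ?C)" by (simp add: x)
    qed
  qed (rule A.generate_incl[OF imC])
  obtain B \<chi> where B: "B \<subseteq> cos ` ?C" "card B = vectorspace.dim class_ring (tensor_complex A)"
    and add: "\<And>b g h. b \<in> B \<Longrightarrow> g \<in> carrier A \<Longrightarrow> h \<in> carrier A \<Longrightarrow>
        \<chi> b (g \<otimes>\<^bsub>A\<^esub> h) = \<chi> b g + (\<chi> b h :: complex)"
    and delta: "\<And>b c. b \<in> B \<Longrightarrow> c \<in> B \<Longrightarrow> \<chi> b c = (if b = c then 1 else 0)"
    and univ: "\<And>f g. (\<And>g h. g \<in> carrier A \<Longrightarrow> h \<in> carrier A \<Longrightarrow> f (g \<otimes>\<^bsub>A\<^esub> h) = f g + f h) \<Longrightarrow>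
        g \<in> carrier A \<Longrightarrow> f g = (\<Sum>b\<in>B. \<chi> b g * f b)"
  proof (rule dual_basis_tensor_complex[OF comm_group finite_imageI[OF finC] imC gen])
    fix B \<chi>
    assume 1: "B \<subseteq> cos ` ?C" and 2: "card B = vectorspace.dim class_ring (tensor_complex A)"
      and 3: "\<And>b g h. b \<in> B \<Longrightarrow> g \<in> carrier A \<Longrightarrow> h \<in> carrier A \<Longrightarrow>
        \<chi> b (g \<otimes>\<^bsub>A\<^esub> h) = \<chi> b g + (\<chi> b h :: complex)"
      and 4: "\<And>b c. b \<in> B \<Longrightarrow> c \<in> B \<Longrightarrow> \<chi> b c = (if b = c then 1 else 0)"
      and 5: "\<And>f g. (\<And>g h. g \<in> carrier A \<Longrightarrow> h \<in> carrier A \<Longrightarrow> f (g \<otimes>\<^bsub>A\<^esub> h) = f g + f h) \<Longrightarrow>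
        g \<in> carrier A \<Longrightarrow> f g = (\<Sum>b\<in>B. \<chi> b g * f b)"
    show thesis by (rule that[OF 1 2 3 4 5])
  qed
  have card: "card B = lcs_rank G k" using B(2) by (simp add: lcs_rank_def A_def L_def N_def)
  have finB: "finite B" using B(1) finC finite_subset by blast
  obtain \<beta> where \<beta>: "bij_betw \<beta> {..<lcs_rank G k} B"
    using ex_bij_betw_nat_finite[OF finB] by (auto simp: card atLeast0LessThan)
  have \<beta>B: "\<beta> i \<in> B" if "i < lcs_rank G k" for i using \<beta> that by (auto simp: bij_betw_def)
  define a where "a i = (SOME c. c \<in> ?C \<and> cos c = \<beta> i)" for i
  have a: "a i \<in> ?C" "cos (a i) = \<beta> i" if "i < lcs_rank G k" for i
  proof -
    have "\<exists>c. c \<in> ?C \<and> cos c = \<beta> i" using \<beta>B[OF that] B(1) by blast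
    from someI_ex[OF this] show "a i \<in> ?C" "cos (a i) = \<beta> i" by (auto simp: a_def)
  qed
  show thesis
  proof (rule that[of a "\<lambda>i g. \<chi> (\<beta> i) (cos g)"])
    show "a i \<in> lcs k" if "i < lcs_rank G k" for i using a[OF that] C_sub by blast
    show "lcs_form k (\<lambda>g. \<chi> (\<beta> i) (cos g))" if "i < lcs_rank G k" for i
      unfolding lcs_form_def
    proof (intro conjI ballI)
      fix g h assume gh: "g \<in> lcs k" "h \<in> lcs k"
      then show "\<chi> (\<beta> i) (cos (g \<otimes> h)) = \<chi> (\<beta> i) (cos g) + \<chi> (\<beta> i) (cos h)"
        using add[OF \<beta>B[OF that], of "cos g" "cos h"] by (simp add: Am Ac)
    next
      fix g assume g: "g \<in> lcs (Suc k)"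
      have "cos g = cos \<one>" using cos_eq[of g \<one>] g lcs_one lcs_carrier[OF g] by (simp add: N_def)
      moreover have "\<chi> (\<beta> i) (cos \<one>) = \<chi> (\<beta> i) (cos \<one>) + \<chi> (\<beta> i) (cos \<one>)"
        using add[OF \<beta>B[OF that], of "cos \<one>" "cos \<one>"] Am[OF lcs_one lcs_one] lcs_one by (simp add: Ac)
      ultimately show "\<chi> (\<beta> i) (cos g) = 0" by simp
    qed
    show "\<chi> (\<beta> i) (cos (a j)) = (if i = j then 1 else 0)"
      if "i < lcs_rank G k" "j < lcs_rank G k" for i j
      using delta[OF \<beta>B[OF that(1)] \<beta>B[OF that(2)]] a(2)[OF that(2)] \<beta> that
      by (auto simp: bij_betw_def inj_on_def)
    show "f g = (\<Sum>i<lcs_rank G k. \<chi> (\<beta> i) (cos g) * f (a i))" if f: "lcs_form k f" and g: "g \<in> lcs k" for f g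
    proof -
      \<comment> \<open>\<open>f\<close> vanishes on \<open>N\<close>, so its value on a coset may
        be computed at any representative.\<close>
      define f' where "f' X = f (SOME x. x \<in> X)" for X
      have f': "f' (cos x) = f x" if x: "x \<in> lcs k" for x
      proof -
        have "(SOME y. y \<in> cos x) \<in> cos x" using cos_self[OF x] by (rule someI)
        then obtain n where n: "n \<in> N" "(SOME y. y \<in> cos x) = n \<otimes> x" using cos_mem by blast
        have "f (n \<otimes> x) = f n + f x" using lcs_formD(1)[OF f] n(1) N_sub x by blast
        also have "f n = 0" using lcs_formD(2)[OF f] n(1) by (simp add: N_def)
        finally show ?thesis using n(2) by (simp add: f'_def)
      qed
      have "f' (X \<otimes>\<^bsub>A\<^esub> Y) = f' X + f' Y" if "X \<in> carrier A" "Y \<in> carrier A" for X Y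
        using that lcs_formD(1)[OF f] f' lcs_mult by (auto simp: Ac Am)
      then have "f' (cos g) = (\<Sum>b\<in>B. \<chi> b (cos g) * f' b)" using g by (intro univ) (auto simp: Ac)
      also have "\<dots> = (\<Sum>i<lcs_rank G k. \<chi> (\<beta> i) (cos g) * f' (\<beta> i))"
        by (rule sum.reindex_bij_betw[OF \<beta>, symmetric])
      also have "\<dots> = (\<Sum>i<lcs_rank G k. \<chi> (\<beta> i) (cos g) * f (a i))"
      proof (intro sum.cong HOL.refl)
        fix i assume "i \<in> {..<lcs_rank G k}"
        then have "f' (\<beta> i) = f (a i)" using a[of i] f'[of "a i"] C_sub by auto
        then show "\<chi> (\<beta> i) (cos g) * f' (\<beta> i) = \<chi> (\<beta> i) (cos g) * f (a i)" by simp
      qed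
      finally show ?thesis using f'[OF g] by simp
    qed
  qed
qed

end

section \<open>Comparison of the associated graded Lie algebra with a truncated algebra\<close>

lemma fa_span_mult:
  assumes "f \<in> fa.span A" "g \<in> fa.span B" "\<And>a b. a \<in> A \<Longrightarrow> b \<in> B \<Longrightarrow> a * b \<in> fa.span C"
  shows "f * g \<in> fa.span C"
proof -
  have 1: "a * g \<in> fa.span C" if "a \<in> A" for a
    using assms(2)
  proof (induction rule: fa.span_induct_alt)
    case (step c b g)
    then have "a * b \<in> fa.span C" using assms(3) that by blast
    then show ?case using step by (simp add: distrib_left fa.span_add fa.span_scale)
  qed (simp add: fa.span_zero)
  show ?thesis using assms(1)
  proof (induction rule: fa.span_induct_alt)
    case (step c a f)
    then show ?case using 1 by (simp add: distrib_right fa.span_add fa.span_scale)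
  qed (simp add: fa.span_zero)
qed

definition prod_val :: "('a \<Rightarrow> 'b free_algebra) \<Rightarrow> 'a list \<Rightarrow> 'b free_algebra" where
  "prod_val z w = prod_list (map z w)"

lemma prod_val_simps [simp]:
  "prod_val z [] = 1" "prod_val z (x # w) = z x * prod_val z w"
  "prod_val z (u @ v) = prod_val z u * prod_val z v"
  by (simp_all add: prod_val_def)

lemma weight_one [simp]: "weight (\<lambda>_. Suc 0) w = length w"
  by (induction w) simp_all

lemma finite_card_words_Union:
  assumes "finite S" "\<And>x. x \<in> S \<Longrightarrow> d x > 0" "\<And>n. R n \<subseteq> words_of d S n"
  shows "finite (\<Union>n<p. R n)" "card (\<Union>n<p. R n) = (\<Sum>n<p. card (R n))"
proof -
  have fin: "finite (R n)" for n using finite_words_of[OF assms(1,2)] assms(3) by (rule rev_finite_subset)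
  then show "finite (\<Union>n<p. R n)" by blast
  show "card (\<Union>n<p. R n) = (\<Sum>n<p. card (R n))"
  proof (rule card_UN_disjoint)
    show "\<forall>i\<in>{..<p}. \<forall>j\<in>{..<p}. i \<noteq> j \<longrightarrow> R i \<inter> R j = {}"
    proof (intro ballI impI)
      fix i j :: nat assume "i \<noteq> j"
      then have "words_of d S i \<inter> words_of d S j = {}" by (auto simp: words_of_def)
      then show "R i \<inter> R j = {}" using assms(3)[of i] assms(3)[of j] by blast
    qed
  qed (use fin in auto)
qed

text \<open>Bases of all lower central quotients at once, with dual functionals. The spanning
  property takes the form \<open>form_expand\<close>, which can be applied to any functional
  obtained from commutators or from an algebra.\<close>

locale lcs_basis = group G for G (structure) +
  fixes a :: "nat \<Rightarrow> nat \<Rightarrow> 'a" and \<chi> :: "nat \<Rightarrow> nat \<Rightarrow> 'a \<Rightarrow> complex"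
  assumes a_in: "k \<ge> 1 \<Longrightarrow> i < lcs_rank G k \<Longrightarrow> a k i \<in> lcs k"
    and chi_form: "k \<ge> 1 \<Longrightarrow> i < lcs_rank G k \<Longrightarrow> lcs_form k (\<chi> k i)"
    and chi_dual: "k \<ge> 1 \<Longrightarrow> i < lcs_rank G k \<Longrightarrow> j < lcs_rank G k \<Longrightarrow>
      \<chi> k i (a k j) = (if i = j then 1 else 0)"
    and form_expand: "k \<ge> 1 \<Longrightarrow> lcs_form k f \<Longrightarrow> g \<in> lcs k \<Longrightarrow>
      f g = (\<Sum>i<lcs_rank G k. \<chi> k i g * f (a k i))"
begin

definition basis_letters :: "(nat \<times> nat) set" where
  "basis_letters = {(k, i). k \<ge> 1 \<and> i < lcs_rank G k}"

definition basis_letters_below :: "nat \<Rightarrow> (nat \<times> nat) set" where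
  "basis_letters_below p = {(k, i). 1 \<le> k \<and> k < p \<and> i < lcs_rank G k}"

definition basis_edge :: "nat \<times> nat \<Rightarrow> nat \<times> nat \<Rightarrow> bool" where
  "basis_edge x y \<longleftrightarrow> x \<noteq> y \<and> x \<in> basis_letters \<and> y \<in> basis_letters"

text \<open>For words the level is twice the degree minus the length. Replacing two letters by one
  of the same total degree therefore raises it by one, as the relators of an enveloping algebra
  require.\<close>

definition basis_level :: "nat \<times> nat \<Rightarrow> nat" where
  "basis_level x = 2 * fst x - 1"

lemma finite_basis_letters_below: "finite (basis_letters_below p)"
proof -
  have "basis_letters_below p \<subseteq> Sigma {..<p} (\<lambda>k. {..<lcs_rank G k})"
    by (auto simp: basis_letters_below_def)
  then show ?thesis by (rule finite_subset) auto
qed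

lemma basis_letters_below_sub: "basis_letters_below p \<subseteq> basis_letters"
  by (auto simp: basis_letters_below_def basis_letters_def)

sublocale basis: commutation basis_edge
  by unfold_locales (auto simp: basis_edge_def)

lemma level_weight:
  assumes "set w \<subseteq> basis_letters"
  shows "weight basis_level w + length w = 2 * weight fst w"
  using assms by (induction w) (auto simp: basis_letters_def basis_level_def)

lemma words_below: "n < p \<Longrightarrow> words_of fst (basis_letters_below p) n = words_of fst basis_letters n"
proof (intro equalityI subsetI)
  fix w assume n: "n < p" and w: "w \<in> words_of fst basis_letters n"
  have "fst x \<le> weight fst w" if "x \<in> set w" for x using that by (induction w) auto
  then show "w \<in> words_of fst (basis_letters_below p) n"
    using w n by (fastforce simp: words_of_def basis_letters_def basis_letters_below_def)
qed (use basis_letters_below_sub in \<open>auto simp: words_of_def\<close>)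

abbreviation elt :: "nat \<times> nat \<Rightarrow> 'a" where
  "elt x \<equiv> a (fst x) (snd x)"

lemma elt_in: "x \<in> basis_letters \<Longrightarrow> elt x \<in> lcs (fst x)"
  using a_in by (auto simp: basis_letters_def)

lemma comm_elt_in:
  "x \<in> basis_letters \<Longrightarrow> y \<in> basis_letters \<Longrightarrow> comm (elt x) (elt y) \<in> lcs (fst x + fst y)"
  using elt_in comm_in_lcs_add by (auto simp: basis_letters_def)

end

subsection \<open>Words in the basis span the image of the group algebra\<close>

text \<open>Multiplicativity is required modulo \<open>J\<close> only, because \<open>\<mu>\<close>
  will be evaluated on arbitrarily chosen words. The last assumption ensures that the elements
  \<open>\<mu> g - 1\<close> reach all letters.\<close>

locale magnus = lcs_basis G a \<chi> for G :: "('a, 'b) monoid_scheme" (structure) and a \<chi> +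
  fixes J :: "'e free_algebra set" and S :: "'e set" and \<mu> :: "'a \<Rightarrow> 'e free_algebra" and p :: nat
  assumes J: "fa.subspace J" "\<And>f g. f \<in> J \<Longrightarrow> f * g \<in> J" "\<And>f g. f \<in> J \<Longrightarrow> g * f \<in> J"
    and J_long: "\<And>w. length w \<ge> p \<Longrightarrow> mon w \<in> J"
    and mu_mult: "\<And>g h. g \<in> carrier G \<Longrightarrow> h \<in> carrier G \<Longrightarrow> \<mu> (g \<otimes> h) - \<mu> g * \<mu> h \<in> J"
    and mu_one: "\<mu> \<one> - 1 \<in> J"
    and mu_aug: "\<And>g. g \<in> carrier G \<Longrightarrow>
      \<mu> g - 1 \<in> fa.span (J \<union> {mon w | w. set w \<subseteq> S \<and> length w \<ge> 1})"
    and letters: "\<And>e. e \<in> S \<Longrightarrow> mon [e] \<in> fa.span (J \<union> {\<mu> g - 1 | g. g \<in> carrier G})"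
begin

text \<open>Modulo \<open>J\<close>, the \<open>k\<close>-th power of the augmentation ideal of the
  free algebra on \<open>S\<close>.\<close>

definition M :: "nat \<Rightarrow> 'e free_algebra set" where
  "M k = fa.span (J \<union> {mon w | w. set w \<subseteq> S \<and> length w \<ge> k})"

lemma M_subspace: "fa.subspace (M k)"
  by (simp add: M_def)

lemmas M_add = fa.subspace_add[OF M_subspace] and M_diff = fa.subspace_diff[OF M_subspace]

lemma J_M: "f \<in> J \<Longrightarrow> f \<in> M k"
  unfolding M_def by (rule fa.span_base) blast

lemma M_antimono: "k \<le> l \<Longrightarrow> M l \<subseteq> M k"
  unfolding M_def by (intro fa.span_mono) fastforce

lemma M_mult: "f \<in> M k \<Longrightarrow> g \<in> M l \<Longrightarrow> f * g \<in> M (k + l)"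
  unfolding M_def
proof (elim fa_span_mult)
  fix x y assume "x \<in> J \<union> {mon w |w. set w \<subseteq> S \<and> k \<le> length w}" "y \<in> J \<union> {mon w |w. set w \<subseteq> S \<and> l \<le> length w}"
  then consider "x \<in> J" | "y \<in> J" | v w where "x = mon v" "y = mon w" "set v \<subseteq> S" "set w \<subseteq> S"
    "k \<le> length v" "l \<le> length w" by blast
  then have "x * y \<in> J \<union> {mon w |w. set w \<subseteq> S \<and> k + l \<le> length w}"
  proof cases
    case (3 v w)
    then have "x * y = mon (v @ w)" "set (v @ w) \<subseteq> S" "k + l \<le> length (v @ w)" by (auto simp: mon_append)
    then show ?thesis by blast
  qed (use J in auto)
  then show "x * y \<in> fa.span (J \<union> {mon w |w. set w \<subseteq> S \<and> k + l \<le> length w})" by (rule fa.span_base)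
qed

lemma mu_M1: "g \<in> carrier G \<Longrightarrow> \<mu> g - 1 \<in> M 1"
  using mu_aug by (simp add: M_def)

lemma mu_M0: "g \<in> carrier G \<Longrightarrow> \<mu> g \<in> M 0"
proof -
  assume g: "g \<in> carrier G"
  have "1 \<in> M 0" unfolding M_def mon_Nil[symmetric] by (rule fa.span_base) force
  moreover have "\<mu> g - 1 \<in> M 0" using mu_M1[OF g] M_antimono[of 0 1] by auto
  ultimately show ?thesis using M_add[of "\<mu> g - 1" 0 1] by simp
qed

text \<open>Rests on the group identity that \<open>comm g h\<close> times
  \<open>h \<otimes> g\<close> equals \<open>g \<otimes> h\<close>: the algebra commutator is the
  group commutator minus one, up to the factor \<open>\<mu> (h \<otimes> g)\<close>.\<close>

lemma mu_comm_approx: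
  assumes g: "g \<in> carrier G" and h: "h \<in> carrier G"
  shows "(\<mu> g - 1) * (\<mu> h - 1) - (\<mu> h - 1) * (\<mu> g - 1) - (\<mu> (comm g h) - 1) * \<mu> (h \<otimes> g) \<in> J"
proof -
  have "comm g h \<otimes> (h \<otimes> g) = g \<otimes> h" using g h by (simp add: m_assoc)
  then have 1: "\<mu> (g \<otimes> h) - \<mu> (comm g h) * \<mu> (h \<otimes> g) \<in> J"
    using mu_mult[of "comm g h" "h \<otimes> g"] g h by simp
  have "(\<mu> g - 1) * (\<mu> h - 1) - (\<mu> h - 1) * (\<mu> g - 1) - (\<mu> (comm g h) - 1) * \<mu> (h \<otimes> g) =
    (\<mu> (g \<otimes> h) - \<mu> (comm g h) * \<mu> (h \<otimes> g)) - (\<mu> (g \<otimes> h) - \<mu> g * \<mu> h) + (\<mu> (h \<otimes> g) - \<mu> h * \<mu> g)"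
    by (simp add: algebra_simps)
  then show ?thesis
    using fa.subspace_add[OF J(1) fa.subspace_diff[OF J(1) 1 mu_mult[OF g h]] mu_mult[OF h g]] by simp
qed

lemma mu_mult_approx:
  assumes "g \<in> carrier G" "h \<in> carrier G" "\<mu> g - 1 \<in> M k" "\<mu> h - 1 \<in> M l"
  shows "\<mu> (g \<otimes> h) - 1 - (\<mu> g - 1) - (\<mu> h - 1) \<in> M (k + l)"
proof -
  have eq: "\<mu> (g \<otimes> h) - 1 - (\<mu> g - 1) - (\<mu> h - 1) = (\<mu> (g \<otimes> h) - \<mu> g * \<mu> h) + (\<mu> g - 1) * (\<mu> h - 1)"
    by (simp add: algebra_simps)
  show ?thesis unfolding eq using M_add[OF J_M[OF mu_mult[OF assms(1,2)]] M_mult[OF assms(3,4)]] by simp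
qed

text \<open>The lower central series is carried into the powers of the augmentation ideal, since
  each further commutator with a group element contributes one more factor from
  \<open>M 1\<close>.\<close>

lemma mu_lcs: "k \<ge> 1 \<Longrightarrow> g \<in> lcs k \<Longrightarrow> \<mu> g - 1 \<in> M k"
proof (induction k arbitrary: g rule: nat_induct_at_least)
  case base
  then show ?case using mu_M1 by simp
next
  case (Suc k)
  from Suc.prems Suc.hyps show ?case
  proof (induction rule: lcs_Suc_induct)
    case (comm h g)
    have hc: "h \<in> carrier G" using comm lcs_carrier by blast
    define c where "c = comm h g"
    have c: "c \<in> carrier G" unfolding c_def using hc comm(2) by simp
    have hM: "\<mu> h - 1 \<in> M k" using Suc.IH comm(1) .
    have "(\<mu> h - 1) * (\<mu> g - 1) \<in> M (Suc k)" "(\<mu> g - 1) * (\<mu> h - 1) \<in> M (Suc k)"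
      using M_mult[OF hM mu_M1[OF comm(2)]] M_mult[OF mu_M1[OF comm(2)] hM] by simp_all
    from M_diff[OF M_diff[OF this] J_M[OF mu_comm_approx[OF hc comm(2)]]]
    have 1: "(\<mu> c - 1) * \<mu> (g \<otimes> h) \<in> M (Suc k)" by (simp add: c_def)
    have gh: "g \<otimes> h \<in> carrier G" using hc comm by simp
    \<comment> \<open>The factor \<open>\<mu> (g \<otimes> h)\<close> is invertible modulo
      \<open>J\<close> and is removed by multiplying with the image of the inverse element.\<close>
    have "((\<mu> c - 1) * \<mu> (g \<otimes> h)) * \<mu> (inv (g \<otimes> h)) \<in> M (Suc k + 0)"
      by (rule M_mult[OF 1 mu_M0]) (use gh in simp)
    moreover have "(\<mu> c - 1) * (\<mu> (g \<otimes> h) * \<mu> (inv (g \<otimes> h)) - 1) \<in> J"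
    proof (rule J(3))
      have "\<mu> (g \<otimes> h) * \<mu> (inv (g \<otimes> h)) - 1 =
         (\<mu> \<one> - 1) - (\<mu> ((g \<otimes> h) \<otimes> inv (g \<otimes> h)) - \<mu> (g \<otimes> h) * \<mu> (inv (g \<otimes> h)))"
        using r_inv[OF gh] by simp
      also have "\<dots> \<in> J" using gh by (intro fa.subspace_diff[OF J(1)] mu_one mu_mult inv_closed)
      finally show "\<mu> (g \<otimes> h) * \<mu> (inv (g \<otimes> h)) - 1 \<in> J" .
    qed
    then have "(\<mu> c - 1) * (\<mu> (g \<otimes> h) * \<mu> (inv (g \<otimes> h)) - 1) \<in> M (Suc k)" by (rule J_M)
    ultimately have "((\<mu> c - 1) * \<mu> (g \<otimes> h)) * \<mu> (inv (g \<otimes> h)) -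
        (\<mu> c - 1) * (\<mu> (g \<otimes> h) * \<mu> (inv (g \<otimes> h)) - 1) \<in> M (Suc k)" using M_diff by simp
    moreover have "((\<mu> c - 1) * \<mu> (g \<otimes> h)) * \<mu> (inv (g \<otimes> h)) -
        (\<mu> c - 1) * (\<mu> (g \<otimes> h) * \<mu> (inv (g \<otimes> h)) - 1) = \<mu> c - 1"
      by (simp add: algebra_simps)
    ultimately show ?case by (simp add: c_def)
  next
    case one
    show ?case by (rule J_M[OF mu_one])
  next
    case (inv c)
    have c: "c \<in> carrier G" using inv(1) lcs_carrier by blast
    have 1: "\<mu> (c \<otimes> inv c) - 1 - (\<mu> c - 1) - (\<mu> (inv c) - 1) \<in> M (Suc k + 1)"
      using c inv by (intro mu_mult_approx mu_M1) auto
    then have 1: "\<mu> (c \<otimes> inv c) - 1 - (\<mu> c - 1) - (\<mu> (inv c) - 1) \<in> M (Suc k)"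
      using M_antimono[of "Suc k" "Suc k + 1"] by auto
    have 2: "\<mu> (c \<otimes> inv c) - 1 \<in> M (Suc k)" using c J_M[OF mu_one] by simp
    have "\<mu> (inv c) - 1 = (\<mu> (c \<otimes> inv c) - 1) - (\<mu> c - 1) -
       (\<mu> (c \<otimes> inv c) - 1 - (\<mu> c - 1) - (\<mu> (inv c) - 1))" by (simp add: algebra_simps)
    also have "\<dots> \<in> M (Suc k)" by (intro M_diff 1 2 inv)
    finally show ?case .
  next
    case (mult c e)
    have ce: "c \<in> carrier G" "e \<in> carrier G" using mult(1,2) lcs_carrier by blast+
    have "\<mu> (c \<otimes> e) - 1 - (\<mu> c - 1) - (\<mu> e - 1) \<in> M (Suc k + Suc k)"
      using ce mult by (intro mu_mult_approx) auto
    then have 1: "\<mu> (c \<otimes> e) - 1 - (\<mu> c - 1) - (\<mu> e - 1) \<in> M (Suc k)"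
      using M_antimono[of "Suc k" "Suc k + Suc k"] by auto
    have "\<mu> (c \<otimes> e) - 1 = (\<mu> (c \<otimes> e) - 1 - (\<mu> c - 1) - (\<mu> e - 1)) + (\<mu> c - 1) + (\<mu> e - 1)"
      by (simp add: algebra_simps)
    also have "\<dots> \<in> M (Suc k)" by (intro M_add 1 mult)
    finally show ?case .
  qed
qed

definition y :: "nat \<times> nat \<Rightarrow> 'e free_algebra" where
  "y x = \<mu> (elt x) - 1"

lemma y_M: "x \<in> basis_letters \<Longrightarrow> y x \<in> M (fst x)"
  unfolding y_def by (rule mu_lcs) (auto simp: basis_letters_def a_in)

text \<open>A functional that kills \<open>M (Suc k)\<close> becomes an \<open>lcs_form\<close>
  after composition with \<open>\<mu> g - 1\<close>, and \<open>form_expand\<close> shows that it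
  vanishes on the difference. No functional can therefore separate the difference from
  \<open>M (Suc k)\<close>.\<close>

lemma mu_expand:
  assumes k: "k \<ge> 1" and g: "g \<in> lcs k"
  shows "\<mu> g - 1 - (\<Sum>i<lcs_rank G k. scal (\<chi> k i g) (y (k, i))) \<in> M (Suc k)" (is "?D \<in> _")
proof (rule ccontr)
  assume "?D \<notin> M (Suc k)"
  then obtain l where l: "Vector_Spaces.linear scal (*) l" "\<forall>x\<in>M (Suc k). l x = 0" "l ?D \<noteq> 0"
    by (rule fa.separating_functional[OF M_subspace])
  interpret l: Vector_Spaces.linear scal "(*)" l by fact
  have "lcs_form k (\<lambda>g. l (\<mu> g - 1))"
    unfolding lcs_form_def
  proof (intro conjI ballI)
    fix g h assume gh: "g \<in> lcs k" "h \<in> lcs k"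
    have "\<mu> (g \<otimes> h) - 1 - (\<mu> g - 1) - (\<mu> h - 1) \<in> M (k + k)"
      using gh k lcs_carrier by (intro mu_mult_approx mu_lcs) auto
    then have "\<mu> (g \<otimes> h) - 1 - (\<mu> g - 1) - (\<mu> h - 1) \<in> M (Suc k)"
      using M_antimono[of "Suc k" "k + k"] k by auto
    then have "l (\<mu> (g \<otimes> h) - 1 - (\<mu> g - 1) - (\<mu> h - 1)) = 0" using l(2) by blast
    then show "l (\<mu> (g \<otimes> h) - 1) = l (\<mu> g - 1) + l (\<mu> h - 1)"
      unfolding l.diff[of "\<mu> (g \<otimes> h) - 1 - (\<mu> g - 1)"] l.diff[of "\<mu> (g \<otimes> h) - 1"] by (simp only: diff_diff_eq right_minus_eq)
  next
    fix g assume "g \<in> lcs (Suc k)"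
    then show "l (\<mu> g - 1) = 0" using mu_lcs[of "Suc k" g] l(2) by simp
  qed
  from form_expand[OF k this g] have "l (\<mu> g - 1) = (\<Sum>i<lcs_rank G k. \<chi> k i g * l (y (k, i)))"
    by (simp add: y_def)
  moreover have "l ?D = l (\<mu> g - 1) - (\<Sum>i<lcs_rank G k. \<chi> k i g * l (y (k, i)))"
    by (simp only: l.diff[of "\<mu> g - 1"] l.sum l.scale)
  ultimately show False using l(3) by simp
qed

lemma y_comm_approx:
  assumes x: "x \<in> basis_letters" and z: "z \<in> basis_letters"
  shows "y x * y z - y z * y x -
    (\<Sum>i<lcs_rank G (fst x + fst z). scal (\<chi> (fst x + fst z) i (comm (elt x) (elt z))) (y (fst x + fst z, i)))
    \<in> M (fst x + fst z + 1)" (is "_ - ?\<Sigma> \<in> _")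
proof -
  define c where "c = comm (elt x) (elt z)"
  let ?n = "fst x + fst z"
  have n: "?n \<ge> 1" using x by (auto simp: basis_letters_def)
  have xz: "elt x \<in> carrier G" "elt z \<in> carrier G" using elt_in[OF x] elt_in[OF z] lcs_carrier by blast+
  have c: "c \<in> lcs ?n" unfolding c_def by (rule comm_elt_in[OF x z])
  have 1: "y x * y z - y z * y x - (\<mu> c - 1) * \<mu> (elt z \<otimes> elt x) \<in> M (?n + 1)"
    unfolding y_def c_def by (rule J_M[OF mu_comm_approx[OF xz]])
  have 2: "(\<mu> c - 1) * (\<mu> (elt z \<otimes> elt x) - 1) \<in> M (?n + 1)"
    using M_mult[OF mu_lcs[OF n c] mu_M1] xz by simp
  have 3: "\<mu> c - 1 - ?\<Sigma> \<in> M (?n + 1)" using mu_expand[OF n c] by (simp add: c_def)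
  have eq: "y x * y z - y z * y x - ?\<Sigma> = (y x * y z - y z * y x - (\<mu> c - 1) * \<mu> (elt z \<otimes> elt x)) +
     (\<mu> c - 1) * (\<mu> (elt z \<otimes> elt x) - 1) + (\<mu> c - 1 - ?\<Sigma>)" by (simp add: algebra_simps)
  show ?thesis unfolding eq by (rule M_add[OF M_add[OF 1 2] 3])
qed

lemma prod_y_M: "set w \<subseteq> basis_letters \<Longrightarrow> prod_val y w \<in> M (weight fst w)"
proof (induction w)
  case Nil
  have "1 \<in> M 0" unfolding M_def mon_Nil[symmetric] by (rule fa.span_base) force
  then show ?case by simp
next
  case (Cons x w)
  then show ?case using M_mult[OF y_M[of x], of "prod_val y w"] by simp
qed

lemma mon_letter_span:
  assumes "e \<in> S"
  shows "mon [e] \<in> fa.span (prod_val y ` words_of fst basis_letters 1 \<union> M 2)" (is "_ \<in> ?T")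
proof -
  have "\<mu> g - 1 \<in> ?T" if g: "g \<in> carrier G" for g
  proof -
    have "\<mu> g - 1 - (\<Sum>i<lcs_rank G 1. scal (\<chi> 1 i g) (y (1, i))) \<in> M 2"
      using mu_expand[of 1 g] g by (simp add: numeral_2_eq_2)
    then have "\<mu> g - 1 - (\<Sum>i<lcs_rank G 1. scal (\<chi> 1 i g) (y (1, i))) \<in> ?T" by (intro fa.span_base) blast
    moreover have "(\<Sum>i<lcs_rank G 1. scal (\<chi> 1 i g) (y (1, i))) \<in> ?T"
    proof (intro fa.span_sum fa.span_scale fa.span_base UnI1 image_eqI)
      fix i assume "i \<in> {..<lcs_rank G 1}"
      then show "y (1, i) = prod_val y [(1, i)]" "[(1, i)] \<in> words_of fst basis_letters 1"
        by (auto simp: words_of_def basis_letters_def)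
    qed
    ultimately show ?thesis using fa.span_add by fastforce
  qed
  then have "J \<union> {\<mu> g - 1 | g. g \<in> carrier G} \<subseteq> ?T" using J_M fa.span_superset by blast
  then have "fa.span (J \<union> {\<mu> g - 1 | g. g \<in> carrier G}) \<subseteq> ?T" by (intro fa.span_minimal) auto
  then show ?thesis using letters[OF assms] by blast
qed

lemma mon_word_span:
  "set w \<subseteq> S \<Longrightarrow> mon w \<in> fa.span (prod_val y ` words_of fst basis_letters (length w) \<union> M (Suc (length w)))"
proof (induction w)
  case Nil
  have "prod_val y [] = mon []" by (simp add: mon_Nil)
  moreover have "[] \<in> words_of fst basis_letters 0" by (simp add: words_of_def)
  ultimately show ?case by (intro fa.span_base) (metis UnI1 imageI list.size(3))
next
  case (Cons e w)
  let ?V = "\<lambda>k. prod_val y ` words_of fst basis_letters k"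
  have "mon [e] * mon w \<in> fa.span (?V (Suc (length w)) \<union> M (Suc (Suc (length w))))"
  proof (rule fa_span_mult)
    show "mon [e] \<in> fa.span (?V 1 \<union> M 2)" using Cons.prems by (intro mon_letter_span) simp
    show "mon w \<in> fa.span (?V (length w) \<union> M (Suc (length w)))" using Cons by simp
    fix f g assume "f \<in> ?V 1 \<union> M 2" "g \<in> ?V (length w) \<union> M (Suc (length w))"
    then consider u v where "f = prod_val y u" "g = prod_val y v" "u \<in> words_of fst basis_letters 1"
        "v \<in> words_of fst basis_letters (length w)"
      | u where "f = prod_val y u" "u \<in> words_of fst basis_letters 1" "g \<in> M (Suc (length w))"
      | "f \<in> M 2" "g \<in> ?V (length w) \<union> M (Suc (length w))" by blast
    then show "f * g \<in> fa.span (?V (Suc (length w)) \<union> M (Suc (Suc (length w))))"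
    proof cases
      case (1 u v)
      then have "f * g = prod_val y (u @ v)" "u @ v \<in> words_of fst basis_letters (Suc (length w))"
        by (auto simp: words_of_def)
      then show ?thesis by (intro fa.span_base) blast
    next
      case (2 u)
      then have "f \<in> M 1" using prod_y_M[of u] by (auto simp: words_of_def)
      then have "f * g \<in> M (Suc (Suc (length w)))" using M_mult[of f 1 g] 2(3) by simp
      then show ?thesis by (intro fa.span_base) blast
    next
      case 3
      have "g \<in> M (length w)"
      proof -
        have "M (Suc (length w)) \<subseteq> M (length w)" by (rule M_antimono) simp
        moreover have "prod_val y v \<in> M (length w)" if "v \<in> words_of fst basis_letters (length w)" for v
          using prod_y_M[of v] that by (simp add: words_of_def)
        ultimately show ?thesis using 3(2) by blast
      qed
      then have "f * g \<in> M (Suc (Suc (length w)))" using M_mult[OF 3(1)] by simp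
      then show ?thesis by (intro fa.span_base) blast
    qed
  qed
  then show ?case by (simp add: mon_Cons[of e w])
qed

text \<open>A swap costs words in which the two letters are replaced by a single one of the same
  total degree, plus an error in \<open>M (Suc n)\<close>. The shorter words have higher
  \<open>basis_level\<close>, which is bounded by \<open>2 * n\<close> in degree
  \<open>n\<close>.\<close>

lemma prod_y_representatives:
  assumes w: "w \<in> words_of fst basis_letters n"
    and r: "\<And>w. commute_equiv basis_edge w (r w)"
  shows "prod_val y w \<in> fa.span (prod_val y ` r ` words_of fst basis_letters n \<union> M (Suc n))"
proof (rule basis.class_representatives_span[where \<omega> = basis_level and W = "words_of fst basis_letters n" and N = "2 * n"])
  show "weight basis_level w \<le> 2 * n" if "w \<in> words_of fst basis_letters n" for w
    using that level_weight[of w] by (auto simp: words_of_def)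
  show "v \<in> words_of fst basis_letters n"
    if "u \<in> words_of fst basis_letters n" "commute_equiv basis_edge u v" for u v
    using that basis.equiv_weight[OF that(2), of fst] basis.equiv_mset[OF that(2)]
    by (metis (mono_tags, lifting) mem_Collect_eq set_mset_mset words_of_def)
  show "\<exists>r\<in>r ` words_of fst basis_letters n. commute_equiv basis_edge w r"
    if "w \<in> words_of fst basis_letters n" for w
    using that r by blast
  show "w \<in> words_of fst basis_letters n" by (rule w)
  fix u x z v assume E: "basis_edge x z" and W: "u @ x # z # v \<in> words_of fst basis_letters n"
  have xz: "x \<in> basis_letters" "z \<in> basis_letters" using E by (auto simp: basis_edge_def)
  let ?n = "fst x + fst z" and ?c = "comm (elt x) (elt z)"
  let ?T = "prod_val y ` {w \<in> words_of fst basis_letters n. weight basis_level (u @ x # z # v) < weight basis_level w} \<union> M (Suc n)"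
  let ?\<Sigma> = "\<Sum>i<lcs_rank G ?n. scal (\<chi> ?n i ?c) (y (?n, i))"
  have uv: "set u \<subseteq> basis_letters" "set v \<subseteq> basis_letters" "weight fst u + ?n + weight fst v = n"
    using W by (auto simp: words_of_def)
  have "prod_val y u * (y x * y z - y z * y x - ?\<Sigma>) * prod_val y v \<in> M (weight fst u + (?n + 1) + weight fst v)"
    by (intro M_mult prod_y_M uv y_comm_approx xz)
  then have 1: "prod_val y u * (y x * y z - y z * y x - ?\<Sigma>) * prod_val y v \<in> fa.span ?T"
    using uv(3) by (intro fa.span_base) (auto simp: add_ac)
  have "prod_val y u * y (?n, i) * prod_val y v \<in> fa.span ?T" if i: "i < lcs_rank G ?n" for i
  proof -
    let ?w = "u @ (?n, i) # v"
    have l: "(?n, i) \<in> basis_letters" using i xz by (auto simp: basis_letters_def)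
    have "?w \<in> words_of fst basis_letters n" using uv l by (auto simp: words_of_def)
    moreover have "weight basis_level (u @ x # z # v) < weight basis_level ?w"
      using xz by (auto simp: basis_letters_def basis_level_def)
    moreover have "prod_val y u * y (?n, i) * prod_val y v = prod_val y ?w" by (simp add: mult.assoc)
    ultimately show ?thesis by (intro fa.span_base) blast
  qed
  then have 2: "(\<Sum>i<lcs_rank G ?n. scal (\<chi> ?n i ?c) (prod_val y u * y (?n, i) * prod_val y v)) \<in> fa.span ?T"
    by (intro fa.span_sum fa.span_scale) auto
  have "prod_val y (u @ x # z # v) - prod_val y (u @ z # x # v) =
    prod_val y u * (y x * y z - y z * y x - ?\<Sigma>) * prod_val y v + prod_val y u * ?\<Sigma> * prod_val y v"
    by (simp add: algebra_simps)
  also have "prod_val y u * ?\<Sigma> * prod_val y v =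
      (\<Sum>i<lcs_rank G ?n. scal (\<chi> ?n i ?c) (prod_val y u * y (?n, i) * prod_val y v))"
    by (simp add: sum_distrib_left sum_distrib_right)
  finally show "prod_val y (u @ x # z # v) - prod_val y (u @ z # x # v) \<in> fa.span ?T"
    using fa.span_add[OF 1 2] by simp
qed

text \<open>Descending induction on the length: a word is a combination of basis words up to longer
  words, and words of length at least \<open>p\<close> lie in \<open>J\<close>.\<close>

lemma mon_in_span_representatives:
  assumes r: "\<And>w. commute_equiv basis_edge w (r w)" and w: "set w \<subseteq> S"
  shows "mon w \<in> fa.span (prod_val y ` (\<Union>n<p. r ` words_of fst (basis_letters_below p) n) \<union> J)"
  using w
proof (induction "p - length w" arbitrary: w rule: less_induct)
  case less
  let ?T = "fa.span (prod_val y ` (\<Union>n<p. r ` words_of fst (basis_letters_below p) n) \<union> J)"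
  show ?case
  proof (cases "length w \<ge> p")
    case True
    then have "mon w \<in> J" by (rule J_long)
    then show ?thesis by (intro fa.span_base) blast
  next
    case False
    let ?n = "length w"
    have M: "M (Suc ?n) \<subseteq> ?T" unfolding M_def
    proof (rule fa.span_minimal)
      have "mon v \<in> ?T" if "set v \<subseteq> S" "Suc ?n \<le> length v" for v
        using that False by (intro less.hyps) auto
      then show "J \<union> {mon v |v. set v \<subseteq> S \<and> Suc ?n \<le> length v} \<subseteq> ?T"
        using fa.span_superset[of "_ \<union> J"] by blast
    qed simp
    have "prod_val y v \<in> ?T" if v: "v \<in> words_of fst basis_letters ?n" for v
    proof -
      have "r ` words_of fst basis_letters ?n \<subseteq> (\<Union>n<p. r ` words_of fst (basis_letters_below p) n)"
        using words_below[of ?n] False by (intro UN_upper[of ?n, THEN subset_trans[rotated]]) auto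
      then have "prod_val y ` r ` words_of fst basis_letters ?n \<subseteq> ?T"
        using fa.span_superset[of "prod_val y ` (\<Union>n<p. r ` words_of fst (basis_letters_below p) n) \<union> J"]
        by blast
      then have "fa.span (prod_val y ` r ` words_of fst basis_letters ?n \<union> M (Suc ?n)) \<subseteq> ?T"
        using M by (intro fa.span_minimal) auto
      then show ?thesis using prod_y_representatives[OF v r] by blast
    qed
    then have "fa.span (prod_val y ` words_of fst basis_letters ?n \<union> M (Suc ?n)) \<subseteq> ?T"
      using M by (intro fa.span_minimal) auto
    then show ?thesis using mon_word_span[OF less.prems] by blast
  qed
qed

end

text \<open>Class representatives of words in \<open>S\<close> are independent modulo the relator
  ideal, whereas basis words span. Expanding a word of length \<open>n\<close> involves basis words
  of all degrees from \<open>n\<close> to \<open>p - 1\<close>, hence the cumulative counts.\<close>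

theorem (in lcs_basis) traces_le_basis_words:
  assumes "relators E (\<lambda>_. 1) \<omega> p \<rho>" and "finite S"
    and "magnus G a \<chi> (relator_ideal E (\<lambda>_. 1) \<omega> p \<rho> 0) S \<mu> p"
  shows "(\<Sum>n<p. card (trace_classes E (\<lambda>_. 1) S n)) \<le>
    (\<Sum>n<p. card (trace_classes basis_edge fst (basis_letters_below p) n))"
proof -
  interpret R: relators E "\<lambda>_. 1" \<omega> p \<rho> by fact
  interpret magnus G a \<chi> "relator_ideal E (\<lambda>_. 1) \<omega> p \<rho> 0" S \<mu> p by fact
  obtain q where q: "\<forall>w. commute_equiv E w (q w)" "\<forall>v w. commute_equiv E v w \<longrightarrow> q v = q w"
    "\<forall>d S n. q ` words_of d S n \<subseteq> words_of d S n"
    "\<forall>d S n. card (q ` words_of d S n) = card (trace_classes E d S n)"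
    by (rule R.class_representatives)
  obtain r where r: "\<forall>w. commute_equiv basis_edge w (r w)"
    "\<forall>v w. commute_equiv basis_edge v w \<longrightarrow> r v = r w"
    "\<forall>d S n. r ` words_of d S n \<subseteq> words_of d S n"
    "\<forall>d S n. card (r ` words_of d S n) = card (trace_classes basis_edge d S n)"
    by (rule basis.class_representatives)
  have q3: "q ` words_of (\<lambda>_. 1) S n \<subseteq> words_of (\<lambda>_. 1) S n" for n using q(3) by blast
  have r3: "r ` words_of fst (basis_letters_below p) n \<subseteq> words_of fst (basis_letters_below p) n" for n
    using r(3) by blast
  define W where "W = (\<Union>n<p. q ` words_of (\<lambda>_. 1) S n)"
  define R where "R = (\<Union>n<p. r ` words_of fst (basis_letters_below p) n)"
  have W: "finite W" "card W = (\<Sum>n<p. card (trace_classes E (\<lambda>_. 1) S n))"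
    using finite_card_words_Union[of S "\<lambda>_. 1" "\<lambda>n. q ` words_of (\<lambda>_. 1) S n", OF assms(2) _ q3]
    by (simp_all add: W_def q(4))
  have R: "finite R" "card R = (\<Sum>n<p. card (trace_classes basis_edge fst (basis_letters_below p) n))"
    using finite_card_words_Union[of "basis_letters_below p" fst "\<lambda>n. r ` words_of fst (basis_letters_below p) n",
        OF finite_basis_letters_below _ r3]
    by (simp_all add: R_def r(4) basis_letters_below_def split_beta)
  have "card W \<le> card (prod_val y ` R)"
  proof (rule fa.card_le_of_independent_modulo[where f = mon])
    show "fa.subspace (relator_ideal E (\<lambda>_. 1) \<omega> p \<rho> 0)" by (rule R.J_subspace)
    fix w assume w: "w \<in> W"
    then have "set w \<subseteq> S" using q3 by (auto simp: W_def words_of_def)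
    then show "mon w \<in> fa.span (prod_val y ` R \<union> relator_ideal E (\<lambda>_. 1) \<omega> p \<rho> 0)"
      unfolding R_def by (rule mon_in_span_representatives[OF r(1)[rule_format]])
    fix c assume J: "(\<Sum>w\<in>W. scal (c w) (mon w)) \<in> relator_ideal E (\<lambda>_. 1) \<omega> p \<rho> 0"
    show "c w = 0"
    proof (rule R.inequivalent_words_independent[OF W(1) _ _ J w])
      show "weight (\<lambda>_. 1) v < p" if "v \<in> W" for v
      proof -
        obtain n where n: "n < p" "v \<in> q ` words_of (\<lambda>_. 1) S n" using \<open>v \<in> W\<close> by (auto simp: W_def)
        then show ?thesis using subsetD[OF q3 n(2)] by (simp add: words_of_def)
      qed
      fix u v assume uv: "u \<in> W" "v \<in> W" "commute_equiv E u v"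
      obtain u' v' where u'v': "u = q u'" "v = q v'" using uv(1,2) by (auto simp: W_def)
      have "commute_equiv E u' v'"
        using R.equiv_trans[OF R.equiv_trans[OF q(1)[rule_format] uv(3)[unfolded u'v']] R.equiv_sym[OF q(1)[rule_format]]] .
      then show "u = v" using q(2) u'v' by simp
    qed
  qed (use W R in auto)
  also have "\<dots> \<le> card R" using R(1) by (rule card_image_le)
  finally show ?thesis using W(2) R(2) by simp
qed

subsection \<open>The Poincare-Birkhoff-Witt theorem for the truncated Lie algebra\<close>

lemma keys_sum_subset: "keys (\<Sum>i\<in>A. f i :: 'a free_algebra) \<subseteq> (\<Union>i\<in>A. keys (f i))"
proof (cases "finite A")
  case True
  then show ?thesis
  proof induction
    case (insert x A)
    then show ?case using keys_add[of "f x" "sum f A"] by auto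
  qed simp
qed simp

context lcs_basis
begin

text \<open>The class of \<open>g\<close> in the \<open>n\<close>-th lower central quotient, written
  as a linear form in the basis letters. With it, \<open>lie_rel\<close> is the defining relation of
  the enveloping algebra.\<close>

definition lie_elt :: "nat \<Rightarrow> 'a \<Rightarrow> (nat \<times> nat) free_algebra" where
  "lie_elt n g = (\<Sum>i<lcs_rank G n. scal (\<chi> n i g) (mon [(n, i)]))"

definition lie_rel :: "nat \<times> nat \<Rightarrow> nat \<times> nat \<Rightarrow> (nat \<times> nat) free_algebra" where
  "lie_rel x y = mon [x, y] - mon [y, x] - lie_elt (fst x + fst y) (comm (elt x) (elt y))"

lemma lie_elt_mult:
  "n \<ge> 1 \<Longrightarrow> g \<in> lcs n \<Longrightarrow> h \<in> lcs n \<Longrightarrow> lie_elt n (g \<otimes> h) = lie_elt n g + lie_elt n h"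
  unfolding lie_elt_def sum.distrib[symmetric]
  by (intro sum.cong HOL.refl) (simp add: lcs_formD(1)[OF chi_form] fa.scale_left_distrib)

lemma lie_elt_inv: "n \<ge> 1 \<Longrightarrow> g \<in> lcs n \<Longrightarrow> lie_elt n (inv g) = - lie_elt n g"
  unfolding lie_elt_def sum_negf[symmetric]
  by (intro sum.cong HOL.refl) (simp add: lcs_form_inv[OF chi_form])

lemma lie_elt_one: "n \<ge> 1 \<Longrightarrow> lie_elt n \<one> = 0"
  unfolding lie_elt_def by (intro sum.neutral ballI) (simp add: lcs_form_one[OF chi_form])

lemma lie_elt_basis: "x \<in> basis_letters \<Longrightarrow> lie_elt (fst x) (elt x) = mon [x]"
proof -
  assume x: "x \<in> basis_letters"
  then have "lie_elt (fst x) (elt x) =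
      (\<Sum>i<lcs_rank G (fst x). if i = snd x then mon [x] else 0)"
    unfolding lie_elt_def by (intro sum.cong HOL.refl) (auto simp: basis_letters_def chi_dual)
  then show ?thesis using x by (simp add: basis_letters_def split_beta)
qed

lemma lie_elt_comm_swap:
  assumes "i \<ge> 1" "j \<ge> 1" "g \<in> lcs i" "h \<in> lcs j"
  shows "lie_elt (i + j) (comm h g) = - lie_elt (i + j) (comm g h)"
proof -
  have c: "g \<in> carrier G" "h \<in> carrier G" using assms lcs_carrier by blast+
  have "lie_elt (i + j) (inv (comm g h)) = - lie_elt (i + j) (comm g h)"
    using assms comm_in_lcs_add by (intro lie_elt_inv) auto
  then show ?thesis by (simp only: comm_swap[OF c])
qed

text \<open>For fixed \<open>h\<close> each coordinate of the commutator is a functional in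
  \<open>g\<close> and can be expanded by \<open>form_expand\<close>; this is bilinearity of the
  bracket in coordinates.\<close>

lemma lie_elt_comm_expand_left:
  assumes ij: "i \<ge> 1" "j \<ge> 1" and g: "g \<in> lcs i" "h \<in> lcs j"
  shows "lie_elt (i + j) (comm g h) = (\<Sum>k<lcs_rank G i. scal (\<chi> i k g) (lie_elt (i + j) (comm (a i k) h)))"
proof -
  have "lie_elt (i + j) (comm g h) = (\<Sum>n<lcs_rank G (i + j).
      scal (\<Sum>k<lcs_rank G i. \<chi> i k g * \<chi> (i + j) n (comm (a i k) h)) (mon [(i + j, n)]))"
    unfolding lie_elt_def
  proof (intro sum.cong HOL.refl arg_cong2[of _ _ _ _ scal])
    fix n assume "n \<in> {..<lcs_rank G (i + j)}"
    then have "lcs_form (i + j) (\<chi> (i + j) n)" using ij by (intro chi_form) auto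
    then have "lcs_form i (\<lambda>u. \<chi> (i + j) n (comm u h))" using ij g by (intro lcs_form_comm_left)
    from form_expand[OF ij(1) this g(1)]
    show "\<chi> (i + j) n (comm g h) = (\<Sum>k<lcs_rank G i. \<chi> i k g * \<chi> (i + j) n (comm (a i k) h))" .
  qed
  also have "\<dots> = (\<Sum>k<lcs_rank G i. scal (\<chi> i k g) (lie_elt (i + j) (comm (a i k) h)))"
    unfolding lie_elt_def fa.scale_sum_left fa.scale_sum_right
    by (subst sum.swap) simp
  finally show ?thesis .
qed

lemma lie_elt_comm_expand_right:
  assumes ij: "i \<ge> 1" "j \<ge> 1" and g: "g \<in> lcs i" "h \<in> lcs j"
  shows "lie_elt (i + j) (comm g h) = (\<Sum>k<lcs_rank G j. scal (\<chi> j k h) (lie_elt (i + j) (comm g (a j k))))"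
proof -
  have "lie_elt (i + j) (comm g h) = - lie_elt (j + i) (comm h g)"
    using lie_elt_comm_swap[OF ij(2,1) g(2,1)] by (simp add: add.commute)
  also have "\<dots> = (\<Sum>k<lcs_rank G j. - scal (\<chi> j k h) (lie_elt (j + i) (comm (a j k) g)))"
    unfolding lie_elt_comm_expand_left[OF ij(2,1) g(2,1)] by (simp add: sum_negf)
  also have "\<dots> = (\<Sum>k<lcs_rank G j. scal (\<chi> j k h) (lie_elt (i + j) (comm g (a j k))))"
  proof (intro sum.cong HOL.refl)
    fix k assume "k \<in> {..<lcs_rank G j}"
    then have "a j k \<in> lcs j" using ij by (intro a_in) auto
    then show "- scal (\<chi> j k h) (lie_elt (j + i) (comm (a j k) g)) = scal (\<chi> j k h) (lie_elt (i + j) (comm g (a j k)))"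
      using lie_elt_comm_swap[OF ij g(1), of "a j k"] by (simp add: add.commute)
  qed
  finally show ?thesis .
qed

lemma lie_elt_jacobi:
  assumes ijk: "i \<ge> 1" "j \<ge> 1" "k \<ge> 1" and el: "x \<in> lcs i" "y \<in> lcs j" "z \<in> lcs k"
  shows "lie_elt (i + j + k) (comm x (comm y z)) + lie_elt (i + j + k) (comm y (comm z x)) +
    lie_elt (i + j + k) (comm z (comm x y)) = 0"
proof -
  have xy: "comm x y \<in> lcs (i + j)" "comm y z \<in> lcs (j + k)" "comm z x \<in> lcs (k + i)"
    using el ijk comm_in_lcs_add by blast+
  have "lie_elt (i + j + k) (comm z (comm x y)) = - lie_elt (i + j + k) (comm (comm x y) z)"
    using lie_elt_comm_swap[OF _ ijk(3) xy(1) el(3)] ijk by simp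
  moreover have "lie_elt (i + j + k) (comm x (comm y z)) = - lie_elt (i + j + k) (comm (comm y z) x)"
    using lie_elt_comm_swap[OF _ ijk(1) xy(2) el(1)] ijk by (simp add: add_ac)
  moreover have "lie_elt (i + j + k) (comm y (comm z x)) = - lie_elt (i + j + k) (comm (comm z x) y)"
    using lie_elt_comm_swap[OF _ ijk(2) xy(3) el(2)] ijk by (simp add: add_ac)
  moreover have "lie_elt (i + j + k) (comm (comm x y) z) + lie_elt (i + j + k) (comm (comm y z) x) +
      lie_elt (i + j + k) (comm (comm z x) y) = 0"
    unfolding lie_elt_def sum.distrib[symmetric] fa.scale_left_distrib[symmetric]
  proof (intro sum.neutral ballI)
    fix n assume "n \<in> {..<lcs_rank G (i + j + k)}"
    then have "lcs_form (i + j + k) (\<chi> (i + j + k) n)" using ijk by (intro chi_form) auto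
    from lcs_form_jacobi[OF this ijk el]
    show "scal (\<chi> (i + j + k) n (comm (comm x y) z) + \<chi> (i + j + k) n (comm (comm y z) x) +
        \<chi> (i + j + k) n (comm (comm z x) y)) (mon [(i + j + k, n)]) = 0" by simp
  qed
  ultimately show ?thesis by (simp add: algebra_simps neg_eq_iff_add_eq_0)
qed

lemma keys_lie_elt: "w \<in> keys (lie_elt n g) \<Longrightarrow> \<exists>i<lcs_rank G n. w = [(n, i)]"
  using subsetD[OF keys_sum_subset[of "\<lambda>i. scal (\<chi> n i g) (mon [(n, i)])" "{..<lcs_rank G n}"], of w]
    keys_scal by (fastforce simp: lie_elt_def)

lemma lie_rel_swap: "x \<in> basis_letters \<Longrightarrow> y \<in> basis_letters \<Longrightarrow> lie_rel y x = - lie_rel x y"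
proof -
  assume xy: "x \<in> basis_letters" "y \<in> basis_letters"
  then have "fst x \<ge> 1" "fst y \<ge> 1" by (auto simp: basis_letters_def)
  then show ?thesis
    using lie_elt_comm_swap[of "fst x" "fst y" "elt x" "elt y"] elt_in xy
    by (simp add: lie_rel_def add.commute)
qed

lemma lie_rel_same: "x \<in> basis_letters \<Longrightarrow> lie_rel x x = 0"
proof -
  assume x: "x \<in> basis_letters"
  then have "elt x \<in> carrier G" "fst x + fst x \<ge> 1" using elt_in lcs_carrier by (auto simp: basis_letters_def)
  then show ?thesis by (simp add: lie_rel_def lie_elt_one m_assoc)
qed

lemma lie_rel_in_ideal:
  assumes "x \<in> basis_letters" "y \<in> basis_letters" "basis_level x + basis_level y \<ge> s"
  shows "lie_rel x y \<in> relator_ideal basis_edge fst basis_level p lie_rel s"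
proof (cases "x = y")
  case True
  then show ?thesis using lie_rel_same[OF assms(1)] by (simp add: relator_ideal_def fa.span_zero)
next
  case False
  then have "mon [] * lie_rel x y * mon [] \<in> relator_ideal basis_edge fst basis_level p lie_rel s"
    using assms by (intro relator_idealI) (auto simp: basis_edge_def)
  then show ?thesis by (simp add: mon_Nil)
qed

text \<open>Expanding the inner bracket into basis letters turns the expression into a combination
  of relators \<open>lie_rel x (n, i)\<close> with \<open>n = fst y + fst z\<close>. Such a pair of
  letters has level exactly one more than the three letters together.\<close>

lemma lie_jacobi_term:
  assumes xyz: "x \<in> basis_letters" "y \<in> basis_letters" "z \<in> basis_letters"
  shows "mon [x] * lie_elt (fst y + fst z) (comm (elt y) (elt z)) -
      lie_elt (fst y + fst z) (comm (elt y) (elt z)) * mon [x] -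
      lie_elt (fst x + fst y + fst z) (comm (elt x) (comm (elt y) (elt z)))
    \<in> relator_ideal basis_edge fst basis_level p lie_rel (basis_level x + basis_level y + basis_level z + 1)"
    (is "?L \<in> ?J")
proof -
  let ?n = "fst y + fst z" and ?c = "comm (elt y) (elt z)"
  have n: "fst x \<ge> 1" "fst y \<ge> 1" "fst z \<ge> 1" using xyz by (auto simp: basis_letters_def)
  have c: "?c \<in> lcs ?n" by (rule comm_elt_in[OF xyz(2,3)])
  have "lie_elt (fst x + ?n) (comm (elt x) ?c) =
      (\<Sum>i<lcs_rank G ?n. scal (\<chi> ?n i ?c) (lie_elt (fst x + ?n) (comm (elt x) (a ?n i))))"
    using n c elt_in[OF xyz(1)] by (intro lie_elt_comm_expand_right) auto
  then have "?L = (\<Sum>i<lcs_rank G ?n. scal (\<chi> ?n i ?c) (lie_rel x (?n, i)))"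
    by (simp add: lie_elt_def[of ?n] sum_distrib_left sum_distrib_right sum_subtractf lie_rel_def
        fa.scale_right_diff_distrib add.assoc flip: mon_append)
  also have "\<dots> \<in> ?J"
  proof (unfold relator_ideal_def, intro fa.span_sum fa.span_scale, fold relator_ideal_def)
    fix i assume "i \<in> {..<lcs_rank G ?n}"
    then have "(?n, i) \<in> basis_letters" using n by (auto simp: basis_letters_def)
    then show "lie_rel x (?n, i) \<in> ?J"
      using xyz n by (intro lie_rel_in_ideal) (auto simp: basis_level_def)
  qed
  finally show ?thesis .
qed

text \<open>In the Jacobi sum the words in three letters cancel by associativity, and the iterated
  brackets cancel by the Jacobi identity of the group; what remains is a sum of three terms as in
  \<open>lie_jacobi_term\<close>.\<close>

lemma lie_relators: "relators basis_edge fst basis_level p lie_rel"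
proof unfold_locales
  fix x y assume E: "basis_edge x y"
  then have xy: "x \<in> basis_letters" "y \<in> basis_letters" by (auto simp: basis_edge_def)
  show "lie_rel y x = - lie_rel x y" by (rule lie_rel_swap[OF xy])
  fix w assume "w \<in> keys (lie_rel x y - (mon [x, y] - mon [y, x]))"
  then have "w \<in> keys (- lie_elt (fst x + fst y) (comm (elt x) (elt y)))" by (simp add: lie_rel_def)
  then have "w \<in> keys (lie_elt (fst x + fst y) (comm (elt x) (elt y)))" by (simp add: in_keys_iff)
  then obtain i where "w = [(fst x + fst y, i)]" using keys_lie_elt by blast
  then show "basis_level x + basis_level y < weight basis_level w \<and> fst x + fst y \<le> weight fst w"
    using xy by (auto simp: basis_level_def basis_letters_def)
next
  fix x y z assume E: "basis_edge x y" "basis_edge y z" "basis_edge x z"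
  then have xyz: "x \<in> basis_letters" "y \<in> basis_letters" "z \<in> basis_letters" by (auto simp: basis_edge_def)
  let ?J = "relator_ideal basis_edge fst basis_level p lie_rel (basis_level x + basis_level y + basis_level z + 1)"
  let ?L = "\<lambda>x y z. mon [x] * lie_elt (fst y + fst z) (comm (elt y) (elt z)) -
      lie_elt (fst y + fst z) (comm (elt y) (elt z)) * mon [x] -
      lie_elt (fst x + fst y + fst z) (comm (elt x) (comm (elt y) (elt z)))"
  have J: "fa.subspace ?J" by (simp add: relator_ideal_def)
  have 1: "?L x y z \<in> ?J" "?L y z x \<in> ?J" "?L z x y \<in> ?J"
    using lie_jacobi_term[of x y z] lie_jacobi_term[of y z x] lie_jacobi_term[of z x y] xyz
    by (simp_all add: add_ac)
  have jac: "lie_elt (fst x + fst y + fst z) (comm (elt x) (comm (elt y) (elt z))) +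
      lie_elt (fst y + fst z + fst x) (comm (elt y) (comm (elt z) (elt x))) +
      lie_elt (fst z + fst x + fst y) (comm (elt z) (comm (elt x) (elt y))) = 0"
    using lie_elt_jacobi[of "fst x" "fst y" "fst z" "elt x" "elt y" "elt z"] elt_in xyz
    by (auto simp: basis_letters_def add_ac)
  have "mon [x] * lie_rel y z - lie_rel y z * mon [x] + (mon [y] * lie_rel z x - lie_rel z x * mon [y]) +
      (mon [z] * lie_rel x y - lie_rel x y * mon [z]) =
      - (?L x y z + ?L y z x + ?L z x y) -
      (lie_elt (fst x + fst y + fst z) (comm (elt x) (comm (elt y) (elt z))) +
      lie_elt (fst y + fst z + fst x) (comm (elt y) (comm (elt z) (elt x))) +
      lie_elt (fst z + fst x + fst y) (comm (elt z) (comm (elt x) (elt y))))"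
    unfolding lie_rel_def by (simp add: algebra_simps flip: mon_append)
  also have "\<dots> \<in> ?J" unfolding jac diff_0_right
    by (intro fa.subspace_neg[OF J] fa.subspace_add[OF J] 1)
  finally show "mon [x] * lie_rel y z - lie_rel y z * mon [x] + (mon [y] * lie_rel z x - lie_rel z x * mon [y]) +
      (mon [z] * lie_rel x y - lie_rel x y * mon [z]) \<in> ?J" .
qed

text \<open>Expanding both arguments bilinearly reduces the claim to the defining relators of pairs
  of basis letters, including the zero relator of a letter with itself.\<close>

lemma lie_elt_comm_in_ideal:
  assumes kl: "k \<ge> 1" "l \<ge> 1" and gh: "g \<in> lcs k" "h \<in> lcs l"
  shows "lie_elt k g * lie_elt l h - lie_elt l h * lie_elt k g - lie_elt (k + l) (comm g h)
    \<in> relator_ideal basis_edge fst basis_level p lie_rel 0" (is "?L \<in> ?J")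
proof -
  have "lie_elt (k + l) (comm g h) =
    (\<Sum>i<lcs_rank G k. scal (\<chi> k i g) (lie_elt (k + l) (comm (a k i) h)))"
    using assms by (intro lie_elt_comm_expand_left)
  also have "\<dots> = (\<Sum>i<lcs_rank G k. \<Sum>j<lcs_rank G l. scal (\<chi> k i g) (scal (\<chi> l j h) (lie_elt (k + l) (comm (a k i) (a l j)))))"
  proof (intro sum.cong HOL.refl)
    fix i assume "i \<in> {..<lcs_rank G k}"
    then have "a k i \<in> lcs k" using kl by (intro a_in) auto
    from lie_elt_comm_expand_right[OF kl this gh(2)]
    show "scal (\<chi> k i g) (lie_elt (k + l) (comm (a k i) h)) =
       (\<Sum>j<lcs_rank G l. scal (\<chi> k i g) (scal (\<chi> l j h) (lie_elt (k + l) (comm (a k i) (a l j)))))"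
      by (simp only: fa.scale_sum_right)
  qed
  finally have e: "lie_elt (k + l) (comm g h) = (\<Sum>i<lcs_rank G k. \<Sum>j<lcs_rank G l.
      scal (\<chi> k i g) (scal (\<chi> l j h) (lie_elt (k + l) (comm (a k i) (a l j)))))" .
  have e1: "lie_elt k g * lie_elt l h = (\<Sum>i<lcs_rank G k. \<Sum>j<lcs_rank G l.
      scal (\<chi> k i g) (scal (\<chi> l j h) (mon [(k, i), (l, j)])))"
    unfolding lie_elt_def sum_product by (simp add: mult.commute flip: mon_append)
  have e2: "lie_elt l h * lie_elt k g = (\<Sum>i<lcs_rank G k. \<Sum>j<lcs_rank G l.
      scal (\<chi> k i g) (scal (\<chi> l j h) (mon [(l, j), (k, i)])))"
    unfolding lie_elt_def sum_product
    by (subst sum.swap) (simp add: mult.commute flip: mon_append)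
  have "?L = (\<Sum>i<lcs_rank G k. \<Sum>j<lcs_rank G l. scal (\<chi> k i g) (scal (\<chi> l j h) (lie_rel (k, i) (l, j))))"
    unfolding e e1 e2 lie_rel_def by (simp only: sum_subtractf fa.scale_right_diff_distrib fst_conv snd_conv)
  also have "\<dots> \<in> ?J"
  proof (unfold relator_ideal_def, intro fa.span_sum fa.span_scale, fold relator_ideal_def)
    fix i j assume "i \<in> {..<lcs_rank G k}" "j \<in> {..<lcs_rank G l}"
    then show "lie_rel (k, i) (l, j) \<in> ?J"
      using kl by (intro lie_rel_in_ideal) (auto simp: basis_letters_def)
  qed
  finally show ?thesis .
qed

end

section \<open>Spanning the enveloping algebra by words in degree one\<close>

locale lie_words = lcs_basis G a \<chi> for G :: "('a, 'b) monoid_scheme" (structure) and a \<chi> +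
  fixes E :: "'e \<Rightarrow> 'e \<Rightarrow> bool" and S :: "'e set" and \<omega> :: "'e \<Rightarrow> nat"
    and z :: "'e \<Rightarrow> (nat \<times> nat) free_algebra" and p :: nat
  assumes comm_E: "commutation E" and fin: "finite S"
    and degree_one: "\<And>g. g \<in> carrier G \<Longrightarrow> lie_elt 1 g \<in> fa.span (z ` S)"
    and quadratic: "\<And>x y. E x y \<Longrightarrow> x \<in> S \<Longrightarrow> y \<in> S \<Longrightarrow> z x * z y - z y * z x \<in>
      fa.span ({z u * z v | u v. u \<in> S \<and> v \<in> S \<and> \<omega> u + \<omega> v > \<omega> x + \<omega> y} \<union>
        relator_ideal basis_edge fst basis_level p lie_rel 0)"
begin

sublocale C: commutation E by (rule comm_E)

sublocale R: relators basis_edge fst basis_level p lie_rel by (rule lie_relators)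

abbreviation "I \<equiv> relator_ideal basis_edge fst basis_level p lie_rel 0"

definition z_span :: "nat \<Rightarrow> (nat \<times> nat) free_algebra set" where
  "z_span n = fa.span (prod_val z ` words_of (\<lambda>_. 1) S n \<union> I)"

lemma I_ideal: "f \<in> I \<Longrightarrow> f * g \<in> I" "f \<in> I \<Longrightarrow> g * f \<in> I"
  using R.J_mult_right[of f 0 g 0] R.J_mult_left[of f 0 g 0] by simp_all

lemma z_span_mult: "f \<in> z_span m \<Longrightarrow> g \<in> z_span n \<Longrightarrow> f * g \<in> z_span (m + n)"
  unfolding z_span_def
proof (elim fa_span_mult)
  fix f g assume "f \<in> prod_val z ` words_of (\<lambda>_. 1) S m \<union> I" "g \<in> prod_val z ` words_of (\<lambda>_. 1) S n \<union> I"
  then consider "f \<in> I" | "g \<in> I" | u v where "f = prod_val z u" "g = prod_val z v"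
    "u \<in> words_of (\<lambda>_. 1) S m" "v \<in> words_of (\<lambda>_. 1) S n" by blast
  then have "f * g \<in> prod_val z ` words_of (\<lambda>_. 1) S (m + n) \<union> I"
  proof cases
    case (3 u v)
    then have "f * g = prod_val z (u @ v)" "u @ v \<in> words_of (\<lambda>_. 1) S (m + n)" by (auto simp: words_of_def)
    then show ?thesis by blast
  qed (use I_ideal in auto)
  then show "f * g \<in> fa.span (prod_val z ` words_of (\<lambda>_. 1) S (m + n) \<union> I)" by (rule fa.span_base)
qed

lemma I_z_span: "f \<in> I \<Longrightarrow> f \<in> z_span n"
  unfolding z_span_def by (intro fa.span_base) blast

lemma letters_z_span: "fa.span (z ` S) \<subseteq> z_span 1"
  unfolding z_span_def
proof (rule fa.span_mono, rule subsetI)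
  fix f assume "f \<in> z ` S"
  then obtain e where "f = prod_val z [e]" "[e] \<in> words_of (\<lambda>_. 1) S 1" by (auto simp: words_of_def)
  then show "f \<in> prod_val z ` words_of (\<lambda>_. 1) S 1 \<union> I" by blast
qed

text \<open>The graded Lie algebra is generated in degree one, because each term of the lower
  central series is generated by commutators of the previous term with group elements.\<close>

lemma lie_elt_z_span: "n \<ge> 1 \<Longrightarrow> g \<in> lcs n \<Longrightarrow> lie_elt n g \<in> z_span n"
proof (induction n arbitrary: g rule: nat_induct_at_least)
  case base
  then have "g \<in> carrier G" by simp
  then show ?case using letters_z_span degree_one by blast
next
  case (Suc n)
  from Suc.prems Suc.hyps show ?case
  proof (induction rule: lcs_Suc_induct)
    case (comm h g)
    have 1: "lie_elt n h \<in> z_span n" "lie_elt 1 g \<in> z_span 1"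
    proof -
      show "lie_elt n h \<in> z_span n" by (rule Suc.IH[OF comm(1)])
      show "lie_elt 1 g \<in> z_span 1" using letters_z_span degree_one[OF comm(2)] by blast
    qed
    have "lie_elt n h * lie_elt 1 g - lie_elt 1 g * lie_elt n h - lie_elt (n + 1) (comm h g) \<in> I"
      using comm Suc.hyps by (intro lie_elt_comm_in_ideal) auto
    then have i: "lie_elt n h * lie_elt 1 g - lie_elt 1 g * lie_elt n h - lie_elt (Suc n) (comm h g) \<in> z_span (Suc n)"
      by (intro I_z_span) simp
    have t: "lie_elt n h * lie_elt 1 g \<in> z_span (Suc n)" "lie_elt 1 g * lie_elt n h \<in> z_span (Suc n)"
      using z_span_mult[OF 1] z_span_mult[OF 1(2,1)] by simp_all
    from t i have m: "(lie_elt n h * lie_elt 1 g - lie_elt 1 g * lie_elt n h) -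
      (lie_elt n h * lie_elt 1 g - lie_elt 1 g * lie_elt n h - lie_elt (Suc n) (comm h g)) \<in> z_span (Suc n)"
      unfolding z_span_def by (rule fa.span_diff[OF fa.span_diff])
    have eq: "u - (u - v) = v" for u v :: "(nat \<times> nat) free_algebra" by simp
    show ?case using m unfolding eq .
  next
    case one
    then show ?case by (simp add: lie_elt_one z_span_def fa.span_zero)
  next
    case (inv c)
    then show ?case by (simp add: lie_elt_inv z_span_def fa.span_neg)
  next
    case (mult c d)
    then show ?case by (simp add: lie_elt_mult z_span_def fa.span_add)
  qed
qed

lemma mon_z_span: "set w \<subseteq> basis_letters \<Longrightarrow> mon w \<in> z_span (weight fst w)"
proof (induction w)
  case Nil
  have "prod_val z [] \<in> prod_val z ` words_of (\<lambda>_. 1) S 0" by (intro imageI) (simp add: words_of_def)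
  then show ?case unfolding z_span_def by (intro fa.span_base UnI1) (simp add: mon_Nil)
next
  case (Cons x w)
  then have "mon [x] \<in> z_span (fst x)"
    using lie_elt_z_span[of "fst x" "elt x"] lie_elt_basis[of x] elt_in[of x] by (auto simp: basis_letters_def)
  from z_span_mult[OF this, of "mon w" "weight fst w"] Cons show ?case by (simp add: mon_Cons[of x w])
qed

text \<open>\<open>quadratic\<close> exchanges two adjacent letters at the cost of pairs of higher
  level and elements of the ideal, without changing the length. Words of length \<open>n\<close>
  have levels at most \<open>n * sum \<omega> S\<close>, so this stops.\<close>

lemma prod_z_representatives:
  assumes w: "w \<in> words_of (\<lambda>_. 1) S n" and q: "\<And>w. commute_equiv E w (q w)"
  shows "prod_val z w \<in> fa.span (prod_val z ` q ` words_of (\<lambda>_. 1) S n \<union> I)"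
proof (rule C.class_representatives_span[where \<omega> = \<omega> and W = "words_of (\<lambda>_. 1) S n" and N = "n * sum \<omega> S"])
  show "weight \<omega> w \<le> n * sum \<omega> S" if "w \<in> words_of (\<lambda>_. 1) S n" for w
  proof -
    have "set w \<subseteq> S \<Longrightarrow> weight \<omega> w \<le> length w * sum \<omega> S"
    proof (induction w)
      case (Cons x w)
      then have "\<omega> x \<le> sum \<omega> S" using fin by (intro member_le_sum) auto
      then show ?case using Cons by simp
    qed simp
    then show ?thesis using that by (simp add: words_of_def)
  qed
  show "v \<in> words_of (\<lambda>_. 1) S n"
    if "u \<in> words_of (\<lambda>_. 1) S n" "commute_equiv E u v" for u v
    using that C.equiv_weight[OF that(2), of "\<lambda>_. 1"] C.equiv_mset[OF that(2)]
    by (metis (mono_tags, lifting) mem_Collect_eq set_mset_mset words_of_def)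
  show "\<exists>r\<in>q ` words_of (\<lambda>_. 1) S n. commute_equiv E w r"
    if "w \<in> words_of (\<lambda>_. 1) S n" for w
    using that q by blast
  show "w \<in> words_of (\<lambda>_. 1) S n" by (rule w)
  fix u x y v assume E: "E x y" and W: "u @ x # y # v \<in> words_of (\<lambda>_. 1) S n"
  let ?T = "prod_val z ` {w \<in> words_of (\<lambda>_. 1) S n. weight \<omega> (u @ x # y # v) < weight \<omega> w} \<union> I"
  have xy: "x \<in> S" "y \<in> S" using W by (auto simp: words_of_def)
  have "prod_val z u * (z x * z y - z y * z x) \<in> fa.span ((\<lambda>f. prod_val z u * f) `
     ({z u * z v | u v. u \<in> S \<and> v \<in> S \<and> \<omega> u + \<omega> v > \<omega> x + \<omega> y} \<union> I))"
    by (rule fa_span_mult[of _ "{prod_val z u}"]) (auto intro: fa.span_base quadratic[OF E xy])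
  then have "prod_val z u * (z x * z y - z y * z x) * prod_val z v \<in> fa.span ?T"
  proof (rule fa_span_mult[of _ _ _ "{prod_val z v}"])
    fix f g assume f: "f \<in> (\<lambda>f. prod_val z u * f) `
       ({z u * z v | u v. u \<in> S \<and> v \<in> S \<and> \<omega> u + \<omega> v > \<omega> x + \<omega> y} \<union> I)" and g: "g \<in> {prod_val z v}"
    then consider h where "h \<in> I" "f = prod_val z u * h"
      | s t where "s \<in> S" "t \<in> S" "\<omega> s + \<omega> t > \<omega> x + \<omega> y" "f = prod_val z u * (z s * z t)" by blast
    then have "f * g \<in> ?T"
    proof cases
      case 1
      then show ?thesis using g I_ideal by auto
    next
      case (2 s t)
      then have "u @ s # t # v \<in> {w \<in> words_of (\<lambda>_. 1) S n. weight \<omega> (u @ x # y # v) < weight \<omega> w}"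
        using W by (auto simp: words_of_def)
      moreover have "f * g = prod_val z (u @ s # t # v)" using g 2 by (simp add: mult.assoc)
      ultimately show ?thesis by blast
    qed
    then show "f * g \<in> fa.span ?T" by (rule fa.span_base)
  qed (auto intro: fa.span_base)
  then show "prod_val z (u @ x # y # v) - prod_val z (u @ y # x # v) \<in> fa.span ?T"
    by (simp add: algebra_simps)
qed

text \<open>The reverse comparison, inside the enveloping algebra: now the basis words are the
  independent family and the words in \<open>S\<close> the spanning one.\<close>

theorem basis_words_le_traces:
  "(\<Sum>n<p. card (trace_classes basis_edge fst (basis_letters_below p) n)) \<le>
    (\<Sum>n<p. card (trace_classes E (\<lambda>_. 1) S n))"
proof -
  obtain q where q: "\<forall>w. commute_equiv E w (q w)" "\<forall>v w. commute_equiv E v w \<longrightarrow> q v = q w"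
    "\<forall>d S n. q ` words_of d S n \<subseteq> words_of d S n"
    "\<forall>d S n. card (q ` words_of d S n) = card (trace_classes E d S n)"
    by (rule C.class_representatives)
  obtain r where r: "\<forall>w. commute_equiv basis_edge w (r w)"
    "\<forall>v w. commute_equiv basis_edge v w \<longrightarrow> r v = r w"
    "\<forall>d S n. r ` words_of d S n \<subseteq> words_of d S n"
    "\<forall>d S n. card (r ` words_of d S n) = card (trace_classes basis_edge d S n)"
    by (rule basis.class_representatives)
  have q3: "q ` words_of (\<lambda>_. 1) S n \<subseteq> words_of (\<lambda>_. 1) S n" for n using q(3) by blast
  have r3: "r ` words_of fst (basis_letters_below p) n \<subseteq> words_of fst (basis_letters_below p) n" for n
    using r(3) by blast
  define W where "W = (\<Union>n<p. q ` words_of (\<lambda>_. 1) S n)"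
  define B where "B = (\<Union>n<p. r ` words_of fst (basis_letters_below p) n)"
  have W: "finite W" "card W = (\<Sum>n<p. card (trace_classes E (\<lambda>_. 1) S n))"
    using finite_card_words_Union[of S "\<lambda>_. 1" "\<lambda>n. q ` words_of (\<lambda>_. 1) S n", OF fin _ q3]
    by (simp_all add: W_def q(4))
  have B: "finite B" "card B = (\<Sum>n<p. card (trace_classes basis_edge fst (basis_letters_below p) n))"
    using finite_card_words_Union[of "basis_letters_below p" fst "\<lambda>n. r ` words_of fst (basis_letters_below p) n",
        OF finite_basis_letters_below _ r3]
    by (simp_all add: B_def r(4) basis_letters_below_def split_beta)
  have "card B \<le> card (prod_val z ` W)"
  proof (rule fa.card_le_of_independent_modulo[where f = mon])
    show "fa.subspace I" by (rule R.J_subspace)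
    fix w assume w: "w \<in> B"
    then obtain n where n: "n < p" "w \<in> r ` words_of fst (basis_letters_below p) n" by (auto simp: B_def)
    have w': "set w \<subseteq> basis_letters" "weight fst w = n"
      using subsetD[OF r3 n(2)] basis_letters_below_sub[of p] by (auto simp: words_of_def)
    have "mon w \<in> z_span n" using mon_z_span[OF w'(1)] w'(2) by simp
    moreover have "z_span n \<subseteq> fa.span (prod_val z ` W \<union> I)"
      unfolding z_span_def
    proof (rule fa.span_minimal)
      have "prod_val z v \<in> fa.span (prod_val z ` W \<union> I)" if "v \<in> words_of (\<lambda>_. 1) S n" for v
      proof -
        have "fa.span (prod_val z ` q ` words_of (\<lambda>_. 1) S n \<union> I) \<subseteq> fa.span (prod_val z ` W \<union> I)"
          using n(1) by (intro fa.span_mono) (auto simp: W_def)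
        then show ?thesis using prod_z_representatives[OF that q(1)[rule_format]] by blast
      qed
      then show "prod_val z ` words_of (\<lambda>_. 1) S n \<union> I \<subseteq> fa.span (prod_val z ` W \<union> I)"
        using fa.span_superset[of "prod_val z ` W \<union> I"] by blast
    qed simp
    ultimately show "mon w \<in> fa.span (prod_val z ` W \<union> I)" by blast
    fix c assume J: "(\<Sum>w\<in>B. scal (c w) (mon w)) \<in> I"
    show "c w = 0"
    proof (rule R.inequivalent_words_independent[OF B(1) _ _ J w])
      show "weight fst v < p" if "v \<in> B" for v
      proof -
        obtain n where n: "n < p" "v \<in> r ` words_of fst (basis_letters_below p) n" using \<open>v \<in> B\<close> by (auto simp: B_def)
        then show ?thesis using subsetD[OF r3 n(2)] by (simp add: words_of_def)
      qed
      fix u v assume uv: "u \<in> B" "v \<in> B" "commute_equiv basis_edge u v"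
      obtain u' v' where u'v': "u = r u'" "v = r v'" using uv(1,2) by (auto simp: B_def)
      have "commute_equiv basis_edge u' v'"
        using basis.equiv_trans[OF basis.equiv_trans[OF r(1)[rule_format] uv(3)[unfolded u'v']]
            basis.equiv_sym[OF r(1)[rule_format]]] .
      then show "u = v" using r(2) u'v' by simp
    qed
  qed (use W B in auto)
  also have "\<dots> \<le> card W" using W(1) by (rule card_image_le)
  finally show ?thesis using W(2) B(2) by simp
qed

end

section \<open>The relations of the pure virtual braid groups\<close>

text \<open>Letters are coloured edges \<open>(c, i, j)\<close> with \<open>i < j\<close>: the edge \<open>(False, i, j)\<close> stands for
  \<open>x i j - 1\<close>, and \<open>(True, i, j)\<close> for the sum of \<open>x i j - 1\<close> and \<open>x j i - 1\<close>.\<close>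

type_synonym edge = "bool \<times> nat \<times> nat"

definition xl :: "(edge \<Rightarrow> 'r :: ring_1) \<Rightarrow> nat \<Rightarrow> nat \<Rightarrow> 'r" where
  "xl z i j = (if i < j then z (False, i, j) else z (True, j, i) - z (False, j, i))"

definition br :: "'r :: ring_1 \<Rightarrow> 'r \<Rightarrow> 'r" where
  "br x y = x * y - y * x"

lemma br_add_left: "br (x + y) w = br x w + br y w"
  and br_diff_left: "br (x - y) w = br x w - br y w"
  and br_minus_left: "br (- x) w = - br x w"
  and br_add_right: "br w (x + y) = br w x + br w y"
  and br_diff_right: "br w (x - y) = br w x - br w y"
  and br_minus_right: "br w (- x) = - br w x"
  and br_zero: "br 0 w = 0" "br w 0 = 0"
  by (simp_all add: br_def algebra_simps)

lemmas br_linear = br_add_left br_diff_left br_minus_left br_add_right br_diff_right br_minus_right br_zero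

lemma br_swap: "br x y = - br y x"
  by (simp add: br_def)

text \<open>The triangle relator with every generator written as one plus a letter. Its two sides
  are the two halves of the boundary of a hexagonal face of the permutohedron.\<close>

definition hexagon :: "(edge \<Rightarrow> 'r :: ring_1) \<Rightarrow> nat \<Rightarrow> nat \<Rightarrow> nat \<Rightarrow> 'r" where
  "hexagon z a b c = (1 + xl z a b) * (1 + xl z a c) * (1 + xl z b c) -
     (1 + xl z b c) * (1 + xl z a c) * (1 + xl z a b)"

definition hexagon2 :: "(edge \<Rightarrow> 'r :: ring_1) \<Rightarrow> nat \<Rightarrow> nat \<Rightarrow> nat \<Rightarrow> 'r" where
  "hexagon2 z a b c = br (xl z a b) (xl z a c) + br (xl z a b) (xl z b c) + br (xl z a c) (xl z b c)"

definition hexagon3 :: "(edge \<Rightarrow> 'r :: ring_1) \<Rightarrow> nat \<Rightarrow> nat \<Rightarrow> nat \<Rightarrow> 'r" where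
  "hexagon3 z a b c = xl z a b * xl z a c * xl z b c - xl z b c * xl z a c * xl z a b"

lemma hexagon_split: "hexagon z a b c = hexagon2 z a b c + hexagon3 z a b c"
  by (simp add: hexagon_def hexagon2_def hexagon3_def br_def algebra_simps)

definition disjoint_edges :: "edge \<Rightarrow> edge \<Rightarrow> bool" where
  "disjoint_edges e f \<longleftrightarrow> {fst (snd e), snd (snd e)} \<inter> {fst (snd f), snd (snd f)} = {}"

lemma disjoint_edges_iff [simp]:
  "disjoint_edges (c, i, j) (d, k, l) \<longleftrightarrow> i \<noteq> k \<and> i \<noteq> l \<and> j \<noteq> k \<and> j \<noteq> l"
  by (auto simp: disjoint_edges_def)

text \<open>The combination of hexagons whose leading term is the commutator of two edges.\<close>

definition pair_rel :: "(nat \<Rightarrow> nat \<Rightarrow> nat \<Rightarrow> 'r :: ring_1) \<Rightarrow> edge \<Rightarrow> edge \<Rightarrow> 'r" where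
  "pair_rel H = (\<lambda>(c, i, j) (d, k, l).
     if i = k \<and> j < l then
       if c then if d then H i j l + H j i l - H l i j - H l j i else H i j l + H j i l
       else if d then - (H j i l + H j l i) else H i j l
     else if j = k then
       if c then H i j l + H i l j - H j l i - H l j i else H i j l + H i l j
     else 0)"

text \<open>For two edges with a common vertex, \<open>pair_rel\<close> vanishes in at least one of
  the two orders; the difference makes the relator antisymmetric. The parameter \<open>H\<close>
  allows the quadratic and cubic parts of the hexagons to be treated separately.\<close>

definition edge_rel_of :: "(nat \<Rightarrow> nat \<Rightarrow> nat \<Rightarrow> 'r) \<Rightarrow> (edge \<Rightarrow> 'r :: ring_1) \<Rightarrow> edge \<Rightarrow> edge \<Rightarrow> 'r" where
  "edge_rel_of H z e f =
     (if disjoint_edges e f then br (z e) (z f) else pair_rel H e f - pair_rel H f e)"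

abbreviation edge_rel :: "(edge \<Rightarrow> 'r :: ring_1) \<Rightarrow> edge \<Rightarrow> edge \<Rightarrow> 'r" where
  "edge_rel z \<equiv> edge_rel_of (hexagon z) z"

definition jac :: "(edge \<Rightarrow> 'r :: ring_1) \<Rightarrow> edge \<Rightarrow> edge \<Rightarrow> edge \<Rightarrow> 'r" where
  "jac z e f g = br (z e) (edge_rel z f g) + br (z f) (edge_rel z g e) + br (z g) (edge_rel z e f)"

text \<open>The cubic part of the relation among relations that comes from the boundary of the
  three-dimensional permutohedron.\<close>

definition pi_rel :: "(edge \<Rightarrow> 'r :: ring_1) \<Rightarrow> nat \<Rightarrow> nat \<Rightarrow> nat \<Rightarrow> nat \<Rightarrow> 'r" where
  "pi_rel z i j k l = (let x = xl z; H = hexagon z in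
     br (x i j + x i k - x j l - x k l) (br (x i l) (x j k)) - br (x i l + x j l + x k l) (H i j k) +
     br (x i k + x j k - x k l) (H i j l) + br (x j k - x i j - x i l - x k l) (br (x i k) (x j l)) +
     br (x i k + x i l + x j k + x j l) (br (x i j) (x k l)) + br (x j k + x j l - x i j) (H i k l) -
     br (x i j + x i k + x i l) (H j k l))"

lemma blue_eq_xl: "i < j \<Longrightarrow> z (False, i, j) = xl z i j"
  and red_eq_xl: "i < j \<Longrightarrow> z (True, i, j) = xl z i j + xl z j i"
  by (simp_all add: xl_def)

lemma br_xl_swap:
  assumes "i < j" "j < k" "k < l"
  shows "br (xl z k l) (xl z i j) = - br (xl z i j) (xl z k l)" "br (xl z l k) (xl z i j) = - br (xl z i j) (xl z l k)"
    "br (xl z k l) (xl z j i) = - br (xl z j i) (xl z k l)" "br (xl z l k) (xl z j i) = - br (xl z j i) (xl z l k)"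
    "br (xl z j l) (xl z i k) = - br (xl z i k) (xl z j l)" "br (xl z l j) (xl z i k) = - br (xl z i k) (xl z l j)"
    "br (xl z j l) (xl z k i) = - br (xl z k i) (xl z j l)" "br (xl z l j) (xl z k i) = - br (xl z k i) (xl z l j)"
    "br (xl z j k) (xl z i l) = - br (xl z i l) (xl z j k)" "br (xl z k j) (xl z i l) = - br (xl z i l) (xl z k j)"
    "br (xl z j k) (xl z l i) = - br (xl z l i) (xl z j k)" "br (xl z k j) (xl z l i) = - br (xl z l i) (xl z k j)"
  by (rule br_swap)+

lemmas jac_simps = jac_def pi_rel_def Let_def edge_rel_of_def pair_rel_def blue_eq_xl red_eq_xl br_linear br_xl_swap

abbreviation bl :: "nat \<Rightarrow> nat \<Rightarrow> edge" where "bl i j \<equiv> (False, i, j)"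
abbreviation rd :: "nat \<Rightarrow> nat \<Rightarrow> edge" where "rd i j \<equiv> (True, i, j)"
abbreviation rel_br :: "(edge \<Rightarrow> 'r :: ring_1) \<Rightarrow> edge \<Rightarrow> edge \<Rightarrow> edge \<Rightarrow> 'r" where
  "rel_br z e f g \<equiv> br (z e) (edge_rel z f g)"

text \<open>Jacobi sums of three pairwise compatible edges that span a tree on the vertices
  \<open>i < j < k < l\<close>, as combinations of permutohedron relations and of brackets of higher level. The
  coefficients were found by linear algebra. In the names, \<open>r\<close> and \<open>t\<close> mark blue and
  red edges, and the vertices are numbered from 1 to 4.\<close>

lemma jacobi_r12r13r14:
  "i < j \<Longrightarrow> j < k \<Longrightarrow> k < l \<Longrightarrow> jac z (bl i j) (bl i k) (bl i l) =
    rel_br z (bl i j) (bl i l) (bl j k) + rel_br z (bl i k) (bl i j) (bl k l)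
    + rel_br z (bl i k) (bl i l) (bl j k) + rel_br z (bl i l) (bl i j) (bl k l)
    + rel_br z (bl j k) (bl i j) (bl i l) + rel_br z (bl j k) (bl i j) (bl k l)
    + rel_br z (bl j k) (bl i k) (bl i l) + rel_br z (bl j k) (bl i k) (bl j l)
    + rel_br z (bl j l) (bl i j) (bl k l) + rel_br z (bl j l) (bl i k) (bl i l) - pi_rel z i j k l
    - rel_br z (bl i j) (bl i k) (bl j l) - rel_br z (bl i j) (bl j k) (bl j l)
    - rel_br z (bl i k) (bl j k) (bl j l) - rel_br z (bl i l) (bl i k) (bl j l)
    - rel_br z (bl i l) (bl j k) (bl j l) - rel_br z (bl j l) (bl i j) (bl i k)
    - rel_br z (bl j l) (bl i l) (bl j k) - rel_br z (bl k l) (bl i j) (bl i k)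
    - rel_br z (bl k l) (bl i j) (bl i l) - rel_br z (bl k l) (bl i k) (bl j l)
    - rel_br z (bl k l) (bl i l) (bl j k)"
  by (simp add: jac_simps)

lemma jacobi_r12r13t14:
  "i < j \<Longrightarrow> j < k \<Longrightarrow> k < l \<Longrightarrow> jac z (bl i j) (bl i k) (rd i l) =
    rel_br z (bl i j) (rd i l) (bl j k) + rel_br z (bl i k) (rd i l) (bl j k)
    + rel_br z (bl j k) (bl i j) (rd i l) + rel_br z (bl j k) (bl i k) (rd i l)
    + rel_br z (bl j l) (bl i k) (rd i l) + rel_br z (rd i j) (bl i k) (rd i l)
    + rel_br z (rd i l) (bl i j) (bl k l) + rel_br z (rd i l) (bl i j) (rd i k)
    + rel_br z (rd i l) (rd i j) (bl i k) + rel_br z (rd i l) (rd i k) (bl j l) - pi_rel z j k i l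
    - pi_rel z j k l i - rel_br z (bl j l) (rd i l) (bl j k) - rel_br z (bl k l) (bl i j) (rd i l)
    - rel_br z (bl k l) (rd i l) (bl j k) - rel_br z (rd i j) (rd i l) (bl j k)
    - rel_br z (rd i k) (bl i j) (rd i l) - rel_br z (rd i k) (rd i l) (bl j k)
    - rel_br z (rd i l) (bl i k) (bl j l) - rel_br z (rd i l) (bl j k) (bl j l)
    - rel_br z (rd i l) (rd i j) (bl k l)"
  by (simp add: jac_simps)

lemma jacobi_r12r13t24:
  "i < j \<Longrightarrow> j < k \<Longrightarrow> k < l \<Longrightarrow> jac z (bl i j) (bl i k) (rd j l) =
    pi_rel z i k j l + pi_rel z i k l j + rel_br z (bl j k) (bl i j) (rd j l)
    + rel_br z (bl j k) (bl i k) (rd j l) + rel_br z (rd j l) (bl i j) (bl k l)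
    + rel_br z (rd j l) (bl i j) (rd j k) + rel_br z (rd j l) (bl i k) (bl i l)
    + rel_br z (rd j l) (bl i l) (rd j k) - rel_br z (bl i j) (bl j k) (rd j l)
    - rel_br z (bl i k) (bl j k) (rd j l) - rel_br z (bl i l) (bl i k) (rd j l)
    - rel_br z (bl i l) (bl j k) (rd j l) - rel_br z (bl k l) (bl i j) (rd j l)
    - rel_br z (bl k l) (bl i k) (rd j l) - rel_br z (rd j k) (bl i j) (rd j l)
    - rel_br z (rd j k) (bl i k) (rd j l) - rel_br z (rd j l) (bl i l) (bl j k)"
  by (simp add: jac_simps)

lemma jacobi_r12r13t34:
  "i < j \<Longrightarrow> j < k \<Longrightarrow> k < l \<Longrightarrow> jac z (bl i j) (bl i k) (rd k l) =
    rel_br z (bl i l) (bl i j) (rd k l) + rel_br z (bl j k) (bl i j) (rd k l)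
    + rel_br z (bl j k) (bl i k) (rd k l) + rel_br z (bl j l) (bl i j) (rd k l)
    + rel_br z (bl j l) (bl i k) (rd k l) - pi_rel z i j k l - pi_rel z i j l k
    - rel_br z (bl i j) (bl j k) (rd k l) - rel_br z (bl i k) (bl j k) (rd k l)
    - rel_br z (bl i l) (bl j k) (rd k l) - rel_br z (rd k l) (bl i j) (bl i l)
    - rel_br z (rd k l) (bl i k) (bl j l) - rel_br z (rd k l) (bl i l) (bl j k)"
  by (simp add: jac_simps)

lemma jacobi_r12t13r14:
  "i < j \<Longrightarrow> j < k \<Longrightarrow> k < l \<Longrightarrow> jac z (bl i j) (rd i k) (bl i l) =
    pi_rel z j i k l + pi_rel z j k i l + rel_br z (bl j k) (rd i k) (bl i l)
    + rel_br z (bl j k) (rd i k) (bl j l) + rel_br z (bl j l) (rd i k) (bl i l)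
    + rel_br z (rd i j) (rd i k) (bl i l) + rel_br z (rd i j) (rd i k) (bl j l)
    + rel_br z (rd i k) (bl i j) (bl k l) + rel_br z (rd i k) (bl i l) (bl j k)
    - rel_br z (bl i j) (rd i k) (bl j l) - rel_br z (bl i l) (rd i k) (bl j l)
    - rel_br z (bl j l) (bl i j) (rd i k) - rel_br z (bl k l) (bl i j) (rd i k)
    - rel_br z (bl k l) (rd i k) (bl j l) - rel_br z (rd i k) (bl j k) (bl j l)
    - rel_br z (rd i k) (rd i j) (bl i l) - rel_br z (rd i k) (rd i j) (bl k l)"
  by (simp add: jac_simps)

lemma jacobi_r12t13t14:
  "i < j \<Longrightarrow> j < k \<Longrightarrow> k < l \<Longrightarrow> jac z (bl i j) (rd i k) (rd i l) =
    pi_rel z i j k l + pi_rel z i j l k + pi_rel z j i k l + pi_rel z j k i l + pi_rel z j k l i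
    + rel_br z (bl i j) (rd i k) (rd k l) + rel_br z (bl j k) (rd i k) (rd i l)
    + rel_br z (bl j l) (rd i k) (rd i l) + rel_br z (rd i j) (bl i k) (rd k l)
    + rel_br z (rd i j) (bl j k) (rd k l) + rel_br z (rd i j) (rd i k) (rd i l)
    + rel_br z (rd i k) (rd i l) (bl j k) + rel_br z (rd i l) (bl j k) (rd k l)
    + rel_br z (rd i l) (rd i j) (rd k l) + rel_br z (rd k l) (bl i j) (rd i l)
    + rel_br z (rd k l) (rd i j) (bl i k) + rel_br z (rd k l) (rd i j) (bl i l)
    + rel_br z (rd k l) (rd i l) (bl j k) - pi_rel z j l i k - rel_br z (bl i k) (rd i j) (rd k l)
    - rel_br z (bl i l) (rd i j) (rd k l) - rel_br z (bl j k) (rd i j) (rd k l)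
    - rel_br z (bl j k) (rd i k) (rd k l) - rel_br z (bl j l) (rd i j) (rd k l)
    - rel_br z (bl j l) (rd i k) (rd k l) - rel_br z (rd i j) (rd i k) (rd k l)
    - rel_br z (rd i l) (bl i j) (rd k l) - rel_br z (rd i l) (rd i k) (bl j l)"
  by (simp add: jac_simps)

lemma jacobi_r12t13t24:
  "i < j \<Longrightarrow> j < k \<Longrightarrow> k < l \<Longrightarrow> jac z (bl i j) (rd i k) (rd j l) =
    pi_rel z i k j l + pi_rel z i k l j + pi_rel z k i j l + pi_rel z k i l j
    + rel_br z (bl j k) (rd i k) (rd j l) + rel_br z (rd j l) (rd i j) (rd j k)
    + rel_br z (rd j l) (rd i k) (bl i l) - rel_br z (bl i l) (rd i k) (rd j l)
    - rel_br z (bl k l) (rd i k) (rd j l) - rel_br z (rd i k) (bl j k) (rd j l)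
    - rel_br z (rd j k) (rd i k) (rd j l) - rel_br z (rd j l) (rd i j) (rd i k)"
  by (simp add: jac_simps)

lemma jacobi_r12t13t34:
  "i < j \<Longrightarrow> j < k \<Longrightarrow> k < l \<Longrightarrow> jac z (bl i j) (rd i k) (rd k l) =
    pi_rel z j i k l + pi_rel z j i l k + rel_br z (bl j k) (rd i k) (rd k l)
    + rel_br z (bl j l) (rd i k) (rd k l) + rel_br z (rd i j) (rd i k) (rd k l)
    + rel_br z (rd i l) (bl i j) (rd k l) - pi_rel z j k l i - pi_rel z j l k i
    - rel_br z (rd i k) (bl j k) (rd k l) - rel_br z (rd i k) (rd i j) (rd k l)
    - rel_br z (rd i l) (bl j k) (rd k l) - rel_br z (rd i l) (rd i j) (rd k l)
    - rel_br z (rd k l) (bl i j) (rd i l) - rel_br z (rd k l) (rd i k) (bl j l)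
    - rel_br z (rd k l) (rd i l) (bl j k)"
  by (simp add: jac_simps)

lemma jacobi_r12r14t23:
  "i < j \<Longrightarrow> j < k \<Longrightarrow> k < l \<Longrightarrow> jac z (bl i j) (bl i l) (rd j k) =
    pi_rel z i j k l + pi_rel z i k j l + rel_br z (bl i j) (rd j k) (bl j l)
    + rel_br z (bl i k) (rd j k) (bl j l) + rel_br z (bl i l) (rd j k) (bl j l)
    + rel_br z (bl j l) (bl i j) (rd j k) + rel_br z (bl j l) (bl i l) (rd j k)
    + rel_br z (bl k l) (bl i j) (rd j k) + rel_br z (bl k l) (bl i l) (rd j k)
    - rel_br z (bl i k) (bl i l) (rd j k) - rel_br z (rd j k) (bl i j) (bl k l)
    - rel_br z (rd j k) (bl i k) (bl i l) - rel_br z (rd j k) (bl i k) (bl j l)"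
  by (simp add: jac_simps)

lemma jacobi_r12t14t23:
  "i < j \<Longrightarrow> j < k \<Longrightarrow> k < l \<Longrightarrow> jac z (bl i j) (rd i l) (rd j k) =
    pi_rel z j k i l + pi_rel z j k l i + pi_rel z k j i l + pi_rel z k j l i
    + rel_br z (bl j l) (rd i l) (rd j k) + rel_br z (bl k l) (rd i l) (rd j k)
    + rel_br z (rd i j) (rd i l) (rd j k) + rel_br z (rd i k) (rd i l) (rd j k)
    + rel_br z (rd i l) (rd j k) (bl j l) - rel_br z (bl i k) (rd i l) (rd j k)
    - rel_br z (rd i l) (rd i j) (rd j k) - rel_br z (rd j k) (bl i k) (rd i l)"
  by (simp add: jac_simps)

lemma jacobi_r12t23t24:
  "i < j \<Longrightarrow> j < k \<Longrightarrow> k < l \<Longrightarrow> jac z (bl i j) (rd j k) (rd j l) =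
    pi_rel z i j l k + pi_rel z i l j k + rel_br z (bl i j) (rd j k) (rd k l)
    + rel_br z (bl i k) (rd j k) (rd k l) + rel_br z (bl i l) (rd j k) (rd k l)
    + rel_br z (rd j k) (bl i k) (rd j l) + rel_br z (rd k l) (bl i j) (rd j l)
    + rel_br z (rd k l) (bl i k) (rd j l) - pi_rel z i k j l - pi_rel z i k l j
    - rel_br z (bl i k) (rd j k) (rd j l) - rel_br z (bl i l) (rd j k) (rd j l)
    - rel_br z (rd j l) (bl i j) (rd k l) - rel_br z (rd j l) (bl i k) (rd k l)
    - rel_br z (rd j l) (bl i l) (rd j k)"
  by (simp add: jac_simps)

lemma jacobi_r12t23t34:
  "i < j \<Longrightarrow> j < k \<Longrightarrow> k < l \<Longrightarrow> jac z (bl i j) (rd j k) (rd k l) =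
    pi_rel z i k l j + pi_rel z i l k j + rel_br z (rd j k) (bl i k) (rd k l)
    + rel_br z (rd j l) (bl i j) (rd k l) + rel_br z (rd j l) (bl i k) (rd k l) - pi_rel z i j k l
    - pi_rel z i j l k - rel_br z (bl i k) (rd j k) (rd k l) - rel_br z (bl i l) (rd j k) (rd k l)
    - rel_br z (rd k l) (bl i j) (rd j l) - rel_br z (rd k l) (bl i k) (rd j l)
    - rel_br z (rd k l) (bl i l) (rd j k)"
  by (simp add: jac_simps)

lemma jacobi_t12r13r14:
  "i < j \<Longrightarrow> j < k \<Longrightarrow> k < l \<Longrightarrow> jac z (rd i j) (bl i k) (bl i l) =
    rel_br z (bl i k) (rd i j) (bl k l) + rel_br z (bl i l) (rd i j) (bl k l)
    + rel_br z (bl j k) (rd i j) (bl i l) + rel_br z (bl j k) (rd i j) (bl k l)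
    + rel_br z (bl j l) (rd i j) (bl k l) + rel_br z (rd i j) (bl i l) (bl j k) - pi_rel z i j k l
    - pi_rel z j i k l - rel_br z (bl j l) (rd i j) (bl i k) - rel_br z (bl k l) (rd i j) (bl i k)
    - rel_br z (bl k l) (rd i j) (bl i l) - rel_br z (rd i j) (bl i k) (bl j l)
    - rel_br z (rd i j) (bl j k) (bl j l)"
  by (simp add: jac_simps)

lemma jacobi_t12r13t14:
  "i < j \<Longrightarrow> j < k \<Longrightarrow> k < l \<Longrightarrow> jac z (rd i j) (bl i k) (rd i l) =
    pi_rel z j k i l + pi_rel z j k l i + pi_rel z k l i j + rel_br z (bl i j) (rd i k) (rd j l)
    + rel_br z (bl i l) (rd i k) (rd j l) + rel_br z (bl j k) (rd i j) (rd i l)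
    + rel_br z (bl j l) (rd i l) (rd j k) + rel_br z (bl k l) (rd i j) (rd j l)
    + rel_br z (bl k l) (rd i k) (rd j l) + rel_br z (bl k l) (rd i l) (rd j k)
    + rel_br z (rd i j) (rd i l) (bl j k) + rel_br z (rd i k) (bl j k) (rd j l)
    + rel_br z (rd i k) (rd i j) (rd j l) + rel_br z (rd i k) (rd i l) (rd j k)
    + rel_br z (rd i l) (bl i j) (rd j k) + rel_br z (rd i l) (bl i k) (rd j l)
    + rel_br z (rd i l) (bl j k) (rd j l) + rel_br z (rd i l) (rd i j) (bl k l)
    + rel_br z (rd i l) (rd i j) (rd i k) + rel_br z (rd i l) (rd j k) (bl j l)
    + rel_br z (rd j k) (rd i j) (rd j l) + rel_br z (rd j k) (rd i k) (rd j l)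
    + rel_br z (rd j l) (bl i j) (rd i k) + rel_br z (rd j l) (rd i j) (rd i k)
    + rel_br z (rd j l) (rd i l) (bl j k) - pi_rel z i k j l - pi_rel z i k l j - pi_rel z k i j l
    - rel_br z (bl i j) (rd i l) (rd j k) - rel_br z (bl i k) (rd i j) (rd j l)
    - rel_br z (bl i k) (rd i l) (rd j k) - rel_br z (bl j k) (rd i j) (rd j l)
    - rel_br z (bl j k) (rd i k) (rd j l) - rel_br z (bl k l) (rd i j) (rd i l)
    - rel_br z (rd i k) (bl i j) (rd j l) - rel_br z (rd i k) (rd i j) (rd i l)
    - rel_br z (rd i l) (rd i j) (rd j k) - rel_br z (rd i l) (rd i k) (rd j l)
    - rel_br z (rd j k) (bl i j) (rd i l) - rel_br z (rd j k) (bl i k) (rd i l)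
    - rel_br z (rd j k) (rd i j) (rd i l) - rel_br z (rd j l) (bl i k) (rd i l)
    - rel_br z (rd j l) (rd i j) (rd j k) - rel_br z (rd j l) (rd i k) (bl i l)
    - rel_br z (rd j l) (rd i l) (rd j k)"
  by (simp add: jac_simps)

lemma jacobi_t12r13t24:
  "i < j \<Longrightarrow> j < k \<Longrightarrow> k < l \<Longrightarrow> jac z (rd i j) (bl i k) (rd j l) =
    pi_rel z k j l i + pi_rel z k l j i + rel_br z (bl j k) (rd i j) (rd j l)
    + rel_br z (rd i j) (rd i k) (rd j l) + rel_br z (rd i l) (rd i k) (rd j l)
    + rel_br z (rd j l) (bl i k) (rd i l) + rel_br z (rd j l) (rd i j) (bl k l)
    + rel_br z (rd j l) (rd i j) (rd i k) + rel_br z (rd j l) (rd i l) (rd j k) - pi_rel z k i j l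
    - pi_rel z k i l j - rel_br z (bl k l) (rd i j) (rd j l) - rel_br z (rd i j) (bl j k) (rd j l)
    - rel_br z (rd i k) (rd i j) (rd j l) - rel_br z (rd i l) (bl i k) (rd j l)
    - rel_br z (rd i l) (bl j k) (rd j l) - rel_br z (rd j k) (rd i j) (rd j l)
    - rel_br z (rd j l) (rd i l) (bl j k)"
  by (simp add: jac_simps)

lemma jacobi_t12r13t34:
  "i < j \<Longrightarrow> j < k \<Longrightarrow> k < l \<Longrightarrow> jac z (rd i j) (bl i k) (rd k l) =
    rel_br z (bl i l) (rd i j) (rd k l) + rel_br z (bl j k) (rd i j) (rd k l)
    + rel_br z (bl j l) (rd i j) (rd k l) - pi_rel z i j k l - pi_rel z i j l k - pi_rel z j i k l
    - pi_rel z j i l k - rel_br z (rd i j) (bl j k) (rd k l) - rel_br z (rd k l) (rd i j) (bl i l)"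
  by (simp add: jac_simps)

lemma jacobi_t12t13r14:
  "i < j \<Longrightarrow> j < k \<Longrightarrow> k < l \<Longrightarrow> jac z (rd i j) (rd i k) (bl i l) =
    pi_rel z i k j l + pi_rel z k i j l + rel_br z (bl i l) (rd i j) (rd j k)
    + rel_br z (bl j l) (rd i j) (rd j k) + rel_br z (bl k l) (rd i j) (rd j k)
    + rel_br z (rd i k) (rd i j) (bl k l) + rel_br z (rd i k) (rd j k) (bl j l) - pi_rel z j i k l
    - pi_rel z j k i l - rel_br z (bl j l) (rd i j) (rd i k) - rel_br z (bl k l) (rd i j) (rd i k)
    - rel_br z (rd i j) (rd i k) (bl j l) - rel_br z (rd i k) (bl i l) (rd j k)
    - rel_br z (rd j k) (rd i k) (bl i l) - rel_br z (rd j k) (rd i k) (bl j l)"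
  by (simp add: jac_simps)

lemma jacobi_t12t13t14:
  "i < j \<Longrightarrow> j < k \<Longrightarrow> k < l \<Longrightarrow> jac z (rd i j) (rd i k) (rd i l) =
    pi_rel z j i l k + pi_rel z j l i k + pi_rel z k j i l + pi_rel z k j l i
    + rel_br z (rd i j) (rd i k) (rd k l) + rel_br z (rd i j) (rd i l) (rd j k)
    + rel_br z (rd i l) (rd i k) (rd j l) + rel_br z (rd i l) (rd j k) (rd j l)
    + rel_br z (rd j k) (rd i j) (rd i l) + rel_br z (rd j l) (rd i k) (rd k l)
    + rel_br z (rd j l) (rd i l) (rd j k) + rel_br z (rd k l) (rd i j) (rd i l) - pi_rel z i l j k
    - pi_rel z k i l j - pi_rel z k l i j - pi_rel z l i j k - rel_br z (rd i k) (rd i j) (rd j l)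
    - rel_br z (rd i l) (rd i j) (rd k l) - rel_br z (rd i l) (rd j k) (rd k l)
    - rel_br z (rd j k) (rd i j) (rd j l) - rel_br z (rd j l) (rd i k) (rd i l)
    - rel_br z (rd k l) (rd i j) (rd j l)"
  by (simp add: jac_simps)

lemma jacobi_t12t13t24:
  "i < j \<Longrightarrow> j < k \<Longrightarrow> k < l \<Longrightarrow> jac z (rd i j) (rd i k) (rd j l) =
    pi_rel z i j l k + pi_rel z i l j k + pi_rel z k i j l + pi_rel z k i l j
    + rel_br z (rd i j) (rd j k) (rd k l) + rel_br z (rd i l) (rd j k) (rd k l)
    + rel_br z (rd j k) (rd i j) (rd j l) + rel_br z (rd j l) (rd i k) (rd i l)
    + rel_br z (rd k l) (rd i j) (rd j l) - pi_rel z j l i k - pi_rel z k j l i - pi_rel z k l j i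
    - pi_rel z l j i k - rel_br z (rd i j) (rd j k) (rd j l) - rel_br z (rd i l) (rd i k) (rd j l)
    - rel_br z (rd i l) (rd j k) (rd j l) - rel_br z (rd j l) (rd i j) (rd k l)
    - rel_br z (rd j l) (rd i k) (rd k l) - rel_br z (rd j l) (rd i l) (rd j k)"
  by (simp add: jac_simps)

lemma jacobi_t12t13t34:
  "i < j \<Longrightarrow> j < k \<Longrightarrow> k < l \<Longrightarrow> jac z (rd i j) (rd i k) (rd k l) =
    pi_rel z j k l i + pi_rel z j l k i + pi_rel z k l i j + pi_rel z l k i j
    + rel_br z (rd i k) (rd j k) (rd k l) + rel_br z (rd i l) (rd i j) (rd k l)
    + rel_br z (rd i l) (rd j k) (rd k l) + rel_br z (rd k l) (rd i j) (rd j k)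
    + rel_br z (rd k l) (rd i j) (rd j l) + rel_br z (rd k l) (rd i k) (rd j l)
    + rel_br z (rd k l) (rd i l) (rd j k) - pi_rel z i k l j - pi_rel z i l k j - pi_rel z j i k l
    - pi_rel z j i l k - rel_br z (rd j k) (rd i k) (rd k l) - rel_br z (rd j l) (rd i k) (rd k l)
    - rel_br z (rd k l) (rd i j) (rd i l)"
  by (simp add: jac_simps)

lemma jacobi_t12r14t23:
  "i < j \<Longrightarrow> j < k \<Longrightarrow> k < l \<Longrightarrow> jac z (rd i j) (bl i l) (rd j k) =
    pi_rel z i j k l + pi_rel z i k j l + rel_br z (bl j l) (rd i j) (rd j k)
    + rel_br z (bl k l) (rd i j) (rd j k) + rel_br z (rd i j) (rd j k) (bl j l)
    + rel_br z (rd i k) (rd j k) (bl j l) - pi_rel z j k i l - pi_rel z k j i l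
    - rel_br z (rd i k) (bl i l) (rd j k) - rel_br z (rd j k) (rd i j) (bl k l)
    - rel_br z (rd j k) (rd i k) (bl i l) - rel_br z (rd j k) (rd i k) (bl j l)"
  by (simp add: jac_simps)

lemma jacobi_t12t14t23:
  "i < j \<Longrightarrow> j < k \<Longrightarrow> k < l \<Longrightarrow> jac z (rd i j) (rd i l) (rd j k) =
    pi_rel z i l j k + pi_rel z i l k j + pi_rel z l i j k + pi_rel z l i k j
    + rel_br z (rd j k) (rd i j) (rd j l) + rel_br z (rd j k) (rd i k) (rd k l) - pi_rel z j k i l
    - pi_rel z j k l i - pi_rel z k j i l - pi_rel z k j l i - rel_br z (rd i k) (rd i l) (rd j k)
    - rel_br z (rd i l) (rd j k) (rd j l) - rel_br z (rd j k) (rd i k) (rd i l)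
    - rel_br z (rd j l) (rd i l) (rd j k) - rel_br z (rd k l) (rd i l) (rd j k)"
  by (simp add: jac_simps)

lemma jacobi_t12t23t24:
  "i < j \<Longrightarrow> j < k \<Longrightarrow> k < l \<Longrightarrow> jac z (rd i j) (rd j k) (rd j l) =
    pi_rel z i j l k + pi_rel z i l j k + pi_rel z j l k i + pi_rel z l j k i
    + rel_br z (rd i j) (rd j k) (rd k l) + rel_br z (rd i k) (rd j k) (rd k l)
    + rel_br z (rd i l) (rd j k) (rd k l) + rel_br z (rd j k) (rd i k) (rd j l)
    + rel_br z (rd k l) (rd i j) (rd j l) + rel_br z (rd k l) (rd i k) (rd j l) - pi_rel z i k j l
    - pi_rel z i k l j - pi_rel z k j l i - pi_rel z k l j i - rel_br z (rd i k) (rd j k) (rd j l)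
    - rel_br z (rd i l) (rd j k) (rd j l) - rel_br z (rd j l) (rd i j) (rd k l)
    - rel_br z (rd j l) (rd i k) (rd k l) - rel_br z (rd j l) (rd i l) (rd j k)"
  by (simp add: jac_simps)

lemma jacobi_t12t23t34:
  "i < j \<Longrightarrow> j < k \<Longrightarrow> k < l \<Longrightarrow> jac z (rd i j) (rd j k) (rd k l) =
    pi_rel z i k l j + pi_rel z i l k j + pi_rel z k l j i + pi_rel z l k j i
    + rel_br z (rd j k) (rd i k) (rd k l) + rel_br z (rd j l) (rd i j) (rd k l)
    + rel_br z (rd j l) (rd i k) (rd k l) - pi_rel z i j k l - pi_rel z i j l k - pi_rel z j k l i
    - pi_rel z j l k i - rel_br z (rd i k) (rd j k) (rd k l) - rel_br z (rd i l) (rd j k) (rd k l)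
    - rel_br z (rd k l) (rd i j) (rd j l) - rel_br z (rd k l) (rd i k) (rd j l)
    - rel_br z (rd k l) (rd i l) (rd j k)"
  by (simp add: jac_simps)

declare One_nat_def [simp del]

definition edges :: "nat \<Rightarrow> bool set \<Rightarrow> edge set" where
  "edges n C = {(c, i, j). 1 \<le> i \<and> i < j \<and> j \<le> n \<and> (c \<longrightarrow> True \<in> C)}"

text \<open>Among pairs of edges that meet, two kinds are excluded: those with a common target, and
  those in which a blue edge starts at the target of the other edge.\<close>

definition compatible :: "edge \<Rightarrow> edge \<Rightarrow> bool" where
  "compatible e f \<longleftrightarrow> (case (e, f) of ((c, i, j), (d, k, l)) \<Rightarrow>
     disjoint_edges e f \<or> (i = k \<and> j \<noteq> l) \<or> (j = k \<and> d) \<or> (l = i \<and> c))"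

definition compatible_on :: "nat \<Rightarrow> bool set \<Rightarrow> edge \<Rightarrow> edge \<Rightarrow> bool" where
  "compatible_on n C e f \<longleftrightarrow> e \<in> edges n C \<and> f \<in> edges n C \<and> compatible e f"

definition vertices :: "edge \<Rightarrow> nat set" where
  "vertices e = {fst (snd e), snd (snd e)}"

lemma vertices_simp [simp]: "vertices (c, i, j) = {i, j}"
  by (simp add: vertices_def)

lemma edges_iff [simp]: "(c, i, j) \<in> edges n C \<longleftrightarrow> 1 \<le> i \<and> i < j \<and> j \<le> n \<and> (c \<longrightarrow> True \<in> C)"
  by (simp add: edges_def)

lemma compatible_on_iff [simp]:
  "compatible_on n C (c, i, j) (d, k, l) \<longleftrightarrow>
    1 \<le> i \<and> i < j \<and> j \<le> n \<and> (c \<longrightarrow> True \<in> C) \<and> 1 \<le> k \<and> k < l \<and> l \<le> n \<and> (d \<longrightarrow> True \<in> C) \<and>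
    (i \<noteq> k \<and> i \<noteq> l \<and> j \<noteq> k \<and> j \<noteq> l \<or> (i = k \<and> j \<noteq> l) \<or> (j = k \<and> d) \<or> (l = i \<and> c))"
  by (auto simp: compatible_on_def compatible_def)

lemma edge_rel_of_swap: "edge_rel_of H z f e = - edge_rel_of H z e f"
  by (auto simp: edge_rel_of_def disjoint_edges_def br_swap[of "z e"])

text \<open>The quadratic part of a relator, solved for the leading commutator.\<close>

definition lower_terms :: "(edge \<Rightarrow> 'r :: ring_1) \<Rightarrow> edge \<Rightarrow> edge \<Rightarrow> 'r" where
  "lower_terms z = (\<lambda>(c, i, j) (d, k, l).
     if i = k then
       if c then if d then br (z (True, i, j)) (z (True, j, l)) else br (z (True, i, j)) (z (False, j, l))
       else if d then - br (z (True, i, j)) (z (True, i, l)) - br (z (False, j, l)) (z (True, i, l))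
       else br (z (False, i, j)) (z (False, j, l)) + br (z (False, i, l)) (z (False, j, l))
     else br (z (c, i, l)) (z (True, j, l)))"

lemma edge_rel_of_oriented:
  assumes "i < j" "k < l" "i = k \<and> j < l \<or> j = k \<and> d"
  shows "edge_rel_of H z (c, i, j) (d, k, l) = pair_rel H (c, i, j) (d, k, l)"
  using assms by (auto simp: edge_rel_of_def pair_rel_def)

lemma pair_rel_hexagon2:
  assumes "i < j" "k < l" "i = k \<and> j < l \<or> j = k \<and> d"
  shows "pair_rel (hexagon2 z) (c, i, j) (d, k, l) =
    br (z (c, i, j)) (z (d, k, l)) + lower_terms z (c, i, j) (d, k, l)"
  using assms
  by (auto simp: pair_rel_def hexagon2_def lower_terms_def xl_def br_linear br_def algebra_simps)

lemma pair_rel_hexagon: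
  "pair_rel (hexagon z) e f = pair_rel (hexagon2 z) e f + pair_rel (hexagon3 z) e f"
  by (simp add: pair_rel_def hexagon_split algebra_simps split: prod.splits)

text \<open>The combinations in \<open>pair_rel\<close> form a triangular system in the six hexagons
  of a triple. Solving it shows that every triangle relator lies in the ideal generated by the edge
  relators.\<close>

lemma hexagon_of_edge_rels:
  assumes "i < j" "j < k"
  shows "hexagon z i j k = edge_rel z (False, i, j) (False, i, k)"
    "hexagon z i k j = edge_rel z (False, i, j) (True, j, k) - hexagon z i j k"
    "hexagon z j i k = edge_rel z (True, i, j) (False, i, k) - hexagon z i j k"
    "hexagon z j k i = - edge_rel z (False, i, j) (True, i, k) - hexagon z j i k"
    "hexagon z k j i = hexagon z i j k + hexagon z i k j - hexagon z j k i - edge_rel z (True, i, j) (True, j, k)"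
    "hexagon z k i j = hexagon z i j k + hexagon z j i k - hexagon z k j i - edge_rel z (True, i, j) (True, i, k)"
  using assms by (simp_all add: edge_rel_of_def pair_rel_def)

text \<open>Both sides telescope to \<open>a * b * c * d * e * f - f * e * d * c * b * a\<close>.
  They follow two paths from a word to its reverse, each with four triangle moves and three
  commutations; together the moves are the fourteen faces of the permutohedron.\<close>

lemma permutohedron:
  fixes a b c d e f :: "'r :: ring_1"
  shows "a * b * (c * d - d * c) * e * f + (a * b * d - d * b * a) * c * e * f + d * b * (a * c * e - e * c * a) * f
    + d * (b * e - e * b) * c * a * f + d * e * b * c * (a * f - f * a) + d * e * (b * c * f - f * c * b) * a
    + (d * e * f - f * e * d) * c * b * a
    = a * b * c * (d * e * f - f * e * d) + a * (b * c * f - f * c * b) * e * d + (a * f - f * a) * c * b * e * d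
    + f * a * c * (b * e - e * b) * d + f * (a * c * e - e * c * a) * b * d + f * e * c * (a * b * d - d * b * a)
    + f * e * (c * d - d * c) * b * a"
  by (simp add: algebra_simps)

text \<open>The constants make levels of up to three letters compare lexicographically: by the
  number of letters, then of red edges, then the sum of sources, then the sum of targets. The
  factors 3 reflect that Jacobi sums involve three edges.\<close>

locale edge_levels =
  fixes n K R N p :: nat and C :: "bool set"
  assumes K: "K > 3 * n" and R: "R > 3 * (K * n + n)" and N: "N > 3 * (R + K * n + n)"
begin

definition lev :: "edge \<Rightarrow> nat" where
  "lev = (\<lambda>(c, i, j). N + (if c then R else 0) + K * i + j)"

abbreviation "E \<equiv> compatible_on n C"

abbreviation "rho \<equiv> edge_rel (\<lambda>e. mon [e])"

abbreviation "J \<equiv> relator_ideal E (\<lambda>_. 1) lev p rho"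

lemma lev_simp [simp]: "lev (c, i, j) = N + (if c then R else 0) + K * i + j"
  by (simp add: lev_def)

lemma K_mono: "i < j \<Longrightarrow> K * i + K \<le> K * j"
  by (metis Suc_leI mult_Suc_right add.commute mult_le_mono2)

text \<open>Besides the level, the vertices are recorded, so that an edge avoiding \<open>V\<close>
  commutes with every letter that occurs. The bound on the length supplies the degree condition for
  tails.\<close>

definition spread :: "nat \<Rightarrow> nat set \<Rightarrow> edge free_algebra set" where
  "spread s V = {f. \<forall>w\<in>keys f. weight lev w \<ge> s \<and> length w \<ge> 2 \<and> (\<forall>x\<in>set w. x \<in> edges n C \<and> vertices x \<subseteq> V)}"

lemma spread_subspace: "fa.subspace (spread s V)"
  unfolding spread_def by (rule subspace_keys)

lemmas spread_add = fa.subspace_add[OF spread_subspace] and spread_diff = fa.subspace_diff[OF spread_subspace]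
  and spread_neg = fa.subspace_neg[OF spread_subspace] and spread_0 = fa.subspace_0[OF spread_subspace]

lemma keys_xl:
  assumes "a \<noteq> b" "True \<in> C \<or> a < b" "1 \<le> a" "a \<le> n" "1 \<le> b" "b \<le> n" "w \<in> keys (xl (\<lambda>e. mon [e]) a b)"
  shows "\<exists>x. w = [x] \<and> x \<in> edges n C \<and> vertices x \<subseteq> {a, b} \<and> lev x \<ge> N"
proof (cases "a < b")
  case True
  then show ?thesis using assms by (simp add: xl_def)
next
  case False
  then have "w \<in> {[(True, b, a)], [(False, b, a)]}"
    using assms(7) keys_diff_subset[of "mon [(True, b, a)]" "mon [(False, b, a)]"] by (auto simp: xl_def)
  then show ?thesis using assms False by auto
qed

lemma lev_le: "x \<in> edges n C \<Longrightarrow> lev x \<le> N + R + K * n + n"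
proof -
  assume "x \<in> edges n C"
  then obtain c i j where x: "x = (c, i, j)" "i < j" "j \<le> n" by (cases x) auto
  then have "K * i \<le> K * n" by simp
  then have "K * i + j \<le> K * n + n" using x(3) by (rule add_mono)
  then show ?thesis by (cases c) (simp_all add: x(1))
qed

lemma hexagon3_spread:
  assumes abc: "distinct [a, b, c]" "{a, b, c} \<subseteq> {1..n}" "True \<in> C \<or> a < b \<and> b < c" and V: "{a, b, c} \<subseteq> V"
    and s: "s \<le> 3 * N"
  shows "hexagon3 (\<lambda>e. mon [e]) a b c \<in> spread s V"
proof -
  let ?x = "xl (\<lambda>e. mon [e])"
  have m: "?x a' b' * ?x a'' b'' * ?x c' d' \<in> spread s V"
    if uv: "\<And>u v. (u, v) \<in> {(a', b'), (a'', b''), (c', d')} \<Longrightarrow> u \<noteq> v \<and> (True \<in> C \<or> u < v) \<and> {u, v} \<subseteq> {1..n} \<and> {u, v} \<subseteq> V"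
    for a' b' a'' b'' c' d'
    unfolding spread_def
  proof (intro CollectI ballI)
    fix w assume "w \<in> keys (?x a' b' * ?x a'' b'' * ?x c' d')"
    then obtain w' w3 where w': "w = w' @ w3" "w' \<in> keys (?x a' b' * ?x a'' b'')" "w3 \<in> keys (?x c' d')"
      using subsetD[OF keys_mult_mon] by blast
    obtain w1 w2 where "w' = w1 @ w2" "w1 \<in> keys (?x a' b')" "w2 \<in> keys (?x a'' b'')"
      using subsetD[OF keys_mult_mon w'(2)] by blast
    note w = w'(1)[unfolded this(1)] this(2,3) w'(3)
    obtain x1 where "w1 = [x1]" "x1 \<in> edges n C" "vertices x1 \<subseteq> {a', b'}" "lev x1 \<ge> N"
      using keys_xl[where a = "a'" and b = "b'" and w = w1] w(2) uv[of "a'" "b'"] by auto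
    moreover obtain x2 where "w2 = [x2]" "x2 \<in> edges n C" "vertices x2 \<subseteq> {a'', b''}" "lev x2 \<ge> N"
      using keys_xl[where a = "a''" and b = "b''" and w = w2] w(3) uv[of "a''" "b''"] by auto
    moreover obtain x3 where "w3 = [x3]" "x3 \<in> edges n C" "vertices x3 \<subseteq> {c', d'}" "lev x3 \<ge> N"
      using keys_xl[where a = "c'" and b = "d'" and w = w3] w(4) uv[of "c'" "d'"] by auto
    ultimately show "s \<le> weight lev w \<and> 2 \<le> length w \<and> (\<forall>x\<in>set w. x \<in> edges n C \<and> vertices x \<subseteq> V)"
      using w(1) s uv[of "a'" "b'"] uv[of "a''" "b''"] uv[of "c'" "d'"] by auto
  qed
  show ?thesis unfolding hexagon3_def by (intro spread_diff m) (use abc V in auto)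
qed

lemma pair_rel_hexagon3_spread:
  assumes "(c, i, j) \<in> edges n C" "(d, k, l) \<in> edges n C" "i = k \<and> j < l \<or> j = k \<and> d"
    and V: "{i, j, l} \<subseteq> V" and s: "s \<le> 3 * N"
  shows "pair_rel (hexagon3 (\<lambda>e. mon [e])) (c, i, j) (d, k, l) \<in> spread s V"
proof -
  have l: "i < j" "j < l" using assms by auto
  have h: "hexagon3 (\<lambda>e. mon [e]) a b c \<in> spread s V"
    if "(a, b, c) = (i, j, l) \<or> True \<in> C \<and> (a, b, c) \<in> {(i, l, j), (j, i, l), (j, l, i), (l, i, j), (l, j, i)}" for a b c
    using that assms l by (intro hexagon3_spread) auto
  show ?thesis
    unfolding pair_rel_def using assms h spread_add spread_diff spread_neg spread_0 by auto
qed

text \<open>Each case gains in the lexicographic order: one more red edge, or equally many and a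
  larger sum of sources, or, for consecutive edges, the same sources and a larger sum of
  targets.\<close>

lemma lower_terms_span:
  assumes "(c, i, j) \<in> edges n C" "(d, k, l) \<in> edges n C" "i = k \<and> j < l \<or> j = k \<and> d"
  shows "lower_terms z (c, i, j) (d, k, l) \<in> fa.span {z u * z v | u v. u \<in> edges n C \<and> v \<in> edges n C \<and>
    vertices u \<union> vertices v \<subseteq> {i, j, l} \<and> lev (c, i, j) + lev (d, k, l) < lev u + lev v}"
proof -
  have l: "i < j" "j < l" "1 \<le> i" "l \<le> n" using assms by auto
  have K': "K * i + K \<le> K * j" "K * j + K \<le> K * l" "K * l \<le> K * n" using l K_mono by auto
  define B where "B = fa.span {z u * z v | u v. u \<in> edges n C \<and> v \<in> edges n C \<and>
    vertices u \<union> vertices v \<subseteq> {i, j, l} \<and> lev (c, i, j) + lev (d, k, l) < lev u + lev v}"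
  have B: "fa.subspace B" by (simp add: B_def)
  note B_add = fa.subspace_add[OF B] and B_diff = fa.subspace_diff[OF B] and B_neg = fa.subspace_neg[OF B]
  have b: "br (z (c', i', j')) (z (d', k', l')) \<in> B"
    if "(c', i', j') \<in> edges n C" "(d', k', l') \<in> edges n C" "{i', j', k', l'} \<subseteq> {i, j, l}"
      "lev (c, i, j) + lev (d, k, l) < lev (c', i', j') + lev (d', k', l')" for c' i' j' d' k' l'
  proof -
    have "z x * z y \<in> B" if "x \<in> edges n C" "y \<in> edges n C" "vertices x \<union> vertices y \<subseteq> {i, j, l}"
      "lev (c, i, j) + lev (d, k, l) < lev x + lev y" for x y
      unfolding B_def by (rule fa.span_base) (use that in blast)
    from this[of "(c', i', j')" "(d', k', l')"] this[of "(d', k', l')" "(c', i', j')"] that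
    show ?thesis unfolding br_def by (intro B_diff) auto
  qed
  consider "i = k" "c" "d" | "i = k" "c" "\<not> d" | "i = k" "\<not> c" "d" | "i = k" "\<not> c" "\<not> d" | "j = k" "d" "i \<noteq> k"
    using assms(3) by blast
  then show ?thesis
    unfolding B_def[symmetric]
    by cases (use assms l K' K R N in \<open>auto simp: lower_terms_def intro!: b B_add B_diff B_neg\<close>)
qed

lemma lower_terms_spread:
  assumes "(c, i, j) \<in> edges n C" "(d, k, l) \<in> edges n C" "i = k \<and> j < l \<or> j = k \<and> d"
    and V: "{i, j, l} \<subseteq> V"
  shows "lower_terms (\<lambda>e. mon [e]) (c, i, j) (d, k, l) \<in> spread (lev (c, i, j) + lev (d, k, l) + 1) V"
proof -
  have "{mon [u] * mon [v] | u v. u \<in> edges n C \<and> v \<in> edges n C \<and> vertices u \<union> vertices v \<subseteq> {i, j, l} \<and>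
      lev (c, i, j) + lev (d, k, l) < lev u + lev v} \<subseteq> spread (lev (c, i, j) + lev (d, k, l) + 1) V"
    using V by (fastforce simp: spread_def simp flip: mon_append)
  from fa.span_minimal[OF this spread_subspace] lower_terms_span[OF assms(1-3), of "\<lambda>e. mon [e]"]
  show ?thesis by blast
qed

lemma tail_spread_oriented:
  assumes e: "(c, i, j) \<in> edges n C" "(d, k, l) \<in> edges n C" "i = k \<and> j < l \<or> j = k \<and> d"
  shows "rho (c, i, j) (d, k, l) - br (mon [(c, i, j)]) (mon [(d, k, l)]) \<in>
    spread (lev (c, i, j) + lev (d, k, l) + 1) ({i, j} \<union> {k, l})"
proof -
  have l: "i < j" "k < l" using e by auto
  \<comment> \<open>Three letters of level at least \<open>N\<close> outweigh any two letters, which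
    places the cubic part of the hexagons above the leading commutator.\<close>
  have s: "lev (c, i, j) + lev (d, k, l) + 1 \<le> 3 * N"
    using lev_le[OF e(1)] lev_le[OF e(2)] N by (simp add: algebra_simps)
  have "rho (c, i, j) (d, k, l) - br (mon [(c, i, j)]) (mon [(d, k, l)]) =
     lower_terms (\<lambda>e. mon [e]) (c, i, j) (d, k, l) + pair_rel (hexagon3 (\<lambda>e. mon [e])) (c, i, j) (d, k, l)"
    unfolding edge_rel_of_oriented[OF l e(3)] pair_rel_hexagon pair_rel_hexagon2[OF l e(3)] by simp
  also have "\<dots> \<in> spread (lev (c, i, j) + lev (d, k, l) + 1) ({i, j} \<union> {k, l})"
    by (intro spread_add lower_terms_spread pair_rel_hexagon3_spread e s) auto
  finally show ?thesis .
qed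

lemma tail_spread:
  assumes "E e f"
  shows "rho e f - br (mon [e]) (mon [f]) \<in> spread (lev e + lev f + 1) (vertices e \<union> vertices f)"
proof -
  obtain c i j d k l where ef: "e = (c, i, j)" "f = (d, k, l)" by (cases e; cases f) auto
  consider "disjoint_edges e f" | "i = k \<and> j < l \<or> j = k \<and> d" | "k = i \<and> l < j \<or> l = i \<and> c"
    using assms unfolding ef disjoint_edges_iff compatible_on_iff by (metis linorder_neqE_nat)
  then show ?thesis
  proof cases
    case 1
    then show ?thesis by (simp add: edge_rel_of_def spread_0)
  next
    case 2
    then show ?thesis using tail_spread_oriented[of c i j d k l] assms by (simp add: ef)
  next
    case 3
    have "rho e f - br (mon [e]) (mon [f]) = - (rho f e - br (mon [f]) (mon [e]))"
      unfolding edge_rel_of_swap[of _ _ e f] br_swap[of "mon [f]" "mon [e]"] by simp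
    moreover have "rho f e - br (mon [f]) (mon [e]) \<in> spread (lev f + lev e + 1) (vertices f \<union> vertices e)"
      using tail_spread_oriented[of d k l c i j] 3 assms by (simp add: ef)
    ultimately show ?thesis using spread_neg by (simp only: add.commute[of "lev f"] Un_commute[of "vertices f"])
  qed
qed

sublocale base: relators_base E "\<lambda>_. 1" lev p rho
proof unfold_locales
  show "\<not> E x x" for x by (cases x) auto
  show "E y x" if "E x y" for x y using that by (cases x; cases y) auto
  show "rho y x = - rho x y" for x y by (rule edge_rel_of_swap)
  show "lev x + lev y < weight lev w \<and> 1 + 1 \<le> weight (\<lambda>_. 1) w"
    if "E x y" "w \<in> keys (rho x y - (mon [x, y] - mon [y, x]))" for x y w
  proof -
    have "weight (\<lambda>_. 1) w = length w" by (simp add: weight_def sum_list_triv)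
    then show ?thesis using tail_spread[OF that(1)] that(2) by (auto simp: spread_def br_def simp flip: mon_append)
  qed
qed

lemmas J_add = base.J_add and J_diff = base.J_diff and J_neg = base.J_neg and J_0 = base.J_0

lemma J_mono: "f \<in> J t \<Longrightarrow> s \<le> t \<Longrightarrow> f \<in> J s"
  using base.J_antimono by blast

lemma rho_in_J: "E e f \<Longrightarrow> lev e + lev f \<ge> s \<Longrightarrow> rho e f \<in> J s"
  using base.J_gen[of e f s "[]" "[]"] by (simp add: mon_Nil)

lemma br_rho_in_J:
  assumes "E e f" "lev g + lev e + lev f \<ge> s"
  shows "br (mon [g]) (rho e f) \<in> J s"
  unfolding br_def
  using base.J_gen[of e f s "[g]" "[]"] base.J_gen[of e f s "[]" "[g]"] assms
  by (intro J_diff) (simp_all add: mon_Nil add_ac)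

lemma lev_ge: "N \<le> lev e"
  by (cases e) simp

lemma xl_far:
  assumes "a \<noteq> b"
  shows "xl (\<lambda>e. mon [e]) a b \<in> base.far N"
proof -
  have "mon [e] \<in> base.far N" for e using lev_ge[of e] by (intro base.far_mon) simp
  then show ?thesis unfolding xl_def using fa.subspace_diff[OF base.far_subspace] by simp
qed

lemma hexagon_in_J:
  assumes abc: "distinct [a, b, c]" "{a, b, c} \<subseteq> {1..n}" "True \<in> C \<or> a < b \<and> b < c"
  shows "hexagon (\<lambda>e. mon [e]) a b c \<in> J (2 * N)"
proof -
  have r: "rho e f \<in> J (2 * N)" if "E e f" for e f
    using that lev_ge[of e] lev_ge[of f] by (intro rho_in_J) auto
  have inc: "hexagon (\<lambda>e. mon [e]) i j k \<in> J (2 * N)" if "i < j" "j < k" "1 \<le> i" "k \<le> n" for i j k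
    unfolding hexagon_of_edge_rels(1)[OF that(1,2)] using that by (intro r) auto
  show ?thesis
  proof (cases "True \<in> C")
    case False
    then show ?thesis using abc inc by auto
  next
    case True
    have all: "hexagon (\<lambda>e. mon [e]) i k j \<in> J (2 * N) \<and> hexagon (\<lambda>e. mon [e]) j i k \<in> J (2 * N) \<and>
       hexagon (\<lambda>e. mon [e]) j k i \<in> J (2 * N) \<and> hexagon (\<lambda>e. mon [e]) k j i \<in> J (2 * N) \<and>
       hexagon (\<lambda>e. mon [e]) k i j \<in> J (2 * N)" if ijk: "i < j" "j < k" "1 \<le> i" "k \<le> n" for i j k
    proof -
      note h = hexagon_of_edge_rels[OF ijk(1,2), of "\<lambda>e. mon [e]"]
      have 1: "hexagon (\<lambda>e. mon [e]) i k j \<in> J (2 * N)" unfolding h(2)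
        using ijk True by (intro J_diff r inc) auto
      have 2: "hexagon (\<lambda>e. mon [e]) j i k \<in> J (2 * N)" unfolding h(3)
        using ijk True by (intro J_diff r inc) auto
      have 3: "hexagon (\<lambda>e. mon [e]) j k i \<in> J (2 * N)" unfolding h(4)
        using ijk True by (intro J_diff J_neg r 2) auto
      have 4: "hexagon (\<lambda>e. mon [e]) k j i \<in> J (2 * N)" unfolding h(5)
        using ijk True by (intro J_diff J_add r inc 1 3) auto
      have 5: "hexagon (\<lambda>e. mon [e]) k i j \<in> J (2 * N)" unfolding h(6)
        using ijk True by (intro J_diff J_add r inc 2 4) auto
      show ?thesis using 1 2 3 4 5 by blast
    qed
    consider "a < b" "b < c" | "a < c" "c < b" | "b < a" "a < c" | "b < c" "c < a" | "c < a" "a < b" | "c < b" "b < a"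
      using abc(1) by fastforce
    then show ?thesis using inc all abc(2) by cases auto
  qed
qed

lemma square_in_J:
  assumes abcd: "distinct [a, b, c, e]" "{a, b, c, e} \<subseteq> {1..n}" "True \<in> C \<or> a < b \<and> c < e"
  shows "br (xl (\<lambda>e. mon [e]) a b) (xl (\<lambda>e. mon [e]) c e) \<in> J (2 * N)"
proof -
  have r: "br (mon [x]) (mon [y]) \<in> J (2 * N)" if "E x y" "disjoint_edges x y" for x y
  proof -
    have "rho x y \<in> J (2 * N)" using that lev_ge[of x] lev_ge[of y] by (intro rho_in_J) auto
    then show ?thesis using that by (simp add: edge_rel_of_def)
  qed
  show ?thesis
    unfolding xl_def using abcd
    by (auto simp: br_linear intro!: J_diff J_add r)
qed

section \<open>First order expansion of the permutohedron identity\<close>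

lemma prod_one_plus:
  assumes "\<And>x. x \<in> set xs \<Longrightarrow> x \<in> base.far N"
  shows "prod_list (map (\<lambda>x. 1 + x) xs) - 1 \<in> base.far N"
    "prod_list (map (\<lambda>x. 1 + x) xs) - 1 - sum_list xs \<in> base.far (2 * N)"
proof -
  note fs = fa.subspace_add[OF base.far_subspace]
  have "prod_list (map (\<lambda>x. 1 + x) xs) - 1 \<in> base.far N \<and>
    prod_list (map (\<lambda>x. 1 + x) xs) - 1 - sum_list xs \<in> base.far (2 * N)"
    using assms
  proof (induction xs)
    case Nil
    then show ?case by (simp add: fa.subspace_0[OF base.far_subspace])
  next
    case (Cons x xs)
    let ?P = "prod_list (map (\<lambda>x. 1 + x) xs)"
    have x: "x \<in> base.far N" "?P - 1 \<in> base.far N" "?P - 1 - sum_list xs \<in> base.far (2 * N)" using Cons by auto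
    have m: "x * (?P - 1) \<in> base.far (2 * N)" using base.far_mult[OF x(1,2)] by (simp add: mult_2)
    then have m': "x * (?P - 1) \<in> base.far N" by (force simp: base.far_def)
    have e1: "prod_list (map (\<lambda>x. 1 + x) (x # xs)) - 1 = x + x * (?P - 1) + (?P - 1)"
      by (simp add: algebra_simps)
    have e2: "prod_list (map (\<lambda>x. 1 + x) (x # xs)) - 1 - sum_list (x # xs) = x * (?P - 1) + (?P - 1 - sum_list xs)"
      by (simp add: algebra_simps)
    show ?case
    proof
      show "prod_list (map (\<lambda>x. 1 + x) (x # xs)) - 1 \<in> base.far N" unfolding e1 by (intro fs x m m')
      show "prod_list (map (\<lambda>x. 1 + x) (x # xs)) - 1 - sum_list (x # xs) \<in> base.far (2 * N)"
        unfolding e2 by (intro fs x m m')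
    qed
  qed
  then show "prod_list (map (\<lambda>x. 1 + x) xs) - 1 \<in> base.far N"
    "prod_list (map (\<lambda>x. 1 + x) xs) - 1 - sum_list xs \<in> base.far (2 * N)" by blast+
qed

text \<open>The relator \<open>h\<close> accounts for level \<open>2 * N\<close> and each factor
  from \<open>us\<close> or \<open>vs\<close> for another \<open>N\<close>, so terms with two such
  factors already lie in \<open>J (4 * N)\<close>.\<close>

lemma conjugate_approx:
  assumes h: "h \<in> J (2 * N)" and us: "\<And>x. x \<in> set us \<Longrightarrow> x \<in> base.far N"
    and vs: "\<And>x. x \<in> set vs \<Longrightarrow> x \<in> base.far N"
  shows "prod_list (map (\<lambda>x. 1 + x) us) * h * prod_list (map (\<lambda>x. 1 + x) vs) -
    (h + sum_list us * h + h * sum_list vs) \<in> J (4 * N)"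
proof -
  let ?u = "prod_list (map (\<lambda>x. 1 + x) us)" and ?v = "prod_list (map (\<lambda>x. 1 + x) vs)"
  note u = prod_one_plus[OF us] and v = prod_one_plus[OF vs]
  have su: "sum_list us \<in> base.far N"
    using us by (induction us) (auto intro: fa.subspace_0[OF base.far_subspace] fa.subspace_add[OF base.far_subspace])
  have 1: "(?u - 1 - sum_list us) * h * ?v \<in> J (4 * N)"
    using base.J_mult_right[OF base.J_mult_left[OF h u(2)] base.far_0[of ?v]] by simp
  have 2: "sum_list us * h * (?v - 1) \<in> J (4 * N)"
    using base.J_mult_right[OF base.J_mult_left[OF h su] v(1)] by (simp add: algebra_simps)
  have 3: "h * (?v - 1 - sum_list vs) \<in> J (4 * N)"
    using base.J_mult_right[OF h v(2)] by simp
  have "?u * h * ?v - (h + sum_list us * h + h * sum_list vs) =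
     (?u - 1 - sum_list us) * h * ?v + sum_list us * h * (?v - 1) + h * (?v - 1 - sum_list vs)"
    by (simp add: algebra_simps)
  then show ?thesis using J_add[OF J_add[OF 1 2] 3] by simp
qed

text \<open>Each face relator occurs once on either side of the permutohedron identity, with
  different surrounding products. The terms of order zero cancel, those of order one add up to
  \<open>pi_rel\<close>, and the others have level at least \<open>4 * N\<close>.\<close>

lemma pi_rel_in_J:
  assumes ijkl: "distinct [i, j, k, l]" "{i, j, k, l} \<subseteq> {1..n}" "True \<in> C \<or> i < j \<and> j < k \<and> k < l"
  shows "pi_rel (\<lambda>e. mon [e]) i j k l \<in> J (4 * N)"
proof -
  let ?x = "xl (\<lambda>e. mon [e])" and ?H = "hexagon (\<lambda>e. mon [e])"
  let ?U = "\<lambda>us. prod_list (map (\<lambda>x. 1 + x) us)"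
  \<comment> \<open>The error of the first order approximation, which
    \<open>conjugate_approx\<close> puts into \<open>J (4 * N)\<close>.\<close>
  define A where "A us h vs = ?U us * h * ?U vs - (h + sum_list us * h + h * sum_list vs)"
    for us vs :: "edge free_algebra list" and h
  have A: "A us h vs \<in> J (4 * N)"
    if "h \<in> J (2 * N)" "set us \<union> set vs \<subseteq> {?x i j, ?x i k, ?x i l, ?x j k, ?x j l, ?x k l}" for us h vs
    unfolding A_def using that ijkl(1) by (intro conjugate_approx) (auto intro!: xl_far)
  have H: "?H i j k \<in> J (2 * N)" "?H i j l \<in> J (2 * N)" "?H i k l \<in> J (2 * N)" "?H j k l \<in> J (2 * N)"
    using ijkl by (auto intro!: hexagon_in_J)
  have S: "br (?x i l) (?x j k) \<in> J (2 * N)" "br (?x i k) (?x j l) \<in> J (2 * N)" "br (?x i j) (?x k l) \<in> J (2 * N)"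
    using ijkl by (auto intro!: square_in_J)
  define a b c d e f where abcdef: "a = 1 + ?x i j" "b = 1 + ?x i k" "c = 1 + ?x i l"
    "d = 1 + ?x j k" "e = 1 + ?x j l" "f = 1 + ?x k l"
  have S': "br (?x i l) (?x j k) = c * d - d * c" "br (?x i k) (?x j l) = b * e - e * b"
    "br (?x i j) (?x k l) = a * f - f * a"
    by (simp_all add: abcdef br_def algebra_simps)
  have H': "?H i j k = a * b * d - d * b * a" "?H i j l = a * c * e - e * c * a"
    "?H i k l = b * c * f - f * c * b" "?H j k l = d * e * f - f * e * d"
    by (simp_all add: hexagon_def abcdef)
  define L where "L = A [?x i j, ?x i k] (br (?x i l) (?x j k)) [?x j l, ?x k l] + A [] (?H i j k) [?x i l, ?x j l, ?x k l] +
      A [?x j k, ?x i k] (?H i j l) [?x k l] + A [?x j k] (br (?x i k) (?x j l)) [?x i l, ?x i j, ?x k l] +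
      A [?x j k, ?x j l, ?x i k, ?x i l] (br (?x i j) (?x k l)) [] + A [?x j k, ?x j l] (?H i k l) [?x i j] +
      A [] (?H j k l) [?x i l, ?x i k, ?x i j]"
  define M where "M = A [?x i j, ?x i k, ?x i l] (?H j k l) [] + A [?x i j] (?H i k l) [?x j l, ?x j k] +
      A [] (br (?x i j) (?x k l)) [?x i l, ?x i k, ?x j l, ?x j k] +
      A [?x k l, ?x i j, ?x i l] (br (?x i k) (?x j l)) [?x j k] + A [?x k l] (?H i j l) [?x i k, ?x j k] +
      A [?x k l, ?x j l, ?x i l] (?H i j k) [] + A [?x k l, ?x j l] (br (?x i l) (?x j k)) [?x i k, ?x i j]"
  have LM: "L \<in> J (4 * N)" "M \<in> J (4 * N)"
    unfolding L_def M_def by (intro J_add A H S; simp)+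
  define P where "P us h vs = ?U us * h * ?U vs" for us vs :: "edge free_algebra list" and h
  define Q where "Q us h vs = h + sum_list us * h + h * sum_list vs" for us vs :: "edge free_algebra list" and h
  have APQ: "A us h vs = P us h vs - Q us h vs" for us h vs by (simp add: A_def P_def Q_def)
  \<comment> \<open>The exact terms \<open>P\<close> agree by the permutohedron identity, so the
    difference of the errors is the difference of the first order approximations
    \<open>Q\<close>.\<close>
  have "P [?x i j, ?x i k] (br (?x i l) (?x j k)) [?x j l, ?x k l] + P [] (?H i j k) [?x i l, ?x j l, ?x k l] +
      P [?x j k, ?x i k] (?H i j l) [?x k l] + P [?x j k] (br (?x i k) (?x j l)) [?x i l, ?x i j, ?x k l] +
      P [?x j k, ?x j l, ?x i k, ?x i l] (br (?x i j) (?x k l)) [] + P [?x j k, ?x j l] (?H i k l) [?x i j] +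
      P [] (?H j k l) [?x i l, ?x i k, ?x i j] =
      P [?x i j, ?x i k, ?x i l] (?H j k l) [] + P [?x i j] (?H i k l) [?x j l, ?x j k] +
      P [] (br (?x i j) (?x k l)) [?x i l, ?x i k, ?x j l, ?x j k] +
      P [?x k l, ?x i j, ?x i l] (br (?x i k) (?x j l)) [?x j k] + P [?x k l] (?H i j l) [?x i k, ?x j k] +
      P [?x k l, ?x j l, ?x i l] (?H i j k) [] + P [?x k l, ?x j l] (br (?x i l) (?x j k)) [?x i k, ?x i j]"
    unfolding P_def S' H' using permutohedron[of a b c d e f]
    by (simp add: abcdef[symmetric] mult.assoc)
  then have "M - L = (Q [?x i j, ?x i k] (br (?x i l) (?x j k)) [?x j l, ?x k l] + Q [] (?H i j k) [?x i l, ?x j l, ?x k l] +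
      Q [?x j k, ?x i k] (?H i j l) [?x k l] + Q [?x j k] (br (?x i k) (?x j l)) [?x i l, ?x i j, ?x k l] +
      Q [?x j k, ?x j l, ?x i k, ?x i l] (br (?x i j) (?x k l)) [] + Q [?x j k, ?x j l] (?H i k l) [?x i j] +
      Q [] (?H j k l) [?x i l, ?x i k, ?x i j]) -
      (Q [?x i j, ?x i k, ?x i l] (?H j k l) [] + Q [?x i j] (?H i k l) [?x j l, ?x j k] +
      Q [] (br (?x i j) (?x k l)) [?x i l, ?x i k, ?x j l, ?x j k] +
      Q [?x k l, ?x i j, ?x i l] (br (?x i k) (?x j l)) [?x j k] + Q [?x k l] (?H i j l) [?x i k, ?x j k] +
      Q [?x k l, ?x j l, ?x i l] (?H i j k) [] + Q [?x k l, ?x j l] (br (?x i l) (?x j k)) [?x i k, ?x i j])"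
    unfolding L_def M_def APQ by (simp add: algebra_simps)
  also have "\<dots> = pi_rel (\<lambda>e. mon [e]) i j k l"
  proof -
    define s1 s2 s3 h1 h2 h3 h4 where sh: "s1 = br (?x i l) (?x j k)" "s2 = br (?x i k) (?x j l)"
      "s3 = br (?x i j) (?x k l)" "h1 = ?H i j k" "h2 = ?H i j l" "h3 = ?H i k l" "h4 = ?H j k l"
    show ?thesis unfolding pi_rel_def Q_def Let_def sh[symmetric] br_linear
      by (simp add: br_def algebra_simps)
  qed
  finally show ?thesis using J_diff[OF LM(2,1)] by simp
qed

end

section \<open>Jacobi sums of pairwise compatible edges\<close>

lemma jac_swap: "jac z f e g = - jac z e f g"
  unfolding jac_def edge_rel_of_swap[of _ _ e f] edge_rel_of_swap[of _ _ f g] edge_rel_of_swap[of _ _ e g]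
  by (simp add: br_linear)

lemma jac_rotate: "jac z f g e = jac z e f g"
  by (simp add: jac_def add_ac)

lemma jac_swap_last: "jac z e g f = - jac z e f g"
  by (rule HOL.trans[OF jac_rotate[of z e g f] jac_swap[of z f e g]])

context edge_levels
begin

text \<open>Bracketing with \<open>g\<close> is a derivation, and on every letter disjoint from
  \<open>g\<close> it produces a commutation relator.\<close>

lemma br_disjoint_mon_in_J:
  assumes "g \<in> edges n C" "\<forall>x\<in>set w. x \<in> edges n C \<and> disjoint_edges g x"
  shows "br (mon [g]) (mon w) \<in> J (lev g + weight lev w)"
  using assms(2)
proof (induction w)
  case Nil
  then show ?case by (simp add: br_def mon_Nil J_0)
next
  case (Cons x w)
  have "E g x" using Cons.prems assms(1) by (simp add: compatible_on_def compatible_def case_prod_unfold)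
  then have "rho g x \<in> J (lev g + lev x)" by (rule rho_in_J) simp
  then have "br (mon [g]) (mon [x]) \<in> J (lev g + lev x)"
    using Cons.prems by (simp add: edge_rel_of_def)
  from base.J_mult_right[OF this base.far_mon[of "weight lev w" w]]
  have 1: "br (mon [g]) (mon [x]) * mon w \<in> J (lev g + weight lev (x # w))" by (simp add: add_ac)
  have "br (mon [g]) (mon w) \<in> J (lev g + weight lev w)" using Cons by simp
  from base.J_mult_left[OF this base.far_mon[of "lev x" "[x]"]]
  have 2: "mon [x] * br (mon [g]) (mon w) \<in> J (lev g + weight lev (x # w))" by (simp add: add_ac)
  have "br (mon [g]) (mon (x # w)) = br (mon [g]) (mon [x]) * mon w + mon [x] * br (mon [g]) (mon w)"
    unfolding mon_Cons[of x w] by (simp add: br_def algebra_simps)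
  then show ?case using J_add[OF 1 2] by simp
qed

lemma br_disjoint_spread_in_J:
  assumes g: "g \<in> edges n C" "vertices g \<inter> V = {}" and f: "f \<in> spread s V"
  shows "br (mon [g]) f \<in> J (lev g + s)"
proof -
  have "br (mon [g]) (\<Sum>w\<in>A. scal (lookup f w) (mon w)) = (\<Sum>w\<in>A. scal (lookup f w) (br (mon [g]) (mon w)))" for A
    by (simp add: br_def fa.scale_right_diff_distrib sum_subtractf sum_distrib_left sum_distrib_right)
  from this[of "keys f"] have "br (mon [g]) f = (\<Sum>w\<in>keys f. scal (lookup f w) (br (mon [g]) (mon w)))"
    unfolding free_algebra_expand[OF finite_keys subset_refl, symmetric] .
  also have "\<dots> \<in> J (lev g + s)"
  proof (intro base.J_sum base.J_scale)
    fix w assume w: "w \<in> keys f"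
    have "br (mon [g]) (mon w) \<in> J (lev g + weight lev w)"
      using w f g by (intro br_disjoint_mon_in_J) (fastforce simp: spread_def disjoint_edges_def vertices_def)+
    then show "br (mon [g]) (mon w) \<in> J (lev g + s)"
      using w f by (elim J_mono) (auto simp: spread_def)
  qed
  finally show ?thesis .
qed

text \<open>When \<open>g\<close> is disjoint from both other edges, the commutators cancel by the
  associative Jacobi identity. There remains the bracket of \<open>g\<close> with the tail of
  \<open>rho e f\<close>, whose letters live on the vertices of \<open>e\<close> and
  \<open>f\<close>.\<close>

lemma jac_disjoint_in_J:
  assumes "E e f" "g \<in> edges n C" "disjoint_edges e g" "disjoint_edges f g"
  shows "jac (\<lambda>e. mon [e]) e f g \<in> J (lev e + lev f + lev g + 1)"
proof -
  have d: "disjoint_edges g e" using assms(3) by (auto simp: disjoint_edges_def)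
  have "jac (\<lambda>e. mon [e]) e f g = br (mon [g]) (rho e f - br (mon [e]) (mon [f]))"
    using assms(3,4) d by (simp add: jac_def edge_rel_of_def[of _ _ f g] edge_rel_of_def[of _ _ g e])
      (simp add: br_def algebra_simps)
  also have "\<dots> \<in> J (lev g + (lev e + lev f + 1))"
    using assms by (intro br_disjoint_spread_in_J[OF _ _ tail_spread]) (auto simp: disjoint_edges_def vertices_def)
  finally show ?thesis by (simp add: add_ac)
qed

text \<open>The permutohedron relation counts as four letters and is therefore above any triple of
  edges.\<close>

lemma pi_rel_in_J_le:
  assumes "distinct [i, j, k, l]" "{i, j, k, l} \<subseteq> {1..n}" "True \<in> C \<or> i < j \<and> j < k \<and> k < l"
    and e: "e \<in> edges n C" "f \<in> edges n C" "g \<in> edges n C"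
  shows "pi_rel (\<lambda>e. mon [e]) i j k l \<in> J (lev e + lev f + lev g + 1)"
proof (rule J_mono[OF pi_rel_in_J[OF assms(1-3)]])
  show "lev e + lev f + lev g + 1 \<le> 4 * N"
    using lev_le[OF e(1)] lev_le[OF e(2)] lev_le[OF e(3)] N by (simp add: algebra_simps)
qed

text \<open>The six shapes are the increasing trees on four vertices. Edges leaving the root may
  have either colour and all others are red. After the explicit formulas have been inserted, each
  summand is settled by a comparison of levels.\<close>

lemma jac_tree_in_J:
  assumes ijkl: "i < j" "j < k" "k < l" and n: "1 \<le> i" "l \<le> n"
    and C: "c1 \<or> c2 \<or> c3 \<longrightarrow> True \<in> C"
  shows "jac (\<lambda>e. mon [e]) (c1, i, j) (c2, i, k) (c3, i, l) \<in> J (lev (c1, i, j) + lev (c2, i, k) + lev (c3, i, l) + 1)" (is ?A)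
    and "c3 \<Longrightarrow> jac (\<lambda>e. mon [e]) (c1, i, j) (c2, i, k) (c3, j, l) \<in> J (lev (c1, i, j) + lev (c2, i, k) + lev (c3, j, l) + 1)"
    and "c3 \<Longrightarrow> jac (\<lambda>e. mon [e]) (c1, i, j) (c2, i, k) (c3, k, l) \<in> J (lev (c1, i, j) + lev (c2, i, k) + lev (c3, k, l) + 1)"
    and "c3 \<Longrightarrow> jac (\<lambda>e. mon [e]) (c1, i, j) (c2, i, l) (c3, j, k) \<in> J (lev (c1, i, j) + lev (c2, i, l) + lev (c3, j, k) + 1)"
    and "c2 \<Longrightarrow> c3 \<Longrightarrow> jac (\<lambda>e. mon [e]) (c1, i, j) (c2, j, k) (c3, j, l) \<in> J (lev (c1, i, j) + lev (c2, j, k) + lev (c3, j, l) + 1)"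
    and "c2 \<Longrightarrow> c3 \<Longrightarrow> jac (\<lambda>e. mon [e]) (c1, i, j) (c2, j, k) (c3, k, l) \<in> J (lev (c1, i, j) + lev (c2, j, k) + lev (c3, k, l) + 1)"
proof -
  have K': "K * i + K \<le> K * j" "K * j + K \<le> K * k" "K * k + K \<le> K * l" "K * l \<le> K * n"
    using ijkl n K_mono by auto
  note facts = ijkl n K' K R N
  have r12r13r14: "jac (\<lambda>e. mon [e]) (False, i, j) (False, i, k) (False, i, l) \<in> J (lev (False, i, j) + lev (False, i, k) + lev (False, i, l) + 1)"
    unfolding jacobi_r12r13r14[OF ijkl]
    by (intro J_add J_diff J_neg br_rho_in_J pi_rel_in_J_le) (use facts in auto)
  have r12r13t14: "jac (\<lambda>e. mon [e]) (False, i, j) (False, i, k) (True, i, l) \<in> J (lev (False, i, j) + lev (False, i, k) + lev (True, i, l) + 1)" if "True \<in> C"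
    unfolding jacobi_r12r13t14[OF ijkl]
    by (intro J_add J_diff J_neg br_rho_in_J pi_rel_in_J_le) (use facts that in auto)
  have r12t13r14: "jac (\<lambda>e. mon [e]) (False, i, j) (True, i, k) (False, i, l) \<in> J (lev (False, i, j) + lev (True, i, k) + lev (False, i, l) + 1)" if "True \<in> C"
    unfolding jacobi_r12t13r14[OF ijkl]
    by (intro J_add J_diff J_neg br_rho_in_J pi_rel_in_J_le) (use facts that in auto)
  have r12t13t14: "jac (\<lambda>e. mon [e]) (False, i, j) (True, i, k) (True, i, l) \<in> J (lev (False, i, j) + lev (True, i, k) + lev (True, i, l) + 1)" if "True \<in> C"
    unfolding jacobi_r12t13t14[OF ijkl]
    by (intro J_add J_diff J_neg br_rho_in_J pi_rel_in_J_le) (use facts that in auto)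
  have t12r13r14: "jac (\<lambda>e. mon [e]) (True, i, j) (False, i, k) (False, i, l) \<in> J (lev (True, i, j) + lev (False, i, k) + lev (False, i, l) + 1)" if "True \<in> C"
    unfolding jacobi_t12r13r14[OF ijkl]
    by (intro J_add J_diff J_neg br_rho_in_J pi_rel_in_J_le) (use facts that in auto)
  have t12r13t14: "jac (\<lambda>e. mon [e]) (True, i, j) (False, i, k) (True, i, l) \<in> J (lev (True, i, j) + lev (False, i, k) + lev (True, i, l) + 1)" if "True \<in> C"
    unfolding jacobi_t12r13t14[OF ijkl]
    by (intro J_add J_diff J_neg br_rho_in_J pi_rel_in_J_le) (use facts that in auto)
  have t12t13r14: "jac (\<lambda>e. mon [e]) (True, i, j) (True, i, k) (False, i, l) \<in> J (lev (True, i, j) + lev (True, i, k) + lev (False, i, l) + 1)" if "True \<in> C"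
    unfolding jacobi_t12t13r14[OF ijkl]
    by (intro J_add J_diff J_neg br_rho_in_J pi_rel_in_J_le) (use facts that in auto)
  have t12t13t14: "jac (\<lambda>e. mon [e]) (True, i, j) (True, i, k) (True, i, l) \<in> J (lev (True, i, j) + lev (True, i, k) + lev (True, i, l) + 1)" if "True \<in> C"
    unfolding jacobi_t12t13t14[OF ijkl]
    by (intro J_add J_diff J_neg br_rho_in_J pi_rel_in_J_le) (use facts that in auto)
  have r12r13t24: "jac (\<lambda>e. mon [e]) (False, i, j) (False, i, k) (True, j, l) \<in> J (lev (False, i, j) + lev (False, i, k) + lev (True, j, l) + 1)" if "True \<in> C"
    unfolding jacobi_r12r13t24[OF ijkl]
    by (intro J_add J_diff J_neg br_rho_in_J pi_rel_in_J_le) (use facts that in auto)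
  have r12t13t24: "jac (\<lambda>e. mon [e]) (False, i, j) (True, i, k) (True, j, l) \<in> J (lev (False, i, j) + lev (True, i, k) + lev (True, j, l) + 1)" if "True \<in> C"
    unfolding jacobi_r12t13t24[OF ijkl]
    by (intro J_add J_diff J_neg br_rho_in_J pi_rel_in_J_le) (use facts that in auto)
  have t12r13t24: "jac (\<lambda>e. mon [e]) (True, i, j) (False, i, k) (True, j, l) \<in> J (lev (True, i, j) + lev (False, i, k) + lev (True, j, l) + 1)" if "True \<in> C"
    unfolding jacobi_t12r13t24[OF ijkl]
    by (intro J_add J_diff J_neg br_rho_in_J pi_rel_in_J_le) (use facts that in auto)
  have t12t13t24: "jac (\<lambda>e. mon [e]) (True, i, j) (True, i, k) (True, j, l) \<in> J (lev (True, i, j) + lev (True, i, k) + lev (True, j, l) + 1)" if "True \<in> C"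
    unfolding jacobi_t12t13t24[OF ijkl]
    by (intro J_add J_diff J_neg br_rho_in_J pi_rel_in_J_le) (use facts that in auto)
  have r12r13t34: "jac (\<lambda>e. mon [e]) (False, i, j) (False, i, k) (True, k, l) \<in> J (lev (False, i, j) + lev (False, i, k) + lev (True, k, l) + 1)" if "True \<in> C"
    unfolding jacobi_r12r13t34[OF ijkl]
    by (intro J_add J_diff J_neg br_rho_in_J pi_rel_in_J_le) (use facts that in auto)
  have r12t13t34: "jac (\<lambda>e. mon [e]) (False, i, j) (True, i, k) (True, k, l) \<in> J (lev (False, i, j) + lev (True, i, k) + lev (True, k, l) + 1)" if "True \<in> C"
    unfolding jacobi_r12t13t34[OF ijkl]
    by (intro J_add J_diff J_neg br_rho_in_J pi_rel_in_J_le) (use facts that in auto)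
  have t12r13t34: "jac (\<lambda>e. mon [e]) (True, i, j) (False, i, k) (True, k, l) \<in> J (lev (True, i, j) + lev (False, i, k) + lev (True, k, l) + 1)" if "True \<in> C"
    unfolding jacobi_t12r13t34[OF ijkl]
    by (intro J_add J_diff J_neg br_rho_in_J pi_rel_in_J_le) (use facts that in auto)
  have t12t13t34: "jac (\<lambda>e. mon [e]) (True, i, j) (True, i, k) (True, k, l) \<in> J (lev (True, i, j) + lev (True, i, k) + lev (True, k, l) + 1)" if "True \<in> C"
    unfolding jacobi_t12t13t34[OF ijkl]
    by (intro J_add J_diff J_neg br_rho_in_J pi_rel_in_J_le) (use facts that in auto)
  have r12r14t23: "jac (\<lambda>e. mon [e]) (False, i, j) (False, i, l) (True, j, k) \<in> J (lev (False, i, j) + lev (False, i, l) + lev (True, j, k) + 1)" if "True \<in> C"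
    unfolding jacobi_r12r14t23[OF ijkl]
    by (intro J_add J_diff J_neg br_rho_in_J pi_rel_in_J_le) (use facts that in auto)
  have r12t14t23: "jac (\<lambda>e. mon [e]) (False, i, j) (True, i, l) (True, j, k) \<in> J (lev (False, i, j) + lev (True, i, l) + lev (True, j, k) + 1)" if "True \<in> C"
    unfolding jacobi_r12t14t23[OF ijkl]
    by (intro J_add J_diff J_neg br_rho_in_J pi_rel_in_J_le) (use facts that in auto)
  have t12r14t23: "jac (\<lambda>e. mon [e]) (True, i, j) (False, i, l) (True, j, k) \<in> J (lev (True, i, j) + lev (False, i, l) + lev (True, j, k) + 1)" if "True \<in> C"
    unfolding jacobi_t12r14t23[OF ijkl]
    by (intro J_add J_diff J_neg br_rho_in_J pi_rel_in_J_le) (use facts that in auto)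
  have t12t14t23: "jac (\<lambda>e. mon [e]) (True, i, j) (True, i, l) (True, j, k) \<in> J (lev (True, i, j) + lev (True, i, l) + lev (True, j, k) + 1)" if "True \<in> C"
    unfolding jacobi_t12t14t23[OF ijkl]
    by (intro J_add J_diff J_neg br_rho_in_J pi_rel_in_J_le) (use facts that in auto)
  have r12t23t24: "jac (\<lambda>e. mon [e]) (False, i, j) (True, j, k) (True, j, l) \<in> J (lev (False, i, j) + lev (True, j, k) + lev (True, j, l) + 1)" if "True \<in> C"
    unfolding jacobi_r12t23t24[OF ijkl]
    by (intro J_add J_diff J_neg br_rho_in_J pi_rel_in_J_le) (use facts that in auto)
  have t12t23t24: "jac (\<lambda>e. mon [e]) (True, i, j) (True, j, k) (True, j, l) \<in> J (lev (True, i, j) + lev (True, j, k) + lev (True, j, l) + 1)" if "True \<in> C"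
    unfolding jacobi_t12t23t24[OF ijkl]
    by (intro J_add J_diff J_neg br_rho_in_J pi_rel_in_J_le) (use facts that in auto)
  have r12t23t34: "jac (\<lambda>e. mon [e]) (False, i, j) (True, j, k) (True, k, l) \<in> J (lev (False, i, j) + lev (True, j, k) + lev (True, k, l) + 1)" if "True \<in> C"
    unfolding jacobi_r12t23t34[OF ijkl]
    by (intro J_add J_diff J_neg br_rho_in_J pi_rel_in_J_le) (use facts that in auto)
  have t12t23t34: "jac (\<lambda>e. mon [e]) (True, i, j) (True, j, k) (True, k, l) \<in> J (lev (True, i, j) + lev (True, j, k) + lev (True, k, l) + 1)" if "True \<in> C"
    unfolding jacobi_t12t23t34[OF ijkl]
    by (intro J_add J_diff J_neg br_rho_in_J pi_rel_in_J_le) (use facts that in auto)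
  show ?A using C r12r13r14 r12r13t14 r12t13r14 r12t13t14 t12r13r14 t12r13t14 t12t13r14 t12t13t14 by (cases c1; cases c2; cases c3) auto
  show "jac (\<lambda>e. mon [e]) (c1, i, j) (c2, i, k) (c3, j, l) \<in> J (lev (c1, i, j) + lev (c2, i, k) + lev (c3, j, l) + 1)" if "c3"
    using that C r12r13t24 r12t13t24 t12r13t24 t12t13t24 by (cases c1; cases c2; cases c3) auto
  show "jac (\<lambda>e. mon [e]) (c1, i, j) (c2, i, k) (c3, k, l) \<in> J (lev (c1, i, j) + lev (c2, i, k) + lev (c3, k, l) + 1)" if "c3"
    using that C r12r13t34 r12t13t34 t12r13t34 t12t13t34 by (cases c1; cases c2; cases c3) auto
  show "jac (\<lambda>e. mon [e]) (c1, i, j) (c2, i, l) (c3, j, k) \<in> J (lev (c1, i, j) + lev (c2, i, l) + lev (c3, j, k) + 1)" if "c3"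
    using that C r12r14t23 r12t14t23 t12r14t23 t12t14t23 by (cases c1; cases c2; cases c3) auto
  show "jac (\<lambda>e. mon [e]) (c1, i, j) (c2, j, k) (c3, j, l) \<in> J (lev (c1, i, j) + lev (c2, j, k) + lev (c3, j, l) + 1)" if "c2" "c3"
    using that C r12t23t24 t12t23t24 by (cases c1; cases c2; cases c3) auto
  show "jac (\<lambda>e. mon [e]) (c1, i, j) (c2, j, k) (c3, k, l) \<in> J (lev (c1, i, j) + lev (c2, j, k) + lev (c3, k, l) + 1)" if "c2" "c3"
    using that C r12t23t34 t12t23t34 by (cases c1; cases c2; cases c3) auto
qed

text \<open>With increasing targets, three pairwise compatible edges either contain one that is
  disjoint from the other two or form an increasing tree on four vertices.\<close>

lemma jac_sorted_in_J:
  assumes E: "E e f" "E f g" "E e g" and s: "snd (snd e) < snd (snd f)" "snd (snd f) < snd (snd g)"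
  shows "jac (\<lambda>e. mon [e]) e f g \<in> J (lev e + lev f + lev g + 1)"
proof -
  obtain c1 a b c2 p c c3 q d where efg: "e = (c1, a, b)" "f = (c2, p, c)" "g = (c3, q, d)"
    by (cases e; cases f; cases g) auto
  have ed: "e \<in> edges n C" "f \<in> edges n C" "g \<in> edges n C" using E by (auto simp: compatible_on_def)
  note C = E[unfolded efg compatible_on_iff] and s' = s[unfolded efg snd_conv]
  have ord: "a < b" "b < c" "c < d" "p < c" "q < d" using C s' by auto
  have pf: "p = a \<or> p = b \<and> c2 \<or> p \<noteq> a \<and> p \<noteq> b" using C(1) ord by linarith
  have qf: "q = a \<or> q = b \<and> c3 \<or> q = c \<and> c3 \<or> q \<noteq> a \<and> q \<noteq> b \<and> q \<noteq> c"
    using C(2,3) ord less_irrefl order.strict_trans by (metis (full_types))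
  have dis: "disjoint_edges e f \<longleftrightarrow> p \<noteq> a \<and> p \<noteq> b" "disjoint_edges e g \<longleftrightarrow> q \<noteq> a \<and> q \<noteq> b"
    "disjoint_edges f g \<longleftrightarrow> q \<noteq> p \<and> q \<noteq> c"
    using ord by (auto simp: efg)
  have "(disjoint_edges e g \<and> disjoint_edges f g) \<or> (disjoint_edges e f \<and> disjoint_edges e g) \<or>
    (disjoint_edges e f \<and> disjoint_edges f g) \<or> (p = a \<and> q = a) \<or> (p = a \<and> q = b \<and> c3) \<or> (p = a \<and> q = c \<and> c3) \<or>
    (p = b \<and> q = a \<and> c2) \<or> (p = b \<and> q = b \<and> c2 \<and> c3) \<or> (p = b \<and> q = c \<and> c2 \<and> c3)"
    using pf qf unfolding dis by (elim disjE conjE) (use ord in auto)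
  then consider "disjoint_edges e g" "disjoint_edges f g" | "disjoint_edges e f" "disjoint_edges e g"
    | "disjoint_edges e f" "disjoint_edges f g" | "p = a" "q = a" | "p = a" "q = b" c3 | "p = a" "q = c" c3
    | "p = b" "q = a" c2 | "p = b" "q = b" c2 c3 | "p = b" "q = c" c2 c3
    by argo
  then show ?thesis
  proof cases
    case 1
    then show ?thesis using jac_disjoint_in_J[OF E(1) ed(3)] by blast
  next
    case 2
    then have "jac (\<lambda>e. mon [e]) f g e \<in> J (lev f + lev g + lev e + 1)"
      using E ed by (intro jac_disjoint_in_J) (auto simp: disjoint_edges_def)
    moreover have "jac (\<lambda>e. mon [e]) f g e = jac (\<lambda>e. mon [e]) e f g" by (rule jac_rotate)
    ultimately show ?thesis by (simp add: add_ac)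
  next
    case 3
    have "jac (\<lambda>e. mon [e]) e g f \<in> J (lev e + lev g + lev f + 1)"
      using 3 E ed by (intro jac_disjoint_in_J) (auto simp: disjoint_edges_def)
    then have "- jac (\<lambda>e. mon [e]) e g f \<in> J (lev e + lev f + lev g + 1)" by (simp add: J_neg add_ac)
    moreover have "jac (\<lambda>e. mon [e]) e f g = - jac (\<lambda>e. mon [e]) e g f" by (rule jac_swap_last)
    ultimately show ?thesis by simp
  next
    case 4
    show ?thesis unfolding efg 4(1,2) by (rule jac_tree_in_J(1)) (use C s' 4 in auto)
  next
    case 5
    show ?thesis unfolding efg 5(1,2) by (rule jac_tree_in_J(2)) (use C s' 5 in auto)
  next
    case 6
    show ?thesis unfolding efg 6(1,2) by (rule jac_tree_in_J(3)) (use C s' 6 in auto)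
  next
    case 7
    have "jac (\<lambda>e. mon [e]) (c1, a, b) (c3, a, d) (c2, b, c) \<in> J (lev (c1, a, b) + lev (c3, a, d) + lev (c2, b, c) + 1)"
      using 7 C s' by (intro jac_tree_in_J(4)) auto
    then have "- jac (\<lambda>e. mon [e]) e g f \<in> J (lev e + lev f + lev g + 1)"
      using 7 by (simp add: efg J_neg add_ac)
    moreover have "jac (\<lambda>e. mon [e]) e f g = - jac (\<lambda>e. mon [e]) e g f" by (rule jac_swap_last)
    ultimately show ?thesis by simp
  next
    case 8
    show ?thesis unfolding efg 8(1,2) by (rule jac_tree_in_J(5)) (use C s' 8 in auto)
  next
    case 9
    show ?thesis unfolding efg 9(1,2) by (rule jac_tree_in_J(6)) (use C s' 9 in auto)
  qed
qed

text \<open>Compatible edges have different targets, and the Jacobi sum is alternating, so the edges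
  may be sorted by target.\<close>

lemma jac_in_J:
  assumes E: "E e f" "E f g" "E e g"
  shows "jac (\<lambda>e. mon [e]) e f g \<in> J (lev e + lev f + lev g + 1)"
proof -
  let ?m = "\<lambda>e :: edge. snd (snd e)"
  have ne: "?m e \<noteq> ?m f" if "E e f" for e f using that by (cases e; cases f) auto
  note E' = E base.sym[OF E(1)] base.sym[OF E(2)] base.sym[OF E(3)]
  have swap: "jac (\<lambda>e. mon [e]) f e g \<in> J (lev f + lev e + lev g + 1)"
    if "jac (\<lambda>e. mon [e]) e f g \<in> J (lev e + lev f + lev g + 1)" for e f g
    unfolding jac_swap[of _ f e g] using J_neg[OF that] by (simp add: add_ac)
  have rot: "jac (\<lambda>e. mon [e]) f g e \<in> J (lev f + lev g + lev e + 1)"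
    if "jac (\<lambda>e. mon [e]) e f g \<in> J (lev e + lev f + lev g + 1)" for e f g
    unfolding jac_rotate[of _ f g e] using that by (simp add: add_ac)
  consider "?m e < ?m f" "?m f < ?m g" | "?m e < ?m g" "?m g < ?m f" | "?m f < ?m e" "?m e < ?m g"
    | "?m f < ?m g" "?m g < ?m e" | "?m g < ?m e" "?m e < ?m f" | "?m g < ?m f" "?m f < ?m e"
    using ne[OF E(1)] ne[OF E(2)] ne[OF E(3)] by linarith
  then show ?thesis
  proof cases
    case 1
    show ?thesis by (rule jac_sorted_in_J[OF E'(1) E'(2) E'(3) 1(1) 1(2)])
  next
    case 2
    have "jac (\<lambda>e. mon [e]) e g f \<in> J (lev e + lev g + lev f + 1)" by (rule jac_sorted_in_J[OF E'(3) E'(5) E'(1) 2(1) 2(2)])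
    then show ?thesis by (rule rot[OF swap])
  next
    case 3
    have "jac (\<lambda>e. mon [e]) f e g \<in> J (lev f + lev e + lev g + 1)" by (rule jac_sorted_in_J[OF E'(4) E'(3) E'(2) 3(1) 3(2)])
    then show ?thesis by (rule swap)
  next
    case 4
    have "jac (\<lambda>e. mon [e]) f g e \<in> J (lev f + lev g + lev e + 1)" by (rule jac_sorted_in_J[OF E'(2) E'(6) E'(4) 4(1) 4(2)])
    then show ?thesis by (rule rot[OF rot])
  next
    case 5
    have "jac (\<lambda>e. mon [e]) g e f \<in> J (lev g + lev e + lev f + 1)" by (rule jac_sorted_in_J[OF E'(6) E'(1) E'(5) 5(1) 5(2)])
    then show ?thesis by (rule rot)
  next
    case 6
    have "jac (\<lambda>e. mon [e]) g f e \<in> J (lev g + lev f + lev e + 1)" by (rule jac_sorted_in_J[OF E'(5) E'(4) E'(6) 6(1) 6(2)])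
    then show ?thesis by (rule swap[OF rot])
  qed
qed

sublocale edge_relators: relators E "\<lambda>_. 1" lev p rho
proof unfold_locales
  show "mon [x] * rho y z - rho y z * mon [x] + (mon [y] * rho z x - rho z x * mon [y]) +
      (mon [z] * rho x y - rho x y * mon [z]) \<in> J (lev x + lev y + lev z + 1)"
    if "E x y" "E y z" "E x z" for x y z
    using jac_in_J[OF that] by (simp add: jac_def br_def)
qed

end

section \<open>Congruences modulo an ideal and inverses\<close>

locale two_sided_ideal =
  fixes I :: "'r :: ring_1 set"
  assumes zero: "0 \<in> I" and diff: "f \<in> I \<Longrightarrow> g \<in> I \<Longrightarrow> f - g \<in> I"
    and mult_left: "f \<in> I \<Longrightarrow> g * f \<in> I" and mult_right: "f \<in> I \<Longrightarrow> f * g \<in> I"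
begin

lemma minus: "f \<in> I \<Longrightarrow> - f \<in> I"
  using diff[OF zero] by simp

lemma add: "f \<in> I \<Longrightarrow> g \<in> I \<Longrightarrow> f + g \<in> I"
  using diff[of f "- g"] minus by simp

lemma trans_diff: "f - g \<in> I \<Longrightarrow> g - h \<in> I \<Longrightarrow> f - h \<in> I"
  using add[of "f - g" "g - h"] by simp

lemma sym_diff: "f - g \<in> I \<Longrightarrow> g - f \<in> I"
  using minus[of "f - g"] by simp

lemma context_diff: "f - g \<in> I \<Longrightarrow> a * f * b - a * g * b \<in> I"
  using mult_right[OF mult_left[of "f - g" a], of b] by (simp add: algebra_simps)

definition inverse_pair :: "'r \<Rightarrow> 'r \<Rightarrow> bool" where
  "inverse_pair a a' \<longleftrightarrow> a * a' - 1 \<in> I \<and> a' * a - 1 \<in> I"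

lemma inverse_pair_commute:
  assumes "inverse_pair a a'" "a * b - b * a \<in> I"
  shows "a' * b - b * a' \<in> I"
proof -
  have "a' * b - b * a' = (a' * a - 1) * b * a' - a' * (a * b - b * a) * a' - a' * b * (a * a' - 1)"
    by (simp add: algebra_simps)
  moreover have "\<dots> \<in> I" using assms unfolding inverse_pair_def by (intro diff) (blast intro: mult_left mult_right)+
  ultimately show ?thesis by simp
qed

text \<open>Inverting generators permutes the triangle relations.\<close>

lemma inverse_pair_hexagon:
  assumes "inverse_pair a a'" "inverse_pair b b'" "inverse_pair c c'" and h: "a * b * c - c * b * a \<in> I"
  shows "b * a * c' - c' * a * b \<in> I" "a' * c * b - b * c * a' \<in> I" "c * a' * b' - b' * a' * c \<in> I"
    "b' * c' * a - a * c' * b' \<in> I" "c' * b' * a' - a' * b' * c' \<in> I"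
proof -
  have I: "a * a' - 1 \<in> I" "a' * a - 1 \<in> I" "b * b' - 1 \<in> I" "b' * b - 1 \<in> I" "c * c' - 1 \<in> I" "c' * c - 1 \<in> I"
    "a * b * c - c * b * a \<in> I"
    using assms by (auto simp: inverse_pair_def)
  have "b * a * c' - c' * a * b = - ((c' * c - 1) * b * a * c') - c' * (a * b * c - c * b * a) * c'
      + c' * a * b * (c * c' - 1)"
    by (simp add: algebra_simps)
  moreover have "\<dots> \<in> I"
    by (intro add diff minus) (blast intro: I add mult_left mult_right)+
  ultimately show "b * a * c' - c' * a * b \<in> I" by simp
  have "a' * c * b - b * c * a' = - (a' * c * b * (a * a' - 1)) - a' * (a * b * c - c * b * a) * a'
      + (a' * a - 1) * b * c * a'"
    by (simp add: algebra_simps)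
  moreover have "\<dots> \<in> I"
    by (intro add diff minus) (blast intro: I add mult_left mult_right)+
  ultimately show "a' * c * b - b * c * a' \<in> I" by simp
  have "c * a' * b' - b' * a' * c = - ((b' * (a' * a - 1) * b + (b' * b - 1)) * c * a' * b')
      + b' * a' * (a * b * c - c * b * a) * a' * b' + b' * a' * c * (b * (a * a' - 1) * b' + (b * b' - 1))"
    by (simp add: algebra_simps)
  moreover have "\<dots> \<in> I"
    by (intro add diff minus) (blast intro: I add mult_left mult_right)+
  ultimately show "c * a' * b' - b' * a' * c \<in> I" by simp
  have "b' * c' * a - a * c' * b' = - (b' * c' * a * (b * (c * c' - 1) * b' + (b * b' - 1)))
      + b' * c' * (a * b * c - c * b * a) * c' * b' + (b' * (c' * c - 1) * b + (b' * b - 1)) * a * c' * b'"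
    by (simp add: algebra_simps)
  moreover have "\<dots> \<in> I"
    by (intro add diff minus) (blast intro: I add mult_left mult_right)+
  ultimately show "b' * c' * a - a * c' * b' \<in> I" by simp
  have "c' * b' * a' - a' * b' * c' = - (c' * b' * a' * (c * b * (a * a' - 1) * b' * c' + c * (b * b' - 1) * c' + (c * c' - 1)))
      - c' * b' * a' * (a * b * c - c * b * a) * a' * b' * c'
      + (c' * b' * (a' * a - 1) * b * c + c' * (b' * b - 1) * c + (c' * c - 1)) * a' * b' * c'"
    by (simp add: algebra_simps)
  moreover have "\<dots> \<in> I"
    by (intro add diff minus) (blast intro: I add mult_left mult_right)+
  ultimately show "c' * b' * a' - a' * b' * c' \<in> I" by simp
qed

end

text \<open>The geometric series for the inverse of \<open>u\<close>, cut off where the powers of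
  \<open>1 - u\<close> consist of dead words.\<close>

definition trunc_inv :: "nat \<Rightarrow> 'r :: ring_1 \<Rightarrow> 'r" where
  "trunc_inv p u = (\<Sum>k<p. (1 - u) ^ k)"

lemma trunc_inv_mult: "u * trunc_inv p u = 1 - (1 - u) ^ p" "trunc_inv p u * u = 1 - (1 - u) ^ p"
proof -
  have "u * (1 - u) ^ k = (1 - u) ^ k * u" for k
    by (rule power_commuting_commutes[symmetric]) (simp add: algebra_simps)
  then have *: "u * trunc_inv p u = trunc_inv p u * u"
    unfolding trunc_inv_def sum_distrib_left sum_distrib_right by simp
  show "u * trunc_inv p u = 1 - (1 - u) ^ p"
    unfolding trunc_inv_def by (induction p) (simp_all add: algebra_simps)
  then show "trunc_inv p u * u = 1 - (1 - u) ^ p" by (simp add: *)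
qed

context
  fixes I :: "'e free_algebra set"
  assumes I: "two_sided_ideal I"
begin

interpretation two_sided_ideal I by (rule I)

text \<open>The universal property of a presentation, with values in the units of a quotient
  algebra; working with congruences keeps everything in the free algebra.\<close>

lemma prod_val_pres_rel:
  assumes "(u, v) \<in> pres_rel S R"
    and inv: "\<And>x. x \<in> S \<Longrightarrow> inverse_pair (val (x, True)) (val (x, False))"
    and rel: "\<And>r s. (r, s) \<in> R \<Longrightarrow> prod_val val r - prod_val val s \<in> I"
  shows "prod_val val u - prod_val val v \<in> I"
  using assms(1)
proof (induction rule: pres_rel.induct)
  case (refl u)
  then show ?case using zero by simp
next
  case (sym u v)
  show ?case by (rule sym_diff[OF sym.IH])
next
  case (trans u v w)
  show ?case by (rule trans_diff[OF trans.IH])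
next
  case (cancel u v x b)
  have "val (x, b) * val (x, \<not> b) - 1 \<in> I"
    using inv[OF cancel(3)] by (cases b) (auto simp: inverse_pair_def)
  from context_diff[OF this, of "prod_val val u" "prod_val val v"]
  show ?case by (simp add: mult.assoc)
next
  case (relation u v r s)
  show ?case using context_diff[OF rel[OF relation(3)], of "prod_val val u" "prod_val val v"]
    by (simp add: mult.assoc)
qed

end

section \<open>Elements without constant term\<close>

definition augmentation :: "'e set \<Rightarrow> 'e free_algebra set" where
  "augmentation S = {f. \<forall>w\<in>keys f. set w \<subseteq> S \<and> w \<noteq> []}"

lemma augmentation_subspace: "fa.subspace (augmentation S)"
  unfolding augmentation_def by (rule subspace_keys)

lemmas augmentation_add = fa.subspace_add[OF augmentation_subspace]
  and augmentation_diff = fa.subspace_diff[OF augmentation_subspace]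
  and augmentation_neg = fa.subspace_neg[OF augmentation_subspace]
  and augmentation_0 = fa.subspace_0[OF augmentation_subspace]
  and augmentation_sum = fa.subspace_sum[OF augmentation_subspace]

lemma augmentation_mult:
  assumes "f \<in> augmentation S" "g \<in> augmentation S"
  shows "f * g \<in> augmentation S"
  unfolding augmentation_def
proof (intro CollectI ballI)
  fix w assume "w \<in> keys (f * g)"
  then obtain u v where "w = u @ v" "u \<in> keys f" "v \<in> keys g" using subsetD[OF keys_mult_mon] by blast
  then show "set w \<subseteq> S \<and> w \<noteq> []" using assms by (auto simp: augmentation_def)
qed

lemma augmentation_power:
  assumes "f \<in> augmentation S"
  shows "k \<ge> 1 \<Longrightarrow> f ^ k \<in> augmentation S"
proof (induction k rule: nat_induct_at_least)
  case base
  then show ?case using assms by simp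
next
  case (Suc k)
  then show ?case using augmentation_mult[OF assms] by simp
qed

lemma keys_augmentation_power:
  assumes "f \<in> augmentation S" "w \<in> keys (f ^ k)"
  shows "length w \<ge> k"
  using assms(2)
proof (induction k arbitrary: w)
  case (Suc k)
  then have "w \<in> keys (f * f ^ k)" by simp
  then obtain u v where "w = u @ v" "u \<in> keys f" "v \<in> keys (f ^ k)"
    using subsetD[OF keys_mult_mon] by blast
  moreover have "u \<noteq> []" using assms(1) \<open>u \<in> keys f\<close> by (auto simp: augmentation_def)
  ultimately show ?case using Suc.IH[of v] by (cases u) auto
qed simp

lemma augmentation_mult_one:
  assumes "f - 1 \<in> augmentation S" "g - 1 \<in> augmentation S"
  shows "f * g - 1 \<in> augmentation S"
proof -
  have eq: "f * g - 1 = (f - 1) * (g - 1) + (f - 1) + (g - 1)" by (simp add: algebra_simps)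
  show ?thesis unfolding eq by (intro augmentation_add augmentation_mult assms)
qed

lemma augmentation_trunc_inv:
  assumes "u - 1 \<in> augmentation S" "p \<ge> 1"
  shows "trunc_inv p u - 1 \<in> augmentation S"
proof -
  have u: "1 - u \<in> augmentation S" using augmentation_neg[OF assms(1)] by simp
  have "trunc_inv p u - 1 = (\<Sum>k\<in>{1..<p}. (1 - u) ^ k)"
    using assms(2) by (simp add: trunc_inv_def lessThan_atLeast0 sum.atLeast_Suc_lessThan One_nat_def)
  also have "\<dots> \<in> augmentation S" using augmentation_power[OF u] by (intro augmentation_sum) auto
  finally show ?thesis .
qed

lemma augmentation_in_span: "f \<in> augmentation S \<Longrightarrow> f \<in> fa.span {mon w | w. set w \<subseteq> S \<and> length w \<ge> 1}"
  using fa.span_mono[of "mon ` keys f" "{mon w | w. set w \<subseteq> S \<and> length w \<ge> 1}"] free_algebra_in_span[of f]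
  by (fastforce simp: augmentation_def Suc_le_eq One_nat_def)

section \<open>The pure virtual braid group as a group of words\<close>

lemma vP_rels_words: "vP_rels n \<subseteq> words (vP_gens n) \<times> words (vP_gens n)"
  by (auto simp: vP_rels_def vP_gens_def words_def)

lemma vP_gen_in: "(i, j) \<in> vP_gens n \<Longrightarrow> vP_gen n i j \<in> carrier (vP n)"
  by (auto simp: vP_def presented_group_def vP_gen_def words_def intro!: quotientI)

lemma vP_carrierE:
  assumes "A \<in> carrier (vP n)"
  obtains u where "u \<in> words (vP_gens n)" "A = pres_rel (vP_gens n) (vP_rels n) `` {u}"
  using assms by (auto simp: vP_def presented_group_def elim!: quotientE)

lemma vP_mult:
  "u \<in> words (vP_gens n) \<Longrightarrow> v \<in> words (vP_gens n) \<Longrightarrow>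
    pres_rel (vP_gens n) (vP_rels n) `` {u} \<otimes>\<^bsub>vP n\<^esub> pres_rel (vP_gens n) (vP_rels n) `` {v} =
    pres_rel (vP_gens n) (vP_rels n) `` {u @ v}"
  unfolding vP_def by (rule presented_group_mult[OF vP_rels_words])

lemma vP_one: "\<one>\<^bsub>vP n\<^esub> = pres_rel (vP_gens n) (vP_rels n) `` {[]}"
  by (simp add: vP_def presented_group_def)

lemma vP_class_eq:
  "(u, v) \<in> pres_rel (vP_gens n) (vP_rels n) \<Longrightarrow>
    pres_rel (vP_gens n) (vP_rels n) `` {u} = pres_rel (vP_gens n) (vP_rels n) `` {v}"
  by (rule equiv_class_eq[OF equiv_pres_rel[OF vP_rels_words]])

lemma vP_gen_word:
  assumes "(i, j) \<in> vP_gens n"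
  shows "[gen_letter i j] \<in> words (vP_gens n)"
  using assms by (simp add: words_def)

lemma vP_hexagon:
  assumes "{i, j, k} \<subseteq> {1..n}" "distinct [i, j, k]"
  shows "vP_gen n i j \<otimes>\<^bsub>vP n\<^esub> vP_gen n i k \<otimes>\<^bsub>vP n\<^esub> vP_gen n j k = vP_gen n j k \<otimes>\<^bsub>vP n\<^esub> vP_gen n i k \<otimes>\<^bsub>vP n\<^esub> vP_gen n i j"
proof -
  have g: "(i, j) \<in> vP_gens n" "(i, k) \<in> vP_gens n" "(j, k) \<in> vP_gens n" using assms by (auto simp: vP_gens_def)
  have "([gen_letter i j, gen_letter i k, gen_letter j k], [gen_letter j k, gen_letter i k, gen_letter i j]) \<in> vP_rels n"
    unfolding vP_rels_def using assms by blast
  from pres_rel.relation[OF words_Nil words_Nil this]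
  have "pres_rel (vP_gens n) (vP_rels n) `` {[gen_letter i j, gen_letter i k, gen_letter j k]} =
    pres_rel (vP_gens n) (vP_rels n) `` {[gen_letter j k, gen_letter i k, gen_letter i j]}"
    by (intro vP_class_eq) simp
  then show ?thesis by (simp add: vP_gen_def vP_mult words_def g)
qed

lemma vP_square:
  assumes "{i, j, k, l} \<subseteq> {1..n}" "distinct [i, j, k, l]"
  shows "vP_gen n i j \<otimes>\<^bsub>vP n\<^esub> vP_gen n k l = vP_gen n k l \<otimes>\<^bsub>vP n\<^esub> vP_gen n i j"
proof -
  have g: "(i, j) \<in> vP_gens n" "(k, l) \<in> vP_gens n" using assms by (auto simp: vP_gens_def)
  have "([gen_letter i j, gen_letter k l], [gen_letter k l, gen_letter i j]) \<in> vP_rels n"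
    unfolding vP_rels_def using assms by blast
  from pres_rel.relation[OF words_Nil words_Nil this]
  have "pres_rel (vP_gens n) (vP_rels n) `` {[gen_letter i j, gen_letter k l]} =
    pres_rel (vP_gens n) (vP_rels n) `` {[gen_letter k l, gen_letter i j]}"
    by (intro vP_class_eq) simp
  then show ?thesis by (simp add: vP_gen_def vP_mult words_def g)
qed

lemma generate_vP: "generate (vP n) ((\<lambda>(i, j). vP_gen n i j) ` vP_gens n) = carrier (vP n)"
proof -
  interpret group "vP n" by (rule group_vP)
  let ?S = "(\<lambda>(i, j). vP_gen n i j) ` vP_gens n"
  let ?c = "\<lambda>u. pres_rel (vP_gens n) (vP_rels n) `` {u}"
  have S: "?S \<subseteq> carrier (vP n)" using vP_gen_in by auto
  have "?c u \<in> generate (vP n) ?S" if "u \<in> words (vP_gens n)" for u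
    using that
  proof (induction u)
    case Nil
    then show ?case using generate.one[of "vP n" ?S] by (simp add: vP_one)
  next
    case (Cons x u)
    obtain i j b where x: "x = ((i, j), b)" by (cases x) auto
    have w: "(i, j) \<in> vP_gens n" "u \<in> words (vP_gens n)" "[x] \<in> words (vP_gens n)" "[gen_letter i j] \<in> words (vP_gens n)"
      using Cons.prems by (auto simp: words_def x)
    have g: "vP_gen n i j \<in> ?S" using w(1) by force
    have "?c [x] \<in> generate (vP n) ?S"
    proof (cases b)
      case True
      then show ?thesis using generate.incl[OF g, of "vP n"] by (simp add: x vP_gen_def)
    next
      case False
      have "([((i, j), False), ((i, j), True)], []) \<in> pres_rel (vP_gens n) (vP_rels n)"
        using pres_rel.cancel[OF words_Nil words_Nil w(1), of False "vP_rels n"] by simp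
      then have "?c [x] \<otimes>\<^bsub>vP n\<^esub> vP_gen n i j = \<one>\<^bsub>vP n\<^esub>"
        unfolding vP_gen_def vP_mult[OF w(3,4)] vP_one using False by (intro vP_class_eq) (simp add: x)
      moreover have "?c [x] \<in> carrier (vP n)"
        using w(3) by (auto simp: vP_def presented_group_def intro: quotientI)
      ultimately have "?c [x] = inv\<^bsub>vP n\<^esub> vP_gen n i j" using vP_gen_in[OF w(1)] inv_equality by simp
      then show ?thesis using generate.inv[OF g, of "vP n"] by simp
    qed
    from generate.eng[OF this Cons.IH[OF w(2)]] show ?case unfolding vP_mult[OF w(3,2)] by simp
  qed
  then have "carrier (vP n) \<subseteq> generate (vP n) ?S" by (metis vP_carrierE subsetI)
  then show ?thesis using generate_incl[OF S] by blast
qed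

section \<open>The Magnus expansion\<close>

context edge_levels
begin

abbreviation "x \<equiv> xl (\<lambda>e. mon [e])"

text \<open>Without red edges, a generator with decreasing indices goes to the inverse of the image
  of the transposed generator. This respects all relations of \<open>vP n\<close> modulo the ideal,
  so elements of the subgroup can be evaluated on any word that represents them.\<close>

definition gen_val :: "nat \<times> nat \<Rightarrow> edge free_algebra" where
  "gen_val = (\<lambda>(i, j). if True \<in> C \<or> i < j then 1 + x i j else trunc_inv p (1 + x j i))"

definition letter_val :: "(nat \<times> nat) \<times> bool \<Rightarrow> edge free_algebra" where
  "letter_val = (\<lambda>(g, b). if b then gen_val g else trunc_inv p (gen_val g))"

text \<open>Depends on the chosen word, but only up to \<open>J 0\<close> by
  \<open>prod_letter_val_cong\<close>.\<close>

definition class_val :: "(nat \<times> nat) word set \<Rightarrow> edge free_algebra" where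
  "class_val A = prod_val letter_val (SOME u. u \<in> A)"

lemma J0_ideal: "two_sided_ideal (J 0)"
proof
  show "g * f \<in> J 0" if "f \<in> J 0" for f g using base.J_mult_left[OF that base.far_0, of g] by simp
  show "f * g \<in> J 0" if "f \<in> J 0" for f g using base.J_mult_right[OF that base.far_0, of g] by simp
qed (auto intro: J_0 J_diff)

sublocale I: two_sided_ideal "J 0"
  by (rule J0_ideal)

lemma weight_one_eq: "weight (\<lambda>_. 1) w = length w"
  by (simp add: weight_def sum_list_triv)

lemma inverse_pair_trunc_inv:
  assumes "u - 1 \<in> augmentation S"
  shows "I.inverse_pair u (trunc_inv p u)"
proof -
  have "1 - u \<in> augmentation S" using augmentation_neg[OF assms] by simp
  then have "(1 - u) ^ p \<in> J 0"
    using keys_augmentation_power by (intro base.J_dead) (auto simp: weight_one_eq)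
  then show ?thesis using I.minus by (simp add: I.inverse_pair_def trunc_inv_mult)
qed

lemma xl_augmentation:
  assumes "(i, j) \<in> vP_gens n" "True \<in> C \<or> i < j"
  shows "x i j \<in> augmentation (edges n C)"
proof -
  have "mon [e] \<in> augmentation (edges n C)" if "e \<in> edges n C" for e using that by (simp add: augmentation_def)
  then show ?thesis unfolding xl_def using assms by (auto simp: vP_gens_def intro!: augmentation_diff)
qed

lemma gen_val_augmentation:
  assumes "g \<in> vP_gens n" "p \<ge> 1"
  shows "gen_val g - 1 \<in> augmentation (edges n C)"
proof -
  obtain i j where g: "g = (i, j)" by (cases g)
  show ?thesis
  proof (cases "True \<in> C \<or> i < j")
    case True
    then show ?thesis using xl_augmentation assms by (simp add: g gen_val_def)
  next
    case False
    then have "x j i \<in> augmentation (edges n C)" using assms(1) by (intro xl_augmentation) (auto simp: g vP_gens_def)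
    then show ?thesis using False assms(2) augmentation_trunc_inv[of "1 + x j i"] by (simp add: g gen_val_def)
  qed
qed

lemma letter_val_augmentation:
  assumes "fst l \<in> vP_gens n" "p \<ge> 1"
  shows "letter_val l - 1 \<in> augmentation (edges n C)"
  using gen_val_augmentation[OF assms] augmentation_trunc_inv[OF gen_val_augmentation[OF assms] assms(2)]
  by (simp add: letter_val_def split_beta)

lemma prod_letter_val_augmentation:
  assumes "u \<in> words (vP_gens n)" "p \<ge> 1"
  shows "prod_val letter_val u - 1 \<in> augmentation (edges n C)"
  using assms(1)
proof (induction u)
  case (Cons l u)
  then have "fst l \<in> vP_gens n" "u \<in> words (vP_gens n)" by (auto simp: words_def)
  then show ?case using Cons.IH letter_val_augmentation[OF _ assms(2)] by (simp add: augmentation_mult_one)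
qed (simp add: augmentation_0)

lemma inverse_pair_gen_val:
  assumes "(i, j) \<in> vP_gens n" "True \<notin> C" "i < j"
  shows "I.inverse_pair (gen_val (i, j)) (gen_val (j, i))"
proof -
  have "(1 + x i j) - 1 \<in> augmentation (edges n C)" using assms xl_augmentation by simp
  from inverse_pair_trunc_inv[OF this] show ?thesis using assms by (simp add: gen_val_def)
qed

lemma gen_val_hexagon:
  assumes ijk: "{i, j, k} \<subseteq> {1..n}" "distinct [i, j, k]"
  shows "gen_val (i, j) * gen_val (i, k) * gen_val (j, k) - gen_val (j, k) * gen_val (i, k) * gen_val (i, j) \<in> J 0"
proof -
  have h: "gen_val (i, j) * gen_val (i, k) * gen_val (j, k) - gen_val (j, k) * gen_val (i, k) * gen_val (i, j) \<in> J 0"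
    if "{i, j, k} \<subseteq> {1..n}" "distinct [i, j, k]" "True \<in> C \<or> i < j \<and> j < k" for i j k
  proof -
    have "hexagon (\<lambda>e. mon [e]) i j k \<in> J (2 * N)" using that by (intro hexagon_in_J) auto
    then have "hexagon (\<lambda>e. mon [e]) i j k \<in> J 0" by (rule J_mono) simp
    then show ?thesis using that(3) by (auto simp: hexagon_def gen_val_def)
  qed
  show ?thesis
  proof (cases "True \<in> C")
    case True
    then show ?thesis using h ijk by blast
  next
    case False
    \<comment> \<open>The five other orders of the indices follow from the increasing one by
      inverting generators.\<close>
    have all: "gen_val (a, c) * gen_val (a, b) * gen_val (c, b) - gen_val (c, b) * gen_val (a, b) * gen_val (a, c) \<in> J 0"
      "gen_val (b, a) * gen_val (b, c) * gen_val (a, c) - gen_val (a, c) * gen_val (b, c) * gen_val (b, a) \<in> J 0"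
      "gen_val (b, c) * gen_val (b, a) * gen_val (c, a) - gen_val (c, a) * gen_val (b, a) * gen_val (b, c) \<in> J 0"
      "gen_val (c, a) * gen_val (c, b) * gen_val (a, b) - gen_val (a, b) * gen_val (c, b) * gen_val (c, a) \<in> J 0"
      "gen_val (c, b) * gen_val (c, a) * gen_val (b, a) - gen_val (b, a) * gen_val (c, a) * gen_val (c, b) \<in> J 0"
      if abc: "a < b" "b < c" "1 \<le> a" "c \<le> n" for a b c
    proof -
      have "I.inverse_pair (gen_val (a, b)) (gen_val (b, a))" "I.inverse_pair (gen_val (a, c)) (gen_val (c, a))"
        "I.inverse_pair (gen_val (b, c)) (gen_val (c, b))"
        using abc False by (auto intro!: inverse_pair_gen_val simp: vP_gens_def)
      from I.inverse_pair_hexagon[OF this h[of a b c]] abc show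
        "gen_val (a, c) * gen_val (a, b) * gen_val (c, b) - gen_val (c, b) * gen_val (a, b) * gen_val (a, c) \<in> J 0"
        "gen_val (b, a) * gen_val (b, c) * gen_val (a, c) - gen_val (a, c) * gen_val (b, c) * gen_val (b, a) \<in> J 0"
        "gen_val (b, c) * gen_val (b, a) * gen_val (c, a) - gen_val (c, a) * gen_val (b, a) * gen_val (b, c) \<in> J 0"
        "gen_val (c, a) * gen_val (c, b) * gen_val (a, b) - gen_val (a, b) * gen_val (c, b) * gen_val (c, a) \<in> J 0"
        "gen_val (c, b) * gen_val (c, a) * gen_val (b, a) - gen_val (b, a) * gen_val (c, a) * gen_val (c, b) \<in> J 0"
        by auto
    qed
    consider "i < j" "j < k" | "i < k" "k < j" | "j < i" "i < k" | "j < k" "k < i" | "k < i" "i < j" | "k < j" "j < i"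
      using ijk(2) by fastforce
    then show ?thesis
    proof cases
      case 1
      then show ?thesis using h ijk by blast
    next
      case 2
      then show ?thesis using all(1)[of i k j] ijk by auto
    next
      case 3
      then show ?thesis using all(2)[of j i k] ijk by auto
    next
      case 4
      then show ?thesis using all(4)[of j k i] ijk by auto
    next
      case 5
      then show ?thesis using all(3)[of k i j] ijk by auto
    next
      case 6
      then show ?thesis using all(5)[of k j i] ijk by auto
    qed
  qed
qed

lemma gen_val_square:
  assumes ijkl: "{i, j, k, l} \<subseteq> {1..n}" "distinct [i, j, k, l]"
  shows "gen_val (i, j) * gen_val (k, l) - gen_val (k, l) * gen_val (i, j) \<in> J 0"
proof -
  have s: "gen_val (i, j) * gen_val (k, l) - gen_val (k, l) * gen_val (i, j) \<in> J 0"
    if "{i, j, k, l} \<subseteq> {1..n}" "distinct [i, j, k, l]" "True \<in> C \<or> i < j \<and> k < l" for i j k l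
  proof -
    have "br (x i j) (x k l) \<in> J (2 * N)" using that by (intro square_in_J) auto
    then have "br (x i j) (x k l) \<in> J 0" by (rule J_mono) simp
    moreover have "(1 + x i j) * (1 + x k l) - (1 + x k l) * (1 + x i j) = br (x i j) (x k l)"
      by (simp add: br_def algebra_simps)
    ultimately show ?thesis using that(3) by (auto simp: gen_val_def)
  qed
  show ?thesis
  proof (cases "True \<in> C")
    case True
    then show ?thesis using s ijkl by blast
  next
    case False
    have inv: "gen_val (b, a) * g - g * gen_val (b, a) \<in> J 0"
      if "gen_val (a, b) * g - g * gen_val (a, b) \<in> J 0" "a < b" "1 \<le> a" "b \<le> n" for a b g
    proof (rule I.inverse_pair_commute[OF inverse_pair_gen_val that(1)])
      show "(a, b) \<in> vP_gens n" "True \<notin> C" "a < b" using that False by (auto simp: vP_gens_def)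
    qed
    have s2: "gen_val (i, j) * gen_val (k, l) - gen_val (k, l) * gen_val (i, j) \<in> J 0"
      if "k < l" "{i, j, k, l} \<subseteq> {1..n}" "distinct [i, j, k, l]" for i j k l
    proof (cases "i < j")
      case True
      then show ?thesis using s that by blast
    next
      case False
      then show ?thesis using inv[OF s[of j i k l]] that by auto
    qed
    show ?thesis
    proof (cases "k < l")
      case True
      then show ?thesis using s2 ijkl by blast
    next
      case False
      have "gen_val (l, k) * gen_val (i, j) - gen_val (i, j) * gen_val (l, k) \<in> J 0"
        by (rule I.sym_diff[OF s2]) (use False ijkl in auto)
      then have "gen_val (k, l) * gen_val (i, j) - gen_val (i, j) * gen_val (k, l) \<in> J 0"
        by (rule inv) (use False ijkl in auto)
      then show ?thesis by (rule I.sym_diff)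
    qed
  qed
qed

lemma prod_letter_val_cong:
  assumes "(u, v) \<in> pres_rel (vP_gens n) (vP_rels n)" "p \<ge> 1"
  shows "prod_val letter_val u - prod_val letter_val v \<in> J 0"
proof (rule prod_val_pres_rel[OF J0_ideal assms(1)])
  show "I.inverse_pair (letter_val (g, True)) (letter_val (g, False))" if "g \<in> vP_gens n" for g
    using inverse_pair_trunc_inv[OF gen_val_augmentation[OF that assms(2)]] by (simp add: letter_val_def)
  fix r s assume "(r, s) \<in> vP_rels n"
  then show "prod_val letter_val r - prod_val letter_val s \<in> J 0"
    unfolding vP_rels_def using gen_val_hexagon gen_val_square
    by (auto simp: letter_val_def mult.assoc)
qed

lemma class_val_word:
  assumes u: "u \<in> words (vP_gens n)" and p: "p \<ge> 1"
  shows "class_val (pres_rel (vP_gens n) (vP_rels n) `` {u}) - prod_val letter_val u \<in> J 0"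
proof -
  have "u \<in> pres_rel (vP_gens n) (vP_rels n) `` {u}" using pres_rel.refl[OF u] by blast
  then have "(SOME v. v \<in> pres_rel (vP_gens n) (vP_rels n) `` {u}) \<in> pres_rel (vP_gens n) (vP_rels n) `` {u}"
    by (rule someI)
  then have "(u, SOME v. v \<in> pres_rel (vP_gens n) (vP_rels n) `` {u}) \<in> pres_rel (vP_gens n) (vP_rels n)" by blast
  from I.sym_diff[OF prod_letter_val_cong[OF this p]] show ?thesis by (simp add: class_val_def)
qed

lemma class_val_augmentation:
  assumes "A \<in> carrier (vP n)" "p \<ge> 1"
  shows "class_val A - 1 \<in> augmentation (edges n C)"
proof -
  obtain u where u: "u \<in> words (vP_gens n)" "A = pres_rel (vP_gens n) (vP_rels n) `` {u}"
    using assms(1) by (rule vP_carrierE)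
  have "u \<in> A" using pres_rel.refl[OF u(1)] u(2) by blast
  then have "(SOME v. v \<in> A) \<in> A" by (rule someI)
  then have "(SOME v. v \<in> A) \<in> words (vP_gens n)" using pres_rel_subset[OF vP_rels_words] u(2) by blast
  then show ?thesis unfolding class_val_def using assms(2) by (rule prod_letter_val_augmentation)
qed

lemma class_val_mult:
  assumes "A \<in> carrier (vP n)" "B \<in> carrier (vP n)" and p: "p \<ge> 1"
  shows "class_val (A \<otimes>\<^bsub>vP n\<^esub> B) - class_val A * class_val B \<in> J 0"
proof -
  obtain u where u: "u \<in> words (vP_gens n)" "A = pres_rel (vP_gens n) (vP_rels n) `` {u}"
    using assms(1) by (rule vP_carrierE)
  obtain v where v: "v \<in> words (vP_gens n)" "B = pres_rel (vP_gens n) (vP_rels n) `` {v}"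
    using assms(2) by (rule vP_carrierE)
  have 1: "class_val (A \<otimes>\<^bsub>vP n\<^esub> B) - prod_val letter_val u * prod_val letter_val v \<in> J 0"
    using class_val_word[of "u @ v"] u v p by (simp add: vP_mult)
  have "(class_val A - prod_val letter_val u) * class_val B + prod_val letter_val u * (class_val B - prod_val letter_val v) \<in> J 0"
    using class_val_word[OF u(1) p] class_val_word[OF v(1) p] u v by (intro I.add I.mult_left I.mult_right) auto
  then have 2: "class_val A * class_val B - prod_val letter_val u * prod_val letter_val v \<in> J 0"
    by (simp add: algebra_simps)
  show ?thesis by (rule I.trans_diff[OF 1 I.sym_diff[OF 2]])
qed

lemma class_val_gen:
  assumes "(i, j) \<in> vP_gens n" "True \<in> C \<or> i < j" "p \<ge> 1"
  shows "x i j - (class_val (vP_gen n i j) - 1) \<in> J 0"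
proof -
  have "class_val (vP_gen n i j) - (1 + x i j) \<in> J 0"
    using class_val_word[OF vP_gen_word[OF assms(1)] assms(3)] assms(2)
    by (simp add: vP_gen_def letter_val_def gen_val_def)
  from I.sym_diff[OF this] show ?thesis by (simp add: algebra_simps)
qed

text \<open>\<open>class_val\<close> lives on \<open>vP n\<close>, so a subgroup with the inherited
  operations is covered. Blue and red letters are recovered as \<open>x i j\<close> and
  \<open>x i j + x j i\<close>, and each \<open>x i j\<close> is a generator value minus one modulo
  \<open>J 0\<close>.\<close>

lemma magnus_class_val:
  fixes G :: "(nat \<times> nat) word set monoid"
  assumes G: "lcs_basis G a \<chi>" "carrier G \<subseteq> carrier (vP n)" "\<And>A B. A \<otimes>\<^bsub>G\<^esub> B = A \<otimes>\<^bsub>vP n\<^esub> B" "\<one>\<^bsub>G\<^esub> = \<one>\<^bsub>vP n\<^esub>"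
    and gens: "\<And>i j. (i, j) \<in> vP_gens n \<Longrightarrow> True \<in> C \<or> i < j \<Longrightarrow> vP_gen n i j \<in> carrier G" and p: "p \<ge> 1"
  shows "magnus G a \<chi> (J 0) (edges n C) class_val p"
proof -
  interpret lcs_basis G a \<chi> by fact
  show ?thesis
  proof unfold_locales
    show "fa.subspace (J 0)" by (rule base.J_subspace)
    show "f * g \<in> J 0" "g * f \<in> J 0" if "f \<in> J 0" for f g using that I.mult_left I.mult_right by blast+
    show "mon w \<in> J 0" if "p \<le> length w" for w using that by (intro base.J_dead) (simp add: weight_one_eq)
    show "class_val (A \<otimes>\<^bsub>G\<^esub> B) - class_val A * class_val B \<in> J 0" if "A \<in> carrier G" "B \<in> carrier G" for A B
      unfolding G(3) using that G(2) p by (intro class_val_mult) auto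
    show "class_val \<one>\<^bsub>G\<^esub> - 1 \<in> J 0" unfolding G(4) vP_one using class_val_word[OF words_Nil p] by simp
    show "class_val g - 1 \<in> fa.span (J 0 \<union> {mon w |w. set w \<subseteq> edges n C \<and> 1 \<le> length w})" if "g \<in> carrier G" for g
      using augmentation_in_span[OF class_val_augmentation[of g]] that G(2) p
        fa.span_mono[of "{mon w |w. set w \<subseteq> edges n C \<and> 1 \<le> length w}" "J 0 \<union> {mon w |w. set w \<subseteq> edges n C \<and> 1 \<le> length w}"]
      by blast
    show "mon [e] \<in> fa.span (J 0 \<union> {class_val g - 1 |g. g \<in> carrier G})" if "e \<in> edges n C" for e
    proof -
      obtain c i j where e: "e = (c, i, j)" by (cases e)
      have xs: "x i j \<in> fa.span (J 0 \<union> {class_val g - 1 |g. g \<in> carrier G})"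
        if "(i, j) \<in> vP_gens n" "True \<in> C \<or> i < j" for i j
      proof -
        have "x i j - (class_val (vP_gen n i j) - 1) \<in> fa.span (J 0 \<union> {class_val g - 1 |g. g \<in> carrier G})"
          using class_val_gen[OF that p] by (intro fa.span_base) blast
        moreover have "class_val (vP_gen n i j) - 1 \<in> fa.span (J 0 \<union> {class_val g - 1 |g. g \<in> carrier G})"
          using gens[OF that] by (intro fa.span_base) blast
        ultimately show ?thesis using fa.span_add by fastforce
      qed
      have ij: "(i, j) \<in> vP_gens n" "(j, i) \<in> vP_gens n" "i < j" using that by (auto simp: e vP_gens_def)
      show ?thesis
      proof (cases c)
        case True
        then have "True \<in> C" using that by (simp add: e)
        then have "x i j + x j i \<in> fa.span (J 0 \<union> {class_val g - 1 |g. g \<in> carrier G})"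
          using xs ij by (intro fa.span_add) auto
        then show ?thesis using True red_eq_xl[OF ij(3), of "\<lambda>e. mon [e]"] by (simp add: e)
      next
        case False
        then show ?thesis using xs[OF ij(1)] ij(3) blue_eq_xl[OF ij(3), of "\<lambda>e. mon [e]"] by (simp add: e)
      qed
    qed
  qed
qed

end

declare One_nat_def [simp]

section \<open>Counting cliques\<close>

lemma finite_edges: "finite (edges n C)"
proof -
  have "edges n C \<subseteq> UNIV \<times> {1..n} \<times> {1..n}" by auto
  then show ?thesis by (rule finite_subset) auto
qed

definition edge_cliques :: "nat \<Rightarrow> bool set \<Rightarrow> nat \<Rightarrow> edge set set" where
  "edge_cliques n C m = {D \<in> cliques (compatible_on n C) (edges n C). card D = m}"

lemma edge_cliques_iff:
  "D \<in> edge_cliques n C m \<longleftrightarrow> D \<subseteq> edges n C \<and> card D = m \<and> (\<forall>e\<in>D. \<forall>f\<in>D. e \<noteq> f \<longrightarrow> compatible e f)"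
  unfolding edge_cliques_def cliques_def compatible_on_def by blast

lemma finite_edge_cliques: "finite (edge_cliques n C m)"
proof (rule finite_subset)
  show "edge_cliques n C m \<subseteq> Pow (edges n C)" unfolding edge_cliques_def cliques_def by blast
qed (simp add: finite_edges)

lemma edge_cliques_finite: "D \<in> edge_cliques n C m \<Longrightarrow> finite D"
  using finite_edges finite_subset unfolding edge_cliques_iff by blast

lemma edge_cliques_edge: "D \<in> edge_cliques n C m \<Longrightarrow> e \<in> D \<Longrightarrow> e \<in> edges n C"
  by (auto simp: edge_cliques_iff)

lemma edges_target: "e \<in> edges n C \<Longrightarrow> snd (snd e) \<in> {1..n}"
  by (cases e) auto

lemma edges_0: "edges 0 C = {}"
  by (auto simp: edges_def)

text \<open>Distinct edges of a clique end in distinct vertices, so \<open>m\<close> edges leave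
  exactly \<open>n - m\<close> roots.\<close>

lemma inj_on_target:
  assumes "D \<in> edge_cliques n C m"
  shows "inj_on (\<lambda>e. snd (snd e)) D"
proof (rule inj_onI)
  fix e f assume ef: "e \<in> D" "f \<in> D" "snd (snd e) = snd (snd f)"
  show "e = f"
  proof (rule ccontr)
    assume "e \<noteq> f"
    then have "compatible e f" "e \<in> edges n C" "f \<in> edges n C" using assms ef by (auto simp: edge_cliques_iff)
    then show False using ef(3) by (cases e; cases f) (auto simp: compatible_def)
  qed
qed

text \<open>A clique is a forest of increasing trees, and a new vertex is attached to any vertex by a red
  edge or to a root by a blue edge.\<close>

definition attachable :: "nat \<Rightarrow> bool set \<Rightarrow> edge set \<Rightarrow> edge set" where
  "attachable n C D = {(c, i, Suc n) | c i. i \<in> {1..n} \<and> (if c then True \<in> C else i \<notin> (\<lambda>e. snd (snd e)) ` D)}"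

lemma card_attachable:
  assumes D: "D \<in> edge_cliques n C m"
  shows "finite (attachable n C D)" "card (attachable n C D) = (if True \<in> C then n else 0) + (n - m)"
proof -
  define t where "t = (\<lambda>e :: edge. snd (snd e)) ` D"
  let ?R = "(\<lambda>i. (True, i, Suc n)) ` (if True \<in> C then {1..n} else {})"
  let ?B = "(\<lambda>i. (False, i, Suc n)) ` ({1..n} - t)"
  have e: "attachable n C D = ?R \<union> ?B"
  proof (rule Set.set_eqI)
    fix e :: edge
    obtain c i j where e: "e = (c, i, j)" by (cases e)
    have "e \<in> attachable n C D \<longleftrightarrow> i \<in> {1..n} \<and> j = Suc n \<and> (if c then True \<in> C else i \<notin> t)"
      unfolding attachable_def t_def[symmetric] e by simp blast
    also have "\<dots> \<longleftrightarrow> e \<in> ?R \<union> ?B" unfolding e by (cases c) (simp_all add: image_iff, blast)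
    finally show "e \<in> attachable n C D \<longleftrightarrow> e \<in> ?R \<union> ?B" .
  qed
  have t: "card t = m" using card_image[OF inj_on_target[OF D]] D by (simp add: edge_cliques_def t_def)
  have t': "t \<subseteq> {1..n}" using edges_target edge_cliques_edge[OF D] unfolding t_def by blast
  have f: "finite t" using edge_cliques_finite[OF D] by (simp add: t_def)
  show "finite (attachable n C D)" unfolding e by auto
  have "card ?B = n - m" using card_Diff_subset[OF f t'] t by (subst card_image) (auto intro: inj_onI)
  moreover have "card ?R = (if True \<in> C then n else 0)" by (subst card_image) (auto intro: inj_onI)
  moreover have "?R \<inter> ?B = {}" by auto
  ultimately show "card (attachable n C D) = (if True \<in> C then n else 0) + (n - m)"
    unfolding e by (subst card_Un_disjoint) auto
qed

text \<open>The last vertex can only be a target and is one at most once. The edge ending there, if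
  any, can be removed and recovered from its colour and its source.\<close>

lemma edge_cliques_Suc:
  "edge_cliques (Suc n) C (Suc m) = edge_cliques n C (Suc m) \<union>
    (\<lambda>(D, e). insert e D) ` (SIGMA D : edge_cliques n C m. attachable n C D)" (is "?L = ?A \<union> ?B")
proof (intro equalityI subsetI)
  fix D assume D: "D \<in> ?L"
  show "D \<in> ?A \<union> ?B"
  proof (cases "D \<subseteq> edges n C")
    case True
    then show ?thesis using D by (simp add: edge_cliques_iff)
  next
    case False
    then obtain e where e: "e \<in> D" "e \<notin> edges n C" by blast
    obtain c i j where cij: "e = (c, i, j)" by (cases e)
    have j: "j = Suc n" "1 \<le> i" "i \<le> n" "c \<longrightarrow> True \<in> C" using e D by (force simp: edge_cliques_iff cij)+
    have D': "D - {e} \<in> edge_cliques n C m"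
    proof -
      have "f \<in> edges n C" if "f \<in> D - {e}" for f
      proof -
        have "snd (snd f) \<noteq> Suc n" using inj_onD[OF inj_on_target[OF D], of f e] that e j(1) by (auto simp: cij)
        moreover have "f \<in> edges (Suc n) C" using D that by (auto simp: edge_cliques_iff)
        ultimately show ?thesis by (cases f) auto
      qed
      moreover have "card (D - {e}) = m" using D e(1) edge_cliques_finite[OF D] by (simp add: edge_cliques_iff)
      ultimately show ?thesis using D by (auto simp: edge_cliques_iff)
    qed
    have "c \<or> i \<notin> (\<lambda>e. snd (snd e)) ` (D - {e})"
    proof (rule ccontr)
      assume "\<not> (c \<or> i \<notin> (\<lambda>e. snd (snd e)) ` (D - {e}))"
      then obtain g where g: "\<not> c" "g \<in> D - {e}" "i = snd (snd g)" by blast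
      moreover obtain d k l where "g = (d, k, l)" by (cases g)
      ultimately have f: "\<not> c" "(d, k, l) \<in> D - {e}" "i = l" by auto
      then have "compatible (d, k, l) e" "(d, k, l) \<in> edges n C"
        using D D' e(1) by (auto simp: edge_cliques_iff)
      then show False using f j by (auto simp: compatible_def cij)
    qed
    then have "e \<in> attachable n C (D - {e})" using j by (auto simp: attachable_def cij)
    then have "(\<lambda>(D, e). insert e D) (D - {e}, e) \<in> ?B" using D' by (intro imageI) auto
    then show ?thesis using e(1) by (simp add: insert_absorb)
  qed
next
  fix D assume "D \<in> ?A \<union> ?B"
  then show "D \<in> ?L"
  proof
    assume D: "D \<in> ?A"
    moreover have "edges n C \<subseteq> edges (Suc n) C" by auto
    ultimately show ?thesis by (auto simp: edge_cliques_iff)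
  next
    assume "D \<in> ?B"
    then obtain D' e where D': "D' \<in> edge_cliques n C m" "e \<in> attachable n C D'" "D = insert e D'" by auto
    obtain c i where e: "e = (c, i, Suc n)" "1 \<le> i" "i \<le> n" "if c then True \<in> C else i \<notin> (\<lambda>e. snd (snd e)) ` D'"
      using D'(2) by (auto simp: attachable_def)
    have c: "compatible e f \<and> compatible f e" if "f \<in> D'" for f
    proof -
      obtain d k l where f: "f = (d, k, l)" by (cases f)
      have "f \<in> edges n C" using D'(1) that by (auto simp: edge_cliques_iff)
      moreover have "c \<or> i \<noteq> l" using e(4) that f by (cases c) force+
      ultimately show ?thesis using e by (auto simp: f compatible_def)
    qed
    have "e \<notin> D'" using D'(1) e(1) by (force simp: edge_cliques_iff)
    moreover have "e \<in> edges (Suc n) C" using e by (auto split: if_splits)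
    moreover have "edges n C \<subseteq> edges (Suc n) C" by auto
    ultimately show ?thesis using D'(1,3) c edge_cliques_finite[OF D'(1)] by (auto simp: edge_cliques_iff)
  qed
qed

lemma card_edge_cliques_Suc:
  "card (edge_cliques (Suc n) C (Suc m)) =
    card (edge_cliques n C (Suc m)) + ((if True \<in> C then n else 0) + (n - m)) * card (edge_cliques n C m)"
proof -
  let ?S = "SIGMA D : edge_cliques n C m. attachable n C D"
  have "card ((\<lambda>(D, e). insert e D) ` ?S) = card ?S"
  proof (rule card_image, rule inj_onI, clarify)
    fix D e D' e' assume D: "D \<in> edge_cliques n C m" "D' \<in> edge_cliques n C m"
      and e: "e \<in> attachable n C D" "e' \<in> attachable n C D'" and eq: "insert e D = insert e' D'"
    have n: "e \<notin> edges n C" "e' \<notin> edges n C" using e by (auto simp: attachable_def)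
    have "D = insert e D \<inter> edges n C" "D' = insert e' D' \<inter> edges n C" using D n by (auto simp: edge_cliques_iff)
    then have "D = D'" using eq by simp
    moreover have "e = e'" using eq n D by (auto simp: edge_cliques_iff)
    ultimately show "D = D' \<and> e = e'" by simp
  qed
  also have "card ?S = ((if True \<in> C then n else 0) + (n - m)) * card (edge_cliques n C m)"
    using card_attachable by (simp add: card_SigmaI finite_edge_cliques)
  finally have "card ((\<lambda>(D, e). insert e D) ` ?S) = ((if True \<in> C then n else 0) + (n - m)) * card (edge_cliques n C m)" .
  moreover have "finite ?S" using card_attachable(1) finite_edge_cliques by blast
  moreover have "edge_cliques n C (Suc m) \<inter> (\<lambda>(D, e). insert e D) ` ?S = {}"
    by (auto simp: edge_cliques_iff attachable_def)
  ultimately show ?thesis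
    unfolding edge_cliques_Suc by (subst card_Un_disjoint) (auto simp: finite_edge_cliques)
qed

lemma edge_cliques_0: "edge_cliques n C 0 = {{}}"
proof -
  have "D = {}" if "D \<in> edge_cliques n C 0" for D
    using that edge_cliques_finite[OF that] by (simp add: edge_cliques_iff)
  then show ?thesis by (intro equalityI subsetI) (blast, simp add: edge_cliques_iff)
qed

text \<open>A forest has fewer edges than vertices. The case \<open>n = 0\<close> is an exception,
  since the empty clique has \<open>m = n\<close>.\<close>

lemma card_edge_cliques_large: "n \<ge> 1 \<Longrightarrow> m \<ge> n \<Longrightarrow> card (edge_cliques n C m) = 0"
proof (induction n arbitrary: m)
  case (Suc n)
  have "m \<noteq> 0" using Suc.prems by simp
  then obtain m' where m: "m = Suc m'" by (auto simp: gr0_conv_Suc)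
  have e: "edge_cliques 0 C (Suc m') = {}" by (auto simp: edge_cliques_iff edges_0)
  show ?case
    using Suc.IH[of m'] Suc.IH[of "Suc m'"] Suc.prems unfolding m card_edge_cliques_Suc[of n]
    by (cases "n = 0") (auto simp: e)
qed simp

text \<open>Indexed by the number \<open>n - m\<close> of roots, the recursion for cliques becomes
  that of \<open>b\<close>: a new isolated vertex adds a root, a blue edge may start at any root,
  and a red edge at any of the \<open>n\<close> old vertices.\<close>

lemma card_edge_cliques:
  assumes rec: "\<And>n k. b (Suc n) (Suc k) = b n k + ((if True \<in> C then n else 0) + Suc k) * b n (Suc k)"
    and zero: "\<And>n. b (Suc n) 0 = 0" and b: "\<And>n. b n n = 1"
  shows "m \<le> n \<Longrightarrow> card (edge_cliques n C m) = b n (n - m)"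
proof (induction n arbitrary: m)
  case 0
  then show ?case by (simp add: edge_cliques_0 b)
next
  case (Suc n)
  show ?case
  proof (cases m)
    case 0
    then show ?thesis by (simp add: edge_cliques_0 b)
  next
    case m: (Suc m')
    show ?thesis
    proof (cases "m' = n")
      case True
      then show ?thesis using card_edge_cliques_large[of "Suc n" m C] by (simp add: m zero)
    next
      case False
      then obtain k where k: "n - m' = Suc k" "n - Suc m' = k" using Suc.prems m by (cases "n - m'") auto
      have "card (edge_cliques n C m') = b n (Suc k)" "card (edge_cliques n C (Suc m')) = b n k"
        using Suc.IH[of m'] Suc.IH[of "Suc m'"] Suc.prems m False k by auto
      then show ?thesis using k by (simp add: m card_edge_cliques_Suc rec)
    qed
  qed
qed

lemma clique_series_edges:
  assumes "n \<ge> 1" and b: "\<And>m. m \<le> n \<Longrightarrow> card (edge_cliques n C m) = b (n - m)"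
  shows "commutation.clique_series (compatible_on n C) (\<lambda>_. 1) (edges n C) =
    (\<Sum>m\<le>n. fps_const ((- 1) ^ m * real (b (n - m))) * fps_X ^ m)"
proof -
  interpret commutation "compatible_on n C"
    by unfold_locales (auto simp: compatible_on_def compatible_def disjoint_edges_def split: prod.splits)
  let ?c = "cliques (compatible_on n C) (edges n C)"
  have fin: "finite ?c" by (rule finite_subset[of _ "Pow (edges n C)"]) (auto simp: cliques_def finite_edges)
  have le: "card D \<le> n" if "D \<in> ?c" for D
  proof (rule ccontr)
    assume "\<not> card D \<le> n"
    then have "edge_cliques n C (card D) = {}"
      using card_edge_cliques_large[of n "card D" C] assms(1) finite_edge_cliques by auto
    then show False using that unfolding edge_cliques_def by blast
  qed
  have "clique_series (\<lambda>_. 1) (edges n C) = (\<Sum>D\<in>?c. (- 1) ^ card D * fps_X ^ card D)"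
    by (simp add: clique_series_def)
  also have "\<dots> = (\<Sum>m\<le>n. \<Sum>D\<in>{D\<in>?c. card D = m}. (- 1) ^ card D * fps_X ^ card D)"
    by (rule sum.group[symmetric]) (use fin le in auto)
  also have "\<dots> = (\<Sum>m\<le>n. fps_const ((- 1) ^ m * real (b (n - m))) * fps_X ^ m)"
  proof (intro sum.cong HOL.refl)
    fix m assume "m \<in> {..n}"
    then have c: "card {D \<in> ?c. card D = m} = b (n - m)" using b by (simp add: edge_cliques_def)
    have "(\<Sum>D\<in>{D\<in>?c. card D = m}. (- 1) ^ card D * fps_X ^ card D :: real fps) =
      of_nat (card {D \<in> ?c. card D = m}) * ((- 1) ^ m * fps_X ^ m)"
      by simp
    also have "\<dots> = fps_const ((- 1) ^ m * real (b (n - m))) * fps_X ^ m"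
      unfolding c by (simp add: fps_of_nat mult_ac flip: fps_const_mult fps_const_power fps_const_neg)
    finally show "(\<Sum>D\<in>{D\<in>?c. card D = m}. (- 1) ^ card D * fps_X ^ card D :: real fps) =
      fps_const ((- 1) ^ m * real (b (n - m))) * fps_X ^ m" .
  qed
  finally show ?thesis .
qed

section \<open>Lah numbers\<close>

text \<open>Disjointness of different nonempty lists contains the injectivity of \<open>set\<close>,
  which leaves plain conditions on lists for the recursion.\<close>

definition ordered_partitions :: "nat \<Rightarrow> nat \<Rightarrow> nat list set set" where
  "ordered_partitions n k = {P. (\<forall>xs\<in>P. distinct xs \<and> xs \<noteq> []) \<and>
     (\<forall>xs\<in>P. \<forall>ys\<in>P. xs \<noteq> ys \<longrightarrow> set xs \<inter> set ys = {}) \<and> \<Union>(set ` P) = {1..n} \<and> card P = k}"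

lemma Lah_eq: "Lah n k = card (ordered_partitions n k)"
proof -
  have "{P :: nat list set. (\<forall>xs\<in>P. distinct xs) \<and> inj_on set P \<and> partition_on {1..n} (set ` P) \<and> card P = k} =
    ordered_partitions n k"
  proof (intro equalityI subsetI)
    fix P :: "nat list set"
    assume "P \<in> {P. (\<forall>xs\<in>P. distinct xs) \<and> inj_on set P \<and> partition_on {1..n} (set ` P) \<and> card P = k}"
    then have P: "\<forall>xs\<in>P. distinct xs" "inj_on set P" "partition_on {1..n} (set ` P)" "card P = k" by auto
    have "set xs \<inter> set ys = {}" if "xs \<in> P" "ys \<in> P" "xs \<noteq> ys" for xs ys
      using partition_onD2[OF P(3)] that inj_onD[OF P(2), of xs ys] unfolding disjoint_def by blast
    moreover have "xs \<noteq> []" if "xs \<in> P" for xs using partition_onD3[OF P(3)] that by auto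
    moreover have "\<Union>(set ` P) = {1..n}" using partition_onD1[OF P(3)] by simp
    ultimately show "P \<in> ordered_partitions n k" using P by (auto simp: ordered_partitions_def)
  next
    fix P assume P: "P \<in> ordered_partitions n k"
    then have "inj_on set P" unfolding ordered_partitions_def inj_on_def
      by (metis (mono_tags, lifting) inf.idem mem_Collect_eq set_empty)
    moreover have "partition_on {1..n} (set ` P)"
    proof (rule partition_onI)
      fix p q assume "p \<in> set ` P" "q \<in> set ` P" "p \<noteq> q"
      then obtain xs ys where "xs \<in> P" "ys \<in> P" "p = set xs" "q = set ys" "xs \<noteq> ys" by blast
      then show "disjnt p q" using P by (simp add: ordered_partitions_def disjnt_def)
    qed (use P in \<open>auto simp: ordered_partitions_def\<close>)
    ultimately show "P \<in> {P. (\<forall>xs\<in>P. distinct xs) \<and> inj_on set P \<and> partition_on {1..n} (set ` P) \<and> card P = k}"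
      using P by (auto simp: ordered_partitions_def)
  qed
  then show ?thesis by (simp add: Lah_def)
qed

lemma ordered_partitions_unique:
  assumes "P \<in> ordered_partitions n k" "xs \<in> P" "ys \<in> P" "x \<in> set xs" "x \<in> set ys"
  shows "xs = ys"
  using assms unfolding ordered_partitions_def by blast

lemma ordered_partitions_list:
  assumes "P \<in> ordered_partitions n k" "xs \<in> P"
  shows "distinct xs" "xs \<noteq> []" "set xs \<subseteq> {1..n}"
  using assms unfolding ordered_partitions_def by blast+

lemma ordered_partitions_Union:
  assumes "P \<in> ordered_partitions n k"
  shows "\<Union>(set ` P) = {1..n}" "card P = k"
  using assms unfolding ordered_partitions_def by blast+

lemmas ordered_partitionsD = ordered_partitions_list ordered_partitions_unique ordered_partitions_Union

lemma finite_ordered_partition: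
  assumes "P \<in> ordered_partitions n k"
  shows "finite P"
proof -
  have "inj_on set P" using ordered_partitionsD(2,4)[OF assms] unfolding inj_on_def
    by (metis equals0I set_empty)
  moreover have "set ` P \<subseteq> Pow {1..n}" using ordered_partitionsD(3)[OF assms] by blast
  ultimately show ?thesis by (meson finite_Pow_iff finite_atLeastAtMost finite_imageD finite_subset)
qed

lemma finite_ordered_partitions: "finite (ordered_partitions n k)"
proof -
  have "ordered_partitions n k \<subseteq> Pow {xs. set xs \<subseteq> {1..n} \<and> distinct xs}"
    using ordered_partitionsD(1,3) by blast
  then show ?thesis by (rule finite_subset) (simp add: finite_subset_distinct)
qed

definition splittings :: "nat list set \<Rightarrow> (nat list \<times> nat list) set" where
  "splittings P = {(xs, ys). xs @ ys \<in> P}"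

text \<open>A list of length \<open>l\<close> can be split in \<open>l + 1\<close> ways, and the
  lengths of the \<open>k\<close> lists add up to \<open>n\<close>. These are the places where a new
  element can be inserted into an existing block.\<close>

lemma card_splittings:
  assumes "P \<in> ordered_partitions n k"
  shows "finite (splittings P)" "card (splittings P) = n + k"
proof -
  note P = ordered_partitionsD[OF assms] and fin = finite_ordered_partition[OF assms]
  have e: "splittings P = (\<lambda>(zs, i). (take i zs, drop i zs)) ` (SIGMA zs : P. {..length zs})" (is "_ = ?f ` ?S")
  proof (intro equalityI subsetI)
    fix s assume "s \<in> splittings P"
    then obtain xs ys where s: "s = (xs, ys)" "xs @ ys \<in> P" by (auto simp: splittings_def)
    then have "s = ?f (xs @ ys, length xs)" "(xs @ ys, length xs) \<in> ?S" by auto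
    then show "s \<in> ?f ` ?S" by blast
  qed (auto simp: splittings_def)
  have inj: "inj_on ?f ?S"
  proof (rule inj_onI, clarify)
    fix zs i zs' i' assume h: "i \<le> length zs" "i' \<le> length zs'" "take i zs = take i' zs'" "drop i zs = drop i' zs'"
    have "zs = zs'" using h(3,4) by (metis append_take_drop_id)
    moreover have "i = i'" using arg_cong[OF h(3), of length] h(1,2) by simp
    ultimately show "zs = zs' \<and> i = i'" ..
  qed
  show "finite (splittings P)" unfolding e using fin by auto
  have "card (splittings P) = (\<Sum>zs\<in>P. Suc (length zs))"
    unfolding e card_image[OF inj] using fin by (subst card_SigmaI) auto
  also have "\<dots> = (\<Sum>zs\<in>P. length zs) + k" using P(6) by (simp add: sum_Suc)
  also have "(\<Sum>zs\<in>P. length zs) = (\<Sum>zs\<in>P. card (set zs))" using P(1) by (simp add: distinct_card)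
  also have "\<dots> = card (\<Union>(set ` P))" using fin P(4)
    by (subst card_UN_disjoint) auto
  finally show "card (splittings P) = n + k" using P(5) by simp
qed

definition insert_max :: "nat \<Rightarrow> nat list set \<times> nat list \<times> nat list \<Rightarrow> nat list set" where
  "insert_max n = (\<lambda>(P, xs, ys). insert (xs @ Suc n # ys) (P - {xs @ ys}))"

text \<open>Deleting the largest element either empties its list or leaves a nonempty list together
  with the position of the deleted element.\<close>

lemma ordered_partitions_Suc:
  "ordered_partitions (Suc n) (Suc k) = insert [Suc n] ` ordered_partitions n k \<union>
    insert_max n ` (SIGMA P : ordered_partitions n (Suc k). splittings P)" (is "?L = ?A \<union> ?B")
proof (intro equalityI subsetI)
  fix Q assume Q: "Q \<in> ?L"
  note QD = ordered_partitionsD[OF Q] and finQ = finite_ordered_partition[OF Q]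
  obtain zs where zs: "zs \<in> Q" "Suc n \<in> set zs" using QD(5) by (metis UN_E atLeastAtMost_iff le_add1 order_refl plus_1_eq_Suc)
  obtain xs ys where xy: "zs = xs @ Suc n # ys" using zs(2) by (meson split_list)
  have other: "set ws \<subseteq> {1..n}" "set ws \<inter> set zs = {}" if "ws \<in> Q - {zs}" for ws
  proof -
    show d: "set ws \<inter> set zs = {}" using that zs(1) QD(4) by blast
    have "set ws \<subseteq> {1..Suc n}" using that QD(3) by blast
    moreover have "Suc n \<notin> set ws" using d zs(2) by blast
    ultimately show "set ws \<subseteq> {1..n}" by (metis atLeastAtMost_insertL atLeastAtMostSuc_conv le_Suc_eq le_add1 plus_1_eq_Suc subset_insert)
  qed
  have xy': "distinct (xs @ ys)" "Suc n \<notin> set (xs @ ys)" using QD(1)[OF zs(1)] by (auto simp: xy)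
  have s: "set (xs @ ys) \<subseteq> {1..n}"
    using QD(3)[OF zs(1)] xy' by (force simp: xy le_Suc_eq)
  have un: "\<Union>(set ` (Q - {zs})) \<union> set (xs @ ys) = {1..n}"
  proof
    show "\<Union>(set ` (Q - {zs})) \<union> set (xs @ ys) \<subseteq> {1..n}" using other(1) s by blast
    show "{1..n} \<subseteq> \<Union>(set ` (Q - {zs})) \<union> set (xs @ ys)"
    proof
      fix v assume v: "v \<in> {1..n}"
      then have "v \<in> \<Union>(set ` Q)" using QD(5) by simp
      then obtain ws where ws: "ws \<in> Q" "v \<in> set ws" by blast
      show "v \<in> \<Union>(set ` (Q - {zs})) \<union> set (xs @ ys)" using ws v by (cases "ws = zs") (auto simp: xy)
    qed
  qed
  have card: "card (Q - {zs}) = k" using QD(6) zs(1) finQ by simp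
  show "Q \<in> ?A \<union> ?B"
  proof (cases "xs @ ys = []")
    case True
    then have "Q - {zs} \<in> ordered_partitions n k"
      using QD un card unfolding ordered_partitions_def by auto
    moreover have "Q = insert [Suc n] (Q - {zs})" using True zs(1) by (auto simp: xy)
    ultimately show ?thesis by blast
  next
    case False
    let ?P = "insert (xs @ ys) (Q - {zs})"
    have ni: "xs @ ys \<notin> Q - {zs}"
    proof
      assume "xs @ ys \<in> Q - {zs}"
      moreover obtain v where "v \<in> set (xs @ ys)" using False by (meson equals0I set_empty)
      ultimately show False using other(2)[of "xs @ ys"] by (auto simp: xy)
    qed
    have "?P \<in> ordered_partitions n (Suc k)"
      unfolding ordered_partitions_def
    proof (intro CollectI conjI ballI impI)
      show "card ?P = Suc k" using card ni finQ by simp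
      show "\<Union>(set ` ?P) = {1..n}" using un by auto
      fix us assume us: "us \<in> ?P"
      then show "distinct us" "us \<noteq> []" using xy' False QD(1,2) by auto
      fix vs assume vs: "vs \<in> ?P" "us \<noteq> vs"
      have "set (xs @ ys) \<subseteq> set zs" by (auto simp: xy)
      then show "set us \<inter> set vs = {}" using us vs other(2) QD(4) by blast
    qed
    moreover have "(xs, ys) \<in> splittings ?P" by (simp add: splittings_def)
    moreover have "Q = insert_max n (?P, xs, ys)"
      using ni zs(1) by (auto simp: insert_max_def xy)
    ultimately show ?thesis by blast
  qed
next
  fix Q assume "Q \<in> ?A \<union> ?B"
  then show "Q \<in> ?L"
  proof
    assume "Q \<in> ?A"
    then obtain P where P: "P \<in> ordered_partitions n k" "Q = insert [Suc n] P" by blast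
    note PD = ordered_partitionsD[OF P(1)]
    have ni: "Suc n \<notin> set xs" if "xs \<in> P" for xs using PD(3)[OF that] by auto
    then have "[Suc n] \<notin> P" by force
    then have "card Q = Suc k" using PD(6) finite_ordered_partition[OF P(1)] by (simp add: P(2))
    moreover have "\<Union>(set ` Q) = {1..Suc n}" using PD(5) by (simp add: P(2) atLeastAtMostSuc_conv)
    moreover have "\<forall>xs\<in>Q. \<forall>ys\<in>Q. xs \<noteq> ys \<longrightarrow> set xs \<inter> set ys = {}" using PD(4) ni by (auto simp: P(2))
    ultimately show ?thesis using PD(1,2) by (auto simp: ordered_partitions_def P(2))
  next
    assume "Q \<in> ?B"
    then obtain P xs ys where P: "P \<in> ordered_partitions n (Suc k)" "xs @ ys \<in> P" "Q = insert_max n (P, xs, ys)"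
      by (auto simp: splittings_def)
    note PD = ordered_partitionsD[OF P(1)]
    let ?z = "xs @ Suc n # ys"
    have Q: "Q = insert ?z (P - {xs @ ys})" by (simp add: P(3) insert_max_def)
    have ni: "Suc n \<notin> set ws" if "ws \<in> P" for ws using PD(3)[OF that] by auto
    have "?z \<notin> P" using ni[of ?z] by auto
    then have "card Q = Suc k" using PD(6) P(2) finite_ordered_partition[OF P(1)] by (simp add: Q)
    moreover have "\<Union>(set ` Q) = {1..Suc n}"
    proof -
      have "\<Union>(set ` Q) = insert (Suc n) (\<Union>(set ` P))"
      proof -
        have "P = insert (xs @ ys) (P - {xs @ ys})" using P(2) by blast
        then have "\<Union>(set ` P) = set (xs @ ys) \<union> \<Union>(set ` (P - {xs @ ys}))" by (metis Union_insert image_insert)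
        then show ?thesis by (auto simp: Q)
      qed
      then show ?thesis using PD(5) by (simp add: atLeastAtMostSuc_conv)
    qed
    moreover have "set us \<inter> set vs = {}" if "us \<in> Q" "vs \<in> Q" "us \<noteq> vs" for us vs
    proof -
      have *: "set ?z \<inter> set ws = {}" if "ws \<in> P - {xs @ ys}" for ws
      proof -
        have "set ws \<inter> set (xs @ ys) = {}" using that P(2) PD(4)[of ws "xs @ ys"] by blast
        then show ?thesis using ni[of ws] that by auto
      qed
      show ?thesis using that *[of us] *[of vs] PD(4)[of us vs] unfolding Q by blast
    qed
    moreover have "distinct us \<and> us \<noteq> []" if "us \<in> Q" for us
      using that PD(1,2) PD(1)[OF P(2)] ni[OF P(2)] by (auto simp: Q)
    ultimately show ?thesis by (auto simp: ordered_partitions_def)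
  qed
qed

lemma Lah_Suc_Suc: "Lah (Suc n) (Suc k) = Lah n k + (n + Suc k) * Lah n (Suc k)"
proof -
  let ?S = "SIGMA P : ordered_partitions n (Suc k). splittings P"
  have ni: "Suc n \<notin> set ws" if "ws \<in> P" "P \<in> ordered_partitions n j" for ws P j
    using ordered_partitionsD(3)[OF that(2,1)] by auto
  have 1: "card (insert [Suc n] ` ordered_partitions n k) = Lah n k"
    unfolding Lah_eq
  proof (rule card_image, rule inj_onI)
    fix P P' assume "P \<in> ordered_partitions n k" "P' \<in> ordered_partitions n k" "insert [Suc n] P = insert [Suc n] P'"
    moreover have "[Suc n] \<notin> P" "[Suc n] \<notin> P'" using ni[of "[Suc n]"] calculation by auto
    ultimately show "P = P'" by (simp add: insert_ident)
  qed
  \<comment> \<open>\<open>Suc n\<close> occurs in exactly one list of the result, and its position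
    there recovers both the list and the splitting.\<close>
  have "inj_on (insert_max n) ?S"
  proof (rule inj_onI)
    fix s s' assume ss: "s \<in> ?S" "s' \<in> ?S" and eq: "insert_max n s = insert_max n s'"
    obtain P xs ys P' xs' ys' where s_eq: "s = (P, xs, ys)" "s' = (P', xs', ys')" by (cases s; cases s') auto
    have P: "P \<in> ordered_partitions n (Suc k)" "P' \<in> ordered_partitions n (Suc k)"
      and s: "(xs, ys) \<in> splittings P" "(xs', ys') \<in> splittings P'"
      using ss by (auto simp: s_eq)
    have eq': "insert (xs @ Suc n # ys) (P - {xs @ ys}) = insert (xs' @ Suc n # ys') (P' - {xs' @ ys'})"
      using eq by (simp add: insert_max_def s_eq)
    have in_P: "xs @ ys \<in> P" "xs' @ ys' \<in> P'" using s by (auto simp: splittings_def)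
    have n: "xs @ Suc n # ys \<notin> P" "xs @ Suc n # ys \<notin> P'" "xs' @ Suc n # ys' \<notin> P" "xs' @ Suc n # ys' \<notin> P'"
      using ni[OF _ P(1)] ni[OF _ P(2)] by force+
    then have z: "xs @ Suc n # ys = xs' @ Suc n # ys'" using eq' by blast
    have "Suc n \<notin> set xs" "Suc n \<notin> set xs'" using ni[OF in_P(1) P(1)] ni[OF in_P(2) P(2)] by auto
    then have xy: "xs = xs'" "ys = ys'" using z by (auto simp: append_eq_append_conv2 Cons_eq_append_conv append_eq_Cons_conv)
    have "xs @ Suc n # ys \<notin> P - {xs @ ys}" "xs @ Suc n # ys \<notin> P' - {xs @ ys}" using n by blast+
    then have "P - {xs @ ys} = P' - {xs @ ys}"
      using insert_ident[of "xs @ Suc n # ys" "P - {xs @ ys}" "P' - {xs @ ys}"] eq'[folded xy] by blast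
    then have "P = P'" using in_P xy insert_Diff by metis
    then show "s = s'" using xy by (simp add: s_eq)
  qed
  then have "card (insert_max n ` ?S) = card ?S" by (rule card_image)
  also have "\<dots> = (\<Sum>P\<in>ordered_partitions n (Suc k). card (splittings P))"
    using card_splittings(1) finite_ordered_partitions by (subst card_SigmaI) auto
  also have "\<dots> = (n + Suc k) * Lah n (Suc k)" using card_splittings(2) by (simp add: Lah_eq)
  finally have 2: "card (insert_max n ` ?S) = (n + Suc k) * Lah n (Suc k)" .
  have "insert [Suc n] ` ordered_partitions n k \<inter> insert_max n ` ?S = {}"
  proof -
    have False if P: "P \<in> ordered_partitions n k" "P' \<in> ordered_partitions n (Suc k)" and s: "xs @ ys \<in> P'"
      and eq: "insert [Suc n] P = insert (xs @ Suc n # ys) (P' - {xs @ ys})" for P P' xs ys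
    proof -
      have "[Suc n] \<notin> P'" using ni[OF _ P(2), of "[Suc n]"] by auto
      then have "[Suc n] = xs @ Suc n # ys" using eq by blast
      then have "xs @ ys = []" by (auto simp: Cons_eq_append_conv)
      then show False using ordered_partitionsD(2)[OF P(2) s] by simp
    qed
    then show ?thesis by (fastforce simp: insert_max_def splittings_def)
  qed
  moreover have "finite ?S" using card_splittings(1) finite_ordered_partitions by blast
  ultimately show ?thesis
    unfolding Lah_eq[of "Suc n"] ordered_partitions_Suc using 1 2 finite_ordered_partitions
    by (subst card_Un_disjoint) auto
qed

lemma Lah_Suc_0: "Lah (Suc n) 0 = 0"
proof -
  have "ordered_partitions (Suc n) 0 = {}"
  proof (intro equals0I)
    fix P assume P: "P \<in> ordered_partitions (Suc n) 0"
    then have "P = {}" using finite_ordered_partition[OF P] ordered_partitionsD(6)[OF P] by simp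
    then show False using ordered_partitionsD(5)[OF P] by simp
  qed
  then show ?thesis by (simp add: Lah_eq)
qed

lemma Lah_same: "Lah n n = 1 \<and> Lah n (Suc n) = 0" for n
proof (induction n)
  case 0
  have "ordered_partitions 0 0 = {{}}" by (auto simp: ordered_partitions_def dest: finite_ordered_partition)
  moreover have "ordered_partitions 0 (Suc 0) = {}" by (auto simp: ordered_partitions_def card_1_singleton_iff)
  ultimately show ?case by (simp add: Lah_eq)
next
  case (Suc n)
  have z: "Lah n k = 0" if "k > n" for n k
    using that
  proof (induction n arbitrary: k)
    case 0
    have "ordered_partitions 0 k = {}"
    proof (intro equals0I)
      fix P assume P: "P \<in> ordered_partitions 0 k"
      have "xs = []" if "xs \<in> P" for xs using ordered_partitionsD(3)[OF P that] by simp
      then have "P = {}" using ordered_partitionsD(2)[OF P] by blast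
      then show False using ordered_partitionsD(6)[OF P] 0 by simp
    qed
    then show ?case by (simp add: Lah_eq)
  next
    case (Suc n)
    then show ?case by (cases k) (simp_all add: Lah_Suc_Suc)
  qed
  show ?case using Suc z by (simp add: Lah_Suc_Suc)
qed

section \<open>Moebius inversion and logarithmic derivatives\<close>

text \<open>Squarefree divisors correspond to sets of prime factors, which reduces the sum to an
  alternating sum over subsets.\<close>

lemma sum_moebius_mu:
  assumes "n > 0"
  shows "(\<Sum>d | d dvd n. moebius_mu d) = (if n = 1 then 1 else 0)"
proof -
  have fin: "finite {d. d dvd n}" using assms by simp
  have "(\<Sum>d | d dvd n. moebius_mu d) = (\<Sum>d | d dvd n \<and> squarefree d. (- 1) ^ card (prime_factors d))"
    unfolding moebius_mu_def using fin by (intro sum.mono_neutral_cong_right) auto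
  also have "\<dots> = (\<Sum>A\<in>Pow (prime_factors n). (- 1) ^ card A)"
  proof (rule sum.reindex_bij_witness[where i = "\<lambda>A. \<Prod>A" and j = prime_factors])
    fix d assume d: "d \<in> {d. d dvd n \<and> squarefree d}"
    then have "d \<noteq> 0" using assms by auto
    then show "\<Prod>(prime_factors d) = d"
      using prod_prime_factors[of d] d squarefree_factorial_semiring'[of d] by simp
    show "prime_factors d \<in> Pow (prime_factors n)"
      using d assms by (auto intro: dvd_prime_factors[THEN subsetD])
  next
    fix A assume A: "A \<in> Pow (prime_factors n)"
    then have fA: "finite A" by (meson PowD finite_set_mset finite_subset)
    have pA: "prime p" if "p \<in> A" for p using that A by auto
    have pf: "prime_factors (\<Prod>A) = A"
      using fA pA by (subst prime_factors_prod) (auto simp: prime_prime_factors dest: pA)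
    then show "prime_factors (\<Prod>A) = A" .
    have "\<Prod>A dvd \<Prod>(prime_factors n)" using A by (intro prod_dvd_prod_subset) auto
    also have "\<dots> dvd (\<Prod>p\<in>prime_factors n. p ^ multiplicity p n)"
      by (intro prod_dvd_prod) (auto simp: prime_factors_multiplicity intro: dvd_power)
    also have "\<dots> = n" using prod_prime_factors[of n] assms by simp
    finally have "\<Prod>A dvd n" .
    moreover have "squarefree (\<Prod>A)"
      using fA pA by (intro squarefree_prod_coprime) (auto simp: primes_coprime squarefree_prime)
    ultimately show "\<Prod>A \<in> {d. d dvd n \<and> squarefree d}" by simp
  qed auto
  also have "\<dots> = (if prime_factors n = {} then 1 else 0)" by (rule sum_alternating_Pow) simp
  also have "\<dots> = (if n = 1 then 1 else 0)"
    using assms by (auto simp: prime_factorization_empty_iff)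
  finally show ?thesis .
qed

lemma moebius_inversion:
  fixes f e :: "nat \<Rightarrow> real"
  assumes e: "\<And>m. 1 \<le> m \<Longrightarrow> m \<le> k \<Longrightarrow> e m = (\<Sum>d | d dvd m. f d)" and k: "k \<ge> 1"
  shows "(\<Sum>d | d dvd k. real_of_int (moebius_mu (k div d)) * e d) = f k"
proof -
  have fin: "finite {d. d dvd m}" if "m > 0" for m :: nat using that by simp
  have "(\<Sum>d | d dvd k. real_of_int (moebius_mu (k div d)) * e d) =
    (\<Sum>d | d dvd k. \<Sum>c | c dvd d. real_of_int (moebius_mu (k div d)) * f c)"
  proof (intro sum.cong HOL.refl)
    fix d assume "d \<in> {d. d dvd k}"
    then have "1 \<le> d" "d \<le> k" using k by (auto intro: dvd_imp_le simp: Suc_le_eq dvd_pos_nat)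
    then show "real_of_int (moebius_mu (k div d)) * e d = (\<Sum>c | c dvd d. real_of_int (moebius_mu (k div d)) * f c)"
      by (simp add: e sum_distrib_left)
  qed
  also have "\<dots> = (\<Sum>(d, c)\<in>(SIGMA d : {d. d dvd k}. {c. c dvd d}). real_of_int (moebius_mu (k div d)) * f c)"
    using k by (intro sum.Sigma ballI) (auto simp: dvd_pos_nat)
  \<comment> \<open>Pairs \<open>c dvd d dvd k\<close> are reparametrised by \<open>c\<close> and
    the complementary divisor \<open>t = k div d\<close>.\<close>
  also have "\<dots> = (\<Sum>(c, t)\<in>(SIGMA c : {c. c dvd k}. {t. t dvd k div c}). real_of_int (moebius_mu t) * f c)"
    by (rule sum.reindex_bij_witness[where i = "\<lambda>(c, t). (k div t, c)" and j = "\<lambda>(d, c). (c, k div d)"])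
      (use k in \<open>auto elim!: dvdE simp: dvd_div_eq_mult dvd_mult_div_cancel\<close>)
  also have "\<dots> = (\<Sum>c | c dvd k. \<Sum>t | t dvd k div c. real_of_int (moebius_mu t) * f c)"
    using k by (intro sum.Sigma[symmetric] ballI) (auto elim!: dvdE)
  also have "\<dots> = (\<Sum>c | c dvd k. (if c = k then f c else 0))"
  proof (intro sum.cong HOL.refl)
    fix c assume c: "c \<in> {c. c dvd k}"
    then have "k div c > 0" using k by (auto elim!: dvdE)
    then have "(\<Sum>t | t dvd k div c. moebius_mu t) = (if k div c = 1 then 1 else 0)" by (rule sum_moebius_mu)
    moreover have "k div c = 1 \<longleftrightarrow> c = k" using c k by (auto elim!: dvdE)
    ultimately have "(\<Sum>t | t dvd k div c. moebius_mu t) = (if c = k then 1 else 0)" by simp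
    then show "(\<Sum>t | t dvd k div c. real_of_int (moebius_mu t) * f c) = (if c = k then f c else 0)"
      by (simp flip: sum_distrib_right of_int_sum)
  qed
  also have "\<dots> = f k" using k by simp
  finally show ?thesis .
qed

section \<open>Power series up to a given order\<close>

definition agree_below :: "nat \<Rightarrow> 'a fps \<Rightarrow> 'a fps \<Rightarrow> bool" where
  "agree_below p f g \<longleftrightarrow> (\<forall>i<p. fps_nth f i = fps_nth g i)"

lemma agree_below_mult:
  fixes f g h :: "real fps"
  assumes "agree_below p f g"
  shows "agree_below p (h * f) (h * g)"
  using assms by (auto simp: agree_below_def fps_mult_nth intro!: sum.cong)

lemma agree_below_cancel:
  fixes f g h :: "real fps"
  assumes "agree_below p (h * f) (h * g)" "fps_nth h 0 \<noteq> 0"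
  shows "agree_below p f g"
  using agree_below_mult[OF assms(1), of "inverse h"] inverse_mult_eq_1[OF assms(2)]
  by (simp add: mult.assoc[symmetric])

lemma agree_below_trans: "agree_below p f g \<Longrightarrow> agree_below p g h \<Longrightarrow> agree_below p f h"
  and agree_below_sym: "agree_below p f g \<Longrightarrow> agree_below p g f"
  by (simp_all add: agree_below_def)

lemma fps_X_deriv_nth: "fps_nth (fps_X * fps_deriv f) i = real i * fps_nth (f :: real fps) i"
  by (cases i) simp_all

lemma agree_below_minus: "agree_below p (- f) (- g) \<longleftrightarrow> agree_below p f (g :: real fps)"
  by (simp add: agree_below_def)

lemma agree_below_deriv:
  assumes "agree_below p f (g :: real fps)"
  shows "agree_below p (fps_X * fps_deriv f) (fps_X * fps_deriv g)"
  using assms by (simp add: agree_below_def fps_X_deriv_nth del: fps_X_mult_nth)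

text \<open>The expansion of \<open>fps_X ^ d / (1 - fps_X ^ d)\<close>. Times \<open>- d\<close> it
  is the logarithmic derivative of \<open>1 - fps_X ^ d\<close>, multiplied by
  \<open>fps_X\<close>.\<close>

definition multiples_series :: "nat \<Rightarrow> real fps" where
  "multiples_series d = Abs_fps (\<lambda>m. if d dvd m \<and> m > 0 then 1 else 0)"

lemma multiples_series_eq:
  assumes "d > 0"
  shows "(1 - fps_X ^ d) * multiples_series d = fps_X ^ d"
proof (rule fps_ext)
  fix m
  show "fps_nth ((1 - fps_X ^ d) * multiples_series d) m = fps_nth (fps_X ^ d) m"
    using assms by (auto simp: left_diff_distrib fps_X_power_mult_nth multiples_series_def dvd_diff_nat
        dest: dvd_imp_le)
      (use dvd_minus_self in \<open>auto simp: not_less\<close>)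
qed

lemma log_deriv_prod:
  assumes "finite B" "\<And>x. x \<in> B \<Longrightarrow> d x > 0"
  shows "fps_X * fps_deriv (\<Prod>x\<in>B. 1 - fps_X ^ d x) =
    - (\<Prod>x\<in>B. 1 - fps_X ^ d x) * (\<Sum>x\<in>B. fps_const (real (d x)) * multiples_series (d x))"
  using assms
proof (induction B)
  case (insert b B)
  let ?P = "\<Prod>x\<in>B. 1 - fps_X ^ d x :: real fps" and ?S = "\<Sum>x\<in>B. fps_const (real (d x)) * multiples_series (d x)"
  have IH: "fps_X * fps_deriv ?P = - ?P * ?S" using insert by simp
  have db: "d b > 0" using insert.prems by simp
  then have e: "fps_X * fps_deriv (1 - fps_X ^ d b :: real fps) = - (fps_const (real (d b)) * fps_X ^ d b)"
    by (intro fps_ext) (auto simp: fps_X_deriv_nth fps_X_power_nth)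
  have "fps_X * fps_deriv ((1 - fps_X ^ d b) * ?P) =
    (fps_X * fps_deriv (1 - fps_X ^ d b)) * ?P + (1 - fps_X ^ d b) * (fps_X * fps_deriv ?P)"
    by (simp only: fps_deriv_mult) (simp add: algebra_simps)
  also have "\<dots> = - (fps_const (real (d b)) * ((1 - fps_X ^ d b) * multiples_series (d b))) * ?P
      + (1 - fps_X ^ d b) * (- ?P * ?S)"
    unfolding IH e multiples_series_eq[OF db] ..
  also have "\<dots> = - ((1 - fps_X ^ d b) * ?P) * (fps_const (real (d b)) * multiples_series (d b) + ?S)"
    by (simp add: algebra_simps)
  finally show ?case using insert.hyps by simp
qed simp

section \<open>The multinomial expansion\<close>

text \<open>Split by the total exponent \<open>r\<close>, which is the power of the polynomial in
  which the monomial occurs. Extensional functions make the set finite.\<close>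

definition exponent_vectors :: "nat set \<Rightarrow> nat \<Rightarrow> nat \<Rightarrow> (nat \<Rightarrow> nat) set" where
  "exponent_vectors A r d = {m \<in> A \<rightarrow>\<^sub>E UNIV. (\<Sum>j\<in>A. m j) = r \<and> (\<Sum>j\<in>A. j * m j) = d}"

lemma finite_exponent_vectors:
  assumes "finite A"
  shows "finite (exponent_vectors A r d)"
proof (rule finite_subset)
  show "exponent_vectors A r d \<subseteq> A \<rightarrow>\<^sub>E {..r}"
    using assms by (auto simp: exponent_vectors_def PiE_iff intro: member_le_sum extensional_arb)
qed (use assms in \<open>auto intro: finite_PiE\<close>)

lemma exponent_vectors_insert:
  assumes "finite A" "j \<notin> A"
  shows "exponent_vectors (insert j A) r d =
    (\<lambda>(i, m). m(j := i)) ` (SIGMA i : {i. i \<le> r \<and> j * i \<le> d}. exponent_vectors A (r - i) (d - j * i))" (is "?L = ?R")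
proof (intro equalityI subsetI)
  fix m assume m: "m \<in> ?L"
  have s: "(\<Sum>i\<in>A. g ((m(j := undefined)) i)) = (\<Sum>i\<in>A. g (m i))" for g :: "nat \<Rightarrow> nat"
    using assms by (intro sum.cong) auto
  have s2: "(\<Sum>i\<in>A. i * (m(j := undefined)) i) = (\<Sum>i\<in>A. i * m i)"
    using assms by (intro sum.cong) auto
  have t: "m j + (\<Sum>i\<in>A. m i) = r" "j * m j + (\<Sum>i\<in>A. i * m i) = d"
    using m assms by (auto simp: exponent_vectors_def)
  have "m(j := undefined) \<in> A \<rightarrow>\<^sub>E UNIV" using m by (auto simp: exponent_vectors_def PiE_iff extensional_def)
  then have "m(j := undefined) \<in> exponent_vectors A (r - m j) (d - j * m j)"
    using s[of "\<lambda>x. x"] s2 t by (auto simp: exponent_vectors_def)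
  then have "(m j, m(j := undefined)) \<in> (SIGMA i : {i. i \<le> r \<and> j * i \<le> d}. exponent_vectors A (r - i) (d - j * i))"
    using t by auto
  moreover have "m = (\<lambda>(i, m). m(j := i)) (m j, m(j := undefined))" by simp
  ultimately show "m \<in> ?R" by blast
next
  fix m assume "m \<in> ?R"
  then obtain i m' where m: "i \<le> r" "j * i \<le> d" "m' \<in> exponent_vectors A (r - i) (d - j * i)" "m = m'(j := i)"
    by auto
  have "(\<Sum>l\<in>A. m l) = (\<Sum>l\<in>A. m' l)" "(\<Sum>l\<in>A. l * m l) = (\<Sum>l\<in>A. l * m' l)"
    using assms(2) by (auto simp: m(4) intro!: sum.cong)
  then show "m \<in> ?L" using m assms by (auto simp: exponent_vectors_def PiE_iff extensional_def)
qed

definition multinomial_sum :: "(nat \<Rightarrow> real) \<Rightarrow> nat set \<Rightarrow> nat \<Rightarrow> nat \<Rightarrow> real" where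
  "multinomial_sum a A r d = (\<Sum>m\<in>exponent_vectors A r d. \<Prod>j\<in>A. a j ^ m j / fact (m j))"

lemma multinomial_sum_insert:
  assumes A: "finite A" "j \<notin> A"
  shows "multinomial_sum a (insert j A) r d =
    (\<Sum>i\<le>r. if j * i \<le> d then a j ^ i / fact i * multinomial_sum a A (r - i) (d - j * i) else 0)"
proof -
  let ?S = "SIGMA i : {i. i \<le> r \<and> j * i \<le> d}. exponent_vectors A (r - i) (d - j * i)"
  have inj: "inj_on (\<lambda>(i, m). m(j := i)) ?S"
  proof (rule inj_onI, clarify)
    fix i m i' m' assume h: "m \<in> exponent_vectors A (r - i) (d - j * i)" "m' \<in> exponent_vectors A (r - i') (d - j * i')"
      "m(j := i) = m'(j := i')"
    have "i = i'" using fun_cong[OF h(3), of j] by simp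
    moreover have "m l = m' l" for l
      using fun_cong[OF h(3), of l] h(1,2) A(2) by (cases "l = j") (auto simp: exponent_vectors_def PiE_iff extensional_def)
    ultimately show "i = i' \<and> m = m'" by auto
  qed
  have "multinomial_sum a (insert j A) r d =
    (\<Sum>(i, m)\<in>?S. \<Prod>l\<in>insert j A. a l ^ ((m(j := i)) l) / fact ((m(j := i)) l))"
    unfolding multinomial_sum_def exponent_vectors_insert[OF A] sum.reindex[OF inj]
    by (simp add: split_def)
  also have "\<dots> = (\<Sum>(i, m)\<in>?S. a j ^ i / fact i * (\<Prod>l\<in>A. a l ^ m l / fact (m l)))"
  proof (intro sum.cong HOL.refl, clarify)
    fix i m
    have "(\<Prod>l\<in>A. a l ^ (m(j := i)) l / fact ((m(j := i)) l)) = (\<Prod>l\<in>A. a l ^ m l / fact (m l))"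
      using A(2) by (intro prod.cong) auto
    then show "(\<Prod>l\<in>insert j A. a l ^ (m(j := i)) l / fact ((m(j := i)) l)) =
      a j ^ i / fact i * (\<Prod>l\<in>A. a l ^ m l / fact (m l))"
      using A by simp
  qed
  also have "\<dots> = (\<Sum>i\<in>{i. i \<le> r \<and> j * i \<le> d}. a j ^ i / fact i * multinomial_sum a A (r - i) (d - j * i))"
    unfolding multinomial_sum_def sum_distrib_left using finite_exponent_vectors[OF A(1)]
    by (intro sum.Sigma[symmetric]) auto
  also have "\<dots> = (\<Sum>i\<le>r. if j * i \<le> d then a j ^ i / fact i * multinomial_sum a A (r - i) (d - j * i) else 0)"
    by (intro sum.mono_neutral_cong_left) auto
  finally show ?thesis .
qed

text \<open>Induction over the set of indices: the binomial theorem peels off one monomial at a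
  time, and the factorials cancel.\<close>

lemma power_nth_multinomial:
  assumes "finite A"
  shows "fps_nth ((\<Sum>j\<in>A. fps_const (a j) * fps_X ^ j) ^ r) d = fact r * multinomial_sum a A r d"
  using assms
proof (induction A arbitrary: r d)
  case empty
  have "exponent_vectors {} r d = (if r = 0 \<and> d = 0 then {\<lambda>_. undefined} else {})"
    by (auto simp: exponent_vectors_def)
  then show ?case by (cases r) (auto simp: multinomial_sum_def)
next
  case (insert j A)
  let ?s = "\<Sum>j\<in>A. fps_const (a j) * fps_X ^ j"
  have "fps_nth ((fps_const (a j) * fps_X ^ j + ?s) ^ r) d =
    (\<Sum>i\<le>r. fps_nth (of_nat (r choose i) * (fps_const (a j) * fps_X ^ j) ^ i * ?s ^ (r - i)) d)"
    by (simp add: binomial_ring fps_sum_nth)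
  also have "\<dots> = (\<Sum>i\<le>r. fact r * (if j * i \<le> d then a j ^ i / fact i * multinomial_sum a A (r - i) (d - j * i) else 0))"
  proof (intro sum.cong HOL.refl)
    fix i assume i: "i \<in> {..r}"
    have tm: "of_nat (r choose i) * (fps_const (a j) * fps_X ^ j) ^ i * ?s ^ (r - i) =
      fps_const (real (r choose i) * a j ^ i) * (fps_X ^ (j * i) * ?s ^ (r - i))"
      by (simp add: power_mult_distrib fps_of_nat mult_ac flip: fps_const_mult fps_const_power power_mult)
    have "fps_nth (of_nat (r choose i) * (fps_const (a j) * fps_X ^ j) ^ i * ?s ^ (r - i)) d =
      (if j * i \<le> d then real (r choose i) * a j ^ i * (fact (r - i) * multinomial_sum a A (r - i) (d - j * i)) else 0)"
      unfolding tm by (simp add: fps_X_power_mult_nth insert.IH)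
    also have "\<dots> = fact r * (if j * i \<le> d then a j ^ i / fact i * multinomial_sum a A (r - i) (d - j * i) else 0)"
      using i by (simp add: binomial_fact field_simps)
    finally show "fps_nth (of_nat (r choose i) * (fps_const (a j) * fps_X ^ j) ^ i * ?s ^ (r - i)) d =
      fact r * (if j * i \<le> d then a j ^ i / fact i * multinomial_sum a A (r - i) (d - j * i) else 0)" .
  qed
  also have "\<dots> = fact r * multinomial_sum a (insert j A) r d"
    by (simp add: multinomial_sum_insert[OF insert.hyps] sum_distrib_left)
  finally show ?case using insert.hyps by simp
qed

text \<open>The truncated logarithm of \<open>1 - q\<close>.\<close>

lemma trunc_log_deriv:
  fixes q :: "real fps"
  assumes "fps_nth q 0 = 0"
  shows "agree_below p ((1 - q) * (\<Sum>r=1..p. fps_const (1 / real r) * (fps_X * fps_deriv (q ^ r)))) (fps_X * fps_deriv q)"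
proof -
  have "fps_const (1 / real r) * (fps_X * fps_deriv (q ^ r)) = fps_X * fps_deriv q * q ^ (r - 1)" if "r \<ge> 1" for r
  proof -
    have c: "fps_const (1 / real r) * fps_const (real r) = 1" using that by simp
    have "fps_const (1 / real r) * (fps_X * fps_deriv (q ^ r)) =
      (fps_const (1 / real r) * fps_const (real r)) * (fps_X * fps_deriv q * q ^ (r - 1))"
      by (simp only: fps_deriv_power mult_ac)
    then show ?thesis unfolding c by simp
  qed
  then have "(\<Sum>r=1..p. fps_const (1 / real r) * (fps_X * fps_deriv (q ^ r))) = (\<Sum>r=1..p. fps_X * fps_deriv q * q ^ (r - 1))"
    by (intro sum.cong) auto
  also have "\<dots> = fps_X * fps_deriv q * (\<Sum>r<p. q ^ r)"
    unfolding sum_distrib_left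
    by (rule sum.reindex_bij_witness[where i = Suc and j = "\<lambda>r. r - 1"]) auto
  finally have "(1 - q) * (\<Sum>r=1..p. fps_const (1 / real r) * (fps_X * fps_deriv (q ^ r))) =
    fps_X * fps_deriv q * ((1 - q) * (\<Sum>r<p. q ^ r))"
    by (simp add: mult_ac)
  also have "(1 - q) * (\<Sum>r<p. q ^ r) = 1 - q ^ p" by (rule one_diff_power_eq[symmetric])
  finally have e: "(1 - q) * (\<Sum>r=1..p. fps_const (1 / real r) * (fps_X * fps_deriv (q ^ r))) =
    fps_X * fps_deriv q - fps_X * fps_deriv q * q ^ p"
    by (simp add: right_diff_distrib)
  have z: "fps_nth (q ^ p) i = 0" if "i < p" for i using startsby_zero_power_prefix[OF assms] that by blast
  have "agree_below p (q ^ p) 0" using z by (simp add: agree_below_def)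
  from agree_below_mult[OF this, of "fps_X * fps_deriv q"]
  show ?thesis unfolding e by (simp add: agree_below_def)
qed

text \<open>A factorisation known only modulo \<open>fps_X ^ Suc k\<close> already determines the
  number of factors of degree \<open>k\<close>, since no higher coefficient enters.\<close>

theorem euler_product_exponents:
  fixes c :: "nat \<Rightarrow> real"
  assumes k: "k \<ge> 1" and B: "finite B" "\<And>x. x \<in> B \<Longrightarrow> d x > 0"
    and agree: "agree_below (Suc k) (\<Prod>x\<in>B. 1 - fps_X ^ d x) (1 - (\<Sum>j=1..n. fps_const (c j) * fps_X ^ j))"
  shows "real k * real (card {x \<in> B. d x = k}) =
    (\<Sum>e | e dvd k. real_of_int (moebius_mu (k div e)) *
      (\<Sum>m | m \<in> {1..n} \<rightarrow>\<^sub>E UNIV \<and> (\<Sum>j=1..n. j * m j) = e.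
        real e * fact ((\<Sum>i=1..n. m i) - 1) * (\<Prod>j=1..n. c j ^ m j / fact (m j))))"
proof -
  define q where "q = (\<Sum>j=1..n. fps_const (c j) * fps_X ^ j)"
  define P where "P = (\<Prod>x\<in>B. 1 - fps_X ^ d x :: real fps)"
  define S where "S = (\<Sum>x\<in>B. fps_const (real (d x)) * multiples_series (d x))"
  define L where "L = (\<Sum>r=1..Suc k. fps_const (1 / real r) * (fps_X * fps_deriv (q ^ r)))"
  have q0: "fps_nth q 0 = 0" by (simp add: q_def fps_sum_nth)
  have "agree_below (Suc k) (fps_X * fps_deriv P) (fps_X * fps_deriv (1 - q))"
    using agree unfolding P_def q_def by (rule agree_below_deriv)
  then have "agree_below (Suc k) (P * S) (fps_X * fps_deriv q)"
    using log_deriv_prod[OF B] agree_below_minus[of "Suc k" "P * S" "fps_X * fps_deriv q"]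
    by (simp add: P_def S_def)
  moreover have "agree_below (Suc k) (S * (1 - q)) (S * P)"
    using agree_below_mult[OF agree_below_sym[OF agree], of S] by (simp add: P_def q_def)
  ultimately have 1: "agree_below (Suc k) ((1 - q) * S) (fps_X * fps_deriv q)"
    by (auto simp: mult.commute intro: agree_below_trans)
  have "agree_below (Suc k) ((1 - q) * L) (fps_X * fps_deriv q)"
    unfolding L_def by (rule trunc_log_deriv[OF q0])
  \<comment> \<open>Both series solve the same linear equation with coefficient
    \<open>1 - q\<close>, whose constant term is one and can therefore be cancelled.\<close>
  then have "agree_below (Suc k) S L"
    using agree_below_cancel[OF agree_below_trans[OF 1 agree_below_sym]] q0 by simp
  then have SL: "fps_nth S m = fps_nth L m" if "m \<le> k" for m using that by (simp add: agree_below_def)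
  define f where "f e = real e * real (card {x \<in> B. d x = e})" for e
  define E where "E e = (\<Sum>m | m \<in> {1..n} \<rightarrow>\<^sub>E UNIV \<and> (\<Sum>j=1..n. j * m j) = e.
        real e * fact ((\<Sum>i=1..n. m i) - 1) * (\<Prod>j=1..n. c j ^ m j / fact (m j)))" for e
  have S: "fps_nth S m = (\<Sum>e | e dvd m. f e)" if m: "1 \<le> m" for m
  proof -
    have fin: "finite {e. e dvd m}" using m by simp
    have "fps_nth S m = (\<Sum>x\<in>B. if d x dvd m then real (d x) else 0)"
      using m by (auto simp: S_def fps_sum_nth multiples_series_def intro!: sum.cong)
    also have "\<dots> = (\<Sum>x\<in>{x\<in>B. d x dvd m}. real (d x))"
      using B(1) by (simp add: sum.inter_filter)
    also have "\<dots> = (\<Sum>e | e dvd m. \<Sum>x\<in>{x \<in> {x\<in>B. d x dvd m}. d x = e}. real (d x))"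
      by (rule sum.group[symmetric]) (use B(1) fin in auto)
    also have "\<dots> = (\<Sum>e | e dvd m. f e)"
    proof (intro sum.cong HOL.refl)
      fix e assume "e \<in> {e. e dvd m}"
      then have "{x \<in> {x\<in>B. d x dvd m}. d x = e} = {x \<in> B. d x = e}" by auto
      then show "(\<Sum>x\<in>{x \<in> {x\<in>B. d x dvd m}. d x = e}. real (d x)) = f e" by (simp add: f_def)
    qed
    finally show ?thesis .
  qed
  have L: "fps_nth L e = E e" if e: "1 \<le> e" "e \<le> k" for e
  proof -
    \<comment> \<open>The total exponent is at most the degree, hence at most \<open>k\<close>, so
      cutting the logarithm off at \<open>Suc k\<close> loses no term.\<close>
    have deg: "(\<Sum>j=1..n. m j) \<le> (\<Sum>j=1..n. j * m j)" for m :: "nat \<Rightarrow> nat" by (intro sum_mono) auto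
    \<comment> \<open>At least one exponent is positive, so the subtraction in the factorial is a
      genuine one.\<close>
    have pos: "(\<Sum>j=1..n. m j) \<ge> 1" if "(\<Sum>j=1..n. j * m j) = e" for m :: "nat \<Rightarrow> nat"
    proof (rule ccontr)
      assume "\<not> ?thesis"
      then have "(\<Sum>j=1..n. m j) = 0" by linarith
      then have "\<forall>j\<in>{1..n}. m j = 0" by simp
      then have "(\<Sum>j=1..n. j * m j) = 0" by (intro sum.neutral) auto
      then show False using that e by simp
    qed
    have "fps_nth L e = (\<Sum>r=1..Suc k. real e * (fact (r - 1) * multinomial_sum c {1..n} r e))"
    proof -
      have "fps_nth (fps_const (1 / real r) * (fps_X * fps_deriv (q ^ r))) e =
        real e * (fact (r - 1) * multinomial_sum c {1..n} r e)" if "r \<in> {1..Suc k}" for r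
      proof -
        obtain e' where e': "e = Suc e'" using e by (cases e) auto
        have "fps_nth (q ^ r) e = fact r * multinomial_sum c {1..n} r e"
          unfolding q_def by (rule power_nth_multinomial) simp
        \<comment> \<open>The factor \<open>1 / real r\<close> of the logarithm lowers the
          multinomial factor \<open>fact r\<close> to \<open>fact (r - 1)\<close>.\<close>
        moreover have "fact r = real r * fact (r - 1)" using that by (cases r) auto
        ultimately show ?thesis using that by (simp add: e')
      qed
      then show ?thesis unfolding L_def fps_sum_nth by (intro sum.cong) auto
    qed
    also have "\<dots> = (\<Sum>r=1..Suc k. \<Sum>m\<in>exponent_vectors {1..n} r e.
        real e * fact ((\<Sum>i=1..n. m i) - 1) * (\<Prod>j=1..n. c j ^ m j / fact (m j)))"
      unfolding multinomial_sum_def sum_distrib_left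
      by (intro sum.cong HOL.refl) (simp add: exponent_vectors_def mult.assoc)
    also have "\<dots> = E e"
    proof -
      have "(\<Sum>r=1..Suc k. \<Sum>m\<in>exponent_vectors {1..n} r e. g m) =
        (\<Sum>m | m \<in> {1..n} \<rightarrow>\<^sub>E UNIV \<and> (\<Sum>j=1..n. j * m j) = e. g m)" for g :: "(nat \<Rightarrow> nat) \<Rightarrow> real"
      proof -
        let ?M = "{m. m \<in> {1..n} \<rightarrow>\<^sub>E UNIV \<and> (\<Sum>j=1..n. j * m j) = e}"
        have r: "(\<Sum>i=1..n. m i) \<in> {1..Suc k}" if "m \<in> ?M" for m using that deg[of m] pos[of m] e by auto
        have M: "?M = (\<Union>r\<in>{1..Suc k}. exponent_vectors {1..n} r e)"
          using r by (auto simp: exponent_vectors_def)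
        then have "finite ?M" using finite_exponent_vectors by auto
        have "(\<Sum>r=1..Suc k. \<Sum>m\<in>{m\<in>?M. (\<Sum>i=1..n. m i) = r}. g m) = sum g ?M"
          by (rule sum.group) (use \<open>finite ?M\<close> r in auto)
        moreover have "{m\<in>?M. (\<Sum>i=1..n. m i) = r} = exponent_vectors {1..n} r e" for r
          by (auto simp: exponent_vectors_def)
        ultimately show ?thesis by simp
      qed
      then show ?thesis by (simp add: E_def)
    qed
    finally show ?thesis .
  qed
  have "(\<Sum>e | e dvd k. real_of_int (moebius_mu (k div e)) * E e) = f k"
  proof (rule moebius_inversion[OF _ k])
    show "E m = (\<Sum>d | d dvd m. f d)" if "1 \<le> m" "m \<le> k" for m
      using S[OF that(1)] L[OF that] SL[OF that(2)] by simp
  qed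
  then show ?thesis by (simp add: f_def E_def)
qed

section \<open>Relations in the associated graded Lie algebra\<close>

context lcs_basis
begin

lemma lie_commuting:
  assumes "g \<in> carrier G" "h \<in> carrier G" "g \<otimes> h = h \<otimes> g"
  shows "br (lie_elt 1 g) (lie_elt 1 h) \<in> relator_ideal basis_edge fst basis_level p lie_rel 0"
proof -
  have "comm g h = h \<otimes> g \<otimes> inv g \<otimes> inv h" using assms(3) by simp
  then have "comm g h = \<one>" using assms(1,2) by (simp add: m_assoc)
  then show ?thesis
    using lie_elt_comm_in_ideal[of 1 1 g h p] assms(1,2) by (simp add: br_def lcs_1 lie_elt_one)
qed

text \<open>The triangle relation is equivalent to the triviality of
  \<open>comm u (v \<otimes> w) \<otimes> comm v w\<close>. Its class of degree two is the asserted
  sum of brackets by bilinearity.\<close>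

lemma lie_hexagon:
  assumes c: "u \<in> carrier G" "v \<in> carrier G" "w \<in> carrier G" and h: "u \<otimes> v \<otimes> w = w \<otimes> v \<otimes> u"
  shows "br (lie_elt 1 u) (lie_elt 1 v) + br (lie_elt 1 u) (lie_elt 1 w) + br (lie_elt 1 v) (lie_elt 1 w)
    \<in> relator_ideal basis_edge fst basis_level p lie_rel 0" (is "_ \<in> ?I")
proof -
  interpret R: relators basis_edge fst basis_level p lie_rel by (rule lie_relators)
  have "comm u (v \<otimes> w) \<otimes> comm v w = u \<otimes> v \<otimes> w \<otimes> inv (w \<otimes> v \<otimes> u)"
    using c by (simp add: m_assoc inv_mult_group)
  also have "\<dots> = \<one>" using c unfolding h by simp
  finally have "lie_elt 2 (comm u (v \<otimes> w) \<otimes> comm v w) = 0" by (simp add: lie_elt_one)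
  moreover have "comm u (v \<otimes> w) \<in> lcs 2" "comm v w \<in> lcs 2"
    using comm_in_lcs_add[of 1 1] c by (simp_all add: lcs_1 numeral_2_eq_2)
  ultimately have z: "lie_elt 2 (comm u (v \<otimes> w)) + lie_elt 2 (comm v w) = 0" by (simp add: lie_elt_mult)
  have bc: "lie_elt 1 (v \<otimes> w) = lie_elt 1 v + lie_elt 1 w" using c by (intro lie_elt_mult) (simp_all add: lcs_1)
  have 1: "br (lie_elt 1 u) (lie_elt 1 v + lie_elt 1 w) - lie_elt 2 (comm u (v \<otimes> w)) \<in> ?I"
    using lie_elt_comm_in_ideal[of 1 1 u "v \<otimes> w" p] c unfolding bc by (simp add: br_def lcs_1 numeral_2_eq_2)
  have 2: "br (lie_elt 1 v) (lie_elt 1 w) - lie_elt 2 (comm v w) \<in> ?I"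
    using lie_elt_comm_in_ideal[of 1 1 v w p] c by (simp add: br_def lcs_1 numeral_2_eq_2)
  have "br (lie_elt 1 u) (lie_elt 1 v) + br (lie_elt 1 u) (lie_elt 1 w) + br (lie_elt 1 v) (lie_elt 1 w) =
    (br (lie_elt 1 u) (lie_elt 1 v + lie_elt 1 w) - lie_elt 2 (comm u (v \<otimes> w))) +
    (br (lie_elt 1 v) (lie_elt 1 w) - lie_elt 2 (comm v w)) + (lie_elt 2 (comm u (v \<otimes> w)) + lie_elt 2 (comm v w))"
    by (simp add: br_linear)
  also have "\<dots> \<in> ?I" unfolding z using R.J_add[OF 1 2] by simp
  finally show ?thesis .
qed

definition graded_letter :: "(nat \<Rightarrow> nat \<Rightarrow> 'a) \<Rightarrow> edge \<Rightarrow> (nat \<times> nat) free_algebra" where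
  "graded_letter X = (\<lambda>(c, i, j). if c then lie_elt 1 (X i j) + lie_elt 1 (X j i) else lie_elt 1 (X i j))"

lemma xl_graded_letter: "xl (graded_letter X) i j = lie_elt 1 (X i j)"
  by (simp add: xl_def graded_letter_def)

end

lemma pair_rel_in_subspace:
  fixes H :: "nat \<Rightarrow> nat \<Rightarrow> nat \<Rightarrow> 'a free_algebra"
  assumes W: "fa.subspace W" and e: "(c, i, j) \<in> edges n C" "(d, k, l) \<in> edges n C" "i = k \<and> j < l \<or> j = k \<and> d"
    and H: "\<And>a b c. {a, b, c} \<subseteq> {1..n} \<Longrightarrow> distinct [a, b, c] \<Longrightarrow> True \<in> C \<or> a < b \<and> b < c \<Longrightarrow> H a b c \<in> W"
  shows "pair_rel H (c, i, j) (d, k, l) \<in> W"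
proof -
  have l: "i < j" "j < l" "1 \<le> i" "l \<le> n" using e by auto
  have h: "H i j l \<in> W" using l by (intro H) auto
  have hs: "H i l j \<in> W" "H j i l \<in> W" "H j l i \<in> W" "H l i j \<in> W" "H l j i \<in> W" if "True \<in> C"
    using l that by (auto intro!: H)
  show ?thesis
    unfolding pair_rel_def using e h hs
    by (auto intro!: fa.subspace_add[OF W] fa.subspace_diff[OF W] fa.subspace_neg[OF W])
qed

context edge_levels
begin

text \<open>In the graded Lie algebra the triangle relations survive as their quadratic parts
  \<open>hexagon2\<close>. The combinations \<open>pair_rel\<close> that served for the group
  algebra then solve for each commutator, now without a cubic tail.\<close>

lemma lie_words_graded_letter:
  fixes G :: "('g, 'h) monoid_scheme" (structure)
  assumes G: "lcs_basis G a \<chi>"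
    and X: "\<And>i j. (i, j) \<in> vP_gens n \<Longrightarrow> True \<in> C \<or> i < j \<Longrightarrow> X i j \<in> carrier G"
    and gen: "generate G {X i j | i j. (i, j) \<in> vP_gens n \<and> (True \<in> C \<or> i < j)} = carrier G"
    and hex: "\<And>i j k. {i, j, k} \<subseteq> {1..n} \<Longrightarrow> distinct [i, j, k] \<Longrightarrow> True \<in> C \<or> i < j \<and> j < k \<Longrightarrow>
      X i j \<otimes> X i k \<otimes> X j k = X j k \<otimes> X i k \<otimes> X i j"
    and sq: "\<And>i j k l. {i, j, k, l} \<subseteq> {1..n} \<Longrightarrow> distinct [i, j, k, l] \<Longrightarrow> True \<in> C \<or> i < j \<and> k < l \<Longrightarrow>
      X i j \<otimes> X k l = X k l \<otimes> X i j"
  shows "lie_words G a \<chi> E (edges n C) lev (lcs_basis.graded_letter G \<chi> X) p"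
proof -
  interpret lcs_basis G a \<chi> by fact
  interpret R: relators basis_edge fst basis_level p lie_rel by (rule lie_relators)
  define z where "z = graded_letter X"
  let ?I = "relator_ideal basis_edge fst basis_level p lie_rel 0"
  have hex2: "hexagon2 z i j k \<in> ?I" if "{i, j, k} \<subseteq> {1..n}" "distinct [i, j, k]" "True \<in> C \<or> i < j \<and> j < k" for i j k
    unfolding hexagon2_def z_def xl_graded_letter
    by (rule lie_hexagon) (use that X hex[OF that] in \<open>auto simp: vP_gens_def\<close>)
  have sq2: "br (xl z i j) (xl z k l) \<in> ?I"
    if "{i, j, k, l} \<subseteq> {1..n}" "distinct [i, j, k, l]" "True \<in> C \<or> i < j \<and> k < l" for i j k l
    unfolding z_def xl_graded_letter
    by (rule lie_commuting) (use that X sq[OF that] in \<open>auto simp: vP_gens_def\<close>)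
  define W where "W s = fa.span ({z u * z v | u v. u \<in> edges n C \<and> v \<in> edges n C \<and> lev u + lev v > s} \<union> ?I)" for s
  have W: "fa.subspace (W s)" for s by (simp add: W_def)
  have IW: "f \<in> W s" if "f \<in> ?I" for f s unfolding W_def using that by (intro fa.span_base) blast
  have oriented: "br (z (c, i, j)) (z (d, k, l)) \<in> W (lev (c, i, j) + lev (d, k, l))"
    if e: "(c, i, j) \<in> edges n C" "(d, k, l) \<in> edges n C" "i = k \<and> j < l \<or> j = k \<and> d" for c i j d k l
  proof -
    have l: "i < j" "k < l" using e by auto
    have "pair_rel (hexagon2 z) (c, i, j) (d, k, l) \<in> ?I"
      by (rule pair_rel_in_subspace[OF R.J_subspace e hex2])
    then have 1: "pair_rel (hexagon2 z) (c, i, j) (d, k, l) \<in> W (lev (c, i, j) + lev (d, k, l))" by (rule IW)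
    have "lower_terms z (c, i, j) (d, k, l) \<in> W (lev (c, i, j) + lev (d, k, l))"
      unfolding W_def by (rule subsetD[OF fa.span_mono lower_terms_span[OF e]]) blast
    from fa.subspace_diff[OF W 1 this] show ?thesis unfolding pair_rel_hexagon2[OF l e(3)] by simp
  qed
  have disj: "br (z e) (z f) \<in> ?I" if "E e f" "disjoint_edges e f" for e f
  proof -
    obtain c i j d k l where ef: "e = (c, i, j)" "f = (d, k, l)" by (cases e; cases f) auto
    have l: "i < j" "k < l" "{i, j, k, l} \<subseteq> {1..n}" "distinct [i, j, k, l]" "c \<or> d \<longrightarrow> True \<in> C"
      using that by (auto simp: ef)
    have s: "br (xl z i j) (xl z k l) \<in> ?I" using l by (intro sq2) auto
    have s': "br (xl z i j) (xl z l k) \<in> ?I" "br (xl z j i) (xl z k l) \<in> ?I" "br (xl z j i) (xl z l k) \<in> ?I"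
      if "True \<in> C" using l that by (auto intro!: sq2)
    show ?thesis
      unfolding ef using s s' l(5) by (cases c; cases d)
        (auto simp: blue_eq_xl[OF l(1)] blue_eq_xl[OF l(2)] red_eq_xl[OF l(1)] red_eq_xl[OF l(2)] br_linear intro!: R.J_add)
  qed
  have "lie_words G a \<chi> E (edges n C) lev z p"
  proof (intro lie_words.intro[OF G] lie_words_axioms.intro)
    show "commutation E" by (rule base.commutation_axioms)
    show "finite (edges n C)" by (rule finite_edges)
    show "lie_elt 1 g \<in> fa.span (z ` edges n C)" if "g \<in> carrier G" for g
    proof -
      have x: "lie_elt 1 (X i j) \<in> fa.span (z ` edges n C)" if "(i, j) \<in> vP_gens n" "True \<in> C \<or> i < j" for i j
      proof -
        have z: "z e \<in> fa.span (z ` edges n C)" if "e \<in> edges n C" for e using that by (intro fa.span_base) blast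
        have "xl z i j \<in> fa.span (z ` edges n C)"
        proof (cases "i < j")
          case True
          then show ?thesis using that z[of "(False, i, j)"] by (auto simp: xl_def vP_gens_def)
        next
          case False
          then show ?thesis using that z[of "(False, j, i)"] z[of "(True, j, i)"]
            by (auto simp: xl_def vP_gens_def intro!: fa.span_diff)
        qed
        then show ?thesis by (simp add: z_def xl_graded_letter)
      qed
      have sub: "{X i j | i j. (i, j) \<in> vP_gens n \<and> (True \<in> C \<or> i < j)} \<subseteq> carrier G" using X by blast
      have "g \<in> generate G {X i j | i j. (i, j) \<in> vP_gens n \<and> (True \<in> C \<or> i < j)}" using that gen by simp
      then show ?thesis
      proof (induction rule: generate.induct)
        case one
        then show ?case by (simp add: lie_elt_one fa.span_zero)
      next
        case (incl h)
        then show ?case using x by blast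
      next
        case (inv h)
        then have "h \<in> lcs 1" using sub by (auto simp: lcs_1)
        moreover have "lie_elt 1 h \<in> fa.span (z ` edges n C)" using inv x by blast
        ultimately show ?case by (simp add: lie_elt_inv fa.span_neg)
      next
        case (eng g h)
        have "g \<in> lcs 1" "h \<in> lcs 1" using eng(1,2) generate_in_carrier[OF sub] by (auto simp: lcs_1)
        then show ?case using eng(3,4) by (simp add: lie_elt_mult fa.span_add)
      qed
    qed
    show "z x * z y - z y * z x \<in> fa.span ({z u * z v |u v. u \<in> edges n C \<and> v \<in> edges n C \<and> lev x + lev y < lev u + lev v} \<union> ?I)"
      if "E x y" "x \<in> edges n C" "y \<in> edges n C" for x y
    proof -
      obtain c i j d k l where xy: "x = (c, i, j)" "y = (d, k, l)" by (cases x; cases y) auto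
      note E' = that(1)
      consider "disjoint_edges x y" | "i = k \<and> j < l \<or> j = k \<and> d" | "k = i \<and> l < j \<or> l = i \<and> c"
        using E' unfolding xy disjoint_edges_iff compatible_on_iff by (metis linorder_neqE_nat)
      then have "br (z x) (z y) \<in> W (lev x + lev y)"
      proof cases
        case 1
        then show ?thesis using disj[OF that(1)] IW by blast
      next
        case 2
        then show ?thesis using oriented[of c i j d k l] that unfolding xy by blast
      next
        case 3
        then have "br (z y) (z x) \<in> W (lev y + lev x)" using oriented[of d k l c i j] that unfolding xy by blast
        from fa.subspace_neg[OF W this] show ?thesis unfolding br_swap[of "z x"] by (simp add: add.commute)
      qed
      then show ?thesis by (simp add: W_def br_def)
    qed
  qed
  then show ?thesis by (simp add: z_def)
qed

end

text \<open>Treats both groups together: \<open>C\<close> decides whether red edges are present, and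
  \<open>G\<close> sits inside \<open>vP n\<close> because the Magnus expansion is evaluated
  there.\<close>

theorem lcs_rank_of_presentation:
  fixes G :: "(nat \<times> nat) word set monoid"
  assumes n: "n \<ge> 1" and "group G"
    and sub: "carrier G \<subseteq> carrier (vP n)" "\<And>A B. A \<otimes>\<^bsub>G\<^esub> B = A \<otimes>\<^bsub>vP n\<^esub> B" "\<one>\<^bsub>G\<^esub> = \<one>\<^bsub>vP n\<^esub>"
    and gens: "\<And>i j. (i, j) \<in> vP_gens n \<Longrightarrow> True \<in> C \<or> i < j \<Longrightarrow> vP_gen n i j \<in> carrier G"
    and gen: "generate G {vP_gen n i j | i j. (i, j) \<in> vP_gens n \<and> (True \<in> C \<or> i < j)} = carrier G"
    and b: "\<And>m. m \<le> n \<Longrightarrow> card (edge_cliques n C m) = b (n - m)" and b1: "b n = 1" and k: "k \<ge> 1"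
  shows "real (lcs_rank G k) =
    1 / real k * (\<Sum>d | d dvd k. real_of_int (moebius_mu (k div d)) *
      (\<Sum>m | m \<in> {1..n} \<rightarrow>\<^sub>E (UNIV :: nat set) \<and> (\<Sum>j=1..n. j * m j) = d.
        (- 1) ^ (\<Sum>i=1..n div 2. m (2 * i)) * real d * fact ((\<Sum>i=1..n. m i) - 1) *
        (\<Prod>j=1..n. real (b (n - j)) ^ m j / fact (m j))))"
proof -
  interpret G: group G by fact
  define S where "S = {vP_gen n i j | i j. (i, j) \<in> vP_gens n \<and> (True \<in> C \<or> i < j)}"
  have S: "finite S" "S \<subseteq> carrier G" "generate G S = carrier G"
  proof -
    have "finite (vP_gens n)" by (rule finite_subset[of _ "{1..n} \<times> {1..n}"]) (auto simp: vP_gens_def)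
    then show "finite S" by (rule finite_subset[rotated, OF finite_imageI, of _ _ "\<lambda>(i, j). vP_gen n i j"]) (auto simp: S_def)
  qed (use gens gen in \<open>auto simp: S_def\<close>)
  define Q where "Q k a \<chi> \<longleftrightarrow> (\<forall>i<lcs_rank G k. a i \<in> G.lcs k) \<and> (\<forall>i<lcs_rank G k. G.lcs_form k (\<chi> i)) \<and>
    (\<forall>i<lcs_rank G k. \<forall>j<lcs_rank G k. \<chi> i (a j) = (if i = j then 1 else 0)) \<and>
    (\<forall>f g. G.lcs_form k f \<longrightarrow> g \<in> G.lcs k \<longrightarrow> f g = (\<Sum>i<lcs_rank G k. \<chi> i g * f (a i)))" for k a \<chi>
  \<comment> \<open>Bases are chosen for all degrees simultaneously: first the elements for which
    dual functionals exist, then the functionals.\<close>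
  define a where "a k = (SOME a. \<exists>\<chi>. Q k a \<chi>)" for k
  define \<chi> where "\<chi> k = (SOME \<chi>. Q k (a k) \<chi>)" for k
  have Q: "Q k (a k) (\<chi> k)" if k: "k \<ge> 1" for k
  proof -
    have "\<exists>a \<chi>. Q k a \<chi>"
    proof (rule G.lcs_rank_dual_basis[OF S k])
      fix a' \<chi>' assume "\<And>i. i < lcs_rank G k \<Longrightarrow> a' i \<in> G.lcs k" "\<And>i. i < lcs_rank G k \<Longrightarrow> G.lcs_form k (\<chi>' i)"
        "\<And>i j. i < lcs_rank G k \<Longrightarrow> j < lcs_rank G k \<Longrightarrow> \<chi>' i (a' j) = (if i = j then 1 else 0)"
        "\<And>f g. G.lcs_form k f \<Longrightarrow> g \<in> G.lcs k \<Longrightarrow> f g = (\<Sum>i<lcs_rank G k. \<chi>' i g * f (a' i))"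
      then show "\<exists>a \<chi>. Q k a \<chi>" unfolding Q_def by (intro exI[of _ a'] exI[of _ \<chi>']) blast
    qed
    then have "\<exists>\<chi>. Q k (a k) \<chi>" unfolding a_def by (rule someI_ex)
    then show ?thesis unfolding \<chi>_def by (rule someI_ex)
  qed
  have basis: "lcs_basis G a \<chi>"
    by unfold_locales (use Q in \<open>unfold Q_def, blast\<close>)+
  interpret L: lcs_basis G a \<chi> by (rule basis)
  let ?E = "compatible_on n C"
  have trace_sums: "(\<Sum>m<p. card (trace_classes ?E (\<lambda>_. 1) (edges n C) m)) =
      (\<Sum>m<p. card (trace_classes L.basis_edge fst (L.basis_letters_below p) m))" if p: "p \<ge> 1" for p
  proof -
    \<comment> \<open>The least values that satisfy the inequalities of
      \<open>edge_levels\<close>.\<close>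
    define K where "K = 3 * n + 1"
    define R where "R = 3 * (K * n + n) + 1"
    define N where "N = 3 * (R + K * n + n) + 1"
    interpret edge_levels n K R N p C by unfold_locales (simp_all add: K_def R_def N_def)
    have "magnus G a \<chi> (relator_ideal ?E (\<lambda>_. 1) lev p rho 0) (edges n C) class_val p"
      using p by (intro magnus_class_val[OF basis sub gens])
    from L.traces_le_basis_words[OF edge_relators.relators_axioms finite_edges this]
    have 1: "(\<Sum>m<p. card (trace_classes ?E (\<lambda>_. 1) (edges n C) m)) \<le>
      (\<Sum>m<p. card (trace_classes L.basis_edge fst (L.basis_letters_below p) m))" .
    have "lie_words G a \<chi> ?E (edges n C) lev (L.graded_letter (vP_gen n)) p"
      by (rule lie_words_graded_letter[OF basis gens gen])
        (use vP_hexagon vP_square in \<open>simp_all add: sub\<close>)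
    from lie_words.basis_words_le_traces[OF this] 1 show ?thesis by simp
  qed
  have traces: "card (trace_classes ?E (\<lambda>_. 1) (edges n C) m) =
      card (trace_classes L.basis_edge fst (L.basis_letters_below p) m)" if "m < p" for m p
  proof -
    have below: "trace_classes L.basis_edge fst (L.basis_letters_below p) m = trace_classes L.basis_edge fst L.basis_letters m"
      if "m < p" for m p
      using L.words_below[OF that] by (simp add: trace_classes_def)
    have s: "(\<Sum>m<p. card (trace_classes ?E (\<lambda>_. 1) (edges n C) m)) =
      (\<Sum>m<p. card (trace_classes L.basis_edge fst L.basis_letters m))" for p
    proof (cases "p = 0")
      case False
      have "(\<Sum>m<p. card (trace_classes L.basis_edge fst (L.basis_letters_below p) m)) =
        (\<Sum>m<p. card (trace_classes L.basis_edge fst L.basis_letters m))"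
        using below by (intro sum.cong) auto
      then show ?thesis using trace_sums[of p] False by simp
    qed simp
    \<comment> \<open>The cumulative counts agree below every bound, so consecutive differences give
      equality in each degree.\<close>
    have "card (trace_classes ?E (\<lambda>_. 1) (edges n C) m) = card (trace_classes L.basis_edge fst L.basis_letters m)"
      using s[of m] s[of "Suc m"] by simp
    then show ?thesis using below[OF that] by simp
  qed
  define B where "B = L.basis_letters_below (Suc k)"
  have B: "finite B" "\<And>x. x \<in> B \<Longrightarrow> fst x > 0"
    using L.finite_basis_letters_below by (auto simp: B_def L.basis_letters_below_def)
  interpret C: commutation ?E
    by unfold_locales (auto simp: compatible_on_def compatible_def disjoint_edges_def split: prod.splits)
  \<comment> \<open>The clique polynomial has constant term one, and with this sign it reads one
    minus a polynomial, ready for the logarithm.\<close>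
  define c where "c j = - ((- 1) ^ j * real (b (n - j)))" for j
  have "agree_below (Suc k) (\<Prod>x\<in>B. 1 - fps_X ^ fst x) (C.clique_series (\<lambda>_. 1) (edges n C))"
  proof -
    have P: "L.basis.clique_series fst B = (\<Prod>x\<in>B. 1 - fps_X ^ fst x)"
      using L.basis_letters_below_sub[of "Suc k"]
      by (intro L.basis.clique_series_complete[OF B(1)]) (auto simp: B_def L.basis_edge_def)
    have u: "L.basis.clique_series fst B * L.basis.class_series fst B = 1"
      by (rule L.basis.clique_series_mult_class_series[OF B])
    have v: "C.clique_series (\<lambda>_. 1) (edges n C) * C.class_series (\<lambda>_. 1) (edges n C) = 1"
      by (rule C.clique_series_mult_class_series[OF finite_edges]) simp
    have s: "agree_below (Suc k) (C.class_series (\<lambda>_. 1) (edges n C)) (L.basis.class_series fst B)"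
      unfolding agree_below_def C.class_series_def L.basis.class_series_def B_def using traces by simp
    \<comment> \<open>Each class series is inverse to its clique series, so agreement of the former
      passes to the latter.\<close>
    have "agree_below (Suc k) (L.basis.class_series fst B * C.clique_series (\<lambda>_. 1) (edges n C))
      (L.basis.class_series fst B * L.basis.clique_series fst B)"
      using agree_below_mult[OF agree_below_sym[OF s], of "C.clique_series (\<lambda>_. 1) (edges n C)"] u v
      by (simp add: mult.commute)
    moreover have "fps_nth (L.basis.class_series fst B) 0 \<noteq> 0"
      using arg_cong[OF u, of "\<lambda>f. fps_nth f 0"] by auto
    ultimately have "agree_below (Suc k) (C.clique_series (\<lambda>_. 1) (edges n C)) (L.basis.clique_series fst B)"
      by (rule agree_below_cancel)
    then show ?thesis unfolding P[symmetric] by (rule agree_below_sym)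
  qed
  also have "C.clique_series (\<lambda>_. 1) (edges n C) = 1 - (\<Sum>j=1..n. fps_const (c j) * fps_X ^ j)"
  proof -
    have "C.clique_series (\<lambda>_. 1) (edges n C) = (\<Sum>m\<le>n. fps_const ((- 1) ^ m * real (b (n - m))) * fps_X ^ m)"
      by (rule clique_series_edges[OF n b])
    also have "{..n} = insert 0 {1..n}" by auto
    also have "(\<Sum>m\<in>insert 0 {1..n}. fps_const ((- 1) ^ m * real (b (n - m))) * fps_X ^ m) =
      1 + (\<Sum>m=1..n. - (fps_const (c m) * fps_X ^ m))"
      using b1 by (simp add: c_def flip: fps_const_neg)
    finally show ?thesis by (simp add: sum_negf)
  qed
  finally have agree: "agree_below (Suc k) (\<Prod>x\<in>B. 1 - fps_X ^ fst x) (1 - (\<Sum>j=1..n. fps_const (c j) * fps_X ^ j))" .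
  have "{x \<in> B. fst x = k} = Pair k ` {..<lcs_rank G k}"
    using k by (auto simp: B_def L.basis_letters_below_def)
  then have "card {x \<in> B. fst x = k} = lcs_rank G k" by (simp add: card_image inj_on_def)
  then have "real k * real (lcs_rank G k) =
    (\<Sum>e | e dvd k. real_of_int (moebius_mu (k div e)) *
      (\<Sum>m | m \<in> {1..n} \<rightarrow>\<^sub>E UNIV \<and> (\<Sum>j=1..n. j * m j) = e.
        real e * fact ((\<Sum>i=1..n. m i) - 1) * (\<Prod>j=1..n. c j ^ m j / fact (m j))))"
    using euler_product_exponents[OF k B agree] by simp
  \<comment> \<open>\<open>c j\<close> is negative or zero for even \<open>j\<close> and nonnegative
    for odd \<open>j\<close>, so only the even indices contribute to the sign.\<close>
  moreover have "(\<Prod>j=1..n. c j ^ m j / fact (m j)) =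
    (- 1) ^ (\<Sum>i=1..n div 2. m (2 * i)) * (\<Prod>j=1..n. real (b (n - j)) ^ m j / fact (m j))" for m
  proof -
    have "(\<Prod>j=1..n. c j ^ m j / fact (m j)) =
      (\<Prod>j=1..n. (if even j then (- 1) ^ m j else 1)) * (\<Prod>j=1..n. real (b (n - j)) ^ m j / fact (m j))"
      unfolding prod.distrib[symmetric]
      by (intro prod.cong) (auto simp: c_def power_minus[of "real _"])
    also have "(\<Prod>j=1..n. (if even j then (- 1) ^ m j else 1)) = (\<Prod>j\<in>{j\<in>{1..n}. even j}. (- 1 :: real) ^ m j)"
      by (rule prod.inter_filter[symmetric]) simp
    also have "\<dots> = (\<Prod>i=1..n div 2. (- 1) ^ m (2 * i))"
      by (rule prod.reindex_bij_witness[where i = "\<lambda>i. 2 * i" and j = "\<lambda>j. j div 2"]) auto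
    also have "\<dots> = (- 1) ^ (\<Sum>i=1..n div 2. m (2 * i))" by (simp add: power_sum)
    finally show ?thesis .
  qed
  ultimately have "real k * real (lcs_rank G k) =
    (\<Sum>d | d dvd k. real_of_int (moebius_mu (k div d)) *
      (\<Sum>m | m \<in> {1..n} \<rightarrow>\<^sub>E (UNIV :: nat set) \<and> (\<Sum>j=1..n. j * m j) = d.
        (- 1) ^ (\<Sum>i=1..n div 2. m (2 * i)) * real d * fact ((\<Sum>i=1..n. m i) - 1) *
        (\<Prod>j=1..n. real (b (n - j)) ^ m j / fact (m j))))"
    by (simp add: mult_ac)
  then show ?thesis using k by (simp add: field_simps)
qed

theorem corollary5p7:
  fixes n k :: nat
    and G :: "(nat \<times> nat) word set monoid"
    and b :: "nat \<Rightarrow> nat \<Rightarrow> nat"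
  assumes "n \<ge> 2"
    and "(G = vP n \<and> b = Lah) \<or> (G = vP_plus n \<and> b = Stirling)"
    and "k \<ge> 1"
  shows "real (lcs_rank G k) =
    1 / real k * (\<Sum>d | d dvd k. real_of_int (moebius_mu (k div d)) *
      (\<Sum>m | m \<in> {1..n} \<rightarrow>\<^sub>E (UNIV :: nat set) \<and> (\<Sum>j=1..n. j * m j) = d.
        (- 1) ^ (\<Sum>i=1..n div 2. m (2 * i)) * real d * fact ((\<Sum>i=1..n. m i) - 1) *
        (\<Prod>j=1..n. real (b n (n - j)) ^ m j / fact (m j))))"
  using assms(2)
proof
  assume G: "G = vP n \<and> b = Lah"
  have S: "{vP_gen n i j | i j. (i, j) \<in> vP_gens n \<and> (True \<in> UNIV \<or> i < j)} = (\<lambda>(i, j). vP_gen n i j) ` vP_gens n"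
    by force
  show ?thesis
  proof (rule lcs_rank_of_presentation[where C = UNIV])
    show "generate G {vP_gen n i j | i j. (i, j) \<in> vP_gens n \<and> (True \<in> UNIV \<or> i < j)} = carrier G"
      unfolding S using generate_vP G by simp
    show "card (edge_cliques n UNIV m) = b n (n - m)" if "m \<le> n" for m
      using Lah_Suc_Suc Lah_Suc_0 Lah_same G that by (intro card_edge_cliques) auto
    show "b n n = 1" using Lah_same G by simp
  qed (use assms G group_vP vP_gen_in in auto)
next
  assume G: "G = vP_plus n \<and> b = Stirling"
  interpret V: group "vP n" by (rule group_vP)
  have S: "{vP_gen n i j | i j. (i, j) \<in> vP_gens n \<and> (True \<in> {False} \<or> i < j)} = {vP_gen n i j | i j. 1 \<le> i \<and> i < j \<and> j \<le> n}"
    by (fastforce simp: vP_gens_def)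
  have sub: "{vP_gen n i j | i j. 1 \<le> i \<and> i < j \<and> j \<le> n} \<subseteq> carrier (vP n)"
    using vP_gen_in by (fastforce simp: vP_gens_def)
  \<comment> \<open>The set \<open>{False}\<close> admits blue edges only, which turns the recursion
    for cliques into that of the Stirling numbers.\<close>
  show ?thesis
  proof (rule lcs_rank_of_presentation[where C = "{False}"])
    have "generate (vP n\<lparr>carrier := generate (vP n) {vP_gen n i j | i j. 1 \<le> i \<and> i < j \<and> j \<le> n}\<rparr>)
      {vP_gen n i j | i j. 1 \<le> i \<and> i < j \<and> j \<le> n} = generate (vP n) {vP_gen n i j | i j. 1 \<le> i \<and> i < j \<and> j \<le> n}"
      by (rule V.generate_consistent[OF _ V.generate_is_subgroup[OF sub]]) (blast intro: generate.incl)
    then show "generate G {vP_gen n i j | i j. (i, j) \<in> vP_gens n \<and> (True \<in> {False} \<or> i < j)} = carrier G"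
      unfolding S using G by (simp add: vP_plus_def)
    show "carrier G \<subseteq> carrier (vP n)"
      using V.generate_incl[OF sub] G by (simp add: vP_plus_def)
    show "vP_gen n i j \<in> carrier G" if "(i, j) \<in> vP_gens n" "True \<in> {False} \<or> i < j" for i j
    proof -
      have "vP_gen n i j \<in> {vP_gen n i j | i j. 1 \<le> i \<and> i < j \<and> j \<le> n}" using that by (auto simp: vP_gens_def)
      then show ?thesis using G by (auto simp: vP_plus_def intro: generate.incl)
    qed
    show "card (edge_cliques n {False} m) = b n (n - m)" if "m \<le> n" for m
      using G that by (intro card_edge_cliques) auto
    show "b n n = 1" using G by simp
  qed (use assms G group_vP_plus in \<open>auto simp: vP_plus_def\<close>)
qed

end
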